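(* Let $1<p<\infty$ and let $\phi\in GL^\infty(\mathbb{T})$. The operator $M(\phi)$ is a Fredholm operator on $H^p(\mathbb{T})$ if and only if the function $\phi$ admits an asymmetric factorization $\phi(t)=\phi_-(t)t^\kappa\phi_0(t)$ in $L^p(\mathbb{T})$. In this case the defect numbers are given by $$\dim\ker M(\phi)=\max\{0,-\kappa\},\qquad \dim\ker (M(\phi))^*=\max\{0,\kappa\}.$$
   Context: $\mathbb{T}$ is the complex unit circle, $1<p<\infty$, $p^{-1}+q^{-1}=1$. $H^p(\mathbb{T})$ is the Hardy space of functions in $L^p(\mathbb{T})$ whose Fourier coefficients with negative index vanish; $\overline{H^p(\mathbb{T})}$ is the set of functions whose complex conjugate belongs to $H^p(\mathbb{T})$. $P:\sum_{n\in\mathbb{Z}} f_nt^n\mapsto\sum_{n\ge 0}f_nt^n$ is the Riesz projection, bounded on $L^p(\mathbb{T})$ with image $H^p(\mathbb{T})$. $J$ is the flip operator $(Jf)(t)=t^{-1}f(t^{-1})$. $I$ is the identity. $L(\phi):f\mapsto\phi f$ denotes multiplication by $\phi$. $GL^\infty(\mathbb{T})$ is the group of invertible elements of the algebra $L^\infty(\mathbb{T})$. For $\phi\in L^\infty(\mathbb{T})$, $M(\phi)=T(\phi)+H(\phi)$ is the bounded operator on $H^p(\mathbb{T})$ given by $T(\phi)f=P(\phi f)$, $H(\phi)f=P(\phi\,(Jf))$; $(M(\phi))^*$ is its adjoint. $L^p_{\rm even}(\mathbb{T})$ is the set of $f\in L^p(\mathbb{T})$ with $f(t)=f(t^{-1})$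 a.e. $L^p_J(\mathbb{T})$ is the image of the projection $P_J=(I+J)/2$ on $L^p(\mathbb{T})$, i.e. $\{f\in L^p(\mathbb{T}):Jf=f\}$. $\mathcal{R}$ is the space of all trigonometric polynomials. A function $\phi\in GL^\infty(\mathbb{T})$ is said to admit an asymmetric factorization in $L^p(\mathbb{T})$ (with index $\kappa$) if it admits a representation $\phi(t)=\phi_-(t)t^{\kappa}\phi_0(t)$, $t\in\mathbb{T}$, with $\kappa\in\mathbb{Z}$ and (i) $(1+t^{-1})\phi_-\in\overline{H^p(\mathbb{T})}$, $(1-t^{-1})\phi_-^{-1}\in\overline{H^q(\mathbb{T})}$; (ii) $|1-t|\phi_0\in L^q_{\rm even}(\mathbb{T})$, $|1+t|\phi_0^{-1}\in L^p_{\rm even}(\mathbb{T})$; (iii) the linear operator $B=L(\phi_0^{-1})(I+J)PL(\phi_-^{-1})$ acting from $X_1$ into $X_2$ extends to a linear bounded operator from $L^p(\mathbb{T})$ into $L^p_J(\mathbb{T})$, where $X_1=\{(1-t^{-1})f(t):f\in\mathcal{R}\}$ (dense in $L^p(\mathbb{T})$) and $X_2=\{(1+t^{-1})\phi_0^{-1}(t)f(t):f\in\mathcal{R},\ f(t)=f(t^{-1})\}\subseteq L^p_J(\mathbb{T})$. *)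

theory Defs
  imports "HOL-Analysis.Analysis" "HOL-Library.Function_Algebras"
begin

subsection \<open>Measurable functions on the unit circle modulo equality almost everywhere\<close>

text \<open>Normalized arc length, as a Borel measure on the complex plane that is concentrated on the
  unit circle; values of functions off the circle are therefore irrelevant.\<close>

definition circle_measure :: "complex measure" where
  "circle_measure = distr (uniform_measure lborel {-pi..pi}) borel cis"

lemma sets_circle_measure [simp, measurable_cong]: "sets circle_measure = sets borel"
  by (simp add: circle_measure_def)

lemma space_circle_measure [simp]: "space circle_measure = UNIV"
  by (simp add: circle_measure_def)

lemma measurable_cis [measurable]: "cis \<in> borel_measurable borel"
  by (intro borel_measurable_continuous_onI continuous_intros)

lemma distr_uminus_uniform:
  "distr (uniform_measure lborel {-pi..pi}) borel uminus = uniform_measure lborel {-pi..pi}"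
proof (rule measure_eqI)
  fix A assume "A \<in> sets (distr (uniform_measure lborel {-pi..pi}) borel uminus)"
  then have A [measurable]: "A \<in> sets borel" by simp
  have "emeasure lborel ({-pi..pi} \<inter> uminus -` A)
      = emeasure (distr lborel borel uminus) ({-pi..pi} \<inter> uminus -` A)"
    by (simp add: lborel_distr_uminus)
  also have "\<dots> = emeasure lborel (uminus -` ({-pi..pi} \<inter> uminus -` A))"
    by (subst emeasure_distr) auto
  also have "uminus -` ({-pi..pi} \<inter> uminus -` A) = {-pi..pi} \<inter> A"
    by auto
  finally have *: "emeasure lborel ({-pi..pi} \<inter> uminus -` A) = emeasure lborel ({-pi..pi} \<inter> A)" .
  have "uminus -` A \<in> sets (borel :: real measure)"
    using measurable_sets[of "uminus :: real \<Rightarrow> real" borel borel A] A by simp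
  then show "emeasure (distr (uniform_measure lborel {-pi..pi}) borel uminus) A
      = emeasure (uniform_measure lborel {-pi..pi}) A"
    using * by (subst emeasure_distr) (auto simp: emeasure_uniform_measure)
qed simp

lemma distr_inverse_circle_measure: "distr circle_measure borel inverse = circle_measure"
proof -
  have "distr circle_measure borel inverse
      = distr (uniform_measure lborel {-pi..pi}) borel (inverse \<circ> cis)"
    unfolding circle_measure_def by (subst distr_distr) auto
  also have "inverse \<circ> cis = cis \<circ> uminus"
    by (auto simp: fun_eq_iff)
  also have "distr (uniform_measure lborel {-pi..pi}) borel (cis \<circ> uminus)
      = distr (distr (uniform_measure lborel {-pi..pi}) borel uminus) borel cis"
    by (subst distr_distr) auto
  finally show ?thesis
    by (simp add: distr_uminus_uniform circle_measure_def)
qed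

lemma AE_circle_inverse:
  assumes "AE t in circle_measure. Q t"
  shows "AE t in circle_measure. Q (inverse t)"
proof -
  have "AE t in distr circle_measure borel inverse. Q t"
    unfolding distr_inverse_circle_measure by (rule assms)
  then show ?thesis
    by (rule AE_distrD[rotated]) measurable
qed

lemma measurable_powi [measurable]: "(\<lambda>t::complex. t powi n) \<in> borel_measurable borel"
  unfolding power_int_def by (cases "n \<ge> 0") auto

definition circle_eq :: "(complex \<Rightarrow> complex) \<Rightarrow> (complex \<Rightarrow> complex) \<Rightarrow> bool" where
  "circle_eq f g \<longleftrightarrow> f \<in> borel_measurable borel \<and> g \<in> borel_measurable borel \<and>
     (AE t in circle_measure. f t = g t)"

quotient_type L0 = "complex \<Rightarrow> complex" / partial: circle_eq
proof (rule part_equivpI)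
  show "\<exists>f. circle_eq f f" by (rule exI[of _ "\<lambda>_. 0"]) (simp add: circle_eq_def)
  show "symp circle_eq" by (auto simp: symp_def circle_eq_def eq_commute)
  show "transp circle_eq" unfolding transp_def circle_eq_def
    by (auto elim: AE_mp)
qed

instantiation L0 :: comm_ring_1
begin

lift_definition zero_L0 :: L0 is "\<lambda>_. 0"
  by (simp add: circle_eq_def)

lift_definition one_L0 :: L0 is "\<lambda>_. 1"
  by (simp add: circle_eq_def)

lift_definition plus_L0 :: "L0 \<Rightarrow> L0 \<Rightarrow> L0" is "\<lambda>f g t. f t + g t"
  by (auto simp: circle_eq_def)

lift_definition minus_L0 :: "L0 \<Rightarrow> L0 \<Rightarrow> L0" is "\<lambda>f g t. f t - g t"
  by (auto simp: circle_eq_def)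

lift_definition uminus_L0 :: "L0 \<Rightarrow> L0" is "\<lambda>f t. - f t"
  by (auto simp: circle_eq_def)

lift_definition times_L0 :: "L0 \<Rightarrow> L0 \<Rightarrow> L0" is "\<lambda>f g t. f t * g t"
  by (auto simp: circle_eq_def)

instance
proof
  have "\<not> (AE t in circle_measure. False)"
  proof
    assume "AE t in circle_measure. False"
    then have "emeasure circle_measure UNIV = 0"
      by (simp add: AE_iff_measurable[of UNIV])
    moreover have "emeasure circle_measure UNIV = 1"
      unfolding circle_measure_def by (subst emeasure_distr) (auto simp: emeasure_uniform_measure)
    ultimately show False by simp
  qed
  then show "(0::L0) \<noteq> 1"
    by transfer (simp add: circle_eq_def)
qed (transfer; auto simp: circle_eq_def algebra_simps)+

end

text \<open>The pointwise reciprocal; it is the multiplicative inverse exactly for those classes that are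
  nonzero almost everywhere.\<close>

instantiation L0 :: inverse
begin

lift_definition inverse_L0 :: "L0 \<Rightarrow> L0" is "\<lambda>f t. inverse (f t)"
  by (auto simp: circle_eq_def)

definition divide_L0 :: "L0 \<Rightarrow> L0 \<Rightarrow> L0" where
  "divide_L0 f g = f * inverse g"

instance ..

end

lift_definition cscale :: "complex \<Rightarrow> L0 \<Rightarrow> L0" (infixr \<open>*\<^sub>C\<close> 75) is "\<lambda>c f t. c * f t"
  by (auto simp: circle_eq_def)

interpretation L0: vector_space cscale
  by unfold_locales (transfer; auto simp: circle_eq_def algebra_simps)+

lemma measurable_cnj [measurable]: "cnj \<in> borel_measurable borel"
  by (intro borel_measurable_continuous_onI continuous_intros)

lift_definition conj_fun :: "L0 \<Rightarrow> L0" is "\<lambda>f t. cnj (f t)"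
  by (auto simp: circle_eq_def)

lift_definition abs_fun :: "L0 \<Rightarrow> L0" is "\<lambda>f t. complex_of_real (norm (f t))"
  by (auto simp: circle_eq_def)

lift_definition tpow :: "int \<Rightarrow> L0" is "\<lambda>n t. t powi n"
  by (auto simp: circle_eq_def)

text \<open>The reflection sends \<open>f(t)\<close> to \<open>f(1/t)\<close>.\<close>

lift_definition reflect :: "L0 \<Rightarrow> L0" is "\<lambda>f t. f (inverse t)"
proof -
  fix f g :: "complex \<Rightarrow> complex"
  assume "circle_eq f g"
  then have [measurable]: "f \<in> borel_measurable borel" "g \<in> borel_measurable borel"
    and *: "AE t in circle_measure. f t = g t"
    by (auto simp: circle_eq_def)
  show "circle_eq (\<lambda>t. f (inverse t)) (\<lambda>t. g (inverse t))"
    unfolding circle_eq_def using AE_circle_inverse[OF *] by simp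
qed

text \<open>Meaningful for integrable functions only.\<close>

lift_definition fourier_coeff :: "L0 \<Rightarrow> int \<Rightarrow> complex" is
  "\<lambda>f n. integral\<^sup>L circle_measure (\<lambda>t. f t * t powi (- n))"
proof (rule ext)
  fix f g :: "complex \<Rightarrow> complex" and n :: int
  assume "circle_eq f g"
  then have [measurable]: "f \<in> borel_measurable borel" "g \<in> borel_measurable borel"
    and "AE t in circle_measure. f t = g t"
    by (auto simp: circle_eq_def)
  then show "integral\<^sup>L circle_measure (\<lambda>t. f t * t powi (- n))
      = integral\<^sup>L circle_measure (\<lambda>t. g t * t powi (- n))"
    by (intro integral_cong_AE) auto
qed


subsection \<open>Function spaces\<close>

lift_definition in_Lp :: "real \<Rightarrow> L0 \<Rightarrow> bool" is
  "\<lambda>p f. integrable circle_measure (\<lambda>t. norm (f t) powr p)"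
proof -
  fix p :: real and f g :: "complex \<Rightarrow> complex"
  assume "circle_eq f g"
  then have [measurable]: "f \<in> borel_measurable borel" "g \<in> borel_measurable borel"
    and "AE t in circle_measure. f t = g t"
    by (auto simp: circle_eq_def)
  then show "integrable circle_measure (\<lambda>t. norm (f t) powr p)
      = integrable circle_measure (\<lambda>t. norm (g t) powr p)"
    by (intro integrable_cong_AE) auto
qed

lift_definition Lp_norm :: "real \<Rightarrow> L0 \<Rightarrow> real" is
  "\<lambda>p f. (integral\<^sup>L circle_measure (\<lambda>t. norm (f t) powr p)) powr (1 / p)"
proof -
  fix p :: real and f g :: "complex \<Rightarrow> complex"
  assume "circle_eq f g"
  then have [measurable]: "f \<in> borel_measurable borel" "g \<in> borel_measurable borel"
    and "AE t in circle_measure. f t = g t"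
    by (auto simp: circle_eq_def)
  then have "integral\<^sup>L circle_measure (\<lambda>t. norm (f t) powr p)
      = integral\<^sup>L circle_measure (\<lambda>t. norm (g t) powr p)"
    by (intro integral_cong_AE) auto
  then show "(integral\<^sup>L circle_measure (\<lambda>t. norm (f t) powr p)) powr (1 / p)
      = (integral\<^sup>L circle_measure (\<lambda>t. norm (g t) powr p)) powr (1 / p)"
    by simp
qed

lift_definition ess_bounded :: "L0 \<Rightarrow> bool" is
  "\<lambda>f. \<exists>C. AE t in circle_measure. norm (f t) \<le> C"
  unfolding circle_eq_def by (rule iff_exI, rule eventually_subst, elim conjE) (auto elim: AE_mp)

definition Lp :: "real \<Rightarrow> L0 set" where
  "Lp p = {f. in_Lp p f}"

definition Linf :: "L0 set" where
  "Linf = {f. ess_bounded f}"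

definition GLinf :: "L0 set" where
  "GLinf = {f \<in> Linf. \<exists>g \<in> Linf. f * g = 1}"

definition Hp :: "real \<Rightarrow> L0 set" where
  "Hp p = {f \<in> Lp p. \<forall>n<0. fourier_coeff f n = 0}"

definition conj_Hp :: "real \<Rightarrow> L0 set" where
  "conj_Hp p = {f. conj_fun f \<in> Hp p}"

definition Lp_even :: "real \<Rightarrow> L0 set" where
  "Lp_even p = {f \<in> Lp p. reflect f = f}"

definition trig_poly :: "L0 set" where
  "trig_poly = L0.span (range tpow)"


subsection \<open>Operators\<close>

definition J :: "L0 \<Rightarrow> L0" where
  "J f = tpow (- 1) * reflect f"

definition Lp_J :: "real \<Rightarrow> L0 set" where
  "Lp_J p = (\<lambda>f. (1/2) *\<^sub>C (f + J f)) ` Lp p"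

text \<open>An integrable function is determined by its Fourier coefficients. For \<open>f\<close> in \<open>L\<^sup>p\<close> with
  \<open>1 < p < \<infinity>\<close> the function described here exists (and lies in \<open>L\<^sup>p\<close>) by M. Riesz' theorem.\<close>

definition riesz_proj :: "L0 \<Rightarrow> L0" where
  "riesz_proj f = (THE g. g \<in> Lp 1 \<and>
     (\<forall>n. fourier_coeff g n = (if n \<ge> 0 then fourier_coeff f n else 0)))"

definition T_op :: "L0 \<Rightarrow> L0 \<Rightarrow> L0" where
  "T_op \<phi> f = riesz_proj (\<phi> * f)"

definition H_op :: "L0 \<Rightarrow> L0 \<Rightarrow> L0" where
  "H_op \<phi> f = riesz_proj (\<phi> * J f)"

definition M_op :: "L0 \<Rightarrow> L0 \<Rightarrow> L0" where
  "M_op \<phi> f = T_op \<phi> f + H_op \<phi> f"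

text \<open>In the following, a normed space is a subspace \<open>V\<close> of \<^typ>\<open>L0\<close> with a norm \<open>N\<close> on it, and
  the values of an operator outside \<open>V\<close> are irrelevant.\<close>

definition linear_on_space ::
  "(complex \<Rightarrow> 'b \<Rightarrow> 'b) \<Rightarrow> L0 set \<Rightarrow> (L0 \<Rightarrow> 'b::ab_group_add) \<Rightarrow> bool" where
  "linear_on_space s V A \<longleftrightarrow>
     (\<forall>f\<in>V. \<forall>g\<in>V. A (f + g) = A f + A g) \<and> (\<forall>c. \<forall>f\<in>V. A (c *\<^sub>C f) = s c (A f))"

definition bounded_op :: "L0 set \<Rightarrow> (L0 \<Rightarrow> real) \<Rightarrow> L0 set \<Rightarrow> (L0 \<Rightarrow> real) \<Rightarrow> (L0 \<Rightarrow> L0) \<Rightarrow> bool" where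
  "bounded_op V N W N' A \<longleftrightarrow>
     A ` V \<subseteq> W \<and> linear_on_space cscale V A \<and> (\<exists>C. \<forall>f\<in>V. N' (A f) \<le> C * N f)"

definition ker_on :: "L0 set \<Rightarrow> (L0 \<Rightarrow> L0) \<Rightarrow> L0 set" where
  "ker_on V A = {f \<in> V. A f = 0}"

definition norm_closed_in :: "L0 set \<Rightarrow> (L0 \<Rightarrow> real) \<Rightarrow> L0 set \<Rightarrow> bool" where
  "norm_closed_in V N S \<longleftrightarrow>
     (\<forall>g\<in>V. \<forall>u::nat \<Rightarrow> L0. range u \<subseteq> S \<and> (\<lambda>n. N (u n - g)) \<longlonglongrightarrow> 0 \<longrightarrow> g \<in> S)"

text \<open>The last conjunct says that the cokernel \<open>V / A(V)\<close> is finite dimensional.\<close>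

definition fredholm :: "L0 set \<Rightarrow> (L0 \<Rightarrow> real) \<Rightarrow> (L0 \<Rightarrow> L0) \<Rightarrow> bool" where
  "fredholm V N A \<longleftrightarrow>
     bounded_op V N V N A \<and>
     norm_closed_in V N (A ` V) \<and>
     (\<exists>F. finite F \<and> ker_on V A \<subseteq> L0.span F) \<and>
     (\<exists>F. finite F \<and> F \<subseteq> V \<and> V \<subseteq> L0.span (F \<union> A ` V))"


subsection \<open>The dual space and the adjoint\<close>

text \<open>Functionals on \<open>V\<close> are represented by functions that vanish outside \<open>V\<close>.\<close>

interpretation fnl: vector_space "\<lambda>(c::complex) (l::L0 \<Rightarrow> complex) f. c * l f"
  by unfold_locales (auto simp: fun_eq_iff algebra_simps)

definition dual_space :: "L0 set \<Rightarrow> (L0 \<Rightarrow> real) \<Rightarrow> (L0 \<Rightarrow> complex) set" where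
  "dual_space V N = {l. linear_on_space (*) V l \<and> (\<exists>C. \<forall>f\<in>V. norm (l f) \<le> C * N f) \<and>
     (\<forall>f. f \<notin> V \<longrightarrow> l f = 0)}"

definition adjoint_op :: "L0 set \<Rightarrow> (L0 \<Rightarrow> L0) \<Rightarrow> (L0 \<Rightarrow> complex) \<Rightarrow> (L0 \<Rightarrow> complex)" where
  "adjoint_op V A l = (\<lambda>f. if f \<in> V then l (A f) else 0)"

definition ker_adjoint :: "L0 set \<Rightarrow> (L0 \<Rightarrow> real) \<Rightarrow> (L0 \<Rightarrow> L0) \<Rightarrow> (L0 \<Rightarrow> complex) set" where
  "ker_adjoint V N A = {l \<in> dual_space V N. adjoint_op V A l = 0}"


subsection \<open>Asymmetric factorization\<close>

definition X1 :: "L0 set" where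
  "X1 = {(1 - tpow (- 1)) * f |f. f \<in> trig_poly}"

definition X2 :: "L0 \<Rightarrow> L0 set" where
  "X2 \<phi>0 = {(1 + tpow (- 1)) * inverse \<phi>0 * f |f. f \<in> trig_poly \<and> reflect f = f}"

definition B_op :: "L0 \<Rightarrow> L0 \<Rightarrow> L0 \<Rightarrow> L0" where
  "B_op \<phi>m \<phi>0 f = (let g = riesz_proj (inverse \<phi>m * f) in inverse \<phi>0 * (g + J g))"

definition asymmetric_factorization ::
  "real \<Rightarrow> real \<Rightarrow> L0 \<Rightarrow> L0 \<Rightarrow> int \<Rightarrow> L0 \<Rightarrow> bool" where
  "asymmetric_factorization p q \<phi> \<phi>m \<kappa> \<phi>0 \<longleftrightarrow>
     \<phi> = \<phi>m * tpow \<kappa> * \<phi>0 \<and>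
     (1 + tpow (- 1)) * \<phi>m \<in> conj_Hp p \<and>
     (1 - tpow (- 1)) * inverse \<phi>m \<in> conj_Hp q \<and>
     abs_fun (1 - tpow 1) * \<phi>0 \<in> Lp_even q \<and>
     abs_fun (1 + tpow 1) * inverse \<phi>0 \<in> Lp_even p \<and>
     B_op \<phi>m \<phi>0 ` X1 \<subseteq> X2 \<phi>0 \<and>
     (\<exists>E. bounded_op (Lp p) (Lp_norm p) (Lp_J p) (Lp_norm p) E \<and> (\<forall>f\<in>X1. E f = B_op \<phi>m \<phi>0 f))"

end

(* Put M(phi) x = P(phi (x + J x)); the function x + J x runs through the fixed space of J as x runs
   through H^p. If M(phi) is invertible, solving M(phi) x = 1 and the corresponding dual equation
   yields antianalytic f and k in L^p and L^q whose product is, by a parity argument, 1 - t^(-2); so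
   phi_- = f/(1 + t^(-1)), and phi_0 = phi/phi_- is even. The operator B of (iii) agrees on X_1 with
   y |-> (I + J) M(phi)^(-1) P y, so B extends boundedly exactly when M(phi) is invertible, X_1 being
   dense. Thus index zero factorizations correspond to invertible operators.

   In general P t^(-n) M(phi) = M(t^(-n) phi). This makes a Fredholm M(phi) surjective after a large
   shift, and Coburn's lemma allows one to remove the kernel again by successive multiplications
   with t while keeping surjectivity. So phi = t^kappa psi with M(psi) invertible, and the defect
   numbers are those of the n-fold backward shift. The analytic input is the boundedness of P for
   all p (M. Riesz), proved from the conformal estimate for |Im z|^p when p <= 2 and by duality
   for p >= 2, and the duality of L^p and L^q, proved by minimization with the help of Clarkson's
   inequality. *)
theory Submission
  imports Defs "HOL-Complex_Analysis.Complex_Analysis"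
begin

subsection \<open>The circle measure\<close>

text \<open>The weights in the factorization come from t = 1 and t = -1, the fixed points of the
  flip t -> 1/t. A function fixed by \<open>J\<close> satisfies
  \<open>reflect h = tpow 1 * h\<close>; its counterpart for the adjoint satisfies, up to a shift,
  such a relation with a minus sign, so their product is odd up to a power of t. Oddness and
  antianalyticity together leave the single mode t - t^(-1), which vanishes exactly at those two
  points, and one zero is given to each factor. The same parity argument with leading coefficient 0
  instead of 1 yields injectivity and the analogue of Coburn's lemma.

  Finite codimension of the range does not by itself make a shifted operator surjective: the
  complement must consist of polynomials, for these are what a backward shift kills. Closedness of
  the range and density of the polynomials in H^p provide such a complement. In the opposite
  direction, if the constant 1 is missing from the range after multiplication by t, the constant
  left over when an equation is solved modulo the range is a nonzero functional annihilating the
  range; its boundedness is an instance of the open mapping theorem.\<close>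

lemma emeasure_circle_UNIV [simp]: "emeasure circle_measure UNIV = 1"
  unfolding circle_measure_def by (subst emeasure_distr) (auto simp: emeasure_uniform_measure)

lemma measure_circle_UNIV [simp]: "measure circle_measure UNIV = 1"
  by (simp add: measure_def)

interpretation circle: finite_measure circle_measure
  by standard simp

lemma AE_circle_cis:
  assumes "Measurable.pred borel Q"
    and "AE x in lborel. x \<in> {-pi..pi} \<longrightarrow> Q (cis x)"
  shows "AE t in circle_measure. Q t"
proof -
  have "AE x in uniform_measure lborel {-pi..pi}. Q (cis x)"
    by (rule AE_uniform_measureI) (use assms in auto)
  then show ?thesis
    unfolding circle_measure_def using assms(1)
    by (subst AE_distr_iff) (auto simp: pred_def)
qed

lemma AE_circle_norm: "AE t in circle_measure. norm t = 1"
proof (rule AE_circle_cis)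
  show "Measurable.pred borel (\<lambda>t::complex. norm t = 1)" by measurable
qed simp

text \<open>On the circle \<open>Im t = 0\<close> singles out t = 1 and t = -1, the zeros of all the
  weights \<open>1 + tpow (- 1)\<close>, \<open>1 - tpow (- 1)\<close> and their relatives, so these
  weights may be divided by.\<close>

lemma AE_circle_Im: "AE t in circle_measure. Im t \<noteq> 0"
proof (rule AE_circle_cis)
  have *: "x \<in> {-pi, 0, pi}" if x: "x \<in> {-pi..pi}" "sin x = 0" for x :: real
  proof -
    obtain k :: int where k: "x = of_int k * pi"
      using x(2) by (auto simp: sin_zero_iff_int2)
    then have "\<bar>of_int k * pi\<bar> \<le> 1 * pi"
      using x(1) by (auto simp: abs_le_iff)
    then have "\<bar>of_int k :: real\<bar> \<le> 1"
      by (simp add: abs_mult)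
    then have "k \<in> {-1, 0, 1}" by auto
    then show ?thesis using k by auto
  qed
  have "AE x in lborel. x \<notin> {-pi, 0, pi :: real}"
    by (rule AE_not_in) (rule finite_imp_null_set_lborel, simp)
  then show "AE x in lborel. x \<in> {- pi..pi} \<longrightarrow> Im (cis x) \<noteq> 0"
    by eventually_elim (use * in auto)
qed measurable

lemma AE_circle_nonzero: "AE t in circle_measure. t \<noteq> 0"
  using AE_circle_norm by eventually_elim auto

lemma integral_circle_measure:
  fixes f :: "complex \<Rightarrow> complex"
  assumes [measurable]: "f \<in> borel_measurable borel"
  shows "integral\<^sup>L circle_measure f = (LINT x:{-pi..pi}|lborel. f (cis x)) /\<^sub>R (2 * pi)"
proof -
  have eq: "(a / b) *\<^sub>R z = inverse b *\<^sub>R (a *\<^sub>R z)" for a b :: real and z :: complex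
    by (simp only: scaleR_scaleR divide_inverse mult.commute)
  have "integral\<^sup>L circle_measure f = (LINT x|uniform_measure lborel {-pi..pi}. f (cis x))"
    unfolding circle_measure_def by (subst integral_distr) auto
  also have "uniform_measure lborel {-pi..pi}
      = density lborel (\<lambda>x. ennreal (indicator {-pi..pi} x / (2 * pi)))"
    unfolding uniform_measure_def
    by (rule density_cong)
       (auto simp: divide_ennreal[symmetric] split: split_indicator)
  also have "(LINT x|\<dots>. f (cis x)) = (LINT x|lborel. (indicator {-pi..pi} x / (2 * pi)) *\<^sub>R f (cis x))"
    by (subst integral_density) auto
  also have "(LINT x|lborel. (indicator {-pi..pi} x / (2 * pi)) *\<^sub>R f (cis x)) = (LINT x|lborel. inverse (2 * pi) *\<^sub>R (indicator {-pi..pi} x *\<^sub>R f (cis x)))"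
    unfolding eq ..
  finally show ?thesis
    unfolding set_lebesgue_integral_def by (simp only: integral_scaleR_right)
qed

lemma integral_circle_measure_has_integral:
  fixes f :: "complex \<Rightarrow> complex"
  assumes "continuous_on (sphere 0 1) f" "f \<in> borel_measurable borel"
    "((\<lambda>x. f (cis x)) has_integral I) {-pi..pi}"
  shows "integral\<^sup>L circle_measure f = I / of_real (2 * pi)"
proof -
  have "continuous_on {-pi..pi} (\<lambda>x. f (cis x))"
    by (rule continuous_on_compose2[OF assms(1)]) (auto intro!: continuous_intros)
  then have "set_integrable lborel {-pi..pi} (\<lambda>x. f (cis x))"
    by (rule borel_integrable_atLeastAtMost')
  then have "(LINT x:{-pi..pi}|lborel. f (cis x)) = integral {-pi..pi} (\<lambda>x. f (cis x))"
    by (rule set_borel_integral_eq_integral)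
  also have "\<dots> = I" using assms(3) by (rule integral_unique)
  finally show ?thesis
    by (simp add: integral_circle_measure[OF assms(2)] scaleR_conv_of_real field_simps)
qed

lemma integrable_circle_bounded:
  fixes f :: "complex \<Rightarrow> 'a::{banach, second_countable_topology}"
  assumes [measurable]: "f \<in> borel_measurable borel" and "AE t in circle_measure. norm (f t) \<le> C"
  shows "integrable circle_measure f"
  by (rule circle.integrable_const_bound[OF assms(2)]) simp

lemma integral_circle_powi:
  "integral\<^sup>L circle_measure (\<lambda>t. t powi n) = (if n = 0 then 1 else 0)"
proof (cases "n = 0")
  case True
  then show ?thesis by simp
next
  case False
  have cis_powi: "cis x powi n = cis (of_int n * x)" for x
    by (simp add: cis_power_int)
  have "((\<lambda>x. cis (of_int n * x)) has_integral
      (cis (of_int n * pi) / (\<i> * of_int n) - cis (of_int n * - pi) / (\<i> * of_int n))) {-pi..pi}"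
  proof (rule fundamental_theorem_of_calculus)
    fix x :: real
    have "((\<lambda>z. exp (\<i> * of_int n * z) / (\<i> * of_int n)) has_field_derivative
        exp (\<i> * of_int n * of_real x)) (at (of_real x))"
      using False by (auto intro!: derivative_eq_intros)
    then have "((\<lambda>x. exp (\<i> * of_int n * of_real x) / (\<i> * of_int n)) has_vector_derivative
        exp (\<i> * of_int n * of_real x)) (at x within {-pi..pi})"
      by (rule has_vector_derivative_real_field)
    then show "((\<lambda>x. cis (of_int n * x) / (\<i> * of_int n)) has_vector_derivative
        cis (of_int n * x)) (at x within {-pi..pi})"
      by (simp add: cis_conv_exp mult_ac)
  qed simp
  moreover have "cis (of_int n * pi) = cis (of_int n * - pi)"
    by (simp add: complex_eq_iff sin_int_times_real mult.commute[of _ pi] sin_npi_int)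
  ultimately have *: "((\<lambda>x. cis x powi n) has_integral 0) {-pi..pi}"
    unfolding cis_powi by simp
  have "continuous_on (sphere 0 1) (\<lambda>t::complex. t powi n)"
    by (intro continuous_on_power_int continuous_on_id) auto
  then have "integral\<^sup>L circle_measure (\<lambda>t. t powi n) = 0 / of_real (2 * pi)"
    using measurable_powi * by (rule integral_circle_measure_has_integral)
  then show ?thesis using False by simp
qed

subsection \<open>The algebra of classes of functions\<close>

lemma circle_eqI:
  assumes "f \<in> borel_measurable borel" "g \<in> borel_measurable borel"
    and "\<And>t. norm t = 1 \<Longrightarrow> f t = g t"
  shows "circle_eq f g"
  unfolding circle_eq_def using assms AE_circle_norm by (auto elim: AE_mp)

lemma circle_eq_refl_iff [simp]: "circle_eq f f \<longleftrightarrow> f \<in> borel_measurable borel"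
  by (auto simp: circle_eq_def)

lemma nonzero_norm_1: "norm (t::complex) = 1 \<Longrightarrow> t \<noteq> 0"
  by auto

lemma inverse_norm_1: "norm (t::complex) = 1 \<Longrightarrow> inverse t = cnj t"
  by (rule inverse_unique) (simp add: complex_norm_square[symmetric])

lemma L0_exhaust:
  obtains f where "f \<in> borel_measurable borel" "x = abs_L0 f"
proof -
  have "\<exists>f. f \<in> borel_measurable borel \<and> x = abs_L0 f"
    by (rule L0.abs_induct[of _ x]) auto
  then show ?thesis using that by blast
qed

lemma abs_L0_eq_iff:
  assumes "f \<in> borel_measurable borel" "g \<in> borel_measurable borel"
  shows "abs_L0 f = abs_L0 g \<longleftrightarrow> (AE t in circle_measure. f t = g t)"
  using Quotient_rel[OF Quotient_L0, of f g] assms by (auto simp: circle_eq_def)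

lemma tpow_add: "tpow m * tpow n = tpow (m + n)"
  by transfer (intro circle_eqI, auto simp: nonzero_norm_1 power_int_add)

lemma tpow_0 [simp]: "tpow 0 = 1"
  by transfer (simp add: circle_eq_def)

lemma tpow_mult_cancel: "tpow n * (tpow (- n) * f) = f" "tpow (- n) * (tpow n * f) = f"
  by (simp_all add: mult.assoc[symmetric] tpow_add)

lemma tpow_mult_assoc: "tpow m * (tpow n * f) = tpow (m + n) * f"
  by (simp add: mult.assoc[symmetric] tpow_add)

lemma cscale_mult_left: "(c *\<^sub>C f) * g = c *\<^sub>C (f * g)"
  by transfer (auto simp: circle_eq_def mult.assoc)

lemma cscale_mult_right: "f * (c *\<^sub>C g) = c *\<^sub>C (f * g)"
  by transfer (auto simp: circle_eq_def)

lemma reflect_add: "reflect (f + g) = reflect f + reflect g"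
  by transfer (auto simp: circle_eq_def)

lemma reflect_diff: "reflect (f - g) = reflect f - reflect g"
  by transfer (auto simp: circle_eq_def)

lemma reflect_mult: "reflect (f * g) = reflect f * reflect g"
  by transfer (auto simp: circle_eq_def)

lemma reflect_inverse: "reflect (inverse f) = inverse (reflect f)"
  by transfer (auto simp: circle_eq_def)

lemma reflect_cscale: "reflect (c *\<^sub>C f) = c *\<^sub>C reflect f"
  by transfer (auto simp: circle_eq_def)

lemma reflect_reflect [simp]: "reflect (reflect f) = f"
  by transfer (auto simp: circle_eq_def)

lemma reflect_1 [simp]: "reflect 1 = 1"
  by transfer (auto simp: circle_eq_def)

lemma reflect_0 [simp]: "reflect 0 = 0"
  by transfer (auto simp: circle_eq_def)

lemma reflect_tpow [simp]: "reflect (tpow n) = tpow (- n)"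
  by transfer (auto simp: circle_eq_def power_int_minus power_int_inverse)

lemma conj_fun_conj_fun [simp]: "conj_fun (conj_fun f) = f"
  by transfer (auto simp: circle_eq_def)

text \<open>On the circle 1 + c/t is the complex conjugate of 1 + (cnj c) t. The values c = 1 and c
  = -1 show that the weights in condition (ii) are even.\<close>

lemma reflect_abs_tpow: "reflect (abs_fun (1 + c *\<^sub>C tpow 1)) = abs_fun (1 + cnj c *\<^sub>C tpow 1)"
proof (transfer, intro circle_eqI)
  fix c t :: complex assume t: "norm t = 1"
  have "1 + c * inverse t = cnj (1 + cnj c * t)"
    using inverse_norm_1[OF t] by simp
  then have "norm (1 + c * inverse t) = norm (1 + cnj c * t)"
    by (metis complex_mod_cnj)
  then show "complex_of_real (norm (1 + c * inverse t powi 1)) = complex_of_real (norm (1 + cnj c * t powi 1))"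
    by simp
qed measurable

lemma inverse_eqI:
  fixes a b :: L0
  assumes "a * b = 1"
  shows "inverse a = b"
  using assms
  by transfer (auto simp: circle_eq_def elim!: eventually_mono intro: inverse_unique)

lemma mult_inverse_L0:
  fixes a b :: L0
  assumes "a * b = 1"
  shows "a * inverse a = 1"
  using inverse_eqI[OF assms] assms by simp

text \<open>\<open>L0\<close> has zero divisors, so cancellation has to be earned. Since
  \<open>inverse\<close> is the pointwise reciprocal with value 0 at 0, the equation holds exactly
  for classes that are nonzero almost everywhere.\<close>

definition unit :: "L0 \<Rightarrow> bool" where
  "unit a \<longleftrightarrow> a * inverse a = 1"

lemma unitI: "a * b = 1 \<Longrightarrow> unit a"
  by (simp add: unit_def mult_inverse_L0)

lemma unit_inverse: "unit a \<Longrightarrow> a * inverse a = 1"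
  by (simp add: unit_def)

lemma unit_mult: "unit a \<Longrightarrow> unit b \<Longrightarrow> unit (a * b)"
proof (rule unitI)
  assume "unit a" "unit b"
  have "a * b * (inverse a * inverse b) = (a * inverse a) * (b * inverse b)"
    by (simp only: mult_ac)
  also have "\<dots> = 1"
    using \<open>unit a\<close> \<open>unit b\<close> by (simp add: unit_def)
  finally show "a * b * (inverse a * inverse b) = 1" .
qed

lemma unit_multD: "unit (a * b) \<Longrightarrow> unit a" "unit (a * b) \<Longrightarrow> unit b"
  by (rule unitI[of _ "b * inverse (a * b)"], simp add: unit_def mult.assoc)
     (rule unitI[of _ "a * inverse (a * b)"], simp add: unit_def mult_ac)

lemma unit_cancel: "unit a \<Longrightarrow> a * f = a * g \<Longrightarrow> f = g"
  by (metis mult.assoc mult.commute mult_1 unit_def)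

lemma unit_tpow [simp]: "unit (tpow n)"
  by (rule unitI[of _ "tpow (- n)"]) (simp add: tpow_add)

lemma unit_iff_nonzero: "unit (abs_L0 f) \<longleftrightarrow> (AE t in circle_measure. f t \<noteq> 0)"
  if [measurable]: "f \<in> borel_measurable borel"
proof -
  have "unit (abs_L0 f) \<longleftrightarrow> (AE t in circle_measure. f t * inverse (f t) = 1)"
    unfolding unit_def inverse_L0.abs_eq[OF circle_eq_refl_iff[THEN iffD2, OF that]] one_L0.abs_eq
    by (subst times_L0.abs_eq) (auto simp: abs_L0_eq_iff)
  also have "\<dots> \<longleftrightarrow> (AE t in circle_measure. f t \<noteq> 0)"
    by (intro AE_cong) (auto simp: field_simps)
  finally show ?thesis .
qed

lemma unit_nonvanishing:
  assumes "\<And>t. norm t = 1 \<Longrightarrow> Im t \<noteq> 0 \<Longrightarrow> f t \<noteq> 0" "f \<in> borel_measurable borel"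
  shows "unit (abs_L0 f)"
  unfolding unit_iff_nonzero[OF assms(2)] using AE_circle_norm AE_circle_Im
  by eventually_elim (use assms(1) in auto)

lemma unit_tpow_plus:
  "unit (1 + tpow (- 1))" "unit (1 - tpow (- 1))" "unit (1 + tpow 1)" "unit (1 - tpow 1)"
  "unit (abs_fun (1 + tpow 1))" "unit (abs_fun (1 - tpow 1))"
proof -
  have *: "t \<noteq> 1" "t \<noteq> - 1" "inverse t \<noteq> 1" "inverse t \<noteq> -1" if "Im t \<noteq> 0" for t :: complex
    using that by (auto simp: inverse_eq_iff_eq[of t "-1", simplified])
  note [simp] = tpow.abs_eq one_L0.abs_eq plus_L0.abs_eq minus_L0.abs_eq abs_fun.abs_eq
  show "unit (1 + tpow (- 1))" "unit (1 - tpow (- 1))" "unit (1 + tpow 1)" "unit (1 - tpow 1)"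
       "unit (abs_fun (1 + tpow 1))" "unit (abs_fun (1 - tpow 1))"
    by (simp, rule unit_nonvanishing, use * in \<open>auto simp: add_eq_0_iff power_int_minus equation_minus_iff\<close>)+
qed

lemma J_add: "J (f + g) = J f + J g"
  by (simp add: J_def reflect_add algebra_simps)

lemma J_cscale: "J (c *\<^sub>C f) = c *\<^sub>C J f"
  by (simp add: J_def reflect_cscale cscale_mult_right)

lemma J_0 [simp]: "J 0 = 0"
  by (simp add: J_def)

lemma J_J [simp]: "J (J f) = f"
  by (simp add: J_def reflect_mult tpow_mult_assoc)

lemma J_tpow [simp]: "J (tpow n) = tpow (- 1 - n)"
  by (simp add: J_def tpow_add)

lemma J_mult: "J (f * g) = reflect f * J g"
  by (simp add: J_def reflect_mult mult_ac)

subsection \<open>Norm inequalities\<close>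

text \<open>The concave function x^s lies below its tangent at x = 1. With s = p/r this linear bound
  replaces Jensen's inequality in the comparison of L^p and L^r norms.\<close>

lemma bernoulli_powr:
  fixes x s :: real
  assumes "0 \<le> x" "0 < s" "s \<le> 1"
  shows "x powr s \<le> 1 + s * (x - 1)"
proof (cases "x = 0")
  case False
  then show ?thesis
    using Youngs_inequality_0[of s "1 - s" x 1] assms by (simp add: algebra_simps)
qed (use assms in auto)

text \<open>For positive x and y this is convexity of the power function; on the boundary it reduces
  to u^p <= u for 0 <= u <= 1.\<close>

lemma powr_convex_nonneg:
  fixes x y p u v :: real
  assumes "1 \<le> p" "0 \<le> x" "0 \<le> y" "0 \<le> u" "0 \<le> v" "u + v = 1"
  shows "(u * x + v * y) powr p \<le> u * x powr p + v * y powr p"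
proof -
  have aux: "(u * x) powr p \<le> u * x powr p" if "0 \<le> u" "u \<le> 1" "0 \<le> x" for u x :: real
  proof (cases "u = 0")
    case False
    then have "u powr p \<le> u" using that powr_le_one_le[of u p] assms by auto
    then show ?thesis using that by (simp add: powr_mult mult_right_mono)
  qed auto
  consider "x = 0" | "y = 0" | "x > 0" "y > 0" using assms by force
  then show ?thesis
  proof cases
    case 1
    then show ?thesis using aux[of v y] assms by simp
  next
    case 2
    then show ?thesis using aux[of u x] assms by simp
  next
    case 3
    have u: "u = 1 - v" using assms by simp
    show ?thesis
      using convex_onD[OF powr_convex[OF assms(1)], of v x y] 3 assms unfolding u by simp
  qed
qed

text \<open>A common form for multiplication by bounded functions, moduli, conjugates and powers of
  t: the single lemma \<open>dominated_Lp\<close> turns it into membership in L^p and a norm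
  bound.\<close>

lift_definition dominated :: "real \<Rightarrow> L0 \<Rightarrow> L0 \<Rightarrow> bool" is
  "\<lambda>C f g. AE t in circle_measure. norm (f t) \<le> C * norm (g t)"
proof -
  fix C :: real and f f' g g' :: "complex \<Rightarrow> complex"
  assume "circle_eq f f'" "circle_eq g g'"
  then have "AE t in circle_measure. f t = f' t" "AE t in circle_measure. g t = g' t"
    by (auto simp: circle_eq_def)
  then show "(AE t in circle_measure. norm (f t) \<le> C * norm (g t))
      = (AE t in circle_measure. norm (f' t) \<le> C * norm (g' t))"
    by (intro eventually_subst) (auto elim: AE_mp)
qed

text \<open>The p-th power of the L^p norm. Pointwise inequalities integrate to inequalities between
  such quantities, and the root is taken only at the end.\<close>

lift_definition absint :: "real \<Rightarrow> L0 \<Rightarrow> real" is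
  "\<lambda>p f. integral\<^sup>L circle_measure (\<lambda>t. norm (f t) powr p)"
proof -
  fix p :: real and f g :: "complex \<Rightarrow> complex"
  assume "circle_eq f g"
  then have [measurable]: "f \<in> borel_measurable borel" "g \<in> borel_measurable borel"
    and "AE t in circle_measure. f t = g t"
    by (auto simp: circle_eq_def)
  then show "integral\<^sup>L circle_measure (\<lambda>t. norm (f t) powr p)
      = integral\<^sup>L circle_measure (\<lambda>t. norm (g t) powr p)"
    by (intro integral_cong_AE) auto
qed

section \<open>Inequalities and invariance properties of the L^p norms\<close>

lemma Lp_norm_absint: "Lp_norm p f = absint p f powr (1 / p)"
  by transfer simp

lemma absint_nonneg [simp]: "0 \<le> absint p f"
  by transfer auto

lemma absint_Lp_norm: "0 < p \<Longrightarrow> absint p f = Lp_norm p f powr p"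
  by (simp add: Lp_norm_absint powr_powr)

lemma Lp_norm_nonneg [simp]: "0 \<le> Lp_norm p f"
  by (simp add: Lp_norm_absint)

lemma Lp_norm_1: "Lp_norm 1 f = absint 1 f"
  by (simp add: Lp_norm_absint)

lemma Lp_norm_leI: "0 < p \<Longrightarrow> 0 \<le> C \<Longrightarrow> absint p f \<le> C powr p \<Longrightarrow> Lp_norm p f \<le> C"
  using powr_mono2[of "1/p" "absint p f" "C powr p"] by (simp add: Lp_norm_absint powr_powr)

lemma Lp_iff: "f \<in> Lp p \<longleftrightarrow> in_Lp p f"
  by (simp add: Lp_def)

lemma abs_L0_Lp:
  "f \<in> borel_measurable borel \<Longrightarrow> abs_L0 f \<in> Lp p \<longleftrightarrow> integrable circle_measure (\<lambda>t. norm (f t) powr p)"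
  "f \<in> borel_measurable borel \<Longrightarrow> absint p (abs_L0 f) = (LINT t|circle_measure. norm (f t) powr p)"
  by (simp_all add: Lp_iff in_Lp.abs_eq absint.abs_eq)

lemma dominated_Lp:
  assumes "dominated C f g" "0 < p" "0 \<le> C" "g \<in> Lp p"
  shows "f \<in> Lp p" "Lp_norm p f \<le> C * Lp_norm p g"
proof -
  have "in_Lp p f \<and> absint p f \<le> C powr p * absint p g"
    using assms(1,4) unfolding Lp_iff
  proof (transfer fixing: C p)
    fix f g :: "complex \<Rightarrow> complex"
    assume "circle_eq f f" "circle_eq g g" 
      and dom: "AE t in circle_measure. norm (f t) \<le> C * norm (g t)"
      and int: "integrable circle_measure (\<lambda>t. norm (g t) powr p)"
    then have [measurable]: "f \<in> borel_measurable borel" "g \<in> borel_measurable borel" by simp_all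
    have le: "AE t in circle_measure. norm (f t) powr p \<le> C powr p * norm (g t) powr p"
      using dom by eventually_elim (use assms powr_mono2 in \<open>fastforce simp flip: powr_mult\<close>)
    have int': "integrable circle_measure (\<lambda>t. C powr p * norm (g t) powr p)"
      using int by simp
    have 1: "integrable circle_measure (\<lambda>t. norm (f t) powr p)"
      by (rule Bochner_Integration.integrable_bound[OF int']) (use le in \<open>auto elim: eventually_mono\<close>)
    moreover have "(LINT t|circle_measure. norm (f t) powr p)
        \<le> (LINT t|circle_measure. C powr p * norm (g t) powr p)"
      by (rule integral_mono_AE[OF 1 int' le])
    ultimately show "integrable circle_measure (\<lambda>t. norm (f t) powr p) \<and>
      (LINT t|circle_measure. norm (f t) powr p) \<le> C powr p * (LINT t|circle_measure. norm (g t) powr p)"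
      by simp
  qed
  then show "f \<in> Lp p" "Lp_norm p f \<le> C * Lp_norm p g"
    using assms powr_mono2[of "1/p" "absint p f" "C powr p * absint p g"]
    by (simp_all add: Lp_iff Lp_norm_absint powr_mult powr_powr)
qed

lemma dominated_tpow: "dominated 1 (tpow n * f) f" "dominated 1 f (tpow n * f)"
  by (transfer, rule eventually_mono[OF AE_circle_norm], simp add: norm_mult norm_power_int)+

lemma dominated_conj: "dominated 1 (conj_fun f) f"
  by transfer simp

lemma dominated_abs: "dominated 1 (abs_fun f) f" "dominated 1 f (abs_fun f)"
  "dominated 1 (abs_fun f * g) (f * g)" "dominated 1 (f * g) (abs_fun f * g)"
  by (transfer, simp add: norm_mult)+

lemma dominated_cscale: "dominated (norm c) (c *\<^sub>C f) f"
  by transfer (simp add: norm_mult)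

lemma Linf_dominated:
  assumes "\<phi> \<in> Linf"
  obtains C where "0 \<le> C" "\<And>f. dominated C (\<phi> * f) f"
proof -
  obtain u where u [measurable]: "u \<in> borel_measurable borel" and \<phi>: "\<phi> = abs_L0 u"
    by (rule L0_exhaust)
  obtain C where C: "AE t in circle_measure. norm (u t) \<le> C"
    using assms u by (auto simp: Linf_def \<phi> ess_bounded.abs_eq)
  show ?thesis
  proof (rule that[of "max C 0"])
    fix f
    obtain v where v [measurable]: "v \<in> borel_measurable borel" and f: "f = abs_L0 v"
      by (rule L0_exhaust)
    have "AE t in circle_measure. norm (u t * v t) \<le> max C 0 * norm (v t)"
      using C by eventually_elim (auto simp: norm_mult intro!: mult_right_mono)
    then show "dominated (max C 0) (\<phi> * f) f"
      by (simp add: \<phi> f times_L0.abs_eq dominated.abs_eq)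
  qed simp
qed

lemma Lp_reflect:
  "f \<in> Lp p \<Longrightarrow> reflect f \<in> Lp p" "Lp_norm p (reflect f) = Lp_norm p f"
proof -
  have *: "circle_measure = distr circle_measure borel inverse"
    by (simp add: distr_inverse_circle_measure)
  have "in_Lp p (reflect f) = in_Lp p f"
  proof transfer
    fix p and f :: "complex \<Rightarrow> complex" assume "circle_eq f f"
    then have [measurable]: "f \<in> borel_measurable borel" by simp
    show "integrable circle_measure (\<lambda>t. norm (f (inverse t)) powr p) = 
        integrable circle_measure (\<lambda>t. norm (f t) powr p)"
      by (subst (2) *, subst integrable_distr_eq) auto
  qed
  then show "f \<in> Lp p \<Longrightarrow> reflect f \<in> Lp p" by (simp add: Lp_iff)
  have "absint p (reflect f) = absint p f"
  proof transfer
    fix p and f :: "complex \<Rightarrow> complex" assume "circle_eq f f"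
    then have [measurable]: "f \<in> borel_measurable borel" by simp
    show "(LINT t|circle_measure. norm (f (inverse t)) powr p) = (LINT t|circle_measure. norm (f t) powr p)"
      by (subst (2) *, subst integral_distr) auto
  qed
  then show "Lp_norm p (reflect f) = Lp_norm p f" by (simp add: Lp_norm_absint)
qed

lemma Lp_norm_eq_0:
  assumes "0 < p" "f \<in> Lp p" "Lp_norm p f = 0"
  shows "f = 0"
proof -
  have "absint p f = 0" using assms by (simp add: Lp_norm_absint)
  then show ?thesis using assms(2) unfolding Lp_iff
    by transfer (auto simp: circle_eq_def integral_nonneg_eq_0_iff_AE)
qed

lemma Lp_0 [simp]: "0 \<in> Lp p" "Lp_norm p 0 = 0" "absint p 0 = 0"
  unfolding Lp_iff Lp_norm_absint by (transfer, simp)+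

text \<open>Writing |f| + |g| as (a + b) times a convex combination of |f|/a and |g|/b and using
  convexity of the p-th power gives a bound for all positive a and b. The weights stay free so that
  they can later be set to the two norms.\<close>

lemma Lp_add_aux:
  assumes "1 \<le> p" "f \<in> Lp p" "g \<in> Lp p"
  shows "f + g \<in> Lp p \<and> (\<forall>a>0. \<forall>b>0. absint p (f + g) \<le>
     (a + b) powr p * (a / (a + b) * (absint p f / a powr p) + b / (a + b) * (absint p g / b powr p)))"
  using assms(2,3) unfolding Lp_iff
proof (transfer fixing: p)
  fix f g :: "complex \<Rightarrow> complex"
  assume "circle_eq f f" "circle_eq g g" 
    and int [simp]: "integrable circle_measure (\<lambda>t. norm (f t) powr p)"
      "integrable circle_measure (\<lambda>t. norm (g t) powr p)"
  then have [measurable]: "f \<in> borel_measurable borel" "g \<in> borel_measurable borel" by simp_all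
  have eq: "c * (a / c * (x / a) + b / c * (y / b)) = x + y" if "a \<noteq> 0" "b \<noteq> 0" "c \<noteq> 0" for a b c x y :: real
    using that by (simp add: field_simps)
  have le: "norm (f t + g t) powr p \<le> (a + b) powr p *
      (a / (a + b) * (norm (f t) powr p / a powr p) + b / (a + b) * (norm (g t) powr p / b powr p))"
    if ab: "a > 0" "b > 0" for a b t
  proof -
    have "norm (f t + g t) powr p \<le> (norm (f t) + norm (g t)) powr p"
      using assms norm_triangle_ineq by (intro powr_mono2) auto
    also have "norm (f t) + norm (g t)
        = (a + b) * (a / (a + b) * (norm (f t) / a) + b / (a + b) * (norm (g t) / b))"
      using ab by (intro eq[symmetric]) auto
    also have "\<dots> powr p = (a + b) powr p * (a / (a + b) * (norm (f t) / a) + b / (a + b) * (norm (g t) / b)) powr p"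
      by (simp add: powr_mult)
    also have "\<dots> \<le> (a + b) powr p *
      (a / (a + b) * (norm (f t) / a) powr p + b / (a + b) * (norm (g t) / b) powr p)"
      using ab assms by (intro mult_left_mono powr_convex_nonneg) (auto simp: add_divide_distrib[symmetric])
    finally show ?thesis by (simp add: powr_divide)
  qed
  have int': "integrable circle_measure (\<lambda>t. (a + b) powr p *
      (a / (a + b) * (norm (f t) powr p / a powr p) + b / (a + b) * (norm (g t) powr p / b powr p)))" for a b
    by (intro integrable_mult_right Bochner_Integration.integrable_add integrable_divide) auto
  have 1: "integrable circle_measure (\<lambda>t. norm (f t + g t) powr p)"
    by (rule Bochner_Integration.integrable_bound[OF int'[of 1 1]]) (use le[of 1 1] in \<open>auto intro!: AE_I2 order_trans[OF _ abs_ge_self]\<close>)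
  show "integrable circle_measure (\<lambda>t. norm (f t + g t) powr p) \<and>
     (\<forall>a>0. \<forall>b>0. (LINT t|circle_measure. norm (f t + g t) powr p) \<le>
     (a + b) powr p * (a / (a + b) * ((LINT t|circle_measure. norm (f t) powr p) / a powr p)
        + b / (a + b) * ((LINT t|circle_measure. norm (g t) powr p) / b powr p)))"
  proof (intro conjI allI impI 1)
    fix a b :: real assume ab: "a > 0" "b > 0"
    have "(LINT t|circle_measure. norm (f t + g t) powr p) \<le> (LINT t|circle_measure. (a + b) powr p *
      (a / (a + b) * (norm (f t) powr p / a powr p) + b / (a + b) * (norm (g t) powr p / b powr p)))"
      by (rule integral_mono[OF 1 int' le[OF ab]])
    then show "(LINT t|circle_measure. norm (f t + g t) powr p) \<le>
     (a + b) powr p * (a / (a + b) * ((LINT t|circle_measure. norm (f t) powr p) / a powr p)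
        + b / (a + b) * ((LINT t|circle_measure. norm (g t) powr p) / b powr p))"
      by (subst (asm) integral_mult_right_zero, subst (asm) Bochner_Integration.integral_add) auto
  qed
qed

lemma Lp_add:
  assumes "1 \<le> p" "f \<in> Lp p" "g \<in> Lp p"
  shows "f + g \<in> Lp p" "Lp_norm p (f + g) \<le> Lp_norm p f + Lp_norm p g"
proof -
  show "f + g \<in> Lp p" using Lp_add_aux[OF assms] by simp
  show "Lp_norm p (f + g) \<le> Lp_norm p f + Lp_norm p g"
  proof (cases "Lp_norm p f = 0 \<or> Lp_norm p g = 0")
    case True
    then show ?thesis using Lp_norm_eq_0[of p f] Lp_norm_eq_0[of p g] assms by force
  next
    case False
    define a b where "a = Lp_norm p f" and "b = Lp_norm p g"
    have ab: "a > 0" "b > 0" using False by (auto simp: a_def b_def less_le)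
    have f: "absint p f = a powr p" "absint p g = b powr p"
      using assms by (simp_all add: a_def b_def absint_Lp_norm)
    \<comment> \<open>With a and b equal to the norms, both normalized integrals in the auxiliary
      bound are 1.\<close>
    have "absint p (f + g) \<le> (a + b) powr p * (a / (a + b) + b / (a + b))"
      using Lp_add_aux[OF assms] ab unfolding f by (metis divide_self_if less_irrefl mult.right_neutral powr_gt_zero)
    also have "a / (a + b) + b / (a + b) = 1" using ab by (simp add: add_divide_distrib[symmetric])
    finally show ?thesis
      using assms ab by (intro Lp_norm_leI) (auto simp: a_def b_def)
  qed
qed

lemma Lp_cscale:
  assumes "0 < p" "f \<in> Lp p"
  shows "c *\<^sub>C f \<in> Lp p" "Lp_norm p (c *\<^sub>C f) = norm c * Lp_norm p f"
proof -
  show 1: "c *\<^sub>C f \<in> Lp p"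
    by (rule dominated_Lp[OF dominated_cscale]) (use assms in auto)
  show "Lp_norm p (c *\<^sub>C f) = norm c * Lp_norm p f"
  proof (cases "c = 0")
    case False
    have "Lp_norm p (c *\<^sub>C f) \<le> norm c * Lp_norm p f"
      by (rule dominated_Lp[OF dominated_cscale]) (use assms in auto)
    moreover have "Lp_norm p (inverse c *\<^sub>C c *\<^sub>C f) \<le> norm (inverse c) * Lp_norm p (c *\<^sub>C f)"
      by (rule dominated_Lp[OF dominated_cscale]) (use assms 1 in auto)
    ultimately show ?thesis using False by (simp add: norm_divide field_simps)
  qed simp
qed

lemma Lp_uminus:
  assumes "0 < p" "f \<in> Lp p"
  shows "- f \<in> Lp p" "Lp_norm p (- f) = Lp_norm p f"
  using Lp_cscale[OF assms, of "-1"] by simp_all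

lemma Lp_diff:
  assumes "1 \<le> p" "f \<in> Lp p" "g \<in> Lp p"
  shows "f - g \<in> Lp p" "Lp_norm p (f - g) \<le> Lp_norm p f + Lp_norm p g"
  using Lp_add[OF assms(1,2) Lp_uminus(1)[OF _ assms(3)]] Lp_uminus[OF _ assms(3)] assms(1) by auto

lemma Lp_norm_minus_commute: "0 < p \<Longrightarrow> f - g \<in> Lp p \<Longrightarrow> Lp_norm p (f - g) = Lp_norm p (g - f)"
  using Lp_uminus(2)[of p "f - g"] by simp

lemma subspace_Lp: "1 \<le> p \<Longrightarrow> L0.subspace (Lp p)"
  by (auto simp: L0.subspace_def Lp_add Lp_cscale)

lemma Lp_tpow_mult:
  assumes "0 < p" 
  shows "tpow n * f \<in> Lp p \<longleftrightarrow> f \<in> Lp p" "Lp_norm p (tpow n * f) = Lp_norm p f"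
proof -
  show *: "tpow n * f \<in> Lp p \<longleftrightarrow> f \<in> Lp p"
    using dominated_Lp(1)[OF dominated_tpow(1)[of n f], of p] dominated_Lp(1)[OF dominated_tpow(2)[of f n], of p] assms by auto
  have "absint p (tpow n * f) = absint p f"
    by transfer (rule integral_cong_AE, simp_all, use AE_circle_norm in eventually_elim, simp add: norm_mult norm_power_int)
  then show "Lp_norm p (tpow n * f) = Lp_norm p f" by (simp add: Lp_norm_absint)
qed

lemma Lp_J: 
  assumes "0 < p" "f \<in> Lp p"
  shows "J f \<in> Lp p" "Lp_norm p (J f) = Lp_norm p f"
  using assms by (simp_all add: J_def Lp_tpow_mult Lp_reflect)

lemma Lp_conj: 
  assumes "0 < p" "f \<in> Lp p"
  shows "conj_fun f \<in> Lp p" "Lp_norm p (conj_fun f) = Lp_norm p f"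
proof -
  show "conj_fun f \<in> Lp p" by (rule dominated_Lp[OF dominated_conj]) (use assms in auto)
  have "absint p (conj_fun f) = absint p f" by transfer simp
  then show "Lp_norm p (conj_fun f) = Lp_norm p f" by (simp add: Lp_norm_absint)
qed

lemma Lp_tpow [simp]: "tpow n \<in> Lp p" 
  and Lp_1 [simp]: "1 \<in> Lp p" "Lp_norm p 1 = 1"
proof -
  show "1 \<in> Lp p" unfolding Lp_iff by transfer simp
  have "absint p 1 = 1" by transfer simp
  then show "Lp_norm p 1 = 1" by (simp add: Lp_norm_absint)
  show "tpow n \<in> Lp p" unfolding Lp_iff
    by transfer (rule integrable_circle_bounded[of _ 1], simp, use AE_circle_norm in eventually_elim, simp add: norm_power_int)
qed

lemma trig_poly_Lp: "1 \<le> p \<Longrightarrow> trig_poly \<subseteq> Lp p"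
  unfolding trig_poly_def by (rule L0.span_minimal) (auto simp: subspace_Lp)

text \<open>Bernoulli's inequality with exponent p/r, applied to (|f|/a)^r, bounds the integral of
  |f|^p for every a > 0. For a equal to the L^r norm the correction term vanishes; the total mass 1
  of the circle makes the constant 1.\<close>

lemma Lp_mono:
  assumes "0 < p" "p \<le> r" "f \<in> Lp r"
  shows "f \<in> Lp p" "Lp_norm p f \<le> Lp_norm r f"
proof -
  have *: "in_Lp p f \<and> (\<forall>a>0. absint p f \<le> a powr p * (1 + p / r * (absint r f / a powr r - 1)))"
    using assms(3) unfolding Lp_iff
  proof (transfer fixing: p r)
    fix f :: "complex \<Rightarrow> complex"
    assume "circle_eq f f" and int [simp]: "integrable circle_measure (\<lambda>t. norm (f t) powr r)"
    then have [measurable]: "f \<in> borel_measurable borel" by simp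
    have le: "norm (f t) powr p \<le> a powr p * (1 + p / r * (norm (f t) powr r / a powr r - 1))" if "a > 0" for a t
    proof -
      have "norm (f t) powr p = a powr p * ((norm (f t) / a) powr r) powr (p / r)"
        using that assms by (simp add: powr_powr powr_divide)
      also have "\<dots> \<le> a powr p * (1 + p / r * ((norm (f t) / a) powr r - 1))"
        using assms by (intro mult_left_mono bernoulli_powr) auto
      finally show ?thesis by (simp add: powr_divide)
    qed
    have int': "integrable circle_measure (\<lambda>t. a powr p * (1 + p / r * (norm (f t) powr r / a powr r - 1)))" for a
      by (intro integrable_mult_right Bochner_Integration.integrable_add Bochner_Integration.integrable_diff integrable_divide) auto
    have 1: "integrable circle_measure (\<lambda>t. norm (f t) powr p)"
      by (rule Bochner_Integration.integrable_bound[OF int'[of 1]]) (use le[of 1] in \<open>auto intro!: AE_I2 order_trans[OF _ abs_ge_self]\<close>)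
    have eq: "(LINT t|circle_measure. a powr p * (1 + p / r * (norm (f t) powr r / a powr r - 1)))
        = a powr p * (1 + p / r * ((LINT t|circle_measure. norm (f t) powr r) / a powr r - 1))" for a
      by (subst integral_mult_right_zero, subst Bochner_Integration.integral_add, simp, intro integrable_mult_right Bochner_Integration.integrable_diff integrable_divide, simp, simp,
          subst integral_mult_right_zero, subst Bochner_Integration.integral_diff, intro integrable_divide, simp_all)
    show "integrable circle_measure (\<lambda>t. norm (f t) powr p) \<and> (\<forall>a>0. (LINT t|circle_measure. norm (f t) powr p)
        \<le> a powr p * (1 + p / r * ((LINT t|circle_measure. norm (f t) powr r) / a powr r - 1)))"
      using integral_mono[OF 1 int' le] 1 unfolding eq by blast
  qed
  then show "f \<in> Lp p" by (simp add: Lp_iff)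
  show "Lp_norm p f \<le> Lp_norm r f"
  proof (cases "Lp_norm r f = 0")
    case True
    then have "f = 0" using Lp_norm_eq_0[of r f] assms by auto
    then show ?thesis by simp
  next
    case False
    then have pos: "Lp_norm r f > 0" by (simp add: less_le)
    have e: "absint r f / Lp_norm r f powr r = 1"
      using assms pos by (simp add: absint_Lp_norm)
    have "absint p f \<le> Lp_norm r f powr p"
      using *[THEN conjunct2, rule_format, OF pos] unfolding e by simp
    then show ?thesis using assms by (intro Lp_norm_leI) auto
  qed
qed

text \<open>Young's inequality is applied to |f|/a and |g|/b with free a, b > 0; choosing the norms
  turns the right-hand side into a b (1/p + 1/q) = a b.\<close>

lemma Holder:
  assumes "1 < p" "1 / p + 1 / q = 1" "f \<in> Lp p" "g \<in> Lp q"
  shows "f * g \<in> Lp 1" "Lp_norm 1 (f * g) \<le> Lp_norm p f * Lp_norm q g"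
proof -
  have q: "1 < q"
  proof -
    have "1 / q = 1 - 1 / p" using assms by simp
    moreover have "0 < 1 - 1 / p" "1 - 1 / p < 1" using assms by auto
    ultimately have "0 < 1 / q" "1 / q < 1" by auto
    then show ?thesis by (simp add: field_simps split: if_splits)
  qed
  have *: "in_Lp 1 (f * g) \<and> (\<forall>a>0. \<forall>b>0. absint 1 (f * g) \<le> a * b * (absint p f / a powr p / p + absint q g / b powr q / q))"
    using assms(3,4) unfolding Lp_iff
  proof (transfer fixing: p q)
    fix f g :: "complex \<Rightarrow> complex"
    assume "circle_eq f f" "circle_eq g g" and int [simp]: "integrable circle_measure (\<lambda>t. norm (f t) powr p)"
     "integrable circle_measure (\<lambda>t. norm (g t) powr q)"
    then have [measurable]: "f \<in> borel_measurable borel" "g \<in> borel_measurable borel" by simp_all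
    have le: "norm (f t * g t) powr 1 \<le> a * b * (norm (f t) powr p / a powr p / p + norm (g t) powr q / b powr q / q)"
      if "a > 0" "b > 0" for a b t
    proof -
      have "norm (f t * g t) powr 1 = a * b * ((norm (f t) / a) * (norm (g t) / b))"
        using that by (simp add: norm_mult)
      also have "\<dots> \<le> a * b * ((norm (f t) / a) powr p / p + (norm (g t) / b) powr q / q)"
        using assms q that by (intro mult_left_mono Youngs_inequality) auto
      finally show ?thesis by (simp add: powr_divide)
    qed
    have int': "integrable circle_measure (\<lambda>t. a * b * (norm (f t) powr p / a powr p / p + norm (g t) powr q / b powr q / q))" for a b
      by (intro integrable_mult_right Bochner_Integration.integrable_add integrable_divide) auto
    have 1: "integrable circle_measure (\<lambda>t. norm (f t * g t) powr 1)"
      by (rule Bochner_Integration.integrable_bound[OF int'[of 1 1]]) (use le[of 1 1] in \<open>auto intro!: AE_I2 order_trans[OF _ abs_ge_self]\<close>)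
    have eq: "(LINT t|circle_measure. a * b * (norm (f t) powr p / a powr p / p + norm (g t) powr q / b powr q / q))
        = a * b * ((LINT t|circle_measure. norm (f t) powr p) / a powr p / p + (LINT t|circle_measure. norm (g t) powr q) / b powr q / q)" for a b
      by (subst integral_mult_right_zero, subst Bochner_Integration.integral_add) (auto intro!: integrable_divide)
    show "integrable circle_measure (\<lambda>t. norm (f t * g t) powr 1) \<and> (\<forall>a>0. \<forall>b>0. (LINT t|circle_measure. norm (f t * g t) powr 1)
        \<le> a * b * ((LINT t|circle_measure. norm (f t) powr p) / a powr p / p + (LINT t|circle_measure. norm (g t) powr q) / b powr q / q))"
      using integral_mono[OF 1 int' le] 1 unfolding eq by blast
  qed
  then show "f * g \<in> Lp 1" by (simp add: Lp_iff)
  show "Lp_norm 1 (f * g) \<le> Lp_norm p f * Lp_norm q g"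
  proof (cases "Lp_norm p f = 0 \<or> Lp_norm q g = 0")
    case True
    then have "f * g = 0" using Lp_norm_eq_0[of p f] Lp_norm_eq_0[of q g] assms q by auto
    then show ?thesis by simp
  next
    case False
    then have pos: "Lp_norm p f > 0" "Lp_norm q g > 0" by (auto simp: less_le)
    have e: "absint p f / Lp_norm p f powr p = 1" "absint q g / Lp_norm q g powr q = 1"
      using assms q pos by (simp_all add: absint_Lp_norm)
    have "absint 1 (f * g) \<le> Lp_norm p f * Lp_norm q g"
      using *[THEN conjunct2, rule_format, OF pos] unfolding e assms(2) by simp
    then show ?thesis by (simp add: Lp_norm_1)
  qed
qed

subsection \<open>Fourier coefficients\<close>

lemma Lp_1_integrable:
  "f \<in> borel_measurable borel \<Longrightarrow> abs_L0 f \<in> Lp 1 \<longleftrightarrow> integrable circle_measure f"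
  by (simp add: abs_L0_Lp integrable_norm_iff)

lemma integrable_mult_powi:
  assumes [measurable]: "f \<in> borel_measurable borel" and "integrable circle_measure f"
  shows "integrable circle_measure (\<lambda>t. f t * t powi n)"
  by (rule Bochner_Integration.integrable_bound[OF assms(2)], simp,
      rule eventually_mono[OF AE_circle_norm], simp add: norm_mult norm_power_int)

lemma fourier_coeff_abs_L0:
  "f \<in> borel_measurable borel \<Longrightarrow> fourier_coeff (abs_L0 f) n = (LINT t|circle_measure. f t * t powi (- n))"
  by (simp add: fourier_coeff.abs_eq)

lemma fourier_coeff_add:
  assumes "f \<in> Lp 1" "g \<in> Lp 1"
  shows "fourier_coeff (f + g) n = fourier_coeff f n + fourier_coeff g n"
proof -
  obtain u v where [measurable]: "u \<in> borel_measurable borel" "v \<in> borel_measurable borel"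
    and [simp]: "f = abs_L0 u" "g = abs_L0 v"
    by (metis L0_exhaust)
  show ?thesis using assms
    by (simp add: plus_L0.abs_eq fourier_coeff_abs_L0 Lp_1_integrable integrable_mult_powi distrib_right)
qed

lemma fourier_coeff_cscale: "fourier_coeff (c *\<^sub>C f) n = c * fourier_coeff f n"
proof -
  obtain u where [measurable]: "u \<in> borel_measurable borel" and [simp]: "f = abs_L0 u"
    by (rule L0_exhaust)
  show ?thesis
    by (simp add: cscale.abs_eq fourier_coeff_abs_L0 mult.assoc)
qed

lemma fourier_coeff_uminus: "fourier_coeff (- f) n = - fourier_coeff f n"
  using fourier_coeff_cscale[of "-1" f n] by simp

lemma fourier_coeff_diff:
  assumes "f \<in> Lp 1" "g \<in> Lp 1"
  shows "fourier_coeff (f - g) n = fourier_coeff f n - fourier_coeff g n"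
  using fourier_coeff_add[OF assms(1) Lp_uminus(1)[OF _ assms(2)], of n] by (simp add: fourier_coeff_uminus)

lemma fourier_coeff_0 [simp]: "fourier_coeff 0 n = 0"
  using fourier_coeff_cscale[of 0 0 n] by simp

lemma powi_mult: "t \<noteq> 0 \<Longrightarrow> t powi m * t powi (- n) = t powi (m - n)" for t :: complex
  using power_int_add[of t m "- n"] by simp

lemma fourier_coeff_tpow: "fourier_coeff (tpow m) n = (if m = n then 1 else 0)"
proof -
  have "fourier_coeff (tpow m) n = (LINT t|circle_measure. t powi (m - n))"
    unfolding tpow.abs_eq fourier_coeff_abs_L0[OF measurable_powi]
    by (rule integral_cong_AE[OF _ _ eventually_mono[OF AE_circle_nonzero powi_mult]]) measurable
  then show ?thesis by (simp add: integral_circle_powi)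
qed

lemma fourier_coeff_1: "fourier_coeff 1 n = (if n = 0 then 1 else 0)"
  using fourier_coeff_tpow[of 0 n] by (cases "n = 0") auto

lemma fourier_coeff_shift: "fourier_coeff (tpow m * f) n = fourier_coeff f (n - m)"
proof -
  obtain u where [measurable]: "u \<in> borel_measurable borel" and [simp]: "f = abs_L0 u"
    by (rule L0_exhaust)
  have "(LINT t|circle_measure. t powi m * u t * t powi (- n)) = (LINT t|circle_measure. u t * t powi (m - n))"
  proof (rule integral_cong_AE)
    have "t powi m * u t * t powi (- n) = u t * t powi (m - n)" if "t \<noteq> 0" for t
      unfolding powi_mult[OF that, symmetric] by (simp only: mult_ac)
    then show "AE t in circle_measure. t powi m * u t * t powi (- n) = u t * t powi (m - n)"
      by (rule eventually_mono[OF AE_circle_nonzero])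
  qed measurable
  then show ?thesis
    by (simp add: tpow.abs_eq times_L0.abs_eq fourier_coeff_abs_L0)
qed

lemma fourier_coeff_reflect: "fourier_coeff (reflect f) n = fourier_coeff f (- n)"
proof -
  obtain u where [measurable]: "u \<in> borel_measurable borel" and [simp]: "f = abs_L0 u"
    by (rule L0_exhaust)
  have *: "circle_measure = distr circle_measure borel inverse"
    by (simp add: distr_inverse_circle_measure)
  have "(LINT t|circle_measure. u t * t powi n) = (LINT t|circle_measure. u (inverse t) * t powi (- n))"
    by (subst *, subst integral_distr) (auto simp: power_int_minus power_int_inverse)
  then show ?thesis
    by (simp add: reflect.abs_eq fourier_coeff_abs_L0)
qed

lemma fourier_coeff_J: "fourier_coeff (J f) n = fourier_coeff f (- 1 - n)"
  by (simp add: J_def fourier_coeff_shift fourier_coeff_reflect minus_diff_commute)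

lemma fourier_coeff_conj: "fourier_coeff (conj_fun f) n = cnj (fourier_coeff f (- n))"
proof -
  obtain u where [measurable]: "u \<in> borel_measurable borel" and [simp]: "f = abs_L0 u"
    by (rule L0_exhaust)
  have "(LINT t|circle_measure. cnj (u t) * t powi (- n)) = (LINT t|circle_measure. cnj (u t * t powi n))"
    by (rule integral_cong_AE, simp_all, use AE_circle_norm in eventually_elim,
        simp add: power_int_minus power_int_inverse flip: inverse_norm_1)
  then show ?thesis
    by (simp add: conj_fun.abs_eq fourier_coeff_abs_L0 Bochner_Integration.integral_cnj del: complex_cnj_mult)
qed

lemma fourier_coeff_le_1: "norm (fourier_coeff f n) \<le> Lp_norm 1 f"
proof -
  obtain u where [measurable]: "u \<in> borel_measurable borel" and [simp]: "f = abs_L0 u"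
    by (rule L0_exhaust)
  have "norm (LINT t|circle_measure. u t * t powi (- n)) \<le> (LINT t|circle_measure. norm (u t * t powi (- n)))"
    by (rule integral_norm_bound)
  also have "\<dots> = (LINT t|circle_measure. norm (u t) powr 1)"
    by (rule integral_cong_AE, simp_all, use AE_circle_norm in eventually_elim, simp add: norm_mult norm_power_int)
  finally show ?thesis by (simp add: fourier_coeff_abs_L0 Lp_norm_1 abs_L0_Lp)
qed

lemma fourier_coeff_le: "1 \<le> p \<Longrightarrow> f \<in> Lp p \<Longrightarrow> norm (fourier_coeff f n) \<le> Lp_norm p f"
  using fourier_coeff_le_1[of f n] Lp_mono(2)[of 1 p f] by simp

lemma fourier_coeff_sum:
  assumes "\<And>i. i \<in> I \<Longrightarrow> f i \<in> Lp 1"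
  shows "fourier_coeff (\<Sum>i\<in>I. f i) n = (\<Sum>i\<in>I. fourier_coeff (f i) n)"
  using assms
  by (induction I rule: infinite_finite_induct)
     (auto simp: fourier_coeff_add L0.subspace_sum[OF subspace_Lp[of 1]])

subsection \<open>Trigonometric polynomials\<close>

lemma subspace_trig_poly: "L0.subspace trig_poly"
  by (simp add: trig_poly_def)

lemma tpow_trig_poly [simp]: "tpow n \<in> trig_poly"
  by (auto simp: trig_poly_def intro: L0.span_base)

lemma one_trig_poly [simp]: "1 \<in> trig_poly"
  using tpow_trig_poly[of 0] by simp

lemma trig_poly_induct [consumes 1, case_names subspace tpow]:
  assumes "f \<in> trig_poly" "L0.subspace {f. Q f}" "\<And>n. Q (tpow n)"
  shows "Q f"
  using assms by (auto simp: trig_poly_def elim!: L0.span_induct[where P = Q])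

lemma trig_poly_tpow_mult: "f \<in> trig_poly \<Longrightarrow> tpow m * f \<in> trig_poly"
  by (induction f rule: trig_poly_induct)
     (auto simp: L0.subspace_def subspace_trig_poly[unfolded L0.subspace_def] distrib_left cscale_mult_right tpow_add)

lemma trig_poly_mult: "f \<in> trig_poly \<Longrightarrow> g \<in> trig_poly \<Longrightarrow> f * g \<in> trig_poly"
  by (induction f rule: trig_poly_induct)
     (auto simp: L0.subspace_def subspace_trig_poly[unfolded L0.subspace_def] distrib_right cscale_mult_left trig_poly_tpow_mult)

section \<open>Uniform approximation by trigonometric polynomials and uniqueness of Fourier
  coefficients\<close>

lemma real_polynomial_function_measurable:
  fixes g :: "complex \<Rightarrow> real"
  assumes "real_polynomial_function g"
  shows "g \<in> borel_measurable borel"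
  using assms continuous_on_polymonial_function[of g UNIV]
  by (intro borel_measurable_continuous_onI) (simp add: real_polynomial_function_eq)

text \<open>On the circle Re t and Im t are combinations of t and 1/t, so real polynomials restrict
  to Laurent polynomials. This converts the Stone-Weierstrass theorem for real polynomial functions
  into approximation by trigonometric polynomials.\<close>

lemma real_polynomial_function_circle_sum:
  fixes g :: "complex \<Rightarrow> real"
  assumes "real_polynomial_function g"
  shows "\<exists>S a. finite S \<and> (\<forall>t. norm t = 1 \<longrightarrow> of_real (g t) = (\<Sum>n\<in>S. a n * t powi n))"
  using assms
proof (induction g rule: real_polynomial_function.induct)
  case (linear f)
  then interpret bounded_linear f .
  have f: "f t = Re t * f 1 + Im t * f \<i>" for t
  proof -
    have "t = Re t *\<^sub>R 1 + Im t *\<^sub>R \<i>" by (simp add: complex_eq_iff)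
    then show ?thesis by (metis add real_scaleR_def scaleR)
  qed
  \<comment> \<open>A real linear form is Re (2 c t); the value of c follows by evaluating at t = 1
    and t = i.\<close>
  define c where "c = (f 1 - \<i> * f \<i>) / 2"
  have "of_real (f t) = (\<Sum>n\<in>{1,-1}. (if n = 1 then c else cnj c) * t powi n)" if "norm t = 1" for t
  proof -
    have "Re t * f 1 + Im t * f \<i> = Re (c * t) * 2" by (simp add: c_def algebra_simps)
    then have "of_real (f t) = c * t + cnj (c * t)"
      unfolding f[of t] complex_add_cnj by simp
    then show ?thesis using that by (simp add: power_int_minus inverse_norm_1)
  qed
  then show ?case by (intro exI[of _ "{1,-1}"] exI[of _ "\<lambda>n. if n = 1 then c else cnj c"]) auto
next
  case (const c)
  show ?case by (intro exI[of _ "{0}"] exI[of _ "\<lambda>n. of_real c"]) auto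
next
  case (add f g)
  then obtain S a T b where *: "finite S" "finite T" "\<And>t. norm t = 1 \<Longrightarrow> of_real (f t) = (\<Sum>n\<in>S. a n * t powi n)"
    "\<And>t. norm t = 1 \<Longrightarrow> of_real (g t) = (\<Sum>n\<in>T. b n * t powi n)" by blast
  define a' b' where "a' n = (if n \<in> S then a n else 0)" and "b' n = (if n \<in> T then b n else 0)" for n
  have "(\<Sum>n\<in>S. a n * t powi n) = (\<Sum>n\<in>S \<union> T. a' n * t powi n)" "(\<Sum>n\<in>T. b n * t powi n) = (\<Sum>n\<in>S \<union> T. b' n * t powi n)" for t :: complex
    using *(1,2) by (auto intro!: sum.mono_neutral_cong_left simp: a'_def b'_def)
  then show ?case using *
    by (intro exI[of _ "S \<union> T"] exI[of _ "\<lambda>n. a' n + b' n"]) (simp add: sum.distrib distrib_right)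
next
  case (mult f g)
  then obtain S a T b where *: "finite S" "finite T" "\<And>t. norm t = 1 \<Longrightarrow> of_real (f t) = (\<Sum>n\<in>S. a n * t powi n)"
    "\<And>t. norm t = 1 \<Longrightarrow> of_real (g t) = (\<Sum>n\<in>T. b n * t powi n)" by blast
  \<comment> \<open>The product of two Laurent polynomials, collected by total exponent: U holds the
    exponents that occur and c is the convolution of the coefficients.\<close>
  define U where "U = (\<lambda>(m, n). m + n) ` (S \<times> T)"
  define c where "c k = (\<Sum>(m, n)\<in>{x \<in> S \<times> T. (\<lambda>(m, n). m + n) x = k}. a m * b n)" for k
  have "of_real (f t * g t) = (\<Sum>k\<in>U. c k * t powi k)" if t: "norm t = 1" for t
  proof -
    have "of_real (f t * g t) = (\<Sum>(m, n)\<in>S \<times> T. (a m * t powi m) * (b n * t powi n))"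
      using *(3,4)[OF t] by (simp add: sum_product sum.cartesian_product)
    also have "\<dots> = (\<Sum>(m, n)\<in>S \<times> T. a m * b n * t powi (m + n))"
      using nonzero_norm_1[OF t] by (intro sum.cong) (auto simp: power_int_add mult_ac)
    also have "\<dots> = (\<Sum>k\<in>U. \<Sum>(m, n)\<in>{x \<in> S \<times> T. (\<lambda>(m, n). m + n) x = k}. a m * b n * t powi (m + n))"
      unfolding U_def using *(1,2) by (intro sum.image_gen) auto
    also have "\<dots> = (\<Sum>k\<in>U. c k * t powi k)"
      unfolding c_def sum_distrib_right by (intro sum.cong) auto
    finally show ?thesis .
  qed
  moreover have "finite U" using *(1,2) by (simp add: U_def)
  ultimately show ?case by blast
qed

lemma tpow_sum:
  "finite T \<Longrightarrow> (\<Sum>n\<in>T. a n *\<^sub>C tpow (k n)) = abs_L0 (\<lambda>t. \<Sum>n\<in>T. a n * t powi k n)"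
proof (induction T rule: finite_induct)
  case (insert n T)
  have "(\<lambda>t. \<Sum>n\<in>T. a n * t powi k n) \<in> borel_measurable borel" by measurable
  with insert show ?case by (simp add: tpow.abs_eq cscale.abs_eq plus_L0.abs_eq)
qed (simp add: zero_L0.abs_eq)

lemma real_polynomial_function_trig_poly:
  fixes g :: "complex \<Rightarrow> real"
  assumes "real_polynomial_function g"
  shows "abs_L0 (\<lambda>t. of_real (g t)) \<in> trig_poly"
proof -
  obtain S a where S: "finite S" "\<And>t. norm t = 1 \<Longrightarrow> of_real (g t) = (\<Sum>n\<in>S. a n * t powi n)"
    using real_polynomial_function_circle_sum[OF assms] by blast
  have [measurable]: "g \<in> borel_measurable borel" by (rule real_polynomial_function_measurable[OF assms])
  have "abs_L0 (\<lambda>t. of_real (g t)) = abs_L0 (\<lambda>t. \<Sum>n\<in>S. a n * t powi n)"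
    by (subst abs_L0_eq_iff) (measurable, rule eventually_mono[OF AE_circle_norm S(2)])
  also have "\<dots> = (\<Sum>n\<in>S. a n *\<^sub>C tpow n)" by (rule tpow_sum[OF S(1), symmetric])
  also have "\<dots> \<in> trig_poly" by (intro L0.subspace_sum L0.subspace_scale subspace_trig_poly tpow_trig_poly)
  finally show ?thesis .
qed

lemma continuous_approx_trig_poly:
  fixes u :: "complex \<Rightarrow> real"
  assumes "continuous_on (sphere 0 1) u" "e > 0"
  obtains g where "continuous_on UNIV g" "g \<in> borel_measurable borel" 
    "\<And>t. norm t = 1 \<Longrightarrow> \<bar>u t - g t\<bar> < e"
    "abs_L0 (\<lambda>t. of_real (g t)) \<in> trig_poly"
proof -
  obtain g where g: "real_polynomial_function g" "\<And>x. x \<in> sphere 0 1 \<Longrightarrow> \<bar>u x - g x\<bar> < e"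
    using Stone_Weierstrass_real_polynomial_function[of "sphere 0 1" u e] assms compact_sphere by blast
  have c: "continuous_on UNIV g"
    using g(1) by (simp add: real_polynomial_function_eq continuous_on_polymonial_function)
  show ?thesis
    by (rule that[of g]) (use g c real_polynomial_function_trig_poly borel_measurable_continuous_onI in auto)
qed

text \<open>Continuous functions decreasing to the indicator of a nonempty closed K as n grows. For
  empty K the distance \<open>infdist\<close> is 0 and the tent is constantly 1, whence the case
  distinctions on \<open>K = {}\<close> below.\<close>

definition tent :: "complex set \<Rightarrow> nat \<Rightarrow> complex \<Rightarrow> real" where
  "tent K n t = max 0 (1 - real n * infdist t K)"

lemma tent_continuous: "continuous_on A (tent K n)"
  unfolding tent_def by (intro continuous_intros)

lemma tent_measurable [measurable]: "tent K n \<in> borel_measurable borel"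
  by (intro borel_measurable_continuous_onI tent_continuous)

lemma tent_range: "0 \<le> tent K n t" "tent K n t \<le> 1"
  by (simp_all add: tent_def infdist_nonneg)

lemma tent_tendsto:
  assumes "closed K" "K \<noteq> {}"
  shows "(\<lambda>n. tent K n t) \<longlonglongrightarrow> indicator K t"
proof (cases "t \<in> K")
  case True
  then show ?thesis by (simp add: tent_def)
next
  case False
  then have pos: "infdist t K > 0"
    using assms infdist_pos_not_in_closed by blast
  obtain N where N: "1 / infdist t K < real N" using reals_Archimedean2 by blast
  have "tent K n t = 0" if "n \<ge> N" for n
  proof -
    have "1 / infdist t K < real n" using N that by linarith
    then show ?thesis using pos by (simp add: tent_def field_simps)
  qed
  then have "eventually (\<lambda>n. tent K n t = 0) sequentially"
    by (auto simp: eventually_sequentially)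
  then show ?thesis using False by (simp add: tendsto_eventually)
qed

text \<open>The form in which approximation arguments end: an error e times a fixed constant c.
  Dividing by c + 1 covers c = 0.\<close>

lemma le_0_if_le_eps:
  fixes x c :: real
  assumes "\<And>e. e > 0 \<Longrightarrow> x \<le> e * c" "0 \<le> c"
  shows "x \<le> 0"
proof (rule field_le_epsilon)
  fix e :: real assume "e > 0"
  then have "x \<le> e / (c + 1) * c" using assms(2) by (intro assms(1)) simp
  also have "\<dots> \<le> e" using assms(2) \<open>e > 0\<close> by (simp add: field_simps)
  finally show "x \<le> 0 + e" by simp
qed

lemma inner_regular_approx:
  fixes M :: "complex measure"
  assumes "sets M = sets borel" "emeasure M (space M) \<noteq> \<infinity>" "B \<in> sets borel" "e > 0"
  obtains K where "K \<subseteq> B" "compact K" "emeasure M B \<le> emeasure M K + ennreal e"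
proof -
  have "emeasure M B \<noteq> \<infinity>"
    using emeasure_space[of M B] assms(2) by (auto simp: top_unique)
  then have "\<exists>K\<in>{K. K \<subseteq> B \<and> compact K}. emeasure M B < emeasure M K + ennreal e"
    by (intro SUP_approx_ennreal[OF assms(4) _ inner_regular[OF assms(1-3)]]) auto
  then show ?thesis using that by (auto intro: less_imp_le)
qed

text \<open>The integral of f against test functions vanishes in four stages: trigonometric
  polynomials by hypothesis, continuous functions by uniform approximation, indicators of compact
  sets by dominated convergence of tents, and indicators of Borel sets by inner regularity.
  Vanishing integrals over all Borel sets force f = 0.\<close>

lemma integral_zero_if_fourier_coeff_zero:
  assumes [measurable]: "f \<in> borel_measurable borel" and int: "integrable circle_measure f"
    and zero: "\<And>n. fourier_coeff (abs_L0 f) n = 0"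
  shows "AE t in circle_measure. f t = 0"
proof (rule circle.density_zero[OF int])
  have poly: "abs_L0 f * r \<in> Lp 1 \<and> fourier_coeff (abs_L0 f * r) 0 = 0" if "r \<in> trig_poly" for r
    using that
  proof (induction r rule: trig_poly_induct)
    case subspace
    show ?case
      by (auto simp: L0.subspace_def distrib_left fourier_coeff_add Lp_add cscale_mult_right fourier_coeff_cscale Lp_cscale)
  next
    case (tpow n)
    have "abs_L0 f \<in> Lp 1" using int by (simp add: Lp_1_integrable)
    then show ?case
      by (simp add: mult.commute[of _ "tpow n"] fourier_coeff_shift zero Lp_tpow_mult)
  qed
  have bdd: "integrable circle_measure (\<lambda>t. f t * complex_of_real (u t))"
    if [measurable]: "u \<in> borel_measurable borel" and "\<And>t. norm t = 1 \<Longrightarrow> \<bar>u t\<bar> \<le> C" for u C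
    by (rule Bochner_Integration.integrable_bound[OF integrable_mult_left[OF integrable_norm[OF int], of C]], simp,
        rule eventually_mono[OF AE_circle_norm], use that in \<open>auto simp: norm_mult intro!: mult_left_mono order_trans[OF _ abs_ge_self]\<close>)
  have cont: "(LINT t|circle_measure. f t * of_real (u t)) = 0"
    if u: "continuous_on UNIV u" "\<And>t. norm t = 1 \<Longrightarrow> \<bar>u t\<bar> \<le> C" for u C
  proof -
    have [measurable]: "u \<in> borel_measurable borel" using u(1) by (rule borel_measurable_continuous_onI)
    have "norm (LINT t|circle_measure. f t * of_real (u t)) \<le> e * (LINT t|circle_measure. norm (f t))" if "e > 0" for e
    proof -
      obtain g where g [measurable]: "g \<in> borel_measurable borel"
        and ug: "\<And>t. norm t = 1 \<Longrightarrow> \<bar>u t - g t\<bar> < e" and tp: "abs_L0 (\<lambda>t. of_real (g t)) \<in> trig_poly"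
        using continuous_approx_trig_poly[of u e] u(1) \<open>e > 0\<close> continuous_on_subset by (metis subset_UNIV)
      have ug': "\<bar>g t\<bar> \<le> C + e" if "norm t = 1" for t
        using ug[OF that] u(2)[OF that] by linarith
      have g0: "(LINT t|circle_measure. f t * of_real (g t)) = 0"
        using poly[OF tp] by (simp add: times_L0.abs_eq fourier_coeff_abs_L0)
      have "(LINT t|circle_measure. f t * of_real (u t)) = (LINT t|circle_measure. f t * of_real (u t) - f t * of_real (g t))"
        by (subst Bochner_Integration.integral_diff) (use bdd[of u C] bdd[of g "C + e"] u ug' g0 in auto)
      also have "norm \<dots> \<le> (LINT t|circle_measure. norm (f t * of_real (u t) - f t * of_real (g t)))"
        by (rule integral_norm_bound)
      also have "\<dots> \<le> (LINT t|circle_measure. e * norm (f t))"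
      proof (rule integral_mono_AE)
        show "integrable circle_measure (\<lambda>t. norm (f t * of_real (u t) - f t * of_real (g t)))"
          by (intro integrable_norm Bochner_Integration.integrable_diff bdd[of u C] bdd[of g "C + e"]) (use u ug' in auto)
        show "integrable circle_measure (\<lambda>t. e * norm (f t))" using int by simp
        show "AE t in circle_measure. norm (f t * of_real (u t) - f t * of_real (g t)) \<le> e * norm (f t)"
          using AE_circle_norm
        proof eventually_elim
          case (elim t)
          have "norm (f t * of_real (u t) - f t * of_real (g t)) = norm (f t) * \<bar>u t - g t\<bar>"
            by (simp add: norm_mult flip: right_diff_distrib of_real_diff)
          also have "\<dots> \<le> norm (f t) * e" using ug[OF elim] by (intro mult_left_mono) auto
          finally show ?case by (simp add: mult.commute)
        qed
      qed
      finally show ?thesis by simp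
    qed
    then have "norm (LINT t|circle_measure. f t * of_real (u t)) \<le> 0"
      by (rule le_0_if_le_eps) simp_all
    then show ?thesis by simp
  qed
  have comp: "(LINT t:K|circle_measure. f t) = 0" if "compact K" for K
  proof (cases "K = {}")
    case False
    have K: "closed K" using that by (rule compact_imp_closed)
    then have [measurable]: "K \<in> sets borel" by simp
    have "(\<lambda>n. LINT t|circle_measure. f t * of_real (tent K n t)) \<longlonglongrightarrow> (LINT t|circle_measure. f t * of_real (indicator K t))"
    proof (rule integral_dominated_convergence[where w = "\<lambda>t. norm (f t)"])
      show "integrable circle_measure (\<lambda>t. norm (f t))" using int by simp
      show "AE t in circle_measure. (\<lambda>n. f t * of_real (tent K n t)) \<longlonglongrightarrow> f t * of_real (indicator K t)"
        using tent_tendsto[OF K False] by (intro AE_I2 tendsto_intros)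
      show "AE t in circle_measure. norm (f t * of_real (tent K n t)) \<le> norm (f t)" for n
        using tent_range[of K n] by (auto simp: norm_mult mult_left_le)
    qed simp_all
    moreover have "(LINT t|circle_measure. f t * of_real (tent K n t)) = 0" for n
      by (rule cont[of _ 1]) (use tent_continuous tent_range[of K n] in auto)
    ultimately have "(LINT t|circle_measure. f t * of_real (indicator K t)) = 0"
      by (simp add: LIMSEQ_const_iff)
    then show ?thesis
      by (simp add: set_lebesgue_integral_def scaleR_conv_of_real mult.commute)
  qed (simp add: set_lebesgue_integral_def)
  fix B assume "B \<in> sets circle_measure"
  then have B [measurable]: "B \<in> sets borel" by simp
  \<comment> \<open>The finite measure with density |f|: choosing K inside B with respect to it
    makes the integral of |f| over B - K small, which is the error that matters here.\<close>
  define \<nu> where "\<nu> = density circle_measure (\<lambda>t. ennreal (norm (f t)))"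
  have \<nu>: "emeasure \<nu> A = ennreal (LINT t:A|circle_measure. norm (f t))" if [measurable]: "A \<in> sets borel" for A
  proof -
    have "emeasure \<nu> A = (\<integral>\<^sup>+t. ennreal (indicator A t *\<^sub>R norm (f t)) \<partial>circle_measure)"
      unfolding \<nu>_def by (subst emeasure_density) (auto intro!: nn_integral_cong split: split_indicator)
    also have "\<dots> = ennreal (LINT t|circle_measure. indicator A t *\<^sub>R norm (f t))"
      by (rule nn_integral_eq_integral, rule integrable_mult_indicator) (simp_all add: int)
    finally show ?thesis by (simp add: set_lebesgue_integral_def)
  qed
  have s: "sets \<nu> = sets borel" "space \<nu> = UNIV" by (simp_all add: \<nu>_def)
  have "norm (LINT t:B|circle_measure. f t) \<le> 0 + e" if "e > 0" for e
  proof -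
    obtain K where K: "K \<subseteq> B" "compact K" "emeasure \<nu> B \<le> emeasure \<nu> K + ennreal e"
      using inner_regular_approx[of \<nu> B e] \<open>e > 0\<close> s \<nu>[of UNIV] B by auto
    have [measurable]: "K \<in> sets borel" using K by (intro borel_closed compact_imp_closed)
    have iB: "set_integrable circle_measure A f" "set_integrable circle_measure A (\<lambda>t. norm (f t))"
      if "A \<in> sets borel" for A
      unfolding set_integrable_def
      by (rule integrable_mult_indicator, simp add: that, (rule int | rule integrable_norm[OF int]))+
    have split: "(LINT t:B|circle_measure. g t) = (LINT t:K|circle_measure. g t) + (LINT t:B - K|circle_measure. g t)"
      if "\<And>A. A \<in> sets borel \<Longrightarrow> set_integrable circle_measure A g" for g :: "complex \<Rightarrow> 'b::{banach, second_countable_topology}"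
      using set_integral_Un[of K "B - K" circle_measure g] that K by (simp add: Un_absorb1)
    have "norm (LINT t:B|circle_measure. f t) = norm (LINT t:B-K|circle_measure. f t)"
      using split[of f] iB comp[OF K(2)] by simp
    also have "\<dots> \<le> (LINT t:B-K|circle_measure. norm (f t))"
      unfolding set_lebesgue_integral_def
      by (rule order_trans[OF integral_norm_bound]) (simp add: norm_scaleR)
    also have "\<dots> = (LINT t:B|circle_measure. norm (f t)) - (LINT t:K|circle_measure. norm (f t))"
      using split[of "\<lambda>t. norm (f t)"] iB by simp
    also have "\<dots> \<le> e"
    proof -
      have nn: "0 \<le> (LINT t:K|circle_measure. norm (f t))" by (simp add: set_lebesgue_integral_def)
      have "ennreal (LINT t:B|circle_measure. norm (f t)) \<le> ennreal ((LINT t:K|circle_measure. norm (f t)) + e)"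
        using K(3) \<nu>[of B] \<nu>[of K] nn that by (subst ennreal_plus) auto
      then have "(LINT t:B|circle_measure. norm (f t)) \<le> (LINT t:K|circle_measure. norm (f t)) + e"
        using nn that by (subst (asm) ennreal_le_iff) auto
      then show ?thesis by simp
    qed
    finally show ?thesis by simp
  qed
  then have "norm (LINT t:B|circle_measure. f t) \<le> 0" by (rule field_le_epsilon)
  then show "(LINT t:B|circle_measure. f t) = 0" by simp
qed

lemma fourier_coeff_unique:
  assumes "f \<in> Lp 1" "g \<in> Lp 1" "\<And>n. fourier_coeff f n = fourier_coeff g n"
  shows "f = g"
proof -
  have fg: "f - g \<in> Lp 1" using assms by (intro Lp_diff) auto
  obtain u where u [measurable]: "u \<in> borel_measurable borel" and eq: "f - g = abs_L0 u"
    by (rule L0_exhaust)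
  have "AE t in circle_measure. u t = 0"
  proof (rule integral_zero_if_fourier_coeff_zero[OF u])
    show "integrable circle_measure u" using fg u by (simp add: eq Lp_1_integrable)
    show "fourier_coeff (abs_L0 u) n = 0" for n
      using assms by (simp add: eq[symmetric] fourier_coeff_diff)
  qed
  then have "f - g = 0" by (simp add: eq zero_L0.abs_eq abs_L0_eq_iff)
  then show ?thesis by simp
qed

subsection \<open>Convergence in \<open>L\<^sup>p\<close>\<close>

lemma Lp_dominated_convergence:
  fixes s :: "nat \<Rightarrow> complex \<Rightarrow> complex"
  assumes [measurable]: "f \<in> borel_measurable borel" "\<And>i. s i \<in> borel_measurable borel" "w \<in> borel_measurable borel"
    and p: "0 < p"
    and int: "integrable circle_measure (\<lambda>t. w t powr p)"
    and lim: "AE t in circle_measure. (\<lambda>i. s i t) \<longlonglongrightarrow> f t"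
    and bound: "\<And>i. AE t in circle_measure. norm (s i t) \<le> w t"
  shows "abs_L0 f \<in> Lp p" "\<And>i. abs_L0 (s i) \<in> Lp p"
    "(\<lambda>i. Lp_norm p (abs_L0 (s i) - abs_L0 f)) \<longlonglongrightarrow> 0"
proof -
  have bf: "AE t in circle_measure. norm (f t) \<le> w t"
  proof -
    have "AE t in circle_measure. \<forall>i. norm (s i t) \<le> w t"
      using bound by (simp add: AE_all_countable)
    with lim show ?thesis
      by eventually_elim (auto intro!: LIMSEQ_le_const2[OF tendsto_norm])
  qed
  have le: "integrable circle_measure (\<lambda>t. norm (g t) powr p)"
    if [measurable]: "g \<in> borel_measurable borel" and g: "AE t in circle_measure. norm (g t) \<le> w t" for g :: "complex \<Rightarrow> complex"
    by (rule Bochner_Integration.integrable_bound[OF int], simp, use g in eventually_elim)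
       (use p in \<open>auto intro: powr_mono2\<close>)
  show "abs_L0 f \<in> Lp p" "\<And>i. abs_L0 (s i) \<in> Lp p"
    using le bf bound by (simp_all add: abs_L0_Lp)
  have "(\<lambda>i. LINT t|circle_measure. norm (s i t - f t) powr p) \<longlonglongrightarrow> (LINT t|circle_measure. 0)"
  proof (rule integral_dominated_convergence[where w = "\<lambda>t. 2 powr p * w t powr p"])
    show "integrable circle_measure (\<lambda>t. 2 powr p * w t powr p)" using int by simp
    show "AE t in circle_measure. (\<lambda>i. norm (s i t - f t) powr p) \<longlonglongrightarrow> 0"
      using lim
    proof eventually_elim
      case (elim t)
      then have "(\<lambda>i. norm (s i t - f t)) \<longlonglongrightarrow> 0"
        by (simp add: tendsto_norm_zero_iff LIM_zero_iff)
      then have "(\<lambda>i. norm (s i t - f t) powr p) \<longlonglongrightarrow> 0 powr p"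
        using p by (intro tendsto_powr') auto
      then show ?case by simp
    qed
    show "AE t in circle_measure. norm (norm (s i t - f t) powr p) \<le> 2 powr p * w t powr p" for i
      using bf bound[of i]
    proof eventually_elim
      case (elim t)
      have "norm (s i t - f t) \<le> 2 * w t"
        using elim norm_triangle_ineq4[of "s i t" "f t"] by linarith
      then have "norm (s i t - f t) powr p \<le> (2 * w t) powr p"
        using p by (intro powr_mono2) auto
      then show ?case by (simp add: powr_mult)
    qed
  qed simp_all
  then have "(\<lambda>i. (LINT t|circle_measure. norm (s i t - f t) powr p) powr (1 / p)) \<longlonglongrightarrow> 0 powr (1 / p)"
    using p by (intro tendsto_powr') auto
  then show "(\<lambda>i. Lp_norm p (abs_L0 (s i) - abs_L0 f)) \<longlonglongrightarrow> 0"
    by (simp add: Lp_norm_absint minus_L0.abs_eq abs_L0_Lp)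
qed

text \<open>The L^p closure of the trigonometric polynomials. It is shown to be all of
  \<open>Lp p\<close> by passing through continuous functions, indicators and simple
  functions.\<close>

definition Lp_trig_closure :: "real \<Rightarrow> L0 set" where
  "Lp_trig_closure p = {f \<in> Lp p. \<forall>e>0. \<exists>r\<in>trig_poly. Lp_norm p (f - r) < e}"

lemma trig_closureD:
  assumes "f \<in> Lp_trig_closure p"
  shows "f \<in> Lp p" "e > 0 \<Longrightarrow> \<exists>r\<in>trig_poly. Lp_norm p (f - r) < e"
  using assms by (auto simp: Lp_trig_closure_def)

lemma trig_closureI:
  assumes "1 \<le> p" "f \<in> Lp p" "\<And>e. e > 0 \<Longrightarrow> \<exists>g\<in>Lp_trig_closure p. Lp_norm p (f - g) < e"
  shows "f \<in> Lp_trig_closure p"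
  unfolding Lp_trig_closure_def mem_Collect_eq
proof (intro conjI allI impI assms(2))
  fix e :: real assume "e > 0"
  then obtain g where g: "g \<in> Lp_trig_closure p" "Lp_norm p (f - g) < e / 2"
    using assms(3)[of "e / 2"] by auto
  then obtain r where r: "r \<in> trig_poly" "Lp_norm p (g - r) < e / 2"
    using \<open>e > 0\<close> trig_closureD(2)[of g p "e / 2"] by auto
  have "g \<in> Lp p" "r \<in> Lp p" using g r trig_poly_Lp[OF assms(1)] by (auto simp: Lp_trig_closure_def)
  then have "Lp_norm p ((f - g) + (g - r)) \<le> Lp_norm p (f - g) + Lp_norm p (g - r)"
    using assms by (intro Lp_add Lp_diff)
  then show "\<exists>r\<in>trig_poly. Lp_norm p (f - r) < e" using g r by (intro bexI[of _ r]) auto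
qed

lemma trig_closure_limit:
  assumes "1 \<le> p" "f \<in> Lp p" "\<And>i::nat. s i \<in> Lp_trig_closure p" "(\<lambda>i. Lp_norm p (s i - f)) \<longlonglongrightarrow> 0"
  shows "f \<in> Lp_trig_closure p"
proof (rule trig_closureI[OF assms(1,2)])
  fix e :: real assume "e > 0"
  then obtain i where i: "Lp_norm p (s i - f) < e"
    using LIMSEQ_D[OF assms(4), of e] by auto
  have "s i - f \<in> Lp p" using assms by (intro Lp_diff) (auto simp: Lp_trig_closure_def)
  then show "\<exists>g\<in>Lp_trig_closure p. Lp_norm p (f - g) < e"
    using i assms by (intro bexI[of _ "s i"]) (auto simp: Lp_norm_minus_commute)
qed

lemma subspace_trig_closure: "1 \<le> p \<Longrightarrow> L0.subspace (Lp_trig_closure p)"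
proof (rule L0.subspaceI)
  assume p: "1 \<le> p"
  note sub = subspace_trig_poly
  have tp: "r \<in> Lp p" if "r \<in> trig_poly" for r using trig_poly_Lp[OF p] that by auto
  show "0 \<in> Lp_trig_closure p"
    using L0.subspace_0[OF sub] by (auto simp: Lp_trig_closure_def intro!: bexI[of _ 0])
  fix f g assume f: "f \<in> Lp_trig_closure p" and g: "g \<in> Lp_trig_closure p"
  show "f + g \<in> Lp_trig_closure p"
    unfolding Lp_trig_closure_def mem_Collect_eq
  proof (intro conjI allI impI)
    show "f + g \<in> Lp p" using f g p by (auto simp: Lp_trig_closure_def Lp_add)
    fix e :: real assume "e > 0"
    then obtain r s where rs: "r \<in> trig_poly" "Lp_norm p (f - r) < e / 2" "s \<in> trig_poly" "Lp_norm p (g - s) < e / 2"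
      using trig_closureD(2)[OF f, of "e / 2"] trig_closureD(2)[OF g, of "e / 2"] by auto
    have "Lp_norm p ((f - r) + (g - s)) \<le> Lp_norm p (f - r) + Lp_norm p (g - s)"
      using f g rs p tp by (intro Lp_add Lp_diff) (auto simp: Lp_trig_closure_def)
    then show "\<exists>r\<in>trig_poly. Lp_norm p (f + g - r) < e"
      using rs sub by (intro bexI[of _ "r + s"]) (auto simp: algebra_simps L0.subspace_add)
  qed
next
  assume p: "1 \<le> p"
  fix c f assume f: "f \<in> Lp_trig_closure p"
  show "c *\<^sub>C f \<in> Lp_trig_closure p"
    unfolding Lp_trig_closure_def mem_Collect_eq
  proof (intro conjI allI impI)
    show "c *\<^sub>C f \<in> Lp p" using f p by (auto simp: Lp_trig_closure_def Lp_cscale)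
    fix e :: real assume "e > 0"
    then have "e / (norm c + 1) > 0" by (simp add: add_nonneg_pos)
    then obtain r where r: "r \<in> trig_poly" "Lp_norm p (f - r) < e / (norm c + 1)"
      using f unfolding Lp_trig_closure_def by blast
    have fr: "f - r \<in> Lp p" using f r p trig_poly_Lp[OF p] by (intro Lp_diff) (auto simp: Lp_trig_closure_def)
    have "Lp_norm p (c *\<^sub>C (f - r)) = norm c * Lp_norm p (f - r)"
      using fr p by (intro Lp_cscale) auto
    also have "\<dots> \<le> (norm c + 1) * Lp_norm p (f - r)" by (intro mult_right_mono) auto
    also have "\<dots> < e"
    proof -
      have "norm c + 1 > 0" by (simp add: add_nonneg_pos)
      then show ?thesis using r(2) by (simp only: pos_less_divide_eq mult.commute)
    qed
    finally show "\<exists>r\<in>trig_poly. Lp_norm p (c *\<^sub>C f - r) < e"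
      using r subspace_trig_poly by (intro bexI[of _ "c *\<^sub>C r"]) (auto simp: L0.scale_right_diff_distrib L0.subspace_scale)
  qed
qed

lemma continuous_in_trig_closure:
  fixes u :: "complex \<Rightarrow> real"
  assumes p: "1 \<le> p" and u: "continuous_on UNIV u" 
  shows "abs_L0 (\<lambda>t. of_real (u t)) \<in> Lp_trig_closure p"
  unfolding Lp_trig_closure_def mem_Collect_eq
proof (intro conjI allI impI)
  have [measurable]: "u \<in> borel_measurable borel" using u by (rule borel_measurable_continuous_onI)
  have dist: "abs_L0 (\<lambda>t. of_real (u t)) - abs_L0 (\<lambda>t. of_real (g t)) \<in> Lp p \<and>
      Lp_norm p (abs_L0 (\<lambda>t. of_real (u t)) - abs_L0 (\<lambda>t. of_real (g t))) \<le> e"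
    if [measurable]: "g \<in> borel_measurable borel" and g: "\<And>t. norm t = 1 \<Longrightarrow> \<bar>u t - g t\<bar> < e" and e: "e > 0" for g e
  proof -
    have "dominated e (abs_L0 (\<lambda>t. of_real (u t)) - abs_L0 (\<lambda>t. of_real (g t))) 1"
      using less_imp_le[OF g] by (simp add: minus_L0.abs_eq one_L0.abs_eq dominated.abs_eq eventually_mono[OF AE_circle_norm] flip: of_real_diff)
    then show ?thesis using dominated_Lp[of e _ 1 p] p e by auto
  qed
  have ex: "\<exists>g. g \<in> borel_measurable borel \<and> (\<forall>t. norm t = 1 \<longrightarrow> \<bar>u t - g t\<bar> < e) \<and> abs_L0 (\<lambda>t. of_real (g t)) \<in> trig_poly" if "e > 0" for e
    using continuous_approx_trig_poly[of u e] continuous_on_subset[OF u] that by (metis subset_UNIV)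
  obtain g where g: "g \<in> borel_measurable borel" "\<And>t. norm t = 1 \<Longrightarrow> \<bar>u t - g t\<bar> < 1" "abs_L0 (\<lambda>t. of_real (g t)) \<in> trig_poly"
    using ex[of 1] by auto
  have "abs_L0 (\<lambda>t. of_real (g t)) \<in> Lp p" using g trig_poly_Lp[OF p] by auto
  from Lp_add(1)[OF p dist[OF g(1,2), THEN conjunct1] this] 
  show "abs_L0 (\<lambda>t. of_real (u t)) \<in> Lp p" by simp
  fix e :: real assume "e > 0"
  then obtain g where g: "g \<in> borel_measurable borel" "\<And>t. norm t = 1 \<Longrightarrow> \<bar>u t - g t\<bar> < e / 2" "abs_L0 (\<lambda>t. of_real (g t)) \<in> trig_poly"
    using ex[of "e / 2"] by auto
  show "\<exists>r\<in>trig_poly. Lp_norm p (abs_L0 (\<lambda>t. of_real (u t)) - r) < e"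
    using dist[OF g(1,2)] \<open>e > 0\<close> by (intro bexI[OF _ g(3)]) auto
qed

text \<open>Compact sets are reached as L^p limits of tents; a general Borel set is exhausted from
  inside by compact sets.\<close>

lemma indicator_in_trig_closure:
  assumes p: "1 \<le> p" and B [measurable]: "B \<in> sets borel"
  shows "abs_L0 (indicator B) \<in> Lp_trig_closure p"
proof -
  have int: "integrable circle_measure (\<lambda>t. norm (indicator A t :: complex) powr p)" if [measurable]: "A \<in> sets borel" for A
    by (rule integrable_circle_bounded[of _ 1]) (use p in \<open>auto split: split_indicator\<close>)
  have comp: "abs_L0 (indicator K) \<in> Lp_trig_closure p" if "compact K" for K
  proof (cases "K = {}")
    case True
    then have "(indicator K :: complex \<Rightarrow> complex) = (\<lambda>_. 0)" by (simp add: fun_eq_iff)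
    then have "abs_L0 (indicator K) = 0" by (simp add: zero_L0.abs_eq)
    then show ?thesis using L0.subspace_0[OF subspace_trig_closure[OF p]] by simp
  next
    case False
    have K: "closed K" using that by (rule compact_imp_closed)
    then have [measurable]: "K \<in> sets borel" by simp
    have eq: "(indicator K :: complex \<Rightarrow> complex) = (\<lambda>t. of_real (indicator K t))"
      by (auto simp: fun_eq_iff split: split_indicator)
    note dc = Lp_dominated_convergence[of "\<lambda>t. of_real (indicator K t)" "\<lambda>i t. of_real (tent K i t)" "\<lambda>_. 1" p]
    have *: "AE t in circle_measure. (\<lambda>i. complex_of_real (tent K i t)) \<longlonglongrightarrow> of_real (indicator K t)"
      using tent_tendsto[OF K False] by (intro AE_I2 tendsto_of_real)
    have **: "AE t in circle_measure. norm (complex_of_real (tent K i t)) \<le> 1" for i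
      using tent_range[of K i] by simp
    show ?thesis unfolding eq
      by (rule trig_closure_limit[where s = "\<lambda>i. abs_L0 (\<lambda>t. of_real (tent K i t))", OF p])
         (use dc * ** p continuous_in_trig_closure[OF p tent_continuous] in auto)
  qed
  show ?thesis
  proof (rule trig_closureI[OF p])
    show "abs_L0 (indicator B) \<in> Lp p" using int by (simp add: abs_L0_Lp)
    fix e :: real assume e: "e > 0"
    \<comment> \<open>The p-th power of the L^p norm of an indicator is the measure of the set, so a
      defect of (e/2)^p in measure means e/2 in norm.\<close>
    obtain K where K: "K \<subseteq> B" "compact K" "emeasure circle_measure B \<le> emeasure circle_measure K + ennreal ((e / 2) powr p)"
      using inner_regular_approx[of circle_measure B "(e / 2) powr p"] e by auto
    have [measurable]: "K \<in> sets borel" using K by (intro borel_closed compact_imp_closed)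
    have "measure circle_measure B \<le> measure circle_measure K + (e / 2) powr p"
      using K(3) by (simp add: circle.emeasure_eq_measure flip: ennreal_plus)
    then have m: "measure circle_measure (B - K) \<le> (e / 2) powr p"
      using circle.finite_measure_Diff[of B K] K by simp
    have "absint p (abs_L0 (indicator B) - abs_L0 (indicator K)) = (LINT t|circle_measure. indicator (B - K) t)"
      unfolding minus_L0.abs_eq[OF circle_eq_refl_iff[THEN iffD2] circle_eq_refl_iff[THEN iffD2], OF borel_measurable_indicator borel_measurable_indicator, OF B \<open>K \<in> sets borel\<close>]
      by (subst abs_L0_Lp, measurable, rule Bochner_Integration.integral_cong) (use K p in \<open>auto split: split_indicator\<close>)
    also have "\<dots> \<le> (e / 2) powr p" using m by simp
    finally have "Lp_norm p (abs_L0 (indicator B) - abs_L0 (indicator K)) \<le> e / 2"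
      using p e by (intro Lp_norm_leI) auto
    then show "\<exists>g\<in>Lp_trig_closure p. Lp_norm p (abs_L0 (indicator B) - g) < e"
      using comp[OF K(2)] e by (intro bexI[of _ "abs_L0 (indicator K)"]) auto
  qed
qed

lemma simple_function_in_trig_closure:
  fixes f :: "complex \<Rightarrow> complex"
  assumes p: "1 \<le> p" and f: "simple_function borel f"
  shows "abs_L0 f \<in> Lp_trig_closure p"
proof -
  have aux: "(\<lambda>t. \<Sum>y\<in>A. y * indicator (f -` {y}) t) \<in> borel_measurable borel \<and>
     abs_L0 (\<lambda>t. \<Sum>y\<in>A. y * indicator (f -` {y}) t) \<in> Lp_trig_closure p" if "finite A" for A
    using that
  proof (induction A)
    case empty
    have "abs_L0 (\<lambda>t. 0) = 0" by (simp add: zero_L0.abs_eq)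
    then show ?case using L0.subspace_0[OF subspace_trig_closure[OF p]] by simp
  next
    case (insert y A)
    have S [measurable]: "f -` {y} \<in> sets borel"
      using simple_functionD(2)[OF f, of "{y}"] by simp
    have [measurable]: "(\<lambda>t. \<Sum>y\<in>A. y * indicator (f -` {y}) t) \<in> borel_measurable borel"
      using insert by blast
    have eq: "(\<lambda>t. \<Sum>y\<in>insert y A. y * indicator (f -` {y}) t)
       = (\<lambda>t. y * indicator (f -` {y}) t + (\<Sum>y\<in>A. y * indicator (f -` {y}) t))"
      by (simp only: sum.insert[OF insert(1,2)])
    have "abs_L0 (\<lambda>t. y * indicator (f -` {y}) t + (\<Sum>y\<in>A. y * indicator (f -` {y}) t))
       = y *\<^sub>C abs_L0 (indicator (f -` {y})) + abs_L0 (\<lambda>t. \<Sum>y\<in>A. y * indicator (f -` {y}) t)"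
      by (simp add: cscale.abs_eq plus_L0.abs_eq)
    also have "\<dots> \<in> Lp_trig_closure p"
      by (intro L0.subspace_add L0.subspace_scale subspace_trig_closure p indicator_in_trig_closure S) (use insert in blast)
    finally have "abs_L0 (\<lambda>t. y * indicator (f -` {y}) t + (\<Sum>y\<in>A. y * indicator (f -` {y}) t)) \<in> Lp_trig_closure p" .
    moreover have "(\<lambda>t. y * indicator (f -` {y}) t + (\<Sum>y\<in>A. y * indicator (f -` {y}) t)) \<in> borel_measurable borel"
      by measurable
    ultimately show ?case unfolding eq by blast
  qed
  have "f t = (\<Sum>y\<in>range f. y * indicator (f -` {y}) t)" for t
  proof -
    have "f t = (\<Sum>y\<in>range f. indicator (f -` {y}) t *\<^sub>R y)"
      using simple_function_indicator_representation_banach[OF f, of t]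
      by (simp only: space_borel Int_UNIV_right UNIV_I)
    also have "\<dots> = (\<Sum>y\<in>range f. y * indicator (f -` {y}) t)"
      by (rule sum.cong) (simp_all split: split_indicator)
    finally show ?thesis .
  qed
  then have eq: "f = (\<lambda>t. \<Sum>y\<in>range f. y * indicator (f -` {y}) t)" by (rule ext)
  show ?thesis
    using aux[OF simple_functionD(1)[OF f], unfolded space_borel] unfolding eq[symmetric] by blast
qed

theorem trig_poly_dense:
  assumes p: "1 \<le> p" and f: "f \<in> Lp p" and e: "e > 0"
  obtains r where "r \<in> trig_poly" "Lp_norm p (f - r) < e"
proof -
  obtain u where u [measurable]: "u \<in> borel_measurable borel" and eq: "f = abs_L0 u"
    by (rule L0_exhaust)
  \<comment> \<open>Besides pointwise convergence, the bound of |F i| by 2 |u| matters: it is the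
    majorant for dominated convergence in L^p.\<close>
  obtain F where F: "\<And>i. simple_function borel (F i)" "\<And>x. (\<lambda>i. F i x) \<longlonglongrightarrow> u x"
    "\<And>i x. dist (F i x) 0 \<le> 2 * dist (u x) 0"
    using borel_measurable_implies_sequence_metric[OF u, of 0] by auto
  have [measurable]: "F i \<in> borel_measurable borel" for i
    using F(1) by (rule borel_measurable_simple_function)
  have "integrable circle_measure (\<lambda>t. norm (u t) powr p)" using f by (simp add: eq abs_L0_Lp)
  then have int: "integrable circle_measure (\<lambda>t. (2 * norm (u t)) powr p)" by (simp add: powr_mult)
  have "f \<in> Lp_trig_closure p"
  proof (rule trig_closure_limit[where s = "\<lambda>i. abs_L0 (F i)", OF p f])
    show "(\<lambda>i. Lp_norm p (abs_L0 (F i) - f)) \<longlonglongrightarrow> 0"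
      unfolding eq by (rule Lp_dominated_convergence(3)[OF _ _ _ _ int]) (use F p in \<open>auto simp: dist_norm\<close>)
  qed (use F p in \<open>auto intro: simple_function_in_trig_closure\<close>)
  then show ?thesis using that e by (auto simp: Lp_trig_closure_def)
qed

lemma trig_poly_finite_coeffs:
  assumes "f \<in> trig_poly"
  shows "finite {n. fourier_coeff f n \<noteq> 0}"
proof -
  have "f \<in> Lp 1 \<and> finite {n. fourier_coeff f n \<noteq> 0}"
    using assms
  proof (induction f rule: trig_poly_induct)
    case subspace
    have "finite {n. fourier_coeff f n + fourier_coeff g n \<noteq> 0}"
      if "finite {n. fourier_coeff f n \<noteq> 0}" "finite {n. fourier_coeff g n \<noteq> 0}" for f g
      by (rule finite_subset[OF _ finite_UnI[OF that]]) auto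
    then show ?case
      by (auto simp: L0.subspace_def fourier_coeff_add Lp_add fourier_coeff_cscale Lp_cscale)
  qed (simp add: fourier_coeff_tpow)
  then show ?thesis ..
qed

text \<open>The Riemann-Lebesgue lemma: a trigonometric polynomial has only finitely many nonzero
  coefficients, and coefficients are bounded by the L^1 norm of the difference.\<close>

lemma fourier_coeff_tendsto_0:
  assumes f: "f \<in> Lp 1"
  shows "(\<lambda>n. fourier_coeff f (int n)) \<longlonglongrightarrow> 0"
proof (rule LIMSEQ_I)
  fix e :: real assume "e > 0"
  then obtain r where r: "r \<in> trig_poly" "Lp_norm 1 (f - r) < e"
    using trig_poly_dense[of 1 f e] f by auto
  have "r \<in> Lp 1" using r trig_poly_Lp[of 1] by auto
  have fin: "finite {n. fourier_coeff r (int n) \<noteq> 0}"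
    using finite_vimageI[OF trig_poly_finite_coeffs[OF r(1)], of int] by (simp add: vimage_def)
  then obtain N where N: "\<And>n. fourier_coeff r (int n) \<noteq> 0 \<Longrightarrow> n < N"
    by (metis (mono_tags, lifting) finite_nat_set_iff_bounded mem_Collect_eq)
  have "norm (fourier_coeff f (int n)) < e" if "n \<ge> N" for n
  proof -
    have "fourier_coeff r (int n) = 0" using N[of n] that by fastforce
    then have "fourier_coeff f (int n) = fourier_coeff (f - r) (int n)"
      using f \<open>r \<in> Lp 1\<close> by (simp add: fourier_coeff_diff)
    then show ?thesis using fourier_coeff_le_1[of "f - r" "int n"] r by simp
  qed
  then show "\<exists>N. \<forall>n\<ge>N. norm (fourier_coeff f (int n) - 0) < e" by auto
qed

subsection \<open>Completeness\<close>

text \<open>Fatou's lemma for |v k|^p gives membership of the limit together with the bound. It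
  serves completeness of L^p and, later, the passage from truncations to a function in L^q.\<close>

lemma Lp_fatou:
  fixes v :: "nat \<Rightarrow> complex \<Rightarrow> complex"
  assumes p: "0 < p" and [measurable]: "\<And>k. v k \<in> borel_measurable borel" "f \<in> borel_measurable borel"
    and lim: "AE t in circle_measure. (\<lambda>k. v k t) \<longlonglongrightarrow> f t"
    and bound: "\<And>k. abs_L0 (v k) \<in> Lp p" "\<And>k. k \<ge> K \<Longrightarrow> Lp_norm p (abs_L0 (v k)) \<le> C"
  shows "abs_L0 f \<in> Lp p \<and> Lp_norm p (abs_L0 f) \<le> C"
proof -
  have C: "C \<ge> 0" using bound(2)[of K] Lp_norm_nonneg[of p "abs_L0 (v K)"] by linarith
  have b: "(\<integral>\<^sup>+t. ennreal (norm (v k t) powr p) \<partial>circle_measure) \<le> ennreal (C powr p)" if "k \<ge> K" for k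
  proof -
    have "(\<integral>\<^sup>+t. ennreal (norm (v k t) powr p) \<partial>circle_measure) = ennreal (absint p (abs_L0 (v k)))"
      using bound(1)[of k] by (subst nn_integral_eq_integral) (auto simp: abs_L0_Lp)
    also have "absint p (abs_L0 (v k)) \<le> C powr p"
      using bound(2)[OF that] p by (simp add: absint_Lp_norm powr_mono2)
    finally show ?thesis by (simp add: ennreal_leI)
  qed
  have "(\<integral>\<^sup>+t. ennreal (norm (f t) powr p) \<partial>circle_measure)
      = (\<integral>\<^sup>+t. liminf (\<lambda>k. ennreal (norm (v k t) powr p)) \<partial>circle_measure)"
  proof (rule nn_integral_cong_AE)
    show "AE t in circle_measure. ennreal (norm (f t) powr p) = liminf (\<lambda>k. ennreal (norm (v k t) powr p))"
      using lim
    proof eventually_elim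
      case (elim t)
      then have "(\<lambda>k. ennreal (norm (v k t) powr p)) \<longlonglongrightarrow> ennreal (norm (f t) powr p)"
        using p by (intro tendsto_ennrealI tendsto_powr' tendsto_norm) auto
      then show ?case by (metis lim_imp_Liminf trivial_limit_sequentially)
    qed
  qed
  also have "\<dots> \<le> liminf (\<lambda>k. \<integral>\<^sup>+t. ennreal (norm (v k t) powr p) \<partial>circle_measure)"
    by (rule nn_integral_liminf) measurable
  also have "\<dots> \<le> liminf (\<lambda>k. ennreal (C powr p))"
    by (rule Liminf_mono) (use b in \<open>auto simp: eventually_sequentially\<close>)
  also have "\<dots> = ennreal (C powr p)" by (simp add: Liminf_const)
  finally have le: "(\<integral>\<^sup>+t. ennreal (norm (f t) powr p) \<partial>circle_measure) \<le> ennreal (C powr p)" .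
  have int: "integrable circle_measure (\<lambda>t. norm (f t) powr p)"
    by (rule integrableI_bounded) (use le in \<open>auto simp: order_le_less_trans\<close>)
  then have "abs_L0 f \<in> Lp p" by (simp add: abs_L0_Lp)
  moreover have "absint p (abs_L0 f) \<le> C powr p"
    using le int by (simp add: nn_integral_eq_integral abs_L0_Lp)
  ultimately show ?thesis using p C by (auto intro: Lp_norm_leI)
qed

theorem Lp_complete:
  fixes u :: "nat \<Rightarrow> L0"
  assumes p: "1 \<le> p" and u: "\<And>n. u n \<in> Lp p"
    and cauchy: "\<And>e. e > 0 \<Longrightarrow> \<exists>K. \<forall>m\<ge>K. \<forall>n\<ge>K. Lp_norm p (u m - u n) < e"
  obtains f where "f \<in> Lp p" "(\<lambda>n. Lp_norm p (u n - f)) \<longlonglongrightarrow> 0"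
proof -
  have "\<exists>v. v \<in> borel_measurable borel \<and> u n = abs_L0 v" for n
    using L0_exhaust[of "u n"] by metis
  then obtain v where v [measurable]: "\<And>n. v n \<in> borel_measurable borel" and uv: "\<And>n. u n = abs_L0 (v n)"
    by metis
  have "\<exists>K. \<forall>m\<ge>K. \<forall>n\<ge>K. Lp_norm p (u m - u n) < (1/2) ^ k" for k :: nat
    by (rule cauchy) simp
  then obtain K where K: "\<And>k m n. m \<ge> K k \<Longrightarrow> n \<ge> K k \<Longrightarrow> Lp_norm p (u m - u n) < (1/2) ^ k"
    by metis
  \<comment> \<open>An explicit index choice that is at least \<open>K k\<close>, at least k, and
    nondecreasing, so no recursive selection of a subsequence is involved.\<close>
  define r where "r k = (\<Sum>i\<le>k. K i) + k" for k
  have rK: "r k \<ge> K k" for k by (simp add: r_def sum.atMost_Suc trans_le_add1 member_le_sum)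
  have rmono: "r k \<le> r l" if "k \<le> l" for k l unfolding r_def by (intro add_mono sum_mono2) (use that in auto)
  have rk: "k \<le> r k" for k by (simp add: r_def)
  define g where "g k t = norm (v (r (Suc k)) t - v (r k) t)" for k t
  have [measurable]: "g k \<in> borel_measurable borel" for k unfolding g_def by measurable
  have gN: "abs_L0 (\<lambda>t. of_real (g k t)) \<in> Lp p" "Lp_norm p (abs_L0 (\<lambda>t. of_real (g k t))) \<le> (1/2) ^ k" for k
  proof -
    have eq: "abs_L0 (\<lambda>t. of_real (g k t)) = abs_fun (u (r (Suc k)) - u (r k))"
      by (simp add: uv minus_L0.abs_eq abs_fun.abs_eq g_def)
    have d: "u (r (Suc k)) - u (r k) \<in> Lp p" using p u by (intro Lp_diff) auto
    show "abs_L0 (\<lambda>t. of_real (g k t)) \<in> Lp p" unfolding eq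
      by (rule dominated_Lp[OF dominated_abs(1)]) (use p d in auto)
    have "Lp_norm p (abs_fun (u (r (Suc k)) - u (r k))) \<le> 1 * Lp_norm p (u (r (Suc k)) - u (r k))"
      by (rule dominated_Lp[OF dominated_abs(1)]) (use p d in auto)
    also have "\<dots> \<le> (1/2) ^ k"
      using K[of k "r (Suc k)" "r k"] rK[of k] rmono[of k "Suc k"] by simp
    finally show "Lp_norm p (abs_L0 (\<lambda>t. of_real (g k t))) \<le> (1/2) ^ k" unfolding eq .
  qed
  \<comment> \<open>The sums of increments have norm at most 2 - 2 (1/2)^n. Monotone convergence
    makes them bounded almost everywhere, so the chosen subsequence converges there by absolute
    summability of its increments.\<close>
  define G where "G n t = (\<Sum>k<n. g k t)" for n t
  have [measurable]: "G n \<in> borel_measurable borel" for n unfolding G_def by measurable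
  have GN: "abs_L0 (\<lambda>t. of_real (G n t)) \<in> Lp p \<and> Lp_norm p (abs_L0 (\<lambda>t. of_real (G n t))) \<le> 2 - 2 * (1/2) ^ n" for n
  proof (induction n)
    case 0
    have "abs_L0 (\<lambda>t. of_real (G 0 t)) = 0" by (simp add: zero_L0.abs_eq G_def)
    then show ?case by simp
  next
    case (Suc n)
    have "abs_L0 (\<lambda>t. of_real (G (Suc n) t)) = abs_L0 (\<lambda>t. of_real (G n t)) + abs_L0 (\<lambda>t. of_real (g n t))"
      by (simp add: plus_L0.abs_eq G_def)
    then show ?case
      using Lp_add[OF p, of "abs_L0 (\<lambda>t. of_real (G n t))" "abs_L0 (\<lambda>t. of_real (g n t))"] Suc gN[of n] by auto
  qed
  have G0: "0 \<le> G n t" for n t by (simp add: G_def g_def sum_nonneg)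
  have Gmono: "G n t \<le> G (Suc n) t" for n t by (simp add: G_def g_def)
  have "(\<integral>\<^sup>+t. (SUP n. ennreal (G n t powr p)) \<partial>circle_measure) = (SUP n. \<integral>\<^sup>+t. ennreal (G n t powr p) \<partial>circle_measure)"
    by (rule nn_integral_monotone_convergence_SUP)
       (use Gmono G0 p in \<open>auto intro!: incseq_SucI le_funI ennreal_leI powr_mono2\<close>)
  also have "\<dots> \<le> ennreal (2 powr p)"
  proof (rule SUP_least)
    fix n
    have le2: "Lp_norm p (abs_L0 (\<lambda>t. of_real (G n t))) \<le> 2"
    proof -
      have "0 \<le> (1/2::real) ^ n" by simp
      then show ?thesis using GN[of n] by linarith
    qed
    have "(\<integral>\<^sup>+t. ennreal (G n t powr p) \<partial>circle_measure) = ennreal (absint p (abs_L0 (\<lambda>t. of_real (G n t))))"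
      using GN[of n] G0 by (subst nn_integral_eq_integral) (auto simp: abs_L0_Lp)
    also have "absint p (abs_L0 (\<lambda>t. of_real (G n t))) \<le> 2 powr p"
      using le2 p by (simp add: absint_Lp_norm powr_mono2)
    finally show "(\<integral>\<^sup>+t. ennreal (G n t powr p) \<partial>circle_measure) \<le> ennreal (2 powr p)" by (simp add: ennreal_leI)
  qed
  finally have "(\<integral>\<^sup>+t. (SUP n. ennreal (G n t powr p)) \<partial>circle_measure) < \<infinity>"
    by (simp add: order_le_less_trans)
  then have "AE t in circle_measure. (SUP n. ennreal (G n t powr p)) \<noteq> \<infinity>"
    by (intro nn_integral_PInf_AE) auto
  then have "AE t in circle_measure. convergent (\<lambda>k. v (r k) t)"
  proof eventually_elim
    case (elim t)
    then obtain c where c: "c \<ge> 0" "(SUP n. ennreal (G n t powr p)) = ennreal c"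
      by (metis ennreal_cases infinity_ennreal_def)
    have "G n t \<le> c powr (1 / p)" for n
    proof -
      have "ennreal (G n t powr p) \<le> ennreal c" unfolding c(2)[symmetric] by (rule SUP_upper) simp
      then have "G n t powr p \<le> c" using c by simp
      then have "(G n t powr p) powr (1 / p) \<le> c powr (1 / p)" using p by (intro powr_mono2) auto
      then show ?thesis using p G0 by (simp add: powr_powr)
    qed
    then have "summable (\<lambda>k. g k t)"
      by (intro summableI_nonneg_bounded[where x = "c powr (1 / p)"]) (auto simp: g_def G_def)
    then have "summable (\<lambda>k. v (r (Suc k)) t - v (r k) t)"
      unfolding g_def by (rule summable_norm_cancel)
    then have "convergent (\<lambda>n. (\<Sum>k<n. v (r (Suc k)) t - v (r k) t) + v (r 0) t)"
      by (auto simp: summable_iff_convergent intro!: convergent_add convergent_const)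
    moreover have "(\<Sum>k<n. v (r (Suc k)) t - v (r k) t) + v (r 0) t = v (r n) t" for n
      by (subst sum_lessThan_telescope) simp
    ultimately show ?case by simp
  qed
  then have lim: "AE t in circle_measure. (\<lambda>k. v (r k) t) \<longlonglongrightarrow> lim (\<lambda>k. v (r k) t)"
    by eventually_elim (simp add: convergent_LIMSEQ_iff)
  define w where "w t = lim (\<lambda>k. v (r k) t)" for t
  have [measurable]: "w \<in> borel_measurable borel" unfolding w_def by (rule borel_measurable_lim_metric) simp
  \<comment> \<open>Fatou's lemma along the subsequence, with n fixed: the Cauchy bound for u m - u
    n passes to the limit in m. This yields convergence of the whole sequence.\<close>
  have key: "abs_L0 w - u n \<in> Lp p \<and> Lp_norm p (abs_L0 w - u n) \<le> e"
    if "\<And>m. m \<ge> L \<Longrightarrow> Lp_norm p (u m - u n) \<le> e" for n L e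
  proof -
    have "abs_L0 (\<lambda>t. w t - v n t) \<in> Lp p \<and> Lp_norm p (abs_L0 (\<lambda>t. w t - v n t)) \<le> e"
    proof (rule Lp_fatou[where v = "\<lambda>k t. v (r k) t - v n t" and K = L])
      show "AE t in circle_measure. (\<lambda>k. v (r k) t - v n t) \<longlonglongrightarrow> w t - v n t"
        using lim unfolding w_def by eventually_elim (intro tendsto_intros)
      fix k
      have eq: "abs_L0 (\<lambda>t. v (r k) t - v n t) = u (r k) - u n" by (simp add: uv minus_L0.abs_eq)
      show "abs_L0 (\<lambda>t. v (r k) t - v n t) \<in> Lp p" unfolding eq using u p by (intro Lp_diff) auto
      assume "L \<le> k"
      then show "Lp_norm p (abs_L0 (\<lambda>t. v (r k) t - v n t)) \<le> e"
        unfolding eq using that rk[of k] by simp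
    qed (use p in auto)
    then show ?thesis by (simp add: uv minus_L0.abs_eq)
  qed
  show ?thesis
  proof (rule that[of "abs_L0 w"])
    obtain K1 where "\<forall>m\<ge>K1. \<forall>n\<ge>K1. Lp_norm p (u m - u n) < 1" using cauchy[of 1] by auto
    then have "abs_L0 w - u K1 \<in> Lp p" using key[of K1 K1 1] by force
    from Lp_add(1)[OF p this u[of K1]] show "abs_L0 w \<in> Lp p" by simp
    show "(\<lambda>n. Lp_norm p (u n - abs_L0 w)) \<longlonglongrightarrow> 0"
    proof (rule LIMSEQ_I)
      fix e :: real assume "e > 0"
      then obtain L where L: "\<And>m n. m \<ge> L \<Longrightarrow> n \<ge> L \<Longrightarrow> Lp_norm p (u m - u n) < e / 2"
        using cauchy[of "e / 2"] by auto
      have "Lp_norm p (u n - abs_L0 w) < e" if "n \<ge> L" for n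
      proof -
        have "abs_L0 w - u n \<in> Lp p \<and> Lp_norm p (abs_L0 w - u n) \<le> e / 2"
          by (rule key[of L]) (use L that in \<open>auto intro: less_imp_le\<close>)
        then show ?thesis using \<open>e > 0\<close> p Lp_norm_minus_commute[of p "abs_L0 w" "u n"] by auto
      qed
      then show "\<exists>L. \<forall>n\<ge>L. norm (Lp_norm p (u n - abs_L0 w) - 0) < e" by auto
    qed
  qed
qed

subsection \<open>The theorem of M. Riesz\<close>

text \<open>The graph of \<open>riesz_proj\<close>. As a relation it is linear and single-valued
  before existence is known, whereas the definite description carries information only once a
  suitable function has been found.\<close>

definition riesz_pair :: "L0 \<Rightarrow> L0 \<Rightarrow> bool" where
  "riesz_pair f h \<longleftrightarrow> h \<in> Lp 1 \<and> (\<forall>n. fourier_coeff h n = (if n \<ge> 0 then fourier_coeff f n else 0))"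

lemma riesz_pair_unique: "riesz_pair f h \<Longrightarrow> riesz_pair f h' \<Longrightarrow> h = h'"
  by (rule fourier_coeff_unique) (auto simp: riesz_pair_def)

lemma riesz_proj_eqI: "riesz_pair f h \<Longrightarrow> riesz_proj f = h"
  unfolding riesz_proj_def by (rule the_equality) (auto simp: riesz_pair_def intro!: riesz_pair_unique[unfolded riesz_pair_def])

lemma riesz_pair_add: "f \<in> Lp 1 \<Longrightarrow> f' \<in> Lp 1 \<Longrightarrow> riesz_pair f h \<Longrightarrow> riesz_pair f' h' \<Longrightarrow> riesz_pair (f + f') (h + h')"
  by (auto simp: riesz_pair_def fourier_coeff_add Lp_add)

lemma riesz_pair_cscale: "riesz_pair f h \<Longrightarrow> riesz_pair (c *\<^sub>C f) (c *\<^sub>C h)"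
  by (auto simp: riesz_pair_def fourier_coeff_cscale Lp_cscale)

lemma riesz_pair_diff: "f \<in> Lp 1 \<Longrightarrow> f' \<in> Lp 1 \<Longrightarrow> riesz_pair f h \<Longrightarrow> riesz_pair f' h' \<Longrightarrow> riesz_pair (f - f') (h - h')"
  by (auto simp: riesz_pair_def fourier_coeff_diff Lp_diff)

lemma conjugate_exponent:
  fixes p q :: real
  assumes "1 < p" "1 / p + 1 / q = 1"
  shows "1 < q" "q = p / (p - 1)" "(p - 1) * q = p" "p + q = p * q"
proof -
  \<comment> \<open>Division by zero gives 0, so \<open>q = 0\<close> would mean
    \<open>1 / p = 1\<close>, against \<open>1 < p\<close>.\<close>
  have "q \<noteq> 0" using assms by auto
  then have "q + p = p * q" using assms by (simp add: field_simps)
  then show "p + q = p * q" by simp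
  then show *: "(p - 1) * q = p" by (simp add: algebra_simps)
  then show q: "q = p / (p - 1)" using assms by (simp add: field_simps)
  show "1 < q" unfolding q using assms by (simp add: less_divide_eq)
qed

lemma dominated_trig_poly:
  assumes "r \<in> trig_poly"
  shows "\<exists>C\<ge>0. \<forall>f. dominated C (r * f) f"
  using assms
proof (induction r rule: trig_poly_induct)
  case subspace
  have add: "dominated (C + D) ((r + s) * f) f" if "dominated C (r * f) f" "dominated D (s * f) f" for C D r s f
    using that
  proof transfer
    fix C D :: real and r s f :: "complex \<Rightarrow> complex"
    assume "AE t in circle_measure. norm (r t * f t) \<le> C * norm (f t)"
      "AE t in circle_measure. norm (s t * f t) \<le> D * norm (f t)"
    then show "AE t in circle_measure. norm ((r t + s t) * f t) \<le> (C + D) * norm (f t)"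
    proof eventually_elim
      case (elim t)
      then show ?case using norm_triangle_ineq[of "r t * f t" "s t * f t"] by (simp add: distrib_right)
    qed
  qed
  have scale: "dominated (norm c * C) ((c *\<^sub>C r) * f) f" if "dominated C (r * f) f" for C c r f
    using that
  proof transfer
    fix C :: real and c and r f :: "complex \<Rightarrow> complex"
    assume "AE t in circle_measure. norm (r t * f t) \<le> C * norm (f t)"
    then show "AE t in circle_measure. norm (c * r t * f t) \<le> norm c * C * norm (f t)"
      by eventually_elim (simp add: norm_mult mult.assoc mult_left_mono)
  qed
  have zero: "dominated 0 (0 * f) f" for f by transfer simp
  show ?case
  proof (rule L0.subspaceI; unfold mem_Collect_eq)
    show "\<exists>C\<ge>0. \<forall>f. dominated C (0 * f) f" using zero by blast
  next
    fix r s assume "\<exists>C\<ge>0. \<forall>f. dominated C (r * f) f" "\<exists>C\<ge>0. \<forall>f. dominated C (s * f) f"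
    then show "\<exists>C\<ge>0. \<forall>f. dominated C ((r + s) * f) f" using add add_nonneg_nonneg by meson
  next
    fix c r assume "\<exists>C\<ge>0. \<forall>f. dominated C (r * f) f"
    then show "\<exists>C\<ge>0. \<forall>f. dominated C ((c *\<^sub>C r) * f) f" using scale mult_nonneg_nonneg norm_ge_zero by meson
  qed
next
  case (tpow n)
  show ?case using dominated_tpow(1) by (intro exI[of _ 1]) auto
qed

lemma trig_poly_mult_Lp: "r \<in> trig_poly \<Longrightarrow> 0 < p \<Longrightarrow> f \<in> Lp p \<Longrightarrow> r * f \<in> Lp p"
  using dominated_trig_poly dominated_Lp(1) by blast

text \<open>The last clause is the transpose of P with respect to the bilinear pairing given by the
  coefficient of index 0 of a product: the transpose truncates to indices n <= 0. For monomials it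
  is read off from the shift rule, and linearity does the rest. The truncation k of g is assumed to
  exist, not constructed.\<close>

lemma trig_poly_riesz_pair:
  assumes "r \<in> trig_poly"
  shows "\<exists>h\<in>trig_poly. riesz_pair r h \<and> (\<forall>g k. g \<in> Lp 1 \<longrightarrow> k \<in> Lp 1 \<longrightarrow>
      (\<forall>n. fourier_coeff k n = (if n \<le> 0 then fourier_coeff g n else 0)) \<longrightarrow>
      fourier_coeff (h * g) 0 = fourier_coeff (r * k) 0)" (is "\<exists>h\<in>trig_poly. ?R r h \<and> ?Q r h")
proof -
  have tp: "r \<in> Lp 1" if "r \<in> trig_poly" for r using trig_poly_Lp[of 1] that by auto
  have "r \<in> trig_poly \<and> (\<exists>h\<in>trig_poly. ?R r h \<and> ?Q r h)"
    using assms
  proof (induction r rule: trig_poly_induct)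
    case subspace
    show ?case
    proof (rule L0.subspaceI; unfold mem_Collect_eq)
      show "0 \<in> trig_poly \<and> (\<exists>h\<in>trig_poly. ?R 0 h \<and> ?Q 0 h)"
        using L0.subspace_0[OF subspace_trig_poly] by (auto simp: riesz_pair_def intro!: bexI[of _ 0])
    next
      fix r s assume "r \<in> trig_poly \<and> (\<exists>h\<in>trig_poly. ?R r h \<and> ?Q r h)" "s \<in> trig_poly \<and> (\<exists>h\<in>trig_poly. ?R s h \<and> ?Q s h)"
      then obtain h h' where h: "r \<in> trig_poly" "s \<in> trig_poly" "h \<in> trig_poly" "?R r h" "?Q r h" "h' \<in> trig_poly" "?R s h'" "?Q s h'"
        by auto
      have "?Q (r + s) (h + h')"
      proof (intro allI impI)
        fix g k :: L0 assume gk: "g \<in> Lp 1" "k \<in> Lp 1" "\<forall>n. fourier_coeff k n = (if n \<le> 0 then fourier_coeff g n else 0)"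
        then have "fourier_coeff (h * g) 0 = fourier_coeff (r * k) 0" "fourier_coeff (h' * g) 0 = fourier_coeff (s * k) 0"
          using h by blast+
        then show "fourier_coeff ((h + h') * g) 0 = fourier_coeff ((r + s) * k) 0"
          using gk h by (simp add: distrib_right fourier_coeff_add trig_poly_mult_Lp)
      qed
      then show "r + s \<in> trig_poly \<and> (\<exists>h\<in>trig_poly. ?R (r + s) h \<and> ?Q (r + s) h)"
        using h L0.subspace_add[OF subspace_trig_poly] riesz_pair_add[of r s h h'] tp by blast
    next
      fix c r assume "r \<in> trig_poly \<and> (\<exists>h\<in>trig_poly. ?R r h \<and> ?Q r h)"
      then obtain h where h: "r \<in> trig_poly" "h \<in> trig_poly" "?R r h" "?Q r h"
        by auto
      have "?Q (c *\<^sub>C r) (c *\<^sub>C h)"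
        using h(4) by (simp add: cscale_mult_left fourier_coeff_cscale)
      then show "c *\<^sub>C r \<in> trig_poly \<and> (\<exists>h\<in>trig_poly. ?R (c *\<^sub>C r) h \<and> ?Q (c *\<^sub>C r) h)"
        using h L0.subspace_scale[OF subspace_trig_poly] riesz_pair_cscale[of r h] by blast
    qed
  next
    case (tpow n)
    show ?case
    proof (cases "n \<ge> 0")
      case True
      then show ?thesis
        by (intro conjI bexI[of _ "tpow n"]) (auto simp: riesz_pair_def fourier_coeff_tpow fourier_coeff_shift)
    next
      case False
      then show ?thesis
        using L0.subspace_0[OF subspace_trig_poly]
        by (intro conjI bexI[of _ 0]) (auto simp: riesz_pair_def fourier_coeff_tpow fourier_coeff_shift)
    qed
  qed
  then show ?thesis by blast
qed

lemma circle_mean_value: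
  assumes G: "continuous_on (cball 0 1) G" "G holomorphic_on ball 0 1" "G \<in> borel_measurable borel"
  shows "integral\<^sup>L circle_measure G = G 0"
proof -
  \<comment> \<open>The standard circle path runs over [0, 2 pi], the measure over [-pi, pi]. The
    translation by pi is multiplication by -1 on the circle, which the substitution absorbs.\<close>
  define F where "F z = G (- z)" for z
  have "continuous_on (cball 0 1) F" unfolding F_def
    by (rule continuous_on_compose2[OF G(1)]) (auto intro!: continuous_intros)
  moreover have "F holomorphic_on ball 0 1" unfolding F_def
    by (rule holomorphic_on_compose_gen[OF _ G(2), unfolded o_def]) (auto intro!: holomorphic_intros)
  ultimately have "((\<lambda>u. F u / (u - 0)) has_contour_integral (2 * of_real pi * \<i> * F 0)) (circlepath 0 1)"
    by (intro Cauchy_integral_circlepath) auto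
  then have "((\<lambda>t. F (0 + 1 * cis t) / ((0 + 1 * cis t) - 0) * 1 * \<i> * cis t) has_integral (2 * of_real pi * \<i> * F 0)) {0..2*pi}"
    unfolding circlepath_def by (subst (asm) has_contour_integral_part_circlepath_iff) auto
  then have "((\<lambda>t. F (cis t) * \<i>) has_integral (2 * of_real pi * \<i> * F 0)) {0..2*pi}"
    by simp
  from has_integral_mult_right[OF this, of "- \<i>"]
  have "((\<lambda>t. F (cis t)) has_integral (2 * of_real pi * F 0)) (cbox 0 (2*pi))"
    by (simp add: mult.commute mult.left_commute)
  from has_integral_affinity[OF this, of 1 pi]
  have "((\<lambda>x. F (cis (x + pi))) has_integral (2 * of_real pi * F 0)) ((\<lambda>x. x - pi) ` {0..2*pi})"
    by simp
  moreover have "(\<lambda>x. x - pi) ` {0..2*pi} = {-pi..pi}"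
    using image_add_atLeastAtMost[of "-pi" 0 "2*pi"] by (simp add: add.commute)
  moreover have "F (cis (x + pi)) = G (cis x)" for x by (simp add: F_def cis_mult[symmetric])
  ultimately have "((\<lambda>x. G (cis x)) has_integral (2 * of_real pi * G 0)) {-pi..pi}" by (simp add: F_def)
  moreover have "continuous_on (sphere 0 1) G" using G(1) by (rule continuous_on_subset) auto
  ultimately show ?thesis using G(3) by (simp add: integral_circle_measure_has_integral)
qed

text \<open>By homogeneity only the argument of z matters. Away from the imaginary axis cos is
  bounded below and a large A suffices; near the axis cos (p x) is negative, since p > 1, and the
  term with B takes over. The bound p <= 2 keeps p x within [0, pi], where cos is
  decreasing.\<close>

lemma conjugate_function_pointwise:
  fixes p :: real
  assumes p: "1 < p" "p \<le> 2"
  obtains A B where "0 \<le> A" "0 \<le> B"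
    "\<And>z. Re z > 0 \<Longrightarrow> \<bar>Im z\<bar> powr p \<le> A * Re z powr p - B * Re (z powr of_real p)"
proof -
  \<comment> \<open>The angle for which p times it is the midpoint of pi/2 and p pi/2. It is thus
    below pi/2, yet its p-fold has negative cosine.\<close>
  define \<theta>0 where "\<theta>0 = (pi / 2 + p * (pi / 2)) / 2 / p"
  have p\<theta>0: "p * \<theta>0 = (pi / 2 + p * (pi / 2)) / 2" using p by (simp add: \<theta>0_def)
  have gt: "pi / 2 < p * \<theta>0" using p pi_gt_zero unfolding p\<theta>0 by (simp add: field_simps)
  have lt: "p * \<theta>0 < p * (pi / 2)" using p pi_gt_zero unfolding p\<theta>0 by (simp add: field_simps)
  then have \<theta>0: "\<theta>0 < pi / 2" using p by simp
  have \<theta>0': "0 \<le> \<theta>0" using p by (simp add: \<theta>0_def)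
  have ppi: "p * (pi / 2) \<le> pi" using p by simp
  have "p * \<theta>0 < pi" using lt ppi by linarith
  then have b: "cos (p * \<theta>0) < 0" using gt by (intro cos_lt_zero_pi[unfolded divide_numeral_1]) auto
  \<comment> \<open>B makes -B cos (p x) at least 1 beyond the critical angle; A then pays for 1 and
    for the worst loss B below it.\<close>
  define B where "B = 1 / - cos (p * \<theta>0)"
  define A where "A = (1 + B) / cos \<theta>0 powr p"
  have B: "0 \<le> B" using b by (simp add: B_def)
  have cos0: "cos \<theta>0 > 0" using \<theta>0 \<theta>0' by (intro cos_gt_zero_pi) auto
  have A: "0 \<le> A" using B by (simp add: A_def)
  have trig: "\<bar>sin \<theta>\<bar> powr p \<le> A * cos \<theta> powr p - B * cos (p * \<theta>)" if \<theta>: "0 \<le> \<theta>" "\<theta> < pi / 2" for \<theta>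
  proof -
    have s: "\<bar>sin \<theta>\<bar> powr p \<le> 1" using powr_mono2[of p "\<bar>sin \<theta>\<bar>" 1] p by simp
    show ?thesis
    proof (cases "\<theta> \<le> \<theta>0")
      case True
      have "cos \<theta>0 \<le> cos \<theta>" using True \<theta> \<theta>0 by (intro cos_monotone_0_pi_le) auto
      then have "cos \<theta>0 powr p \<le> cos \<theta> powr p" using cos0 p by (intro powr_mono2) auto
      then have "A * cos \<theta>0 powr p \<le> A * cos \<theta> powr p" using A by (intro mult_left_mono)
      moreover have "A * cos \<theta>0 powr p = 1 + B" using cos0 by (simp add: A_def)
      moreover have "B * cos (p * \<theta>) \<le> B * 1" using B by (intro mult_left_mono) auto
      ultimately show ?thesis using s by linarith
    next
      case False
      have "p * \<theta> \<le> p * (pi / 2)" using \<theta> p by (intro mult_left_mono) auto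
      then have "cos (p * \<theta>) \<le> cos (p * \<theta>0)"
        using False p order_trans[OF _ ppi, of "p * \<theta>"] \<theta>0' by (intro cos_monotone_0_pi_le mult_left_mono) auto
      then have "B * cos (p * \<theta>) \<le> B * cos (p * \<theta>0)" using B by (intro mult_left_mono)
      moreover have "B * cos (p * \<theta>0) = -1" using b by (simp add: B_def)
      moreover have "0 \<le> A * cos \<theta> powr p" using A by simp
      ultimately show ?thesis using s by linarith
    qed
  qed
  show ?thesis
  proof (rule that[OF A B])
    fix z :: complex assume z: "Re z > 0"
    then have z0: "z \<noteq> 0" by auto
    define \<theta> where "\<theta> = Im (Ln z)"
    have \<theta>: "\<bar>\<theta>\<bar> < pi / 2" unfolding \<theta>_def using z Re_Ln_pos_lt[OF z0] by blast
    have Ln: "Ln z = of_real (ln (norm z)) + \<i> * of_real \<theta>"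
      using z0 by (simp add: complex_eq_iff \<theta>_def)
    have "z = exp (Ln z)" using z0 by simp
    also have "\<dots> = of_real (norm z) * cis \<theta>"
      unfolding Ln exp_add cis_conv_exp using z0 by (simp add: exp_of_real)
    finally have zeq: "z = of_real (norm z) * cis \<theta>" .
    have Re: "Re z = norm z * cos \<theta>" and Im: "Im z = norm z * sin \<theta>"
      by (subst zeq, simp)+
    have "z powr of_real p = exp (of_real p * Ln z)" using z0 by (simp add: powr_def)
    also have "of_real p * Ln z = of_real (p * ln (norm z)) + \<i> * of_real (p * \<theta>)"
      unfolding Ln by (simp add: algebra_simps)
    also have "exp \<dots> = of_real (norm z powr p) * cis (p * \<theta>)"
      unfolding exp_add cis_conv_exp using z0 by (simp add: powr_def flip: exp_of_real)
    finally have Rp: "Re (z powr of_real p) = norm z powr p * cos (p * \<theta>)" by simp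
    have "\<bar>sin \<theta>\<bar> powr p \<le> A * cos \<theta> powr p - B * cos (p * \<theta>)"
      using trig[of "\<bar>\<theta>\<bar>"] \<theta> by (cases "\<theta> \<ge> 0") auto
    from mult_left_mono[OF this, of "norm z powr p"]
    show "\<bar>Im z\<bar> powr p \<le> A * Re z powr p - B * Re (z powr of_real p)"
      unfolding Re Im Rp by (simp add: abs_mult powr_mult algebra_simps)
  qed
qed

text \<open>Since \<open>Re (a t\<^sup>n) = Re (cnj a t\<^sup>-\<^sup>n)\<close> on the circle, negative powers can be folded into
  positive ones.\<close>

lemma real_polynomial_function_Re_entire:
  fixes g :: "complex \<Rightarrow> real"
  assumes "real_polynomial_function g"
  obtains S :: "int set" and b where "finite S" "\<And>t. norm t = 1 \<Longrightarrow> Re (\<Sum>n\<in>S. b n * t ^ nat \<bar>n\<bar>) = g t"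
proof -
  obtain S a where S: "finite S" "\<And>t. norm t = 1 \<Longrightarrow> of_real (g t) = (\<Sum>n\<in>S. a n * t powi n)"
    using real_polynomial_function_circle_sum[OF assms] by blast
  show ?thesis
  proof (rule that[of S "\<lambda>n. if n \<ge> 0 then a n else cnj (a n)"])
    fix t :: complex assume t: "norm t = 1"
    have eq: "Re (a n * t powi n) = Re ((if n \<ge> 0 then a n else cnj (a n)) * t ^ nat \<bar>n\<bar>)" for n
    proof (cases "n \<ge> 0")
      case False
      have "cnj (a n * t powi n) = cnj (a n) * t ^ nat \<bar>n\<bar>"
        using False by (simp add: power_int_def inverse_norm_1[OF t])
      then show ?thesis using False by (metis cnj.simps(1))
    qed (simp add: power_int_def)
    have "g t = Re (\<Sum>n\<in>S. a n * t powi n)" using S(2)[OF t] by (metis Re_complex_of_real)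
    also have "\<dots> = Re (\<Sum>n\<in>S. (if n \<ge> 0 then a n else cnj (a n)) * t ^ nat \<bar>n\<bar>)"
      by (simp only: Re_sum eq)
    finally show "Re (\<Sum>n\<in>S. (if n \<ge> 0 then a n else cnj (a n)) * t ^ nat \<bar>n\<bar>) = g t" by simp
  qed (rule S)
qed

text \<open>Let F be the polynomial with Re F = g on the circle and F(0) real. By the minimum
  principle Re F > 0 on the disc, so F^p is analytic and its mean over the circle is F(0)^p >= 0.
  Integrating the pointwise estimate bounds the L^p norm of Im F by that of g, and P g = (F +
  F(0))/2.\<close>

lemma riesz_pair_positive:
  assumes p: "1 < p" "p \<le> 2"
  shows "\<exists>C\<ge>0. \<forall>g. real_polynomial_function g \<longrightarrow> (\<forall>t. norm t = 1 \<longrightarrow> g t > 0) \<longrightarrow>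
    (\<exists>h\<in>Lp p. riesz_pair (abs_L0 (\<lambda>t. of_real (g t))) h \<and> Lp_norm p h \<le> C * Lp_norm p (abs_L0 (\<lambda>t. of_real (g t))))"
proof -
  obtain A B where AB: "0 \<le> A" "0 \<le> B" "\<And>z. Re z > 0 \<Longrightarrow> \<bar>Im z\<bar> powr p \<le> A * Re z powr p - B * Re (z powr of_real p)"
    using conjugate_function_pointwise[OF p] by blast
  \<comment> \<open>The projection is half the sum of F and the constant F(0): the norm of F
    contributes 1 + A^(1/p), and the constant is a Fourier coefficient of g and contributes
    1.\<close>
  define C where "C = (1 + A powr (1 / p) + 1) / 2"
  have C: "C \<ge> 0" by (simp add: C_def)
  have "\<exists>h\<in>Lp p. riesz_pair (abs_L0 (\<lambda>t. of_real (g t))) h \<and> Lp_norm p h \<le> C * Lp_norm p (abs_L0 (\<lambda>t. of_real (g t)))"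
    if g: "real_polynomial_function g" and pos: "\<And>t. norm t = 1 \<Longrightarrow> g t > 0" for g
  proof -
    have [measurable]: "g \<in> borel_measurable borel" by (rule real_polynomial_function_measurable[OF g])
    define r where "r = abs_L0 (\<lambda>t. of_real (g t))"
    have r: "r \<in> trig_poly" unfolding r_def by (rule real_polynomial_function_trig_poly[OF g])
    then have rp: "r \<in> Lp p" "r \<in> Lp 1" using trig_poly_Lp[of p] trig_poly_Lp[of 1] p by auto
    obtain S b where S: "finite S" "\<And>t. norm t = 1 \<Longrightarrow> Re (\<Sum>n\<in>S. b n * t ^ nat \<bar>n\<bar>) = g t"
      using real_polynomial_function_Re_entire[OF g] by blast
    define F0 where "F0 z = (\<Sum>n\<in>S. b n * z ^ nat \<bar>n\<bar>)" for z
    define F where "F z = F0 z - \<i> * of_real (Im (F0 0))" for z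
    have hol: "F holomorphic_on X" for X unfolding F_def F0_def by (intro holomorphic_intros)
    have cont: "continuous_on X F" for X using hol by (rule holomorphic_on_imp_continuous_on)
    have [measurable]: "F \<in> borel_measurable borel" by (rule borel_measurable_continuous_onI[OF cont])
    have ReF: "Re (F t) = g t" if "norm t = 1" for t using S(2)[OF that] by (simp add: F_def F0_def)
    have F00: "Im (F 0) = 0" by (simp add: F_def)
    have posc: "Re (F z) > 0" if z: "norm z \<le> 1" for z
    proof -
      have "compact (sphere (0::complex) 1)" "sphere (0::complex) 1 \<noteq> {}" "continuous_on (sphere 0 1) (\<lambda>t. Re (F t))"
        using cont by (auto intro!: continuous_intros)
      from continuous_attains_inf[OF this] obtain t0 where t0: "norm t0 = 1" "\<And>t. norm t = 1 \<Longrightarrow> Re (F t0) \<le> Re (F t)" 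
        by auto
      have "Re (- F z) \<le> - Re (F t0)"
      proof (rule maximum_real_frontier[where S = "cball 0 1" and f = "\<lambda>z. - F z"])
        show "(\<lambda>z. - F z) holomorphic_on interior (cball 0 1)" using hol by (intro holomorphic_intros)
        show "continuous_on (closure (cball 0 1)) (\<lambda>z. - F z)" using cont by (intro continuous_intros)
      qed (use t0 z in auto)
      then show ?thesis using ReF[OF t0(1)] pos[OF t0(1)] by simp
    qed
    \<comment> \<open>The complex power is continuous only where F stays in the right half-plane.
      Cutting off outside the closed disc gives a Borel function on the whole plane.\<close>
    define G where "G z = indicator (cball 0 1) z *\<^sub>R (F z powr of_real p)" for z
    have Gcont: "continuous_on (cball 0 1) (\<lambda>z. F z powr of_real p)"
      using cont posc by (intro continuous_on_powr_complex continuous_on_const) force+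
    have [measurable]: "G \<in> borel_measurable borel" unfolding G_def
      by (rule borel_measurable_continuous_on_indicator[OF _ Gcont]) simp
    have Gint: "integral\<^sup>L circle_measure G = G 0"
    proof (rule circle_mean_value)
      show "continuous_on (cball 0 1) G" unfolding G_def
        by (rule continuous_on_eq[OF Gcont]) auto
      have "(\<lambda>z. F z powr of_real p) holomorphic_on ball 0 1"
        using posc by (intro holomorphic_on_powr_right holomorphic_on_powr hol holomorphic_intros) (auto simp: complex_nonpos_Reals_iff less_le_not_le dest: less_imp_le)
      then show "G holomorphic_on ball 0 1"
        by (rule holomorphic_transform) (auto simp: G_def)
    qed simp
    have F0pos: "Re (F 0) > 0" using posc[of 0] by simp
    have "F 0 = of_real (Re (F 0))" using F00 by (simp add: complex_eq_iff)
    then have "F 0 powr of_real p = of_real (Re (F 0) powr p)"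
      using F0pos by (metis powr_of_real less_imp_le)
    then have G0: "Re (G 0) \<ge> 0" by (simp add: G_def)
    have bdd: "\<exists>M. \<forall>t. norm t = 1 \<longrightarrow> norm (h t) \<le> M" if "continuous_on (sphere 0 1) h" for h :: "complex \<Rightarrow> complex"
    proof -
      have "bounded (h ` sphere 0 1)" using that compact_continuous_image compact_imp_bounded compact_sphere by blast
      then obtain a where "\<forall>x\<in>sphere 0 1. norm (h x) \<le> a" unfolding bounded_iff by auto
      then show ?thesis by (intro exI[of _ a]) auto
    qed
    have "continuous_on (sphere 0 1) G" unfolding G_def
      by (rule continuous_on_eq[OF continuous_on_subset[OF Gcont]]) auto
    then obtain M where M: "\<And>t. norm t = 1 \<Longrightarrow> norm (G t) \<le> M" using bdd by metis
    have Gi: "integrable circle_measure G"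
      by (rule integrable_circle_bounded[of _ M]) (use M AE_circle_norm in \<open>auto elim: eventually_mono\<close>)
    define v where "v = abs_L0 (\<lambda>t. of_real (Im (F t)))"
    have ri: "integrable circle_measure (\<lambda>t. g t powr p)"
    proof -
      have "integrable circle_measure (\<lambda>t. norm (complex_of_real (g t)) powr p)"
        using rp(1) by (simp add: r_def abs_L0_Lp)
      then show ?thesis
        by (subst integrable_cong_AE[where g = "\<lambda>t. norm (complex_of_real (g t)) powr p"])
           (use pos AE_circle_norm in \<open>auto elim!: eventually_mono simp: less_imp_le\<close>)
    qed
    have ra: "absint p r = (LINT t|circle_measure. g t powr p)"
      unfolding r_def by (subst abs_L0_Lp, simp, rule integral_cong_AE) (use pos AE_circle_norm in \<open>auto elim!: eventually_mono simp: less_imp_le\<close>)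
    have le: "AE t in circle_measure. norm (complex_of_real (Im (F t))) powr p \<le> A * g t powr p - B * Re (G t)"
      using AE_circle_norm
    proof eventually_elim
      case (elim t)
      then show ?case using AB(3)[of "F t"] posc[of t] ReF[of t] by (simp add: G_def)
    qed
    have ui: "integrable circle_measure (\<lambda>t. A * g t powr p - B * Re (G t))"
      using ri Gi by (intro Bochner_Integration.integrable_diff integrable_mult_right integrable_Re)
    have vi: "integrable circle_measure (\<lambda>t. norm (complex_of_real (Im (F t))) powr p)"
      by (rule Bochner_Integration.integrable_bound[OF ui], simp, use le in eventually_elim) auto
    have vp: "v \<in> Lp p" using vi by (simp add: v_def abs_L0_Lp)
    have "absint p v \<le> (LINT t|circle_measure. A * g t powr p - B * Re (G t))"
      unfolding v_def by (subst abs_L0_Lp, simp, rule integral_mono_AE[OF vi ui le])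
    also have "\<dots> = A * absint p r - B * Re (G 0)"
      using ri Gi by (simp add: ra Gint)
    also have "\<dots> \<le> A * absint p r" using AB G0 by simp
    finally have "absint p v \<le> (A powr (1 / p) * Lp_norm p r) powr p"
      using p AB by (simp add: powr_mult powr_powr absint_Lp_norm)
    then have vN: "Lp_norm p v \<le> A powr (1 / p) * Lp_norm p r" using p by (intro Lp_norm_leI) auto
    define f where "f = abs_L0 F"
    have f: "f = r + \<i> *\<^sub>C v"
      unfolding f_def r_def v_def
      by (simp add: plus_L0.abs_eq cscale.abs_eq abs_L0_eq_iff)
         (rule eventually_mono[OF AE_circle_norm], simp add: complex_eq_iff ReF)
    have fp: "f \<in> Lp p" unfolding f using rp vp p by (intro Lp_add Lp_cscale) auto
    have fN: "Lp_norm p f \<le> (1 + A powr (1 / p)) * Lp_norm p r"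
      using Lp_add(2)[of p r "\<i> *\<^sub>C v"] Lp_cscale[of p v \<i>] rp vp p vN unfolding f by (simp add: algebra_simps)
    have f1: "f \<in> Lp 1" using fp p Lp_mono(1)[of 1 p] by simp
    have r_conj: "r = (1/2) *\<^sub>C (f + conj_fun f)"
      unfolding f_def r_def
      by (simp add: plus_L0.abs_eq cscale.abs_eq conj_fun.abs_eq abs_L0_eq_iff)
         (rule eventually_mono[OF AE_circle_norm], simp add: complex_eq_iff ReF)
    have feq: "f = (\<Sum>n\<in>S. b n *\<^sub>C tpow \<bar>n\<bar>) - (\<i> * of_real (Im (F0 0))) *\<^sub>C 1"
    proof -
      from tpow_sum[OF S(1), of b abs] have "(\<Sum>n\<in>S. b n *\<^sub>C tpow \<bar>n\<bar>) = abs_L0 F0"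
        by (simp add: F0_def[abs_def] power_int_def)
      moreover have [measurable]: "F0 \<in> borel_measurable borel"
        unfolding F0_def by (intro borel_measurable_continuous_onI continuous_intros)
      have "f = abs_L0 F0 - (\<i> * of_real (Im (F0 0))) *\<^sub>C 1"
        by (simp add: f_def F_def[abs_def] one_L0.abs_eq cscale.abs_eq minus_L0.abs_eq)
      ultimately show ?thesis by simp
    qed
    have fneg: "fourier_coeff f n = 0" if "n < 0" for n
      unfolding feq using that
      by (subst fourier_coeff_diff) (auto simp: fourier_coeff_sum fourier_coeff_cscale fourier_coeff_tpow fourier_coeff_1 Lp_cscale L0.subspace_sum[OF subspace_Lp[of 1]] intro!: sum.neutral)
    have f0: "fourier_coeff f 0 = F 0"
      unfolding f_def using circle_mean_value[of F] hol cont by (simp add: fourier_coeff_abs_L0)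
    have rc: "fourier_coeff r n = (fourier_coeff f n + cnj (fourier_coeff f (- n))) / 2" for n
      unfolding r_conj using f1 Lp_conj[of 1 f] by (simp add: fourier_coeff_cscale fourier_coeff_add fourier_coeff_conj)
    \<comment> \<open>Since r = (f + conj f)/2 with f analytic, positive coefficients of f are twice
      those of r while the constant ones agree; adding the constant before halving corrects the
      latter.\<close>
    define h where "h = (1/2) *\<^sub>C (f + fourier_coeff r 0 *\<^sub>C 1)"
    have hp: "h \<in> Lp p" unfolding h_def using fp p by (intro Lp_cscale Lp_add) auto
    have hc: "fourier_coeff h n = (if n \<ge> 0 then fourier_coeff r n else 0)" for n
    proof -
      have 1: "fourier_coeff h n = (fourier_coeff f n + fourier_coeff r 0 * (if n = 0 then 1 else 0)) / 2"
        unfolding h_def using f1 by (simp add: fourier_coeff_cscale fourier_coeff_add fourier_coeff_1 Lp_cscale)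
      have 2: "fourier_coeff r 0 = F 0"
        using F00 unfolding rc by (simp add: f0 complex_eq_iff)
      have c3: "fourier_coeff r n = fourier_coeff f n / 2" if "n > 0"
        unfolding rc[of n] using fneg[of "- n"] that by simp
      consider "n < 0" | "n = 0" | "n > 0" by linarith
      then show ?thesis
      proof cases
        case 3
        then have "fourier_coeff h n = fourier_coeff f n / 2" unfolding 1 by simp
        also have "\<dots> = fourier_coeff r n" by (rule c3[OF 3, symmetric])
        finally show ?thesis using 3 by simp
      qed (use 1 2 f0 fneg in auto)
    qed
    have "Lp_norm p h = Lp_norm p (f + fourier_coeff r 0 *\<^sub>C 1) / 2"
      unfolding h_def using fp p by (subst Lp_cscale) (auto intro!: Lp_add Lp_cscale)
    also have "Lp_norm p (f + fourier_coeff r 0 *\<^sub>C 1) \<le> Lp_norm p f + norm (fourier_coeff r 0) * 1"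
      using Lp_add(2)[of p f "fourier_coeff r 0 *\<^sub>C 1"] Lp_cscale[of p 1 "fourier_coeff r 0"] fp p by simp
    also have "\<dots> \<le> (1 + A powr (1 / p)) * Lp_norm p r + Lp_norm p r"
      using fN fourier_coeff_le[of p r 0] rp p by simp
    finally have "Lp_norm p h \<le> C * Lp_norm p r" by (simp add: C_def algebra_simps add_divide_distrib)
    moreover have "riesz_pair r h" using hc hp p Lp_mono(1)[of 1 p h] by (simp add: riesz_pair_def)
    ultimately show ?thesis using hp unfolding r_def by blast
  qed
  then show ?thesis using C by blast
qed

lemma trig_poly_real_imag:
  assumes "r \<in> trig_poly"
  shows "\<exists>g1 g2. real_polynomial_function g1 \<and> real_polynomial_function g2 \<and>
    r = abs_L0 (\<lambda>t. of_real (g1 t)) + \<i> *\<^sub>C abs_L0 (\<lambda>t. of_real (g2 t))"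
  using assms
proof (induction r rule: trig_poly_induct)
  case subspace
  note [measurable] = real_polynomial_function_measurable
  show ?case
  proof (rule L0.subspaceI; unfold mem_Collect_eq)
    show "\<exists>g1 g2. real_polynomial_function g1 \<and> real_polynomial_function g2 \<and>
        0 = abs_L0 (\<lambda>t. of_real (g1 t)) + \<i> *\<^sub>C abs_L0 (\<lambda>t. of_real (g2 t))"
      by (intro exI[of _ "\<lambda>_. 0"]) (auto simp: zero_L0.abs_eq[symmetric])
  next
    fix r s
    assume "\<exists>g1 g2. real_polynomial_function g1 \<and> real_polynomial_function g2 \<and>
        r = abs_L0 (\<lambda>t. of_real (g1 t)) + \<i> *\<^sub>C abs_L0 (\<lambda>t. of_real (g2 t))"
      "\<exists>g1 g2. real_polynomial_function g1 \<and> real_polynomial_function g2 \<and>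
        s = abs_L0 (\<lambda>t. of_real (g1 t)) + \<i> *\<^sub>C abs_L0 (\<lambda>t. of_real (g2 t))"
    then obtain g1 g2 h1 h2 where *: "real_polynomial_function g1" "real_polynomial_function g2"
      "real_polynomial_function h1" "real_polynomial_function h2"
      "r = abs_L0 (\<lambda>t. of_real (g1 t)) + \<i> *\<^sub>C abs_L0 (\<lambda>t. of_real (g2 t))"
      "s = abs_L0 (\<lambda>t. of_real (h1 t)) + \<i> *\<^sub>C abs_L0 (\<lambda>t. of_real (h2 t))" by auto
    show "\<exists>g1 g2. real_polynomial_function g1 \<and> real_polynomial_function g2 \<and>
        r + s = abs_L0 (\<lambda>t. of_real (g1 t)) + \<i> *\<^sub>C abs_L0 (\<lambda>t. of_real (g2 t))"
      using * real_polynomial_function_measurable[OF *(1)] real_polynomial_function_measurable[OF *(2)]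
        real_polynomial_function_measurable[OF *(3)] real_polynomial_function_measurable[OF *(4)]
      by (intro exI[of _ "\<lambda>t. g1 t + h1 t"] exI[of _ "\<lambda>t. g2 t + h2 t"] conjI real_polynomial_function.intros(3))
         (simp_all add: plus_L0.abs_eq cscale.abs_eq algebra_simps)
  next
    fix c r
    assume "\<exists>g1 g2. real_polynomial_function g1 \<and> real_polynomial_function g2 \<and>
        r = abs_L0 (\<lambda>t. of_real (g1 t)) + \<i> *\<^sub>C abs_L0 (\<lambda>t. of_real (g2 t))"
    then obtain g1 g2 where *: "real_polynomial_function g1" "real_polynomial_function g2"
      "r = abs_L0 (\<lambda>t. of_real (g1 t)) + \<i> *\<^sub>C abs_L0 (\<lambda>t. of_real (g2 t))" by auto
    have [measurable]: "g1 \<in> borel_measurable borel" "g2 \<in> borel_measurable borel"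
      using *(1,2) by (auto intro: real_polynomial_function_measurable)
    have "real_polynomial_function (\<lambda>t. Re c * g1 t - Im c * g2 t)"
      by (rule real_polynomial_function_diff) (rule real_polynomial_function.intros(2,4) *(1,2))+
    moreover have "real_polynomial_function (\<lambda>t. Im c * g1 t + Re c * g2 t)"
      by (rule real_polynomial_function.intros(3)) (rule real_polynomial_function.intros(2,4) *(1,2))+
    moreover have "c *\<^sub>C r = abs_L0 (\<lambda>t. of_real (Re c * g1 t - Im c * g2 t)) + \<i> *\<^sub>C abs_L0 (\<lambda>t. of_real (Im c * g1 t + Re c * g2 t))"
      unfolding *(3) by (simp add: plus_L0.abs_eq cscale.abs_eq abs_L0_eq_iff complex_eq_iff)
    ultimately show "\<exists>g1 g2. real_polynomial_function g1 \<and> real_polynomial_function g2 \<and>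
        c *\<^sub>C r = abs_L0 (\<lambda>t. of_real (g1 t)) + \<i> *\<^sub>C abs_L0 (\<lambda>t. of_real (g2 t))" by blast
  qed
next
  case (tpow n)
  have pow: "real_polynomial_function (\<lambda>t. Re (t ^ k)) \<and> real_polynomial_function (\<lambda>t. Im (t ^ k))" for k :: nat
  proof (induction k)
    case 0
    show ?case by (simp add: real_polynomial_function.intros(2))
  next
    case (Suc k)
    have "real_polynomial_function (\<lambda>t. Re t * Re (t ^ k) - Im t * Im (t ^ k))"
      by (rule real_polynomial_function_diff; rule real_polynomial_function.intros(4))
         (use Suc in \<open>auto intro: real_polynomial_function.intros(1) bounded_linear_Re bounded_linear_Im\<close>)
    moreover have "real_polynomial_function (\<lambda>t. Re t * Im (t ^ k) + Im t * Re (t ^ k))"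
      by (rule real_polynomial_function.intros(3); rule real_polynomial_function.intros(4))
         (use Suc in \<open>auto intro: real_polynomial_function.intros(1) bounded_linear_Re bounded_linear_Im\<close>)
    ultimately show ?case by simp
  qed
  define k where "k = nat \<bar>n\<bar>"
  note [measurable] = real_polynomial_function_measurable[OF pow[of k, THEN conjunct1]] real_polynomial_function_measurable[OF pow[of k, THEN conjunct2]]
  define g2 where "g2 t = (if n \<ge> 0 then 1 else -1) * Im (t ^ k)" for t :: complex
  have rg2: "real_polynomial_function g2" unfolding g2_def
    by (rule real_polynomial_function.intros(4)[OF real_polynomial_function.intros(2) pow[THEN conjunct2]])
  note [measurable] = real_polynomial_function_measurable[OF rg2]
  have "t powi n = of_real (Re (t ^ k)) + \<i> * of_real (g2 t)" if t: "norm t = 1" for t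
  proof (cases "n \<ge> 0")
    case True
    then show ?thesis by (simp add: complex_eq_iff power_int_def g2_def k_def)
  next
    case False
    have "t powi n = cnj (t ^ k)" using False by (simp add: power_int_def inverse_norm_1[OF t] k_def)
    moreover have "cnj z = of_real (Re z) + \<i> * of_real (- Im z)" for z
      by (simp add: complex_eq_iff)
    ultimately have "t powi n = of_real (Re (t ^ k)) + \<i> * of_real (- Im (t ^ k))" by metis
    then show ?thesis using False by (simp add: g2_def)
  qed
  then have "tpow n = abs_L0 (\<lambda>t. of_real (Re (t ^ k))) + \<i> *\<^sub>C abs_L0 (\<lambda>t. of_real (g2 t))"
    by (simp add: tpow.abs_eq plus_L0.abs_eq cscale.abs_eq abs_L0_eq_iff eventually_mono[OF AE_circle_norm])
  then show ?case using pow[of k] rg2 by blast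
qed

text \<open>The positive case requires polynomials, but positive and negative parts of g are not
  polynomials. A polynomial close to max(g, 0), raised by e, gives g as a difference of two positive
  polynomials bounded by |g| + 2 e.\<close>

lemma riesz_pair_real:
  assumes p: "1 < p" "p \<le> 2"
  shows "\<exists>C\<ge>0. \<forall>g. real_polynomial_function g \<longrightarrow> 
    (\<exists>h\<in>Lp p. riesz_pair (abs_L0 (\<lambda>t. of_real (g t))) h \<and> Lp_norm p h \<le> C * Lp_norm p (abs_L0 (\<lambda>t. of_real (g t))))"
proof -
  obtain C where C: "C \<ge> 0" and pos: "\<And>g. real_polynomial_function g \<Longrightarrow> (\<And>t. norm t = 1 \<Longrightarrow> g t > 0) \<Longrightarrow>
    (\<exists>h\<in>Lp p. riesz_pair (abs_L0 (\<lambda>t. of_real (g t))) h \<and> Lp_norm p h \<le> C * Lp_norm p (abs_L0 (\<lambda>t. of_real (g t))))"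
    using riesz_pair_positive[OF p] by blast
  have "\<exists>h\<in>Lp p. riesz_pair (abs_L0 (\<lambda>t. of_real (g t))) h \<and> Lp_norm p h \<le> (2 * C) * Lp_norm p (abs_L0 (\<lambda>t. of_real (g t)))"
    if g: "real_polynomial_function g" for g
  proof -
    have [measurable]: "g \<in> borel_measurable borel" by (rule real_polynomial_function_measurable[OF g])
    define r where "r = abs_L0 (\<lambda>t. of_real (g t))"
    have r: "r \<in> trig_poly" unfolding r_def by (rule real_polynomial_function_trig_poly[OF g])
    then have rp: "r \<in> Lp p" "r \<in> Lp 1" using trig_poly_Lp[of p] trig_poly_Lp[of 1] p by auto
    have ex: "\<exists>h\<in>Lp p. riesz_pair r h \<and> Lp_norm p h \<le> 2 * C * Lp_norm p r + e * (4 * C)" if e: "e > 0" for e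
    proof -
      have "continuous_on (sphere 0 1) (\<lambda>t. max (g t) 0)"
        using g by (intro continuous_intros continuous_on_subset[OF continuous_on_polymonial_function])
          (auto simp: real_polynomial_function_eq)
      then obtain g1 where g1: "real_polynomial_function g1" "\<And>t. t \<in> sphere 0 1 \<Longrightarrow> \<bar>max (g t) 0 - g1 t\<bar> < e"
        using Stone_Weierstrass_real_polynomial_function[of "sphere 0 1" "\<lambda>t. max (g t) 0" e] e compact_sphere by blast
      have [measurable]: "g1 \<in> borel_measurable borel" by (rule real_polynomial_function_measurable[OF g1(1)])
      \<comment> \<open>As g1 is within e of max(g, 0), raising it by e puts u above max(g, 0) and v
        above max(g, 0) - g; both exceed these functions by less than 2 e.\<close>
      define u v where "u t = g1 t + e" and "v t = g1 t + e - g t" for t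
      have uv: "real_polynomial_function u" "real_polynomial_function v"
        unfolding u_def v_def
        by (intro real_polynomial_function_diff real_polynomial_function.intros(2,3) g g1(1))+
      note [measurable] = real_polynomial_function_measurable[OF uv(1)] real_polynomial_function_measurable[OF uv(2)]
      have b: "u t > 0" "v t > 0" "u t \<le> \<bar>g t\<bar> + 2 * e" "v t \<le> \<bar>g t\<bar> + 2 * e" if "norm t = 1" for t
        using g1(2)[of t] that e unfolding u_def v_def by auto
      have N: "Lp_norm p (abs_L0 (\<lambda>t. of_real (w t))) \<le> Lp_norm p r + 2 * e"
        if w: "\<And>t. norm t = 1 \<Longrightarrow> w t > 0" "\<And>t. norm t = 1 \<Longrightarrow> w t \<le> \<bar>g t\<bar> + 2 * e"
          and [measurable]: "w \<in> borel_measurable borel" for w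
      proof -
        have "dominated 1 (abs_L0 (\<lambda>t. of_real (w t))) (abs_fun r + of_real (2 * e) *\<^sub>C 1)"
        proof -
          have *: "norm (complex_of_real (w t)) \<le> 1 * norm (complex_of_real (norm (complex_of_real (g t))) + of_real (2 * e) * 1)"
            if "norm t = 1" for t
          proof -
            have "norm (complex_of_real (norm (complex_of_real (g t))) + of_real (2 * e) * 1) = \<bar>\<bar>g t\<bar> + 2 * e\<bar>"
              by (metis norm_of_real of_real_add mult.right_neutral)
            then show ?thesis using w[OF that] e by simp
          qed
          show ?thesis unfolding r_def
            by (simp add: one_L0.abs_eq abs_fun.abs_eq cscale.abs_eq plus_L0.abs_eq dominated.abs_eq del: norm_of_real)
               (use * in \<open>auto intro!: eventually_mono[OF AE_circle_norm]\<close>)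
        qed
        then have "Lp_norm p (abs_L0 (\<lambda>t. of_real (w t))) \<le> 1 * Lp_norm p (abs_fun r + of_real (2 * e) *\<^sub>C 1)"
          using p rp(1) by (intro dominated_Lp(2)) (auto intro!: Lp_add Lp_cscale dominated_Lp(1)[OF dominated_abs(1)])
        also have "\<dots> \<le> Lp_norm p (abs_fun r) + Lp_norm p (of_real (2 * e) *\<^sub>C 1)"
          unfolding mult_1_left by (rule Lp_add(2)) (use p rp(1) in \<open>auto intro!: Lp_cscale dominated_Lp(1)[OF dominated_abs(1)]\<close>)
        also have "Lp_norm p (of_real (2 * e) *\<^sub>C 1) = 2 * e"
          using Lp_cscale(2)[of p 1 "of_real (2 * e)"] p e by simp
        also have "Lp_norm p (abs_fun r) \<le> 1 * Lp_norm p r"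
          using dominated_Lp(2)[OF dominated_abs(1)] p rp(1) by auto
        finally show ?thesis by simp
      qed
      obtain h where h: "h \<in> Lp p" "riesz_pair (abs_L0 (\<lambda>t. of_real (u t))) h" "Lp_norm p h \<le> C * Lp_norm p (abs_L0 (\<lambda>t. of_real (u t)))"
        using pos[OF uv(1)] b by blast
      obtain k where k: "k \<in> Lp p" "riesz_pair (abs_L0 (\<lambda>t. of_real (v t))) k" "Lp_norm p k \<le> C * Lp_norm p (abs_L0 (\<lambda>t. of_real (v t)))"
        using pos[OF uv(2)] b by blast
      have "r = abs_L0 (\<lambda>t. of_real (u t)) - abs_L0 (\<lambda>t. of_real (v t))"
        unfolding r_def by (simp add: minus_L0.abs_eq u_def v_def)
      moreover have "abs_L0 (\<lambda>t. of_real (u t)) \<in> Lp 1" "abs_L0 (\<lambda>t. of_real (v t)) \<in> Lp 1"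
        using real_polynomial_function_trig_poly[OF uv(1)] real_polynomial_function_trig_poly[OF uv(2)] trig_poly_Lp[of 1] by auto
      ultimately have "riesz_pair r (h - k)" using h k by (simp add: riesz_pair_diff)
      moreover have "Lp_norm p (h - k) \<le> C * (Lp_norm p r + 2 * e) + C * (Lp_norm p r + 2 * e)"
      proof -
        have "Lp_norm p (h - k) \<le> Lp_norm p h + Lp_norm p k" using h k p by (intro Lp_diff) auto
        also have "Lp_norm p h \<le> C * (Lp_norm p r + 2 * e)"
          using h(3) N[of u] b C by (meson order_trans mult_left_mono real_polynomial_function_measurable uv(1))
        also have "Lp_norm p k \<le> C * (Lp_norm p r + 2 * e)"
          using k(3) N[of v] b C by (meson order_trans mult_left_mono real_polynomial_function_measurable uv(2))
        finally show ?thesis by simp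
      qed
      moreover have "h - k \<in> Lp p" using h k p by (intro Lp_diff) auto
      ultimately show ?thesis by (intro bexI[of _ "h - k"]) (auto simp: algebra_simps)
    qed
    obtain h where h: "h \<in> Lp p" "riesz_pair r h" using ex[of 1] by auto
    \<comment> \<open>The projections built for different e coincide by uniqueness, so the bound for
      one fixed h may be improved by letting e tend to 0.\<close>
    have "Lp_norm p h - 2 * C * Lp_norm p r \<le> 0"
    proof (rule le_0_if_le_eps[where c = "4 * C"])
      fix e :: real assume "e > 0"
      then obtain h' where "riesz_pair r h'" "Lp_norm p h' \<le> 2 * C * Lp_norm p r + e * (4 * C)" using ex by blast
      then show "Lp_norm p h - 2 * C * Lp_norm p r \<le> e * (4 * C)" using riesz_pair_unique[OF h(2)] by auto
    qed (use C in simp)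
    then show ?thesis using h unfolding r_def by (intro bexI[of _ h]) auto
  qed
  then show ?thesis using C by (intro exI[of _ "2 * C"]) auto
qed

text \<open>Stated for polynomials only. There the projection is a finite sum, so the inequality can
  be dualized before P is known to exist on L^p.\<close>

definition riesz_bounded :: "real \<Rightarrow> bool" where
  "riesz_bounded p \<longleftrightarrow> (\<exists>C\<ge>0. \<forall>r\<in>trig_poly. \<exists>h\<in>Lp p. riesz_pair r h \<and> Lp_norm p h \<le> C * Lp_norm p r)"

lemma riesz_bounded_le_2:
  assumes p: "1 < p" "p \<le> 2"
  shows "riesz_bounded p"
proof -
  obtain C where C: "C \<ge> 0" and real: "\<And>g. real_polynomial_function g \<Longrightarrow>
    (\<exists>h\<in>Lp p. riesz_pair (abs_L0 (\<lambda>t. of_real (g t))) h \<and> Lp_norm p h \<le> C * Lp_norm p (abs_L0 (\<lambda>t. of_real (g t))))"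
    using riesz_pair_real[OF p] by blast
  have "\<exists>h\<in>Lp p. riesz_pair r h \<and> Lp_norm p h \<le> 2 * C * Lp_norm p r" if r: "r \<in> trig_poly" for r
  proof -
    obtain g1 g2 where g: "real_polynomial_function g1" "real_polynomial_function g2"
      and req: "r = abs_L0 (\<lambda>t. of_real (g1 t)) + \<i> *\<^sub>C abs_L0 (\<lambda>t. of_real (g2 t))"
      using trig_poly_real_imag[OF r] by blast
    have [measurable]: "g1 \<in> borel_measurable borel" "g2 \<in> borel_measurable borel"
      using g by (auto intro: real_polynomial_function_measurable)
    define u v where "u = abs_L0 (\<lambda>t. of_real (g1 t))" and "v = abs_L0 (\<lambda>t. of_real (g2 t))"
    have uv1: "u \<in> Lp 1" "v \<in> Lp 1"
      unfolding u_def v_def using g[THEN real_polynomial_function_trig_poly] trig_poly_Lp[of 1] by auto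
    have rp: "r \<in> Lp p" using r trig_poly_Lp[of p] p by auto
    have le: "\<bar>x\<bar> \<le> norm (of_real x + \<i> * of_real y)" "\<bar>y\<bar> \<le> norm (of_real x + \<i> * of_real y)" for x y :: real
      using abs_Re_le_cmod[of "of_real x + \<i> * of_real y"] abs_Im_le_cmod[of "of_real x + \<i> * of_real y"] by simp_all
    have "dominated 1 u r" "dominated 1 v r"
      unfolding u_def v_def req by (simp_all add: plus_L0.abs_eq cscale.abs_eq dominated.abs_eq le)
    then have uv: "Lp_norm p u \<le> Lp_norm p r" "Lp_norm p v \<le> Lp_norm p r"
      using dominated_Lp(2)[of 1 _ r p] p rp by force+
    obtain h where h: "h \<in> Lp p" "riesz_pair u h" "Lp_norm p h \<le> C * Lp_norm p u"
      using real[OF g(1)] unfolding u_def by blast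
    obtain k where k: "k \<in> Lp p" "riesz_pair v k" "Lp_norm p k \<le> C * Lp_norm p v"
      using real[OF g(2)] unfolding v_def by blast
    have "riesz_pair r (h + \<i> *\<^sub>C k)"
      unfolding req u_def[symmetric] v_def[symmetric]
      using h k uv1 by (intro riesz_pair_add riesz_pair_cscale) (auto simp: Lp_cscale)
    moreover have "h + \<i> *\<^sub>C k \<in> Lp p" using h k p by (intro Lp_add Lp_cscale) auto
    moreover have "Lp_norm p (h + \<i> *\<^sub>C k) \<le> 2 * C * Lp_norm p r"
    proof -
      have "Lp_norm p (h + \<i> *\<^sub>C k) \<le> Lp_norm p h + Lp_norm p (\<i> *\<^sub>C k)"
        using h k p by (intro Lp_add Lp_cscale) auto
      also have "Lp_norm p (\<i> *\<^sub>C k) = Lp_norm p k" using k p by (simp add: Lp_cscale)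
      also have "Lp_norm p h \<le> C * Lp_norm p r" using h(3) uv(1) C by (meson mult_left_mono order_trans)
      also have "Lp_norm p k \<le> C * Lp_norm p r" using k(3) uv(2) C by (meson mult_left_mono order_trans)
      finally show ?thesis by simp
    qed
    ultimately show ?thesis by blast
  qed
  then show ?thesis unfolding riesz_bounded_def using C by (intro exI[of _ "2 * C"]) auto
qed

section \<open>Extension of the Riesz inequality to L^p and its dualization\<close>

lemma Lp_diff_trans:
  assumes "1 \<le> p" "f \<in> Lp p" "g \<in> Lp p" "h \<in> Lp p"
  shows "Lp_norm p (f - h) \<le> Lp_norm p (f - g) + Lp_norm p (g - h)"
  using Lp_add(2)[OF assms(1) Lp_diff(1)[OF assms(1,2,3)] Lp_diff(1)[OF assms(1,3,4)]] by simp

lemma Lp_norm_triangle_sub: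
  assumes "1 \<le> p" "f \<in> Lp p" "g \<in> Lp p"
  shows "Lp_norm p f \<le> Lp_norm p g + Lp_norm p (f - g)"
  using Lp_add(2)[OF assms(1,3) Lp_diff(1)[OF assms]] by simp

lemma fourier_coeff_limit:
  assumes p: "1 \<le> p" and u: "\<And>n. u n \<in> Lp p" "f \<in> Lp p" and lim: "(\<lambda>n. Lp_norm p (u n - f)) \<longlonglongrightarrow> 0"
  shows "(\<lambda>n. fourier_coeff (u n) m) \<longlonglongrightarrow> fourier_coeff f m"
proof (rule LIM_zero_cancel, rule Lim_null_comparison[OF _ lim])
  have "norm (fourier_coeff (u n) m - fourier_coeff f m) \<le> Lp_norm p (u n - f)" for n
    using fourier_coeff_le[OF p Lp_diff(1)[OF p u(1) u(2)], of n m] u p Lp_mono(1)[of 1 p]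
    by (simp add: fourier_coeff_diff)
  then show "eventually (\<lambda>n. norm (fourier_coeff (u n) m - fourier_coeff f m) \<le> Lp_norm p (u n - f)) sequentially"
    by simp
qed

text \<open>Differences of projections are projections of differences, so polynomial approximants
  have Cauchy projections. Their limit has the right coefficients because each coefficient is
  continuous in the L^p norm.\<close>

lemma riesz_bounded_extend:
  assumes p: "1 \<le> p" and "riesz_bounded p"
  shows "\<exists>C\<ge>0. \<forall>f\<in>Lp p. \<exists>h\<in>Lp p. riesz_pair f h \<and> Lp_norm p h \<le> C * Lp_norm p f"
proof -
  obtain C where C: "C \<ge> 0" and trig: "\<And>r. r \<in> trig_poly \<Longrightarrow> \<exists>h\<in>Lp p. riesz_pair r h \<and> Lp_norm p h \<le> C * Lp_norm p r"
    using assms unfolding riesz_bounded_def by blast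
  have "\<exists>h\<in>Lp p. riesz_pair f h \<and> Lp_norm p h \<le> C * Lp_norm p f" if f: "f \<in> Lp p" for f
  proof -
    have "\<exists>r\<in>trig_poly. Lp_norm p (f - r) < 1 / (1 + real n)" for n
      using trig_poly_dense[OF p f, of "1 / (1 + real n)"] by (metis divide_pos_pos add_pos_nonneg of_nat_0_le_iff zero_less_one)
    then obtain r where r: "\<And>n. r n \<in> trig_poly" "\<And>n. Lp_norm p (f - r n) < 1 / (1 + real n)" by metis
    have rp: "r n \<in> Lp p" for n using r(1) trig_poly_Lp[OF p] by auto
    have lim0: "(\<lambda>n. 1 / (1 + real n)) \<longlonglongrightarrow> 0"
      using LIMSEQ_inverse_real_of_nat by (simp add: inverse_eq_divide)
    have rlim: "(\<lambda>n. Lp_norm p (r n - f)) \<longlonglongrightarrow> 0"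
    proof (rule tendsto_sandwich[OF _ _ tendsto_const lim0])
      show "eventually (\<lambda>n. Lp_norm p (r n - f) \<le> 1 / (1 + real n)) sequentially"
        using r(2) p Lp_norm_minus_commute[of p f] Lp_diff(1)[OF p f rp] by (auto intro!: always_eventually less_imp_le)
    qed simp
    obtain h where h: "\<And>n. h n \<in> Lp p" "\<And>n. riesz_pair (r n) (h n)" "\<And>n. Lp_norm p (h n) \<le> C * Lp_norm p (r n)"
      using trig[OF r(1)] by metis
    have hd: "Lp_norm p (h m - h n) \<le> C * Lp_norm p (r m - r n)" for m n
    proof -
      have "r m - r n \<in> trig_poly" using r(1) L0.subspace_diff[OF subspace_trig_poly] by blast
      then obtain k where "riesz_pair (r m - r n) k" "Lp_norm p k \<le> C * Lp_norm p (r m - r n)" using trig by blast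
      moreover have "riesz_pair (r m - r n) (h m - h n)"
        using h r(1) trig_poly_Lp[of 1] by (intro riesz_pair_diff) auto
      ultimately show ?thesis using riesz_pair_unique by blast
    qed
    obtain g where g: "g \<in> Lp p" "(\<lambda>n. Lp_norm p (h n - g)) \<longlonglongrightarrow> 0"
    proof (rule Lp_complete[OF p h(1)])
      fix e :: real assume e: "e > 0"
      have "e / (2 * (C + 1)) > 0" using e C by simp
      then obtain K where K: "\<And>n. n \<ge> K \<Longrightarrow> Lp_norm p (r n - f) < e / (2 * (C + 1))"
        using LIMSEQ_D[OF rlim] by fastforce
      have "Lp_norm p (h m - h n) < e" if "m \<ge> K" "n \<ge> K" for m n
      proof -
        have "Lp_norm p (r m - r n) \<le> Lp_norm p (r m - f) + Lp_norm p (f - r n)"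
          by (rule Lp_diff_trans[OF p rp f rp])
        also have "\<dots> < e / (2 * (C + 1)) + e / (2 * (C + 1))"
          using K[OF that(1)] K[OF that(2)] p Lp_norm_minus_commute[of p f "r n"] Lp_diff(1)[OF p f rp[of n]] by simp
        also have "\<dots> = e / (C + 1)"
          proof -
            have "C + 1 \<noteq> 0" using C by simp
            then show ?thesis by (simp add: divide_simps)
          qed
        finally have "C * Lp_norm p (r m - r n) \<le> C * (e / (C + 1))" using C by (intro mult_left_mono) auto
        also have "\<dots> < e" using C e by (simp add: field_simps)
        finally show ?thesis using hd[of m n] by linarith
      qed
      then show "\<exists>K. \<forall>m\<ge>K. \<forall>n\<ge>K. Lp_norm p (h m - h n) < e" by blast
    qed blast
    have "riesz_pair f g" unfolding riesz_pair_def
    proof (intro conjI allI)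
      show "g \<in> Lp 1" using g p Lp_mono(1)[of 1 p] by simp
      fix n
      have 1: "(\<lambda>k. fourier_coeff (h k) n) \<longlonglongrightarrow> fourier_coeff g n" by (rule fourier_coeff_limit[OF p h(1) g])
      have 2: "(\<lambda>k. fourier_coeff (r k) n) \<longlonglongrightarrow> fourier_coeff f n" by (rule fourier_coeff_limit[OF p rp f rlim])
      have eq: "fourier_coeff (h k) n = (if n \<ge> 0 then fourier_coeff (r k) n else 0)" for k using h(2) by (simp add: riesz_pair_def)
      show "fourier_coeff g n = (if n \<ge> 0 then fourier_coeff f n else 0)"
        using LIMSEQ_unique[OF 1] 2 unfolding eq by auto
    qed
    moreover have "Lp_norm p g \<le> C * Lp_norm p f"
    proof (rule LIMSEQ_le_const[where X = "\<lambda>n. C * (Lp_norm p f + Lp_norm p (r n - f)) + Lp_norm p (h n - g)"])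
      have "(\<lambda>n. C * (Lp_norm p f + Lp_norm p (r n - f)) + Lp_norm p (h n - g)) \<longlonglongrightarrow> C * (Lp_norm p f + 0) + 0"
        by (intro tendsto_intros rlim g(2))
      then show "(\<lambda>n. C * (Lp_norm p f + Lp_norm p (r n - f)) + Lp_norm p (h n - g)) \<longlonglongrightarrow> C * Lp_norm p f" by simp
      have "Lp_norm p g \<le> C * (Lp_norm p f + Lp_norm p (r n - f)) + Lp_norm p (h n - g)" for n
      proof -
        have "Lp_norm p g \<le> Lp_norm p (h n) + Lp_norm p (g - h n)" by (rule Lp_norm_triangle_sub[OF p g(1) h(1)])
        moreover have "Lp_norm p (g - h n) = Lp_norm p (h n - g)"
          using p Lp_norm_minus_commute[of p g "h n"] Lp_diff(1)[OF p g(1) h(1)] by simp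
        moreover have "Lp_norm p (h n) \<le> C * (Lp_norm p f + Lp_norm p (r n - f))"
          using h(3)[of n] Lp_norm_triangle_sub[OF p rp f, of n] C by (meson mult_left_mono order_trans)
        ultimately show ?thesis by linarith
      qed
      then show "\<exists>N. \<forall>n\<ge>N. Lp_norm p g \<le> C * (Lp_norm p f + Lp_norm p (r n - f)) + Lp_norm p (h n - g)" by blast
    qed
    ultimately show ?thesis using g(1) by blast
  qed
  then show ?thesis using C by blast
qed

text \<open>The function \<open>|f|\<^sup>p\<^sup>-\<^sup>2 cnj f\<close> attains equality in Hoelder's inequality.\<close>

lift_definition dual_elt :: "real \<Rightarrow> L0 \<Rightarrow> L0" is
  "\<lambda>p f t. cnj (f t) * of_real (norm (f t) powr (p - 2))"
  by (auto simp: circle_eq_def)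

lemma dual_elt_norm: "norm (cnj z * of_real (norm z powr (p - 2))) = norm z powr (p - 1)" for z :: complex
  by (cases "z = 0") (simp_all add: norm_mult powr_mult_base)

text \<open>All claims rest on (p - 1) q = p: the q-th power of the modulus is |f|^p, and the
  product with f is again |f|^p. The last claim is equality in Hoelder, with p/q = p - 1.\<close>

lemma dual_elt:
  assumes p: "1 < p" "1 / p + 1 / q = 1" and f: "f \<in> Lp p"
  shows "dual_elt p f \<in> Lp q" "absint q (dual_elt p f) = absint p f"
    "fourier_coeff (f * dual_elt p f) 0 = of_real (absint p f)"
    "Lp_norm p f \<noteq> 0 \<Longrightarrow> Lp_norm p f powr p = Lp_norm p f * Lp_norm q (dual_elt p f)"
proof -
  note q = conjugate_exponent[OF p]
  obtain u where [measurable]: "u \<in> borel_measurable borel" and fu: "f = abs_L0 u"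
    by (rule L0_exhaust)
  have i: "integrable circle_measure (\<lambda>t. norm (u t) powr p)" using f by (simp add: fu abs_L0_Lp)
  have n: "norm (cnj (u t) * of_real (norm (u t) powr (p - 2))) powr q = norm (u t) powr p" for t
    unfolding dual_elt_norm powr_powr q(3) ..
  have m [measurable]: "(\<lambda>t. cnj (u t) * of_real (norm (u t) powr (p - 2))) \<in> borel_measurable borel"
    by measurable
  have e: "dual_elt p f = abs_L0 (\<lambda>t. cnj (u t) * of_real (norm (u t) powr (p - 2)))"
    by (simp add: fu dual_elt.abs_eq)
  show 1: "dual_elt p f \<in> Lp q"
    unfolding e abs_L0_Lp(1)[OF m] n by (rule i)
  show 2: "absint q (dual_elt p f) = absint p f"
    unfolding e abs_L0_Lp(2)[OF m] n unfolding fu by (simp add: abs_L0_Lp)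
  have "u t * (cnj (u t) * of_real (norm (u t) powr (p - 2))) * t powi - 0 = of_real (norm (u t) powr p)" for t
  proof (cases "u t = 0")
    case False
    have r: "norm (u t) powr p = norm (u t) ^ 2 * norm (u t) powr (p - 2)"
      using False powr_add[of "norm (u t)" 2 "p - 2"] by simp
    have "complex_of_real (norm (u t) powr p) = of_real (norm (u t) ^ 2) * of_real (norm (u t) powr (p - 2))"
      unfolding r by (rule of_real_mult)
    also have "\<dots> = u t * (cnj (u t) * of_real (norm (u t) powr (p - 2)))"
      unfolding complex_norm_square by (simp only: mult.assoc)
    finally show ?thesis unfolding minus_zero power_int_0_right mult_1_right by (rule sym)
  qed simp
  then show "fourier_coeff (f * dual_elt p f) 0 = of_real (absint p f)"
    unfolding e unfolding fu by (simp add: times_L0.abs_eq fourier_coeff_abs_L0 abs_L0_Lp)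
  assume nz: "Lp_norm p f \<noteq> 0"
  have "Lp_norm q (dual_elt p f) = Lp_norm p f powr (p / q)"
    using p(1) by (simp add: Lp_norm_absint[of q] 2 absint_Lp_norm powr_powr)
  also have "p / q = p - 1"
  proof -
    have "p / q = ((p - 1) * q) / q" by (simp only: q(3))
    then show ?thesis using q(1) by simp
  qed
  finally show "Lp_norm p f powr p = Lp_norm p f * Lp_norm q (dual_elt p f)"
    by (simp add: powr_mult_base)
qed

text \<open>The projection h of r is tested against its own dual element g. Transposing P replaces
  the product h g by r k with k the truncation of g to nonpositive indices, and k is controlled by
  the inequality in L^q with the same constant.\<close>

lemma riesz_bounded_dual:
  assumes p: "1 < p" "1 / p + 1 / q = 1" and q: "riesz_bounded q"
  shows "riesz_bounded p"
proof -
  note q' = conjugate_exponent[OF p]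
  obtain C where C: "C \<ge> 0" and ext: "\<And>f. f \<in> Lp q \<Longrightarrow> \<exists>h\<in>Lp q. riesz_pair f h \<and> Lp_norm q h \<le> C * Lp_norm q f"
    using riesz_bounded_extend[OF _ q] q' by force
  have "\<exists>h\<in>Lp p. riesz_pair r h \<and> Lp_norm p h \<le> C * Lp_norm p r" if r: "r \<in> trig_poly" for r
  proof -
    obtain h where h: "h \<in> trig_poly" "riesz_pair r h"
      and dual: "\<And>g k. g \<in> Lp 1 \<Longrightarrow> k \<in> Lp 1 \<Longrightarrow>
        (\<And>n. fourier_coeff k n = (if n \<le> 0 then fourier_coeff g n else 0)) \<Longrightarrow>
        fourier_coeff (h * g) 0 = fourier_coeff (r * k) 0"
      using trig_poly_riesz_pair[OF r] by blast
    have hp: "h \<in> Lp p" and rp: "r \<in> Lp p" using h r trig_poly_Lp[of p] p by auto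
    have "Lp_norm p h \<le> C * Lp_norm p r"
    proof (cases "Lp_norm p h = 0")
      case False
      define g where "g = dual_elt p h"
      have g: "g \<in> Lp q" using dual_elt(1)[OF p hp] by (simp add: g_def)
      obtain k0 where k0: "k0 \<in> Lp q" "riesz_pair (reflect g) k0" "Lp_norm q k0 \<le> C * Lp_norm q (reflect g)"
        using ext[of "reflect g"] g Lp_reflect by blast
      \<comment> \<open>Reflection conjugates P into the truncation to indices n <= 0 and preserves
        all L^q norms.\<close>
      define k where "k = reflect k0"
      have kq: "k \<in> Lp q" using k0 by (simp add: k_def Lp_reflect)
      have kN: "Lp_norm q k \<le> C * Lp_norm q g" using k0 by (simp add: k_def Lp_reflect)
      have q1: "1 \<le> q" "0 < (1::real)" using q' by auto
      have "fourier_coeff (h * g) 0 = fourier_coeff (r * k) 0"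
      proof (rule dual)
        show "g \<in> Lp 1" "k \<in> Lp 1" using Lp_mono(1)[OF q1(2,1)] g kq by auto
        show "fourier_coeff k n = (if n \<le> 0 then fourier_coeff g n else 0)" for n
          using k0(2) by (simp add: k_def riesz_pair_def fourier_coeff_reflect)
      qed
      then have "of_real (absint p h) = fourier_coeff (r * k) 0" using dual_elt(3)[OF p hp] by (simp add: g_def)
      then have "absint p h = norm (fourier_coeff (r * k) 0)" by (metis absint_nonneg abs_of_nonneg norm_of_real)
      also have "\<dots> \<le> Lp_norm 1 (r * k)" by (rule fourier_coeff_le_1)
      also have "\<dots> \<le> Lp_norm p r * Lp_norm q k" by (rule Holder[OF p rp kq])
      also have "\<dots> \<le> Lp_norm p r * (C * Lp_norm q g)" using kN by (intro mult_left_mono) auto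
      finally have "Lp_norm p h * Lp_norm q g \<le> (C * Lp_norm p r) * Lp_norm q g"
        using dual_elt(4)[OF p hp False] p by (simp add: absint_Lp_norm g_def mult_ac)
      moreover have "Lp_norm q g > 0"
      proof -
        have "Lp_norm p h powr p > 0" using False by simp
        then show ?thesis using dual_elt(4)[OF p hp False] by (auto simp: g_def less_le)
      qed
      ultimately show ?thesis by simp
    qed (use C in simp)
    then show ?thesis using h hp by blast
  qed
  then show ?thesis using C unfolding riesz_bounded_def by blast
qed

theorem M_Riesz:
  assumes "1 < p"
  shows "\<exists>C\<ge>0. \<forall>f\<in>Lp p. \<exists>h\<in>Lp p. riesz_pair f h \<and> Lp_norm p h \<le> C * Lp_norm p f"
proof (rule riesz_bounded_extend)
  show "riesz_bounded p"
  proof (cases "p \<le> 2")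
    case True
    then show ?thesis using assms riesz_bounded_le_2 by blast
  next
    case False
    define q where "q = p / (p - 1)"
    have pq: "1 / p + 1 / q = 1" using assms by (simp add: q_def field_simps)
    have "1 < q" "q \<le> 2" using assms False by (simp_all add: q_def less_divide_eq divide_le_eq)
    then show ?thesis using riesz_bounded_dual[OF assms pq] riesz_bounded_le_2 by blast
  qed
qed (use assms in simp)

section \<open>Elementary properties of the Riesz projection on L^p\<close>

lemma riesz_proj_pair:
  assumes "1 < p" "f \<in> Lp p"
  shows "riesz_pair f (riesz_proj f)" "riesz_proj f \<in> Lp p"
proof -
  obtain h where "h \<in> Lp p" "riesz_pair f h" using M_Riesz[OF assms(1)] assms(2) by blast
  then show "riesz_pair f (riesz_proj f)" "riesz_proj f \<in> Lp p" by (simp_all add: riesz_proj_eqI)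
qed

lemma fourier_coeff_riesz_proj:
  assumes "1 < p" "f \<in> Lp p"
  shows "fourier_coeff (riesz_proj f) n = (if n \<ge> 0 then fourier_coeff f n else 0)"
  using riesz_proj_pair(1)[OF assms] by (simp add: riesz_pair_def)

lemma riesz_proj_bounded:
  assumes "1 < p"
  obtains C where "0 \<le> C" "\<And>f. f \<in> Lp p \<Longrightarrow> Lp_norm p (riesz_proj f) \<le> C * Lp_norm p f"
  using M_Riesz[OF assms] riesz_proj_eqI by metis

lemma Lp_subset_1: "1 < p \<Longrightarrow> f \<in> Lp p \<Longrightarrow> f \<in> Lp 1"
  using Lp_mono(1)[of 1 p f] by simp

lemma riesz_proj_add:
  assumes "1 < p" "f \<in> Lp p" "g \<in> Lp p"
  shows "riesz_proj (f + g) = riesz_proj f + riesz_proj g"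
  using assms by (intro riesz_proj_eqI riesz_pair_add riesz_proj_pair Lp_subset_1)

lemma riesz_proj_diff:
  assumes "1 < p" "f \<in> Lp p" "g \<in> Lp p"
  shows "riesz_proj (f - g) = riesz_proj f - riesz_proj g"
  using assms by (intro riesz_proj_eqI riesz_pair_diff riesz_proj_pair Lp_subset_1)

lemma riesz_proj_cscale:
  assumes "1 < p" "f \<in> Lp p"
  shows "riesz_proj (c *\<^sub>C f) = c *\<^sub>C riesz_proj f"
  using assms by (intro riesz_proj_eqI riesz_pair_cscale riesz_proj_pair)

subsection \<open>The dual space of \<open>L\<^sup>p\<close>\<close>

text \<open>With s = p/2 >= 1: x^s + y^s <= (x + y)^s, then the parallelogram identity for the
  squares, then convexity of x^s.\<close>

lemma clarkson_pointwise:
  fixes a b :: complex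
  assumes p: "2 \<le> p"
  shows "norm ((1/2) * (a - b)) powr p \<le> (norm a powr p + norm b powr p) / 2 - norm ((1/2) * (a + b)) powr p"
proof -
  define s where "s = p / 2"
  have s: "1 \<le> s" using p by (simp add: s_def)
  have sq: "x powr p = (x^2) powr s" if "x \<ge> 0" for x :: real
    using that by (cases "x = 0") (simp_all add: s_def powr_powr flip: powr_numeral)
  have super: "x powr s + y powr s \<le> (x + y) powr s" if "x \<ge> 0" "y \<ge> 0" for x y :: real
  proof (cases "x + y = 0")
    case False
    then have pos: "x + y > 0" using that by simp
    have "(x / (x + y)) powr s \<le> x / (x + y)" "(y / (x + y)) powr s \<le> y / (x + y)"
      using that pos s by (cases "x = 0"; cases "y = 0"; auto intro!: powr_le_one_le)+
    then have "(x / (x + y)) powr s + (y / (x + y)) powr s \<le> x / (x + y) + y / (x + y)" by (rule add_mono)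
    also have "\<dots> = 1" using pos by (simp add: add_divide_distrib[symmetric])
    finally have "(x powr s + y powr s) / (x + y) powr s \<le> 1" by (simp add: powr_divide add_divide_distrib)
    then show ?thesis using pos by simp
  qed (use that in \<open>auto simp: add_nonneg_eq_0_iff\<close>)
  have par: "norm ((1/2) * (a - b)) ^ 2 + norm ((1/2) * (a + b)) ^ 2 = (1/2) * norm a ^ 2 + (1/2) * norm b ^ 2"
    unfolding cmod_power2 by (simp add: power2_eq_square field_simps)
  have "norm ((1/2) * (a - b)) powr p + norm ((1/2) * (a + b)) powr p
      \<le> (norm ((1/2) * (a - b)) ^ 2 + norm ((1/2) * (a + b)) ^ 2) powr s"
    using super by (simp add: sq)
  also have "\<dots> \<le> (1/2) * (norm a ^ 2) powr s + (1/2) * (norm b ^ 2) powr s"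
    unfolding par by (rule powr_convex_nonneg[OF s]) auto
  also have "\<dots> = (norm a powr p + norm b powr p) / 2" by (simp add: sq)
  finally show ?thesis by linarith
qed

lemma clarkson:
  assumes p: "2 \<le> p" and f: "f \<in> Lp p" "g \<in> Lp p"
  shows "absint p ((1/2) *\<^sub>C (f - g)) \<le> (absint p f + absint p g) / 2 - absint p ((1/2) *\<^sub>C (f + g))"
proof -
  obtain u v where [measurable]: "u \<in> borel_measurable borel" "v \<in> borel_measurable borel"
    and fg: "f = abs_L0 u" "g = abs_L0 v" by (metis L0_exhaust)
  have e: "(1/2) *\<^sub>C (f - g) = abs_L0 (\<lambda>t. (1/2) * (u t - v t))" "(1/2) *\<^sub>C (f + g) = abs_L0 (\<lambda>t. (1/2) * (u t + v t))"
    by (simp_all add: fg cscale.abs_eq plus_L0.abs_eq minus_L0.abs_eq)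
  have m: "(\<lambda>t. (1/2) * (u t - v t)) \<in> borel_measurable borel" "(\<lambda>t. (1/2) * (u t + v t)) \<in> borel_measurable borel"
    "u \<in> borel_measurable borel" "v \<in> borel_measurable borel" by measurable
  have "(1/2) *\<^sub>C (f - g) \<in> Lp p" "(1/2) *\<^sub>C (f + g) \<in> Lp p"
    using f p by (auto intro!: Lp_cscale Lp_diff Lp_add)
  then have int: "integrable circle_measure (\<lambda>t. norm ((1/2) * (u t - v t)) powr p)"
    "integrable circle_measure (\<lambda>t. norm ((1/2) * (u t + v t)) powr p)"
    "integrable circle_measure (\<lambda>t. norm (u t) powr p)" "integrable circle_measure (\<lambda>t. norm (v t) powr p)"
    using f unfolding e unfolding fg m[THEN abs_L0_Lp(1)] by blast+
  have eq: "absint p ((1/2) *\<^sub>C (f - g)) = (LINT t|circle_measure. norm ((1/2) * (u t - v t)) powr p)"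
     "absint p ((1/2) *\<^sub>C (f + g)) = (LINT t|circle_measure. norm ((1/2) * (u t + v t)) powr p)"
     "absint p f = (LINT t|circle_measure. norm (u t) powr p)" "absint p g = (LINT t|circle_measure. norm (v t) powr p)"
    unfolding e unfolding fg m[THEN abs_L0_Lp(2)] by (rule refl)+
  have "(LINT t|circle_measure. norm ((1/2) * (u t - v t)) powr p) \<le>
    (LINT t|circle_measure. (norm (u t) powr p + norm (v t) powr p) / 2 - norm ((1/2) * (u t + v t)) powr p)"
    by (rule integral_mono[OF int(1)]) (use int(2-4) clarkson_pointwise[OF p] in auto)
  also have "\<dots> = ((LINT t|circle_measure. norm (u t) powr p) + (LINT t|circle_measure. norm (v t) powr p)) / 2
     - (LINT t|circle_measure. norm ((1/2) * (u t + v t)) powr p)"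
    by (subst Bochner_Integration.integral_diff) (use int(2-4) in auto)
  finally show ?thesis unfolding eq .
qed

text \<open>The convex function |a|^p lies above its tangent plane at c. The real part is bounded by
  |a| |c|^(p-1) - |c|^p, and Young's inequality for the pair |a|, |c|^(p-1) finishes it.\<close>

lemma powr_convex_tangent:
  fixes a c :: complex
  assumes p: "1 < p"
  shows "norm c powr p + p * Re ((a - c) * (cnj c * of_real (norm c powr (p - 2)))) \<le> norm a powr p"
proof (cases "c = 0")
  case False
  have "Re (a * cnj c) \<le> norm a * norm c" by (metis complex_Re_le_cmod complex_mod_cnj norm_mult)
  have r: "(a - c) * (cnj c * of_real (norm c powr (p - 2))) = of_real (norm c powr (p - 2)) * (a * cnj c - of_real (norm c ^ 2))"
    unfolding complex_norm_square by (simp add: algebra_simps)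
  have "Re ((a - c) * (cnj c * of_real (norm c powr (p - 2)))) = norm c powr (p - 2) * (Re (a * cnj c) - norm c ^ 2)"
    unfolding r by simp
  also have "\<dots> \<le> norm c powr (p - 2) * (norm a * norm c - norm c ^ 2)"
    using \<open>Re (a * cnj c) \<le> norm a * norm c\<close> by (intro mult_left_mono) auto
  also have "\<dots> = norm a * (norm c powr (p - 2) * norm c) - norm c powr (p - 2) * norm c ^ 2" by (simp add: algebra_simps)
  also have "norm c powr (p - 2) * norm c = norm c powr (p - 1)"
    using False powr_add[of "norm c" "p - 2" 1] by simp
  also have "norm c powr (p - 2) * norm c ^ 2 = norm c powr p"
    using False powr_add[of "norm c" "p - 2" 2] by simp
  finally have 1: "Re ((a - c) * (cnj c * of_real (norm c powr (p - 2)))) \<le> norm a * norm c powr (p - 1) - norm c powr p" .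
  define q where "q = p / (p - 1)"
  have pq: "1 / p + 1 / q = 1" using p by (simp add: q_def field_simps)
  note q = conjugate_exponent[OF p pq]
  have "norm a * norm c powr (p - 1) \<le> norm a powr p / p + (norm c powr (p - 1)) powr q / q"
    by (rule Youngs_inequality[OF p q(1) pq]) auto
  also have "(norm c powr (p - 1)) powr q = norm c powr p" unfolding powr_powr q(3) ..
  finally have "p * (norm a * norm c powr (p - 1)) \<le> p * (norm a powr p / p + norm c powr p / q)"
    using p by (intro mult_left_mono) auto
  also have "\<dots> = norm a powr p + (p / q) * norm c powr p" using p by (simp add: algebra_simps)
  also have "p / q = p - 1"
  proof -
    have "p / q = ((p - 1) * q) / q" by (simp only: q(3))
    then show ?thesis using q(1) by simp
  qed
  finally have 2: "p * (norm a * norm c powr (p - 1)) \<le> norm a powr p + (p - 1) * norm c powr p" .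
  have "p * Re ((a - c) * (cnj c * of_real (norm c powr (p - 2)))) \<le> p * (norm a * norm c powr (p - 1) - norm c powr p)"
    using 1 p by (intro mult_left_mono) auto
  then show ?thesis using 2 by (simp add: algebra_simps)
qed simp

text \<open>The integrated tangent inequality: p times the dual element of g is a subgradient of the
  p-th power of the norm at g.\<close>

lemma absint_tangent:
  assumes p: "1 < p" and f: "f \<in> Lp p" "g \<in> Lp p"
  shows "absint p g + p * Re (fourier_coeff ((f - g) * dual_elt p g) 0) \<le> absint p f"
proof -
  define q where "q = p / (p - 1)"
  have pq: "1 / p + 1 / q = 1" using p by (simp add: q_def field_simps)
  obtain u v where [measurable]: "u \<in> borel_measurable borel" "v \<in> borel_measurable borel"
    and fg: "f = abs_L0 u" "g = abs_L0 v" by (metis L0_exhaust)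
  define w where "w t = (u t - v t) * (cnj (v t) * of_real (norm (v t) powr (p - 2)))" for t
  have wm [measurable]: "w \<in> borel_measurable borel" unfolding w_def by measurable
  have tangent: "norm (v t) powr p + p * Re (w t) \<le> norm (u t) powr p" for t
    unfolding w_def by (rule powr_convex_tangent[OF p])
  have e: "(f - g) * dual_elt p g = abs_L0 w"
    by (simp add: fg dual_elt.abs_eq minus_L0.abs_eq times_L0.abs_eq w_def[abs_def])
  have "(f - g) * dual_elt p g \<in> Lp 1"
    using f p pq by (intro Holder[OF p pq] Lp_diff dual_elt[OF p pq]) auto
  then have wi: "integrable circle_measure w"
    unfolding e Lp_1_integrable[OF wm] .
  have i: "integrable circle_measure (\<lambda>t. norm (u t) powr p)" "integrable circle_measure (\<lambda>t. norm (v t) powr p)"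
    using f unfolding fg by (simp_all add: abs_L0_Lp)
  have w0: "fourier_coeff ((f - g) * dual_elt p g) 0 = (LINT t|circle_measure. w t)"
    unfolding e by (simp add: fourier_coeff_abs_L0)
  have "(LINT t|circle_measure. norm (v t) powr p + p * Re (w t)) \<le> (LINT t|circle_measure. norm (u t) powr p)"
    by (rule integral_mono) (use i wi tangent in \<open>auto intro!: Bochner_Integration.integrable_add integrable_mult_right integrable_Re\<close>)
  also have "(LINT t|circle_measure. norm (v t) powr p + p * Re (w t)) = absint p g + p * Re (LINT t|circle_measure. w t)"
    unfolding fg using i wi by (subst Bochner_Integration.integral_add) (auto simp: abs_L0_Lp)
  finally show ?thesis unfolding w0 by (simp add: fg abs_L0_Lp)
qed

text \<open>Continuity along the sequence g + f/(n+1) is all that the variational argument uses. The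
  integrands are dominated by (|f| + |g|)^p.\<close>

lemma dual_elt_continuous:
  assumes p: "1 < p" and f: "f \<in> Lp p" "g \<in> Lp p"
  shows "(\<lambda>n. fourier_coeff (f * dual_elt p (g + of_real (1 / real (Suc n)) *\<^sub>C f)) 0) \<longlonglongrightarrow> fourier_coeff (f * dual_elt p g) 0"
proof -
  obtain u v where [measurable]: "u \<in> borel_measurable borel" "v \<in> borel_measurable borel"
    and fg: "f = abs_L0 u" "g = abs_L0 v" by (metis L0_exhaust)
  define \<rho> where "\<rho> z = cnj z * of_real (norm z powr (p - 2))" for z :: complex
  have n\<rho>: "norm (\<rho> z) = norm z powr (p - 1)" for z unfolding \<rho>_def by (rule dual_elt_norm)
  have [measurable]: "\<rho> \<in> borel_measurable borel" unfolding \<rho>_def by measurable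
  \<comment> \<open>At z = 0 the factor |z|^(p-2) may be singular; there continuity follows from the
    modulus |z|^(p-1) tending to 0.\<close>
  have cont: "(\<lambda>n. \<rho> (a n)) \<longlonglongrightarrow> \<rho> z" if "a \<longlonglongrightarrow> z" for a z
  proof (cases "z = 0")
    case True
    have "(\<lambda>n. norm (a n) powr (p - 1)) \<longlonglongrightarrow> norm z powr (p - 1)"
      using p that by (intro tendsto_powr' tendsto_norm) auto
    then have "(\<lambda>n. norm (\<rho> (a n))) \<longlonglongrightarrow> 0" unfolding n\<rho> using True by simp
    then show ?thesis using True by (simp add: tendsto_norm_zero_iff \<rho>_def)
  next
    case False
    then show ?thesis unfolding \<rho>_def
      using that by (intro tendsto_intros) auto
  qed
  have e1: "f * dual_elt p (g + of_real (1 / real (Suc n)) *\<^sub>C f) = abs_L0 (\<lambda>t. u t * \<rho> (v t + of_real (1 / real (Suc n)) * u t))" for n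
    by (simp add: fg dual_elt.abs_eq plus_L0.abs_eq cscale.abs_eq times_L0.abs_eq \<rho>_def)
  have e2: "f * dual_elt p g = abs_L0 (\<lambda>t. u t * \<rho> (v t))"
    by (simp add: fg dual_elt.abs_eq times_L0.abs_eq \<rho>_def)
  have "(\<lambda>n. LINT t|circle_measure. u t * \<rho> (v t + of_real (1 / real (Suc n)) * u t)) \<longlonglongrightarrow> (LINT t|circle_measure. u t * \<rho> (v t))"
  proof (rule integral_dominated_convergence[where w = "\<lambda>t. (norm (u t) + norm (v t)) powr p"])
    have "abs_fun f + abs_fun g \<in> Lp p"
      using f p by (intro Lp_add dominated_Lp(1)[OF dominated_abs(1)]) auto
    then have "abs_L0 (\<lambda>t. of_real (norm (u t) + norm (v t))) \<in> Lp p"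
      by (simp add: fg abs_fun.abs_eq plus_L0.abs_eq)
    then show "integrable circle_measure (\<lambda>t. (norm (u t) + norm (v t)) powr p)"
      by (subst (asm) abs_L0_Lp) (simp_all del: of_real_add)
    have "(\<lambda>n. v t + of_real (1 / real (Suc n)) * u t) \<longlonglongrightarrow> v t + of_real 0 * u t" for t
      using LIMSEQ_inverse_real_of_nat by (intro tendsto_intros) (simp add: inverse_eq_divide)
    then show "AE t in circle_measure. (\<lambda>n. u t * \<rho> (v t + of_real (1 / real (Suc n)) * u t)) \<longlonglongrightarrow> u t * \<rho> (v t)"
      by (intro AE_I2 tendsto_mult tendsto_const cont) simp
    show "AE t in circle_measure. norm (u t * \<rho> (v t + of_real (1 / real (Suc n)) * u t)) \<le> (norm (u t) + norm (v t)) powr p" for n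
    proof (rule AE_I2)
      fix t
      have "norm (complex_of_real (1 / real (Suc n))) \<le> 1"
        by (simp only: norm_of_real) simp
      then have "norm (of_real (1 / real (Suc n)) * u t) \<le> 1 * norm (u t)"
        unfolding norm_mult by (intro mult_right_mono) auto
      then have "norm (v t + of_real (1 / real (Suc n)) * u t) \<le> norm (u t) + norm (v t)"
        using norm_triangle_ineq[of "v t" "of_real (1 / real (Suc n)) * u t"] by linarith
      then have "norm (v t + of_real (1 / real (Suc n)) * u t) powr (p - 1) \<le> (norm (u t) + norm (v t)) powr (p - 1)"
        using p by (intro powr_mono2) auto
      then have "norm (u t * \<rho> (v t + of_real (1 / real (Suc n)) * u t)) \<le> (norm (u t) + norm (v t)) * (norm (u t) + norm (v t)) powr (p - 1)"
        unfolding norm_mult n\<rho> by (intro mult_mono) auto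
      also have "\<dots> = (norm (u t) + norm (v t)) powr p"
        by (subst powr_mult_base) auto
      finally show "norm (u t * \<rho> (v t + of_real (1 / real (Suc n)) * u t)) \<le> (norm (u t) + norm (v t)) powr p" .
    qed
  qed simp_all
  then show ?thesis unfolding e1 e2 by (simp add: fourier_coeff_abs_L0 del: of_nat_Suc)
qed

lemma absint_cscale: "absint p (c *\<^sub>C f) = norm c powr p * absint p f"
  by transfer (simp add: norm_mult powr_mult)

text \<open>In contrast to \<open>dual_space\<close>, values outside V are left free. One and the
  same function can thus be a functional on L^p and, restricted, on L^2.\<close>

definition bounded_functional :: "L0 set \<Rightarrow> (L0 \<Rightarrow> real) \<Rightarrow> (L0 \<Rightarrow> complex) \<Rightarrow> bool" where
  "bounded_functional V N l \<longleftrightarrow> linear_on_space (*) V l \<and> (\<exists>C. \<forall>f\<in>V. norm (l f) \<le> C * N f)"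

lemma linear_on_space_0:
  assumes "linear_on_space (*) V l" "0 \<in> V"
  shows "l 0 = 0"
proof -
  have "l (0 *\<^sub>C 0) = 0 * l 0" using assms unfolding linear_on_space_def by blast
  then show ?thesis by simp
qed

text \<open>Minimizing the p-th power of the norm minus p Re l is a strictly convex problem whose
  solution has p times l as its gradient. Clarkson's inequality makes a minimizing sequence Cauchy,
  and the functional is continuous along it.\<close>

lemma Lp_minimizer:
  assumes p: "2 \<le> p" and l: "bounded_functional (Lp p) (Lp_norm p) l"
  shows "\<exists>f0\<in>Lp p. \<forall>f\<in>Lp p. absint p f0 - p * Re (l f0) \<le> absint p f - p * Re (l f)"
proof -
  have p1: "1 < p" "1 \<le> p" "0 < p" using p by auto
  define \<Phi> where "\<Phi> f = absint p f - p * Re (l f)" for f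
  obtain C0 where C0: "\<And>f. f \<in> Lp p \<Longrightarrow> norm (l f) \<le> C0 * Lp_norm p f" using l unfolding bounded_functional_def by blast
  define C where "C = max C0 0"
  have C: "C \<ge> 0" "norm (l f) \<le> C * Lp_norm p f" if "f \<in> Lp p" for f
  proof -
    have "C0 * Lp_norm p f \<le> C * Lp_norm p f" by (rule mult_right_mono) (simp_all add: C_def)
    then show "norm (l f) \<le> C * Lp_norm p f" using C0[OF that] by linarith
  qed (simp add: C_def)
  have C': "C \<ge> 0" by (simp add: C_def)
  have ladd: "l (f + g) = l f + l g" if "f \<in> Lp p" "g \<in> Lp p" for f g
    using l that by (simp add: bounded_functional_def linear_on_space_def)
  have lscale: "l (c *\<^sub>C f) = c * l f" if "f \<in> Lp p" for c f
    using l that by (simp add: bounded_functional_def linear_on_space_def)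
  define q where "q = p / (p - 1)"
  have pq: "1 / p + 1 / q = 1" using p by (simp add: q_def field_simps)
  note q = conjugate_exponent[OF p1(1) pq]
  \<comment> \<open>Young's inequality absorbs the linear term into the p-th power of the norm and
    leaves a constant.\<close>
  have lower: "- (p * (C powr q / q)) \<le> \<Phi> f" if f: "f \<in> Lp p" for f
  proof -
    have "Re (l f) \<le> Lp_norm p f * C" using C(2)[OF f] complex_Re_le_cmod[of "l f"] by (simp add: mult.commute)
    also have "\<dots> \<le> Lp_norm p f powr p / p + C powr q / q"
      by (rule Youngs_inequality[OF p1(1) q(1) pq]) (use C' in auto)
    finally have "p * Re (l f) \<le> p * (Lp_norm p f powr p / p + C powr q / q)" using p by (intro mult_left_mono) auto
    also have "\<dots> = absint p f + p * (C powr q / q)" using p by (simp add: absint_Lp_norm algebra_simps)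
    finally show ?thesis by (simp add: \<Phi>_def)
  qed
  define m where "m = Inf (\<Phi> ` Lp p)"
  have bdd: "bdd_below (\<Phi> ` Lp p)" using lower by (intro bdd_belowI2)
  have m: "m \<le> \<Phi> f" if "f \<in> Lp p" for f unfolding m_def using that bdd by (intro cInf_lower) auto
  have "\<exists>f\<in>Lp p. \<Phi> f < m + 1 / real (Suc n)" for n
  proof -
    have "Inf (\<Phi> ` Lp p) < m + 1 / real (Suc n)" by (simp add: m_def)
    moreover have "\<Phi> ` Lp p \<noteq> {}" using Lp_0(1)[of p] by blast
    ultimately show ?thesis by (subst (asm) cInf_less_iff[OF _ bdd]) auto
  qed
  then obtain u where u: "\<And>n. u n \<in> Lp p" "\<And>n. \<Phi> (u n) < m + 1 / real (Suc n)" by metis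
  \<comment> \<open>The linear terms cancel in the midpoint comparison, and the midpoint cannot lie
    below the infimum m; so Clarkson bounds the difference by the excess of the two values over
    m.\<close>
  have close: "absint p ((1/2) *\<^sub>C (u i - u j)) \<le> 1 / real (Suc K)" if ij: "i \<ge> K" "j \<ge> K" for i j K
  proof -
    have s: "(1/2) *\<^sub>C (u i + u j) \<in> Lp p" using u p by (intro Lp_cscale Lp_add) auto
    have "absint p ((1/2) *\<^sub>C (u i - u j)) \<le> (absint p (u i) + absint p (u j)) / 2 - absint p ((1/2) *\<^sub>C (u i + u j))"
      by (rule clarkson[OF p u(1) u(1)])
    also have "\<dots> = (\<Phi> (u i) + \<Phi> (u j)) / 2 - \<Phi> ((1/2) *\<^sub>C (u i + u j))"
    proof -
      have lsum: "l ((1/2) *\<^sub>C (u i + u j)) = (l (u i) + l (u j)) / 2"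
        using lscale[OF Lp_add(1)[OF p1(2) u(1) u(1)], of "1/2" i j] ladd[OF u(1) u(1), of i j] by simp
      show ?thesis unfolding \<Phi>_def lsum by (simp add: field_simps)
    qed
    also have "\<dots> \<le> (m + 1 / real (Suc i) + (m + 1 / real (Suc j))) / 2 - m"
      using less_imp_le[OF u(2)[of i]] less_imp_le[OF u(2)[of j]] m[OF s]
      by (intro diff_mono divide_right_mono add_mono) auto
    also have "\<dots> = (1 / real (Suc i) + 1 / real (Suc j)) / 2"
      by (simp only: add_divide_distrib diff_divide_distrib)
    also have "\<dots> \<le> (1 / real (Suc K) + 1 / real (Suc K)) / 2"
      using ij by (intro divide_right_mono add_mono divide_left_mono) auto
    also have "\<dots> = 1 / real (Suc K)" by (simp only: add_divide_distrib field_sum_of_halves)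
    finally show ?thesis .
  qed
  obtain f0 where f0: "f0 \<in> Lp p" "(\<lambda>n. Lp_norm p (u n - f0)) \<longlonglongrightarrow> 0"
  proof (rule Lp_complete[OF p1(2) u(1)])
    fix e :: real assume e: "e > 0"
    have "(e / 2) powr p > 0" using e by simp
    then obtain K where K: "1 / real (Suc K) < (e / 2) powr p"
      using reals_Archimedean[of "(e / 2) powr p"] by (auto simp: inverse_eq_divide)
    have "Lp_norm p (u i - u j) < e" if "i \<ge> K" "j \<ge> K" for i j
    proof (rule ccontr)
      assume "\<not> Lp_norm p (u i - u j) < e"
      then have "(e / 2) powr p \<le> (Lp_norm p (u i - u j) / 2) powr p" using e p by (intro powr_mono2) auto
      also have "\<dots> = absint p ((1/2) *\<^sub>C (u i - u j))"
        using p1 by (simp add: absint_cscale absint_Lp_norm powr_divide)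
      also have "\<dots> \<le> 1 / real (Suc K)" using close[OF that] .
      finally show False using K by simp
    qed
    then show "\<exists>K. \<forall>m\<ge>K. \<forall>n\<ge>K. Lp_norm p (u m - u n) < e" by blast
  qed blast
  have Nlim: "(\<lambda>n. Lp_norm p (u n)) \<longlonglongrightarrow> Lp_norm p f0"
  proof (rule LIM_zero_cancel, rule Lim_null_comparison[OF _ f0(2)], rule always_eventually, rule allI)
    fix n
    show "norm (Lp_norm p (u n) - Lp_norm p f0) \<le> Lp_norm p (u n - f0)"
      using Lp_norm_triangle_sub[OF p1(2) u(1) f0(1), of n] Lp_norm_triangle_sub[OF p1(2) f0(1) u(1), of n]
        Lp_norm_minus_commute[OF p1(3) Lp_diff(1)[OF p1(2) f0(1) u(1)], of n] by (auto simp: abs_le_iff)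
  qed
  have llim: "(\<lambda>n. l (u n)) \<longlonglongrightarrow> l f0"
  proof (rule LIM_zero_cancel, rule Lim_null_comparison, rule always_eventually, rule allI)
    fix n
    have d: "u n - f0 \<in> Lp p" using u f0 p1 by (intro Lp_diff) auto
    have "l (u n) = l (u n - f0) + l f0" using ladd[OF d f0(1)] by simp
    then show "norm (l (u n) - l f0) \<le> C * Lp_norm p (u n - f0)" using C(2)[OF d] by simp
    show "(\<lambda>n. C * Lp_norm p (u n - f0)) \<longlonglongrightarrow> 0" using tendsto_mult_right_zero[OF f0(2)] .
  qed
  have "(\<lambda>n. \<Phi> (u n)) \<longlonglongrightarrow> \<Phi> f0"
    unfolding \<Phi>_def absint_Lp_norm[OF p1(3)] by (intro tendsto_intros Nlim llim) (use p in auto)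
  moreover have "(\<lambda>n. m + 1 / real (Suc n)) \<longlonglongrightarrow> m + 0"
    using LIMSEQ_inverse_real_of_nat by (intro tendsto_intros) (simp add: inverse_eq_divide)
  ultimately have "\<Phi> f0 \<le> m + 0"
    by (rule LIMSEQ_le) (use u(2) in \<open>auto intro: less_imp_le\<close>)
  then have "\<Phi> f0 \<le> \<Phi> f" if "f \<in> Lp p" for f using m[OF that] by simp
  then show ?thesis using f0(1) unfolding \<Phi>_def by blast
qed

text \<open>The minimizer f0 is compared with f0 + s f. Using the tangent inequality at the
  perturbed point avoids differentiating the integral: it bounds Re l(f) by the pairing of f with
  the dual element there, and s -> 0 follows by continuity. Replacing f by -f and by i f gives
  equality of complex values.\<close>

lemma Lp_dual_ge_2:
  assumes p: "2 \<le> p" "1 / p + 1 / q = 1" and l: "bounded_functional (Lp p) (Lp_norm p) l"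
  shows "\<exists>g\<in>Lp q. \<forall>f\<in>Lp p. l f = fourier_coeff (f * g) 0"
proof -
  have p1: "1 < p" "1 \<le> p" "0 < p" using p by auto
  obtain f0 where f0: "f0 \<in> Lp p" and min: "\<And>f. f \<in> Lp p \<Longrightarrow> absint p f0 - p * Re (l f0) \<le> absint p f - p * Re (l f)"
    using Lp_minimizer[OF p(1) l] by blast
  have ladd: "l (f + g) = l f + l g" if "f \<in> Lp p" "g \<in> Lp p" for f g
    using l that by (simp add: bounded_functional_def linear_on_space_def)
  have lscale: "l (c *\<^sub>C f) = c * l f" if "f \<in> Lp p" for c f
    using l that by (simp add: bounded_functional_def linear_on_space_def)
  define g where "g = dual_elt p f0"
  have g: "g \<in> Lp q" unfolding g_def by (rule dual_elt[OF p1(1) p(2) f0])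
  have le: "Re (l f) \<le> Re (fourier_coeff (f * g) 0)" if f: "f \<in> Lp p" for f
  proof (rule LIMSEQ_le_const)
    show "(\<lambda>n. Re (fourier_coeff (f * dual_elt p (f0 + of_real (1 / real (Suc n)) *\<^sub>C f)) 0)) \<longlonglongrightarrow> Re (fourier_coeff (f * g) 0)"
      unfolding g_def by (intro tendsto_Re dual_elt_continuous p1 f f0)
    have "Re (l f) \<le> Re (fourier_coeff (f * dual_elt p (f0 + of_real (1 / real (Suc n)) *\<^sub>C f)) 0)" for n
    proof -
      define s where "s = 1 / real (Suc n)"
      have s: "s > 0" by (simp add: s_def)
      have sf: "of_real s *\<^sub>C f \<in> Lp p" using f p1 by (intro Lp_cscale)
      have h: "f0 + of_real s *\<^sub>C f \<in> Lp p" using sf f0 p1 by (intro Lp_add)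
      let ?I = "fourier_coeff (f * dual_elt p (f0 + of_real s *\<^sub>C f)) 0"
      have "f0 - (f0 + of_real s *\<^sub>C f) = (- of_real s) *\<^sub>C f" by simp
      then have "fourier_coeff ((f0 - (f0 + of_real s *\<^sub>C f)) * dual_elt p (f0 + of_real s *\<^sub>C f)) 0 = - of_real s * ?I"
        by (simp only: cscale_mult_left fourier_coeff_cscale)
      then have "absint p (f0 + of_real s *\<^sub>C f) - p * (s * Re ?I) \<le> absint p f0"
        using absint_tangent[OF p1(1) f0 h] by simp
      moreover have "absint p f0 - p * Re (l f0) \<le> absint p (f0 + of_real s *\<^sub>C f) - p * (Re (l f0) + s * Re (l f))"
        using min[OF h] ladd[OF f0 sf] lscale[OF f] by simp
      ultimately have "p * (s * Re (l f)) \<le> p * (s * Re ?I)" by (simp add: algebra_simps)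
      then show ?thesis using s p1 unfolding s_def[symmetric] by simp
    qed
    then show "\<exists>N. \<forall>n\<ge>N. Re (l f) \<le> Re (fourier_coeff (f * dual_elt p (f0 + of_real (1 / real (Suc n)) *\<^sub>C f)) 0)" by blast
  qed
  have Re: "Re (l f) = Re (fourier_coeff (f * g) 0)" if f: "f \<in> Lp p" for f
    using le[OF f] le[OF Lp_cscale(1)[OF p1(3) f], of "-1"] lscale[OF f, of "-1"]
    by (simp add: fourier_coeff_uminus)
  have "l f = fourier_coeff (f * g) 0" if f: "f \<in> Lp p" for f
    using Re[OF f] Re[OF Lp_cscale(1)[OF p1(3) f], of \<i>] lscale[OF f, of \<i>]
    by (simp add: complex_eq_iff cscale_mult_left fourier_coeff_cscale)
  then show ?thesis using g by blast
qed

text \<open>For p < 2 the functional is restricted to L^2, a subset of L^p, where it has a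
  representing function g. Testing with dual elements of truncations of g shows that g is in L^q;
  density of polynomials then extends the representation to L^p.\<close>

theorem Lp_dual:
  assumes p: "1 < p" "1 / p + 1 / q = 1" and l: "bounded_functional (Lp p) (Lp_norm p) l"
  shows "\<exists>g\<in>Lp q. \<forall>f\<in>Lp p. l f = fourier_coeff (f * g) 0"
proof (cases "p \<ge> 2")
  case False
  then have p2: "p \<le> 2" by simp
  have p1: "1 \<le> p" "0 < p" using p by auto
  note q = conjugate_exponent[OF p]
  have qp: "1 / q + 1 / p = 1" using p by simp
  obtain C where C: "\<And>f. f \<in> Lp p \<Longrightarrow> norm (l f) \<le> C * Lp_norm p f" using l unfolding bounded_functional_def by blast
  have ladd: "l (f + g) = l f + l g" if "f \<in> Lp p" "g \<in> Lp p" for f g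
    using l that by (simp add: bounded_functional_def linear_on_space_def)
  have lscale: "l (c *\<^sub>C f) = c * l f" if "f \<in> Lp p" for c f
    using l that by (simp add: bounded_functional_def linear_on_space_def)
  have L2: "f \<in> Lp p" "Lp_norm p f \<le> Lp_norm 2 f" if "f \<in> Lp 2" for f
    using Lp_mono[OF p1(2) p2 that] by auto
  have "bounded_functional (Lp 2) (Lp_norm 2) l"
    unfolding bounded_functional_def linear_on_space_def
  proof (intro conjI ballI allI exI)
    fix f assume f: "f \<in> Lp 2"
    have "norm (l f) \<le> \<bar>C\<bar> * Lp_norm p f" using C[OF L2(1)[OF f]] by (rule order_trans) (simp add: mult_right_mono)
    also have "\<dots> \<le> \<bar>C\<bar> * Lp_norm 2 f" using L2(2)[OF f] by (intro mult_left_mono) auto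
    finally show "norm (l f) \<le> \<bar>C\<bar> * Lp_norm 2 f" .
  qed (auto simp: ladd lscale L2)
  then obtain g where g: "g \<in> Lp 2" "\<And>f. f \<in> Lp 2 \<Longrightarrow> l f = fourier_coeff (f * g) 0"
    using Lp_dual_ge_2[of 2 2 l] by auto
  obtain u where [measurable]: "u \<in> borel_measurable borel" and gu: "g = abs_L0 u" by (rule L0_exhaust)
  \<comment> \<open>Truncations are bounded, so their dual elements lie in both L^p and L^2: the
    first gives the bound of l, the second the representation by g.\<close>
  define v where "v n t = (if norm (u t) \<le> real n then u t else 0)" for n t
  have [measurable]: "v n \<in> borel_measurable borel" for n unfolding v_def by measurable
  have bdd: "abs_L0 w \<in> Lp r" if [measurable]: "w \<in> borel_measurable borel" and "0 < r" "\<And>t. norm (w t) \<le> K" for w r K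
  proof -
    have "norm (w t) powr r \<le> K powr r" for t using that by (intro powr_mono2) auto
    then have "integrable circle_measure (\<lambda>t. norm (w t) powr r)"
      by (intro integrable_circle_bounded[of _ "K powr r"]) auto
    then show ?thesis by (simp add: abs_L0_Lp)
  qed
  have vq: "abs_L0 (v n) \<in> Lp q" for n
    by (rule bdd[where K = "real n"]) (use q in \<open>auto simp: v_def\<close>)
  have vN: "Lp_norm q (abs_L0 (v n)) \<le> max C 0" for n
  proof (cases "Lp_norm q (abs_L0 (v n)) = 0")
    case False
    define h where "h = dual_elt q (abs_L0 (v n))"
    have he: "h = abs_L0 (\<lambda>t. cnj (v n t) * of_real (norm (v n t) powr (q - 2)))"
      by (simp add: h_def dual_elt.abs_eq)
    have hp: "h \<in> Lp p" unfolding h_def by (rule dual_elt[OF q(1) qp vq])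
    have "h \<in> Lp 2" unfolding he
    proof (rule bdd[where K = "real n powr (q - 1)"])
      fix t
      have "norm (v n t) powr (q - 1) \<le> real n powr (q - 1)"
        using q by (intro powr_mono2) (auto simp: v_def)
      then show "norm (cnj (v n t) * complex_of_real (norm (v n t) powr (q - 2))) \<le> real n powr (q - 1)"
        unfolding dual_elt_norm .
    qed simp_all
    then have "l h = fourier_coeff (h * g) 0" by (rule g(2))
    \<comment> \<open>The dual element vanishes wherever the truncation was set to 0, so g may be
      replaced by its truncation in the product.\<close>
    also have "h * g = abs_L0 (v n) * h"
      unfolding he gu by (simp add: times_L0.abs_eq abs_L0_eq_iff v_def)
    also have "fourier_coeff \<dots> 0 = of_real (absint q (abs_L0 (v n)))"
      unfolding h_def by (rule dual_elt[OF q(1) qp vq])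
    finally have "absint q (abs_L0 (v n)) \<le> C * Lp_norm p h"
      using C[OF hp] by simp
    moreover have "absint q (abs_L0 (v n)) = Lp_norm q (abs_L0 (v n)) * Lp_norm p h"
      using dual_elt(4)[OF q(1) qp vq False] q(1) by (simp add: absint_Lp_norm h_def)
    moreover have "Lp_norm p h > 0"
    proof -
      have "Lp_norm q (abs_L0 (v n)) powr q > 0" using False by simp
      then show ?thesis using dual_elt(4)[OF q(1) qp vq False] by (auto simp: h_def less_le)
    qed
    ultimately have "Lp_norm q (abs_L0 (v n)) \<le> C" by simp
    then show ?thesis by simp
  qed simp
  have "abs_L0 u \<in> Lp q \<and> Lp_norm q (abs_L0 u) \<le> max C 0"
  proof (rule Lp_fatou[where v = v and K = 0])
    show "AE t in circle_measure. (\<lambda>n. v n t) \<longlonglongrightarrow> u t"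
    proof (rule AE_I2)
      fix t
      obtain K where K: "norm (u t) \<le> real K" using real_arch_simple by blast
      have "v n t = u t" if "n \<ge> K" for n using K that by (simp add: v_def)
      then have "eventually (\<lambda>n. v n t = u t) sequentially" by (auto simp: eventually_sequentially)
      then show "(\<lambda>n. v n t) \<longlonglongrightarrow> u t" by (rule tendsto_eventually)
    qed
  qed (use q vq vN in auto)
  then have gq: "g \<in> Lp q" by (simp add: gu)
  define D where "D = \<bar>C\<bar> + Lp_norm q g"
  have "l f = fourier_coeff (f * g) 0" if f: "f \<in> Lp p" for f
  proof -
    have "norm (l f - fourier_coeff (f * g) 0) \<le> e * D" if e: "e > 0" for e
    proof -
      obtain r where r: "r \<in> trig_poly" "Lp_norm p (f - r) < e" using trig_poly_dense[OF p1(1) f e] by blast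
      have rp: "r \<in> Lp p" "r \<in> Lp 2" using r trig_poly_Lp[of 2] trig_poly_Lp[OF p1(1)] by auto
      have d: "f - r \<in> Lp p" using f rp p1 by (intro Lp_diff)
      have "l f - fourier_coeff (f * g) 0 = l (f - r) - fourier_coeff ((f - r) * g) 0"
      proof -
        have "l f = l (f - r) + l r" using ladd[OF d rp(1)] by simp
        moreover have "fourier_coeff (f * g) 0 = fourier_coeff ((f - r) * g) 0 + fourier_coeff (r * g) 0"
          using fourier_coeff_add[OF Holder(1)[OF p d gq] Holder(1)[OF p rp(1) gq], of 0] by (simp add: algebra_simps)
        ultimately show ?thesis using g(2)[OF rp(2)] by simp
      qed
      also have "norm \<dots> \<le> norm (l (f - r)) + norm (fourier_coeff ((f - r) * g) 0)" by (rule norm_triangle_ineq4)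
      also have "norm (fourier_coeff ((f - r) * g) 0) \<le> Lp_norm p (f - r) * Lp_norm q g"
        using fourier_coeff_le_1 Holder(2)[OF p d gq] by (rule order_trans)
      also have "norm (l (f - r)) \<le> \<bar>C\<bar> * Lp_norm p (f - r)"
        using C[OF d] by (rule order_trans) (simp add: mult_right_mono)
      finally have "norm (l f - fourier_coeff (f * g) 0) \<le> Lp_norm p (f - r) * D" by (simp add: D_def algebra_simps)
      also have "\<dots> \<le> e * D" using r(2) by (intro mult_right_mono) (auto simp: D_def)
      finally show ?thesis .
    qed
    moreover have "0 \<le> D" unfolding D_def by (intro add_nonneg_nonneg) simp_all
    ultimately have "norm (l f - fourier_coeff (f * g) 0) \<le> 0" by (rule le_0_if_le_eps)
    then show ?thesis by simp
  qed
  then show ?thesis using gq by blast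
qed (use Lp_dual_ge_2[OF _ p(2) l] in auto)

subsection \<open>Banach spaces of classes of functions\<close>

text \<open>The spaces H^p depend on a parameter and are subsets of one type \<open>L0\<close>, on
  which no single norm lives. Hence the Banach space facts are developed relative to a carrier V
  with a norm N.\<close>

locale L0_banach =
  fixes V :: "L0 set" and N :: "L0 \<Rightarrow> real"
  assumes subspace: "L0.subspace V"
    and nonneg [simp]: "\<And>f. 0 \<le> N f"
    and eq_0: "\<And>f. f \<in> V \<Longrightarrow> N f = 0 \<Longrightarrow> f = 0"
    and triangle: "\<And>f g. f \<in> V \<Longrightarrow> g \<in> V \<Longrightarrow> N (f + g) \<le> N f + N g"
    and scale: "\<And>c f. f \<in> V \<Longrightarrow> N (c *\<^sub>C f) = norm c * N f"
    and complete: "\<And>u. (\<And>n::nat. u n \<in> V) \<Longrightarrow> (\<And>e. e > 0 \<Longrightarrow> \<exists>K. \<forall>m\<ge>K. \<forall>n\<ge>K. N (u m - u n) < e) \<Longrightarrow>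
        \<exists>f\<in>V. (\<lambda>n. N (u n - f)) \<longlonglongrightarrow> 0"
begin

lemma mem [simp, intro]: "0 \<in> V" "f \<in> V \<Longrightarrow> g \<in> V \<Longrightarrow> f + g \<in> V" "f \<in> V \<Longrightarrow> g \<in> V \<Longrightarrow> f - g \<in> V" "f \<in> V \<Longrightarrow> c *\<^sub>C f \<in> V"
  using subspace by (auto intro: L0.subspace_0 L0.subspace_add L0.subspace_diff L0.subspace_scale)

lemma N_0 [simp]: "N 0 = 0"
  using scale[of 0 0] by simp

lemma N_minus_commute: "f \<in> V \<Longrightarrow> g \<in> V \<Longrightarrow> N (f - g) = N (g - f)"
  using scale[of "f - g" "-1"] by simp

lemma N_diff: "f \<in> V \<Longrightarrow> g \<in> V \<Longrightarrow> N (f - g) \<le> N f + N g"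
  using triangle[of f "(-1) *\<^sub>C g"] scale[of g "-1"] mem(4)[of g "-1"] by simp

lemma N_trans: "f \<in> V \<Longrightarrow> g \<in> V \<Longrightarrow> h \<in> V \<Longrightarrow> N (f - h) \<le> N (f - g) + N (g - h)"
  using triangle[of "f - g" "g - h"] by simp

lemma N_sub: "f \<in> V \<Longrightarrow> g \<in> V \<Longrightarrow> N f \<le> N g + N (f - g)"
  using triangle[of g "f - g"] by simp

lemma limit_unique:
  assumes "f \<in> V" "g \<in> V" "\<And>n::nat. u n \<in> V" "(\<lambda>n. N (u n - f)) \<longlonglongrightarrow> 0" "(\<lambda>n. N (u n - g)) \<longlonglongrightarrow> 0"
  shows "f = g"
proof -
  have "N (f - g) \<le> 0"
  proof (rule LIMSEQ_le_const[where X = "\<lambda>n. N (u n - f) + N (u n - g)"])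
    show "(\<lambda>n. N (u n - f) + N (u n - g)) \<longlonglongrightarrow> 0" using tendsto_add[OF assms(4,5)] by simp
    have "N (f - g) \<le> N (u n - f) + N (u n - g)" for n
      using N_trans[of f "u n" g] N_minus_commute[of f "u n"] assms by simp
    then show "\<exists>K. \<forall>n\<ge>K. N (f - g) \<le> N (u n - f) + N (u n - g)" by blast
  qed
  then have "N (f - g) = 0" using nonneg[of "f - g"] by linarith
  then show ?thesis using eq_0[of "f - g"] assms by simp
qed

text \<open>A vector outside a closed subspace has positive distance to it. This distance controls
  the coefficient of v, so in a convergent sequence the coefficients converge and the components in
  U do too.\<close>

lemma span_insert_closed:
  assumes U: "L0.subspace U" "U \<subseteq> V" "norm_closed_in V N U" and v: "v \<in> V" "v \<notin> U"
  shows "norm_closed_in V N (L0.span (insert v U))"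
proof -
  have "\<exists>d>0. \<forall>u\<in>U. d \<le> N (v - u)"
  proof (rule ccontr)
    assume "\<not> ?thesis"
    then have "\<forall>d>0. \<exists>u\<in>U. N (v - u) < d" by (meson not_le)
    then have "\<exists>u\<in>U. N (v - u) < 1 / real (Suc n)" for n by (metis of_nat_0_less_iff zero_less_Suc zero_less_divide_1_iff)
    then obtain u where u: "\<And>n. u n \<in> U" "\<And>n. N (v - u n) < 1 / real (Suc n)" by metis
    have "(\<lambda>n. N (u n - v)) \<longlonglongrightarrow> 0"
    proof (rule tendsto_sandwich[OF _ _ tendsto_const])
      show "(\<lambda>n. 1 / real (Suc n)) \<longlonglongrightarrow> 0" using LIMSEQ_inverse_real_of_nat by (simp add: inverse_eq_divide)
      show "eventually (\<lambda>n. N (u n - v) \<le> 1 / real (Suc n)) sequentially"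
        using u U(2) v(1) N_minus_commute[of v] by (intro always_eventually allI) (metis less_imp_le subsetD)
    qed simp
    then have "v \<in> U" using U(3) v(1) u(1) unfolding norm_closed_in_def by blast
    then show False using v(2) by simp
  qed
  then obtain d where d: "d > 0" "\<And>u. u \<in> U \<Longrightarrow> d \<le> N (v - u)" by blast
  have spanU: "L0.span U = U" using U(1) by (simp add: L0.span_eq_iff)
  have mem_span: "x \<in> L0.span (insert v U) \<longleftrightarrow> (\<exists>c. x - c *\<^sub>C v \<in> U)" for x
    unfolding L0.span_breakdown_eq spanU ..
  \<comment> \<open>Dividing by c turns w + c v into v minus an element of U, whose norm is at least
    d.\<close>
  have coef: "norm c * d \<le> N (w + c *\<^sub>C v)" if "w \<in> U" for c w
  proof (cases "c = 0")
    case False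
    have "(- (1 / c)) *\<^sub>C w \<in> U" by (rule L0.subspace_scale[OF U(1) that])
    then have "d \<le> N (v - (- (1 / c)) *\<^sub>C w)" by (rule d(2))
    moreover have "c *\<^sub>C (v - (- (1 / c)) *\<^sub>C w) = w + c *\<^sub>C v" using False by (simp add: L0.scale_right_diff_distrib L0.scale_right_distrib)
    moreover have "v - (- (1 / c)) *\<^sub>C w \<in> V" using v(1) that U(2) by auto
    ultimately have "N (w + c *\<^sub>C v) = norm c * N (v - (- (1 / c)) *\<^sub>C w)" by (metis scale)
    then show ?thesis using \<open>d \<le> N (v - (- (1 / c)) *\<^sub>C w)\<close> by (simp add: mult_left_mono)
  qed simp
  show "norm_closed_in V N (L0.span (insert v U))"
    unfolding norm_closed_in_def
  proof (intro ballI allI impI, elim conjE)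
    fix g and x :: "nat \<Rightarrow> L0"
    assume g: "g \<in> V" and x: "range x \<subseteq> L0.span (insert v U)" and lim: "(\<lambda>n. N (x n - g)) \<longlonglongrightarrow> 0"
    have "\<exists>c. x n - c *\<^sub>C v \<in> U" for n using x mem_span by blast
    then obtain c where c: "\<And>n. x n - c n *\<^sub>C v \<in> U" by metis
    have xV: "x n \<in> V" for n
      using c[of n] U(2) v(1) mem(2)[of "x n - c n *\<^sub>C v" "c n *\<^sub>C v"] by auto
    have cb: "norm (c m - c n) * d \<le> N (x m - x n)" for m n
    proof -
      have "(x m - c m *\<^sub>C v) - (x n - c n *\<^sub>C v) \<in> U" using c U(1) by (simp add: L0.subspace_diff)
      from coef[OF this, of "c m - c n"] show ?thesis
        by (simp add: L0.scale_left_diff_distrib algebra_simps)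
    qed
    have "Cauchy c"
    proof (rule metric_CauchyI)
      fix e :: real assume "e > 0"
      then have "e * d / 2 > 0" using d by simp
      then obtain K where K: "\<And>n. n \<ge> K \<Longrightarrow> N (x n - g) < e * d / 2"
        using LIMSEQ_D[OF lim, of "e * d / 2"] by auto
      have "dist (c m) (c n) < e" if "m \<ge> K" "n \<ge> K" for m n
      proof -
        have "norm (c m - c n) * d \<le> N (x m - g) + N (g - x n)"
          using cb[of m n] N_trans[of "x m" g "x n"] xV g by (meson order_trans)
        also have "\<dots> < e * d" using K[OF that(1)] K[OF that(2)] N_minus_commute[of g "x n"] g xV by simp
        finally show ?thesis using d by (simp add: dist_norm)
      qed
      then show "\<exists>K. \<forall>m\<ge>K. \<forall>n\<ge>K. dist (c m) (c n) < e" by blast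
    qed
    then obtain c0 where c0: "c \<longlonglongrightarrow> c0" by (metis convergent_def Cauchy_convergent)
    have "g - c0 *\<^sub>C v \<in> U"
    proof -
      have "(\<lambda>n. N ((x n - c n *\<^sub>C v) - (g - c0 *\<^sub>C v))) \<longlonglongrightarrow> 0"
      proof (rule tendsto_sandwich[OF _ _ tendsto_const])
        have "(\<lambda>n. N (x n - g) + norm (c0 - c n) * N v) \<longlonglongrightarrow> 0 + norm (c0 - c0) * N v"
          by (intro tendsto_intros lim c0)
        then show "(\<lambda>n. N (x n - g) + norm (c0 - c n) * N v) \<longlonglongrightarrow> 0" by simp
        have "N ((x n - c n *\<^sub>C v) - (g - c0 *\<^sub>C v)) \<le> N (x n - g) + norm (c0 - c n) * N v" for n
        proof -
          have eq: "(x n - c n *\<^sub>C v) - (g - c0 *\<^sub>C v) = (x n - g) + (c0 - c n) *\<^sub>C v"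
            by (simp add: L0.scale_left_diff_distrib algebra_simps)
          show ?thesis unfolding eq using triangle[of "x n - g" "(c0 - c n) *\<^sub>C v"] xV g v(1) by (simp add: scale)
        qed
        then show "eventually (\<lambda>n. N ((x n - c n *\<^sub>C v) - (g - c0 *\<^sub>C v)) \<le> N (x n - g) + norm (c0 - c n) * N v) sequentially" by simp
      qed simp
      moreover have "g - c0 *\<^sub>C v \<in> V" using g v by auto
      moreover have "range (\<lambda>n. x n - c n *\<^sub>C v) \<subseteq> U" using c by auto
      ultimately show ?thesis using U(3) unfolding norm_closed_in_def by blast
    qed
    then show "g \<in> L0.span (insert v U)" using mem_span by blast
  qed
qed

text \<open>Steinitz exchange relative to W: a vector not already in the span of W can take the
  place of some member of F.\<close>

lemma span_exchange:
  assumes "finite F" "e \<in> L0.span (F \<union> W)" "e \<notin> L0.span W"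
  shows "\<exists>f\<in>F. f \<in> L0.span ((F - {f}) \<union> insert e W)"
  using assms
proof (induction F rule: finite_induct)
  case (insert x F)
  show ?case
  proof (cases "e \<in> L0.span (F \<union> W)")
    case True
    then obtain f where f: "f \<in> F" "f \<in> L0.span ((F - {f}) \<union> insert e W)" using insert by blast
    then have "f \<in> L0.span ((insert x F - {f}) \<union> insert e W)"
      using L0.span_mono[of "(F - {f}) \<union> insert e W" "(insert x F - {f}) \<union> insert e W"] by auto
    then show ?thesis using f by blast
  next
    case False
    have "e \<in> L0.span (insert x (F \<union> W))" using insert by simp
    then have "x \<in> L0.span (insert e (F \<union> W))" using False by (rule L0.in_span_insert)
    moreover have "insert e (F \<union> W) = (insert x F - {x}) \<union> insert e W" using insert by auto
    ultimately show ?thesis by auto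
  qed
qed simp

text \<open>A proper closed W cannot contain all of the e n, since they span a dense set. One of
  them outside W is exchanged for a member of F and added to W, which stays closed; F becomes
  smaller. It is applied to monomials, so that a complement of the range consists of
  polynomials.\<close>

lemma dense_complement:
  assumes "finite F" "L0.subspace W" "W \<subseteq> V" "norm_closed_in V N W" "V \<subseteq> L0.span (F \<union> W)"
    and e: "\<And>n::nat. e n \<in> V" and dense: "\<And>y \<epsilon>. y \<in> V \<Longrightarrow> \<epsilon> > 0 \<Longrightarrow> \<exists>s\<in>L0.span (range e). N (y - s) < \<epsilon>"
  shows "\<exists>n. V \<subseteq> L0.span (e ` {..<n} \<union> W)"
  using assms(1-5)
proof (induction "card F" arbitrary: F W rule: less_induct)
  case less
  show ?case
  proof (cases "V \<subseteq> W")
    case True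
    then have "V \<subseteq> L0.span (e ` {..<0} \<union> W)" using L0.span_superset[of W] by auto
    then show ?thesis by blast
  next
    case False
    have "\<exists>k. e k \<notin> W"
    proof (rule ccontr)
      assume "\<not> ?thesis"
      then have sp: "L0.span (range e) \<subseteq> W" using less.prems by (intro L0.span_minimal) auto
      have "y \<in> W" if y: "y \<in> V" for y
      proof -
        have "\<exists>s\<in>L0.span (range e). N (y - s) < 1 / real (Suc n)" for n by (rule dense[OF y]) simp
        then obtain s where s: "\<And>n. s n \<in> W" "\<And>n. N (y - s n) < 1 / real (Suc n)" using sp by (metis subsetD)
        have "(\<lambda>n. N (s n - y)) \<longlonglongrightarrow> 0"
        proof (rule tendsto_sandwich[OF _ _ tendsto_const])
          show "(\<lambda>n. 1 / real (Suc n)) \<longlonglongrightarrow> 0" using LIMSEQ_inverse_real_of_nat by (simp add: inverse_eq_divide)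
          show "eventually (\<lambda>n. N (s n - y) \<le> 1 / real (Suc n)) sequentially"
            using s less.prems(3) y N_minus_commute[of y] by (intro always_eventually allI) (metis less_imp_le subsetD)
        qed simp
        then show ?thesis using less.prems(4) y s(1) unfolding norm_closed_in_def by blast
      qed
      then show False using False by blast
    qed
    then obtain k where k: "e k \<notin> W" by blast
    have spW: "L0.span W = W" using less.prems(2) by (simp add: L0.span_eq_iff)
    obtain f where f: "f \<in> F" "f \<in> L0.span ((F - {f}) \<union> insert (e k) W)"
    proof -
      have "e k \<in> L0.span (F \<union> W)" using e less.prems(5) by blast
      moreover have "e k \<notin> L0.span W" unfolding spW by (rule k)
      ultimately show ?thesis using span_exchange[OF less.prems(1)] that by blast
    qed
    let ?W = "L0.span (insert (e k) W)"
    have WV: "?W \<subseteq> V" using less.prems e subspace by (intro L0.span_minimal) auto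
    have cl: "norm_closed_in V N ?W" using less.prems e k by (intro span_insert_closed) auto
    have sub: "F \<union> W \<subseteq> L0.span ((F - {f}) \<union> ?W)"
    proof -
      have "(F - {f}) \<union> insert (e k) W \<subseteq> (F - {f}) \<union> ?W" using L0.span_superset[of "insert (e k) W"] by auto
      then have "L0.span ((F - {f}) \<union> insert (e k) W) \<subseteq> L0.span ((F - {f}) \<union> ?W)" by (rule L0.span_mono)
      then show ?thesis using f(2) L0.span_superset[of "(F - {f}) \<union> ?W"] L0.span_superset[of "insert (e k) W"] by auto
    qed
    then have "V \<subseteq> L0.span ((F - {f}) \<union> ?W)"
      using less.prems(5) L0.span_minimal[OF sub L0.subspace_span] by blast
    moreover have "card (F - {f}) < card F" using f(1) less.prems(1) by (rule card_Diff1_less[rotated])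
    ultimately obtain n where n: "V \<subseteq> L0.span (e ` {..<n} \<union> ?W)"
      using less.hyps[of "F - {f}" ?W] less.prems WV cl by auto
    let ?m = "max n (Suc k)"
    have "e ` {..<n} \<union> ?W \<subseteq> L0.span (e ` {..<?m} \<union> W)"
    proof -
      have "insert (e k) W \<subseteq> e ` {..<?m} \<union> W" by auto
      then have "?W \<subseteq> L0.span (e ` {..<?m} \<union> W)" by (rule L0.span_mono)
      moreover have "e ` {..<n} \<subseteq> e ` {..<?m} \<union> W" by auto
      ultimately show ?thesis using L0.span_superset[of "e ` {..<?m} \<union> W"] by blast
    qed
    then have "V \<subseteq> L0.span (e ` {..<?m} \<union> W)" using n L0.span_minimal[OF _ L0.subspace_span] by blast
    then show ?thesis by blast
  qed
qed

text \<open>Baire's theorem gives a ball in the closure of the image of some ball. By scaling, every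
  y has an approximate preimage of controlled norm with error at most half the norm of y; iterating
  on the error gives an exact preimage as a geometric series.\<close>

theorem open_mapping:
  assumes A: "bounded_op V N V N A" and surj: "V \<subseteq> A ` V"
  shows "\<exists>C\<ge>0. \<forall>y\<in>V. \<exists>x\<in>V. A x = y \<and> N x \<le> C * N y"
proof -
  have Aadd: "A (f + g) = A f + A g" if "f \<in> V" "g \<in> V" for f g
    using A that by (simp add: bounded_op_def linear_on_space_def)
  have Ascale: "A (c *\<^sub>C f) = c *\<^sub>C A f" if "f \<in> V" for c f
    using A that by (simp add: bounded_op_def linear_on_space_def)
  have AV: "A f \<in> V" if "f \<in> V" for f using A that by (auto simp: bounded_op_def)
  have Adiff: "A (f - g) = A f - A g" if "f \<in> V" "g \<in> V" for f g
    using Aadd[of f "(-1) *\<^sub>C g"] Ascale[of g "-1"] that mem(4)[of g "-1"] by simp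
  obtain CA where CA: "\<And>f. f \<in> V \<Longrightarrow> N (A f) \<le> CA * N f" using A unfolding bounded_op_def by blast
  \<comment> \<open>The axioms of nonnegativity and symmetry are required on the whole type, hence
    the value 0 off V.\<close>
  define d where "d x y = (if x \<in> V \<and> y \<in> V then N (x - y) else 0)" for x y
  interpret M: Metric_space V d
  proof
    show "d x y = d y x" for x y using N_minus_commute by (simp add: d_def)
    show "d x y = 0 \<longleftrightarrow> x = y" if "x \<in> V" "y \<in> V" for x y
      using eq_0[of "x - y"] that by (auto simp: d_def)
  qed (auto simp: d_def intro: N_trans)
  have "M.mcomplete" unfolding M.mcomplete_def
  proof (intro allI impI)
    fix u assume "M.MCauchy u"
    then have u: "\<And>n. u n \<in> V" and c: "\<And>e. e > 0 \<Longrightarrow> \<exists>K. \<forall>m n. K \<le> m \<longrightarrow> K \<le> n \<longrightarrow> d (u m) (u n) < e"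
      unfolding M.MCauchy_def by auto
    have "\<exists>K. \<forall>m\<ge>K. \<forall>n\<ge>K. N (u m - u n) < e" if "e > 0" for e
      using c[OF that] u by (auto simp: d_def)
    then obtain f where f: "f \<in> V" "(\<lambda>n. N (u n - f)) \<longlonglongrightarrow> 0"
      using complete[of u, OF u] by blast
    have "limitin M.mtopology u f sequentially"
      unfolding M.limitin_metric
      using u f order_tendstoD(2)[OF f(2)] by (auto simp: d_def)
    then show "\<exists>x. limitin M.mtopology u x sequentially" by blast
  qed
  define S where "S n = M.mtopology closure_of {y \<in> V. \<exists>x\<in>V. A x = y \<and> N x \<le> real n}" for n
  have "(\<Union>n. S n) = V"
  proof
    show "(\<Union>n. S n) \<subseteq> V" unfolding S_def M.metric_closure_of by auto
    show "V \<subseteq> (\<Union>n. S n)"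
    proof
      fix y assume y: "y \<in> V"
      then obtain x where x: "x \<in> V" "A x = y" using surj by blast
      obtain n where "N x \<le> real n" using real_arch_simple by blast
      then have "y \<in> S n" unfolding S_def
        using closure_of_subset[of "{y \<in> V. \<exists>x\<in>V. A x = y \<and> N x \<le> real n}" M.mtopology] x y by auto
      then show "y \<in> (\<Union>n. S n)" by blast
    qed
  qed
  have "\<exists>n. M.mtopology interior_of S n \<noteq> {}"
  proof (rule ccontr)
    assume "\<not> ?thesis"
    then have "M.mtopology interior_of \<Union>(range S) = {}"
      by (intro M.metric_Baire_category_alt[OF \<open>M.mcomplete\<close>]) (auto simp: S_def)
    then have "M.mtopology interior_of V = {}" using \<open>(\<Union>n. S n) = V\<close> by simp
    then show False using interior_of_topspace[of M.mtopology] mem(1) by auto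
  qed
  then obtain n y0 r where y0: "y0 \<in> V" and r: "r > 0" and ball: "M.mball y0 r \<subseteq> S n"
    unfolding M.metric_interior_of by auto
  have approx0: "\<exists>x\<in>V. N x \<le> real n \<and> N (z - A x) < e" if "z \<in> V" "N (y0 - z) < r" "e > 0" for z e
  proof -
    have "z \<in> S n" using ball y0 that by (auto simp: d_def)
    then have "\<exists>y\<in>{y \<in> V. \<exists>x\<in>V. A x = y \<and> N x \<le> real n}. y \<in> M.mball z e"
      unfolding S_def M.metric_closure_of using \<open>e > 0\<close> by blast
    then obtain y where "y \<in> V" "\<exists>x\<in>V. A x = y \<and> N x \<le> real n" "d z y < e"
      by auto
    then show ?thesis using that(1) by (auto simp: d_def)
  qed
  \<comment> \<open>With s = r / (2 N y), both y0 and y0 + s y lie in the ball. The difference of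
    their approximate preimages has norm at most 2 n, and dividing by s gives 4 n N y / r.\<close>
  define K where "K = 4 * real n / r"
  have K: "K \<ge> 0" using r by (simp add: K_def)
  have approx: "\<exists>x\<in>V. N x \<le> K * N y \<and> N (y - A x) \<le> N y / 2" if y: "y \<in> V" for y
  proof (cases "N y = 0")
    case True
    then have "y = 0" using eq_0 y by blast
    moreover have "A 0 = 0" using Ascale[of 0 0] by simp
    ultimately show ?thesis by (intro bexI[of _ 0]) auto
  next
    case False
    then have Ny: "N y > 0" by (simp add: less_le)
    define s where "s = r / (2 * N y)"
    have s: "s > 0" using r Ny by (simp add: s_def)
    have sy: "of_real s *\<^sub>C y \<in> V" using y by simp
    have "N (y0 - (y0 + of_real s *\<^sub>C y)) = N ((- of_real s) *\<^sub>C y)" by simp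
    also have "\<dots> = s * N y" using scale[OF y, of "- of_real s"] s by simp
    also have "\<dots> < r" using r Ny by (simp add: s_def)
    finally have 1: "N (y0 - (y0 + of_real s *\<^sub>C y)) < r" .
    have e: "s * N y / 4 > 0" using s Ny by simp
    obtain x1 where x1: "x1 \<in> V" "N x1 \<le> real n" "N (y0 + of_real s *\<^sub>C y - A x1) < s * N y / 4"
      using approx0[OF _ 1 e] y0 sy by auto
    obtain x2 where x2: "x2 \<in> V" "N x2 \<le> real n" "N (y0 - A x2) < s * N y / 4"
      using approx0[OF y0 _ e] r by auto
    define x where "x = of_real (1 / s) *\<^sub>C (x1 - x2)"
    have xV: "x \<in> V" using x1 x2 by (simp add: x_def)
    have "N x = (1 / s) * N (x1 - x2)" using scale[of "x1 - x2" "of_real (1 / s)"] x1 x2 s by (simp add: x_def norm_divide)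
    also have "\<dots> \<le> (1 / s) * (real n + real n)"
      using N_diff[OF x1(1) x2(1)] x1(2) x2(2) s by (intro mult_left_mono) auto
    also have "\<dots> = K * N y" using r Ny by (simp add: s_def K_def field_simps)
    finally have 2: "N x \<le> K * N y" .
    have sA: "of_real s *\<^sub>C (y - A x) = (y0 + of_real s *\<^sub>C y - A x1) - (y0 - A x2)"
    proof -
      have "of_real s *\<^sub>C A x = A x1 - A x2"
        using x1 x2 s by (simp add: x_def Ascale Adiff flip: of_real_mult)
      then show ?thesis by (simp add: L0.scale_right_diff_distrib algebra_simps)
    qed
    have "s * N (y - A x) = N (of_real s *\<^sub>C (y - A x))"
      using scale[of "y - A x" "of_real s"] y AV[OF xV] s by simp
    also have "\<dots> \<le> N (y0 + of_real s *\<^sub>C y - A x1) + N (y0 - A x2)"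
      unfolding sA using y0 sy x1 x2 AV by (intro N_diff) auto
    also have "\<dots> \<le> s * (N y / 2)" using x1(3) x2(3) by simp
    finally have "N (y - A x) \<le> N y / 2" using s by simp
    with 2 xV show ?thesis by blast
  qed
  obtain X where X: "\<And>y. y \<in> V \<Longrightarrow> X y \<in> V" "\<And>y. y \<in> V \<Longrightarrow> N (X y) \<le> K * N y" "\<And>y. y \<in> V \<Longrightarrow> N (y - A (X y)) \<le> N y / 2"
    using approx by metis
  have "\<exists>x\<in>V. A x = y \<and> N x \<le> 2 * K * N y" if y: "y \<in> V" for y
  proof -
    \<comment> \<open>Y k is the error left after k corrections; it is halved each time, so the
      corrections sum to at most 2 K N y.\<close>
    define Y where "Y k = ((\<lambda>z. z - A (X z)) ^^ k) y" for k
    have YV: "Y k \<in> V" for k by (induction k) (auto simp: Y_def y X AV)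
    have YN: "N (Y k) \<le> N y * (1/2) ^ k" for k
    proof (induction k)
      case (Suc k)
      have "N (Y (Suc k)) \<le> N (Y k) / 2" using X(3)[OF YV[of k]] by (simp add: Y_def)
      then show ?case using Suc by simp
    qed (simp add: Y_def)
    define s where "s k = (\<Sum>i<k. X (Y i))" for k
    have sV: "s k \<in> V" for k unfolding s_def by (rule L0.subspace_sum[OF subspace]) (use X YV in auto)
    have As: "A (s k) = y - Y k" for k
    proof (induction k)
      case 0
      have "A 0 = 0" using Ascale[of 0 0] by simp
      then show ?case by (simp add: s_def Y_def)
    next
      case (Suc k)
      have "A (s (Suc k)) = A (s k) + A (X (Y k))" using Aadd[OF sV X(1)[OF YV]] by (simp add: s_def)
      then show ?case using Suc by (simp add: Y_def)
    qed
    have sd: "N (s (k + j) - s k) \<le> 2 * K * N y * (1/2) ^ k * (1 - (1/2) ^ j)" for k j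
    proof (induction j)
      case (Suc j)
      have eq: "s (k + Suc j) - s k = (s (k + j) - s k) + X (Y (k + j))" by (simp add: s_def)
      have "N (s (k + Suc j) - s k) \<le> N (s (k + j) - s k) + N (X (Y (k + j)))"
        unfolding eq using sV X(1)[OF YV] by (intro triangle) auto
      also have "N (X (Y (k + j))) \<le> K * (N y * (1/2) ^ (k + j))"
        using X(2)[OF YV, of "k + j"] mult_left_mono[OF YN K, of "k + j"] by linarith
      also have "N (s (k + j) - s k) \<le> 2 * K * N y * (1/2) ^ k * (1 - (1/2) ^ j)" by (rule Suc)
      finally show ?case by (simp add: power_add algebra_simps)
    qed simp
    have sd': "N (s m - s k) \<le> 2 * K * N y * (1/2) ^ k" if "k \<le> m" for m k
    proof -
      have "2 * K * N y * (1/2) ^ k * (1 - (1/2) ^ (m - k)) \<le> 2 * K * N y * (1/2) ^ k * 1"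
        using K by (intro mult_left_mono) auto
      then show ?thesis using sd[of k "m - k"] that by simp
    qed
    have small: "\<exists>k0. \<forall>k\<ge>k0. 2 * K * N y * (1/2) ^ k < e" if "e > 0" for e :: real
    proof -
      have "(\<lambda>k. 2 * K * N y * (1/2) ^ k) \<longlonglongrightarrow> 2 * K * N y * 0"
        by (intro tendsto_intros LIMSEQ_power_zero) simp
      then show ?thesis using that order_tendstoD(2)[of _ "2 * K * N y * 0" sequentially e] by (simp add: eventually_sequentially)
    qed
    obtain x where x: "x \<in> V" "(\<lambda>n. N (s n - x)) \<longlonglongrightarrow> 0"
    proof -
      have "\<exists>x\<in>V. (\<lambda>n. N (s n - x)) \<longlonglongrightarrow> 0"
      proof (rule complete[OF sV])
        fix e :: real assume "e > 0"
        then obtain k0 where k0: "\<And>k. k \<ge> k0 \<Longrightarrow> 2 * K * N y * (1/2) ^ k < e" using small by blast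
        have "N (s m - s n) < e" if "m \<ge> k0" "n \<ge> k0" for m n
        proof (cases "n \<le> m")
          case True
          then show ?thesis using sd'[OF True] k0[OF that(2)] by linarith
        next
          case False
          then show ?thesis using sd'[of m n] k0[OF that(1)] N_minus_commute[OF sV sV, of m n] by simp
        qed
        then show "\<exists>k. \<forall>m\<ge>k. \<forall>n\<ge>k. N (s m - s n) < e" by blast
      qed
      then show ?thesis using that by blast
    qed
    have "A x = y"
    proof (rule limit_unique[of _ _ "\<lambda>n. A (s n)"])
      have 1: "N (A (s n) - A x) \<le> CA * N (s n - x)" for n
        using CA[of "s n - x"] sV x Adiff by simp
      have "(\<lambda>n. CA * N (s n - x)) \<longlonglongrightarrow> 0" using tendsto_mult_right_zero[OF x(2)] .
      then show "(\<lambda>n. N (A (s n) - A x)) \<longlonglongrightarrow> 0"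
        by (rule tendsto_sandwich[OF _ _ tendsto_const, rotated 2]) (use 1 in auto)
      have 2: "N (A (s n) - y) \<le> N y * (1/2) ^ n" for n
        using YN[of n] N_minus_commute[OF AV[OF sV] y, of n] unfolding As by simp
      have "(\<lambda>n. N y * (1/2) ^ n) \<longlonglongrightarrow> N y * 0"
        by (intro tendsto_intros LIMSEQ_power_zero) simp
      then have "(\<lambda>n. N y * (1/2) ^ n) \<longlonglongrightarrow> 0" by simp
      then show "(\<lambda>n. N (A (s n) - y)) \<longlonglongrightarrow> 0"
        by (rule tendsto_sandwich[OF _ _ tendsto_const, rotated 2]) (use 2 in auto)
    qed (use AV sV x y in auto)
    moreover have "N x \<le> 2 * K * N y"
    proof (rule LIMSEQ_le_const)
      show "(\<lambda>n. 2 * K * N y + N (s n - x)) \<longlonglongrightarrow> 2 * K * N y"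
        using tendsto_add[OF tendsto_const x(2), of "2 * K * N y"] by simp
      have "N x \<le> 2 * K * N y + N (s n - x)" for n
      proof -
        have "N (s n) \<le> 2 * K * N y" using sd'[of 0 n] by (simp add: s_def)
        then show ?thesis using N_sub[OF x(1) sV, of n] N_minus_commute[OF x(1) sV, of n] by linarith
      qed
      then show "\<exists>M. \<forall>n\<ge>M. N x \<le> 2 * K * N y + N (s n - x)" by blast
    qed
    ultimately show ?thesis using x(1) by blast
  qed
  then show ?thesis using K by (intro exI[of _ "2 * K"]) auto
qed

end

subsection \<open>Hardy spaces\<close>

lemma Lp_1_of_Lp: "1 \<le> p \<Longrightarrow> f \<in> Lp p \<Longrightarrow> f \<in> Lp 1"
  using Lp_mono(1)[of 1 p f] by simp

lemma Hp_iff: "f \<in> Hp p \<longleftrightarrow> f \<in> Lp p \<and> (\<forall>n<0. fourier_coeff f n = 0)"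
  by (simp add: Hp_def)

lemma conj_Hp_iff:
  assumes "0 < p"
  shows "f \<in> conj_Hp p \<longleftrightarrow> f \<in> Lp p \<and> (\<forall>n>0. fourier_coeff f n = 0)"
proof -
  have "conj_fun f \<in> Lp p \<longleftrightarrow> f \<in> Lp p"
    using Lp_conj(1)[OF assms, of f] Lp_conj(1)[OF assms, of "conj_fun f"] by auto
  moreover have "(\<forall>n<0. fourier_coeff (conj_fun f) n = 0) \<longleftrightarrow> (\<forall>n>0. fourier_coeff f n = 0)"
    unfolding fourier_coeff_conj complex_cnj_zero_iff
    by (metis minus_minus neg_0_less_iff_less neg_less_0_iff_less)
  ultimately show ?thesis by (simp add: conj_Hp_def Hp_iff)
qed

lemma Hp_tpow [simp]: "tpow n \<in> Hp p" if "n \<ge> 0"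
  using that by (auto simp: Hp_iff fourier_coeff_tpow)

lemma Hp_1 [simp]: "1 \<in> Hp p"
  using Hp_tpow[of 0 p] by simp

lemma L0_banach_Hp:
  assumes p: "1 < p"
  shows "L0_banach (Hp p) (Lp_norm p)"
proof
  have p1: "1 \<le> p" "0 < p" using p by auto
  show "L0.subspace (Hp p)"
    using p1 by (auto simp: L0.subspace_def Hp_iff Lp_add Lp_cscale fourier_coeff_add fourier_coeff_cscale Lp_1_of_Lp)
  show "f = 0" if "f \<in> Hp p" "Lp_norm p f = 0" for f using that p1 Lp_norm_eq_0[of p f] by (simp add: Hp_iff)
  show "Lp_norm p (f + g) \<le> Lp_norm p f + Lp_norm p g" if "f \<in> Hp p" "g \<in> Hp p" for f g
    using that p1 by (simp add: Hp_iff Lp_add)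
  show "Lp_norm p (c *\<^sub>C f) = norm c * Lp_norm p f" if "f \<in> Hp p" for c f
    using that p1 by (simp add: Hp_iff Lp_cscale)
  fix u :: "nat \<Rightarrow> L0"
  assume u: "\<And>n. u n \<in> Hp p" and c: "\<And>e. e > 0 \<Longrightarrow> \<exists>K. \<forall>m\<ge>K. \<forall>n\<ge>K. Lp_norm p (u m - u n) < e"
  have uL: "u n \<in> Lp p" for n using u by (simp add: Hp_iff)
  obtain f where f: "f \<in> Lp p" "(\<lambda>n. Lp_norm p (u n - f)) \<longlonglongrightarrow> 0"
    using Lp_complete[OF p1(1) uL c] by blast
  have "fourier_coeff f m = 0" if "m < 0" for m
    using fourier_coeff_limit[OF p1(1) uL f, of m] u that by (simp add: Hp_iff LIMSEQ_const_iff)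
  then show "\<exists>f\<in>Hp p. (\<lambda>n. Lp_norm p (u n - f)) \<longlonglongrightarrow> 0" using f by (auto simp: Hp_iff)
qed simp

lemma riesz_proj_Hp: "1 < p \<Longrightarrow> f \<in> Lp p \<Longrightarrow> riesz_proj f \<in> Hp p"
  by (simp add: Hp_iff riesz_proj_pair fourier_coeff_riesz_proj)

lemma riesz_proj_eq_iff:
  assumes "1 < p" "f \<in> Lp p" "g \<in> Hp p"
  shows "riesz_proj f = g \<longleftrightarrow> (\<forall>n\<ge>0. fourier_coeff f n = fourier_coeff g n)"
proof
  assume "riesz_proj f = g"
  then show "\<forall>n\<ge>0. fourier_coeff f n = fourier_coeff g n"
    using fourier_coeff_riesz_proj[OF assms(1,2)] by auto
next
  assume "\<forall>n\<ge>0. fourier_coeff f n = fourier_coeff g n"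
  then have "riesz_pair f g" using assms Lp_1_of_Lp[of p g] by (auto simp: riesz_pair_def Hp_iff)
  then show "riesz_proj f = g" by (rule riesz_proj_eqI)
qed

lemma riesz_proj_id: "1 < p \<Longrightarrow> f \<in> Hp p \<Longrightarrow> riesz_proj f = f"
  by (subst riesz_proj_eq_iff[of p]) (auto simp: Hp_iff)

lemma riesz_proj_eq_0_iff:
  assumes "1 < p" "f \<in> Lp p"
  shows "riesz_proj f = 0 \<longleftrightarrow> (\<forall>n\<ge>0. fourier_coeff f n = 0)"
  using riesz_proj_eq_iff[OF assms, of 0] by (simp add: Hp_iff)

text \<open>For polynomials this is disjointness of the spectra. A general f in H^p is the limit of
  projected polynomials P r, since f = P f and P is bounded, and Hoelder's inequality passes to the
  limit.\<close>

lemma Hp_annihilate: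
  assumes p: "1 < p" "1 / p + 1 / q = 1" and f: "f \<in> Hp p" and g: "g \<in> Lp q" and g0: "\<And>n. n \<le> 0 \<Longrightarrow> fourier_coeff g n = 0"
  shows "fourier_coeff (f * g) 0 = 0"
proof -
  have p1: "1 \<le> p" using p by simp
  note q = conjugate_exponent(1)[OF p]
  have fp: "f \<in> Lp p" using f by (simp add: Hp_iff)
  have g1: "g \<in> Lp 1" by (rule Lp_subset_1[OF q(1) g])
  obtain C where C: "0 \<le> C" "\<And>f. f \<in> Lp p \<Longrightarrow> Lp_norm p (riesz_proj f) \<le> C * Lp_norm p f"
    using riesz_proj_bounded[OF p(1)] by blast
  have "norm (fourier_coeff (f * g) 0) \<le> e * (C * Lp_norm q g)" if e: "e > 0" for e
  proof -
    obtain r where r: "r \<in> trig_poly" "Lp_norm p (f - r) < e" using trig_poly_dense[OF p1 fp e] by blast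
    have rp: "r \<in> Lp p" using r trig_poly_Lp[OF p1] by auto
    obtain h where h: "riesz_pair r h" and dual: "\<forall>g k. g \<in> Lp 1 \<longrightarrow> k \<in> Lp 1 \<longrightarrow>
      (\<forall>n. fourier_coeff k n = (if n \<le> 0 then fourier_coeff g n else 0)) \<longrightarrow>
      fourier_coeff (h * g) 0 = fourier_coeff (r * k) 0" using trig_poly_riesz_pair[OF r(1)] by blast
    have hr: "h = riesz_proj r" using h by (simp add: riesz_proj_eqI)
    have hp: "h \<in> Lp p" unfolding hr by (rule riesz_proj_pair[OF p(1) rp])
    \<comment> \<open>The truncation of g to nonpositive indices is 0, so the transpose identity is
      used with k = 0.\<close>
    have "fourier_coeff (h * g) 0 = fourier_coeff (r * 0) 0" using dual[rule_format, of g 0] g1 g0 by simp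
    then have z: "fourier_coeff (h * g) 0 = 0" by simp
    have d: "f - r \<in> Lp p" using fp rp p1 by (intro Lp_diff)
    have fh: "f - h = riesz_proj (f - r)" using riesz_proj_diff[OF p(1) fp rp] riesz_proj_id[OF p(1) f] by (simp add: hr)
    have fhp: "f - h \<in> Lp p" using fp hp p1 by (intro Lp_diff)
    have "fourier_coeff (f * g) 0 = fourier_coeff ((f - h) * g) 0"
      using fourier_coeff_diff[OF Holder(1)[OF p fp g] Holder(1)[OF p hp g], of 0] z by (simp add: left_diff_distrib)
    also have "norm \<dots> \<le> Lp_norm p (f - h) * Lp_norm q g"
      using fourier_coeff_le_1 Holder(2)[OF p fhp g] by (rule order_trans)
    also have "Lp_norm p (f - h) \<le> C * Lp_norm p (f - r)" unfolding fh by (rule C(2)[OF d])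
    also have "C * Lp_norm p (f - r) \<le> C * e" using r C by (intro mult_left_mono) auto
    finally show ?thesis by (simp add: mult_right_mono mult_ac)
  qed
  moreover have "0 \<le> C * Lp_norm q g" using C by simp
  ultimately have "norm (fourier_coeff (f * g) 0) \<le> 0" by (rule le_0_if_le_eps)
  then show ?thesis by simp
qed

lemma conj_Hp_annihilate:
  assumes p: "1 < p" "1 / p + 1 / q = 1" and f: "f \<in> conj_Hp p" and g: "g \<in> Lp q" and g0: "\<And>n. n \<ge> 0 \<Longrightarrow> fourier_coeff g n = 0"
  shows "fourier_coeff (f * g) 0 = 0"
proof -
  have "fourier_coeff (reflect f * reflect g) 0 = 0"
    using p f g g0 by (intro Hp_annihilate) (auto simp: Hp_iff conj_Hp_iff fourier_coeff_reflect Lp_reflect)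
  then show ?thesis by (simp add: reflect_mult[symmetric] fourier_coeff_reflect)
qed

text \<open>For a positive index n, shifting k by t^(-n) leaves it with negative indices only, and f
  annihilates it. For index 0 the constant term of f is split off, after which the roles of f and k
  are exchanged.\<close>

lemma conj_Hp_mult:
  assumes p: "1 < p" "1 / p + 1 / q = 1" and f: "f \<in> conj_Hp p" and k: "k \<in> conj_Hp q"
  shows "f * k \<in> Lp 1" "n > 0 \<Longrightarrow> fourier_coeff (f * k) n = 0"
    "fourier_coeff (f * k) 0 = fourier_coeff f 0 * fourier_coeff k 0"
proof -
  note q = conjugate_exponent(1)[OF p]
  have qp: "1 / q + 1 / p = 1" using p by simp
  have fp: "f \<in> Lp p" "\<And>n. n > 0 \<Longrightarrow> fourier_coeff f n = 0" using f p by (simp_all add: conj_Hp_iff)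
  have kq: "k \<in> Lp q" "\<And>n. n > 0 \<Longrightarrow> fourier_coeff k n = 0" using k q by (simp_all add: conj_Hp_iff)
  show fk: "f * k \<in> Lp 1" by (rule Holder[OF p fp(1) kq(1)])
  show "fourier_coeff (f * k) n = 0" if n: "n > 0"
  proof -
    have "fourier_coeff (f * (tpow (- n) * k)) 0 = 0"
      using n kq q by (intro conj_Hp_annihilate[OF p f]) (auto simp: Lp_tpow_mult fourier_coeff_shift)
    moreover have "f * (tpow (- n) * k) = tpow (- n) * (f * k)" by (rule mult.left_commute)
    ultimately show ?thesis by (simp add: fourier_coeff_shift)
  qed
  define f' where "f' = f - fourier_coeff f 0 *\<^sub>C 1"
  have f'p: "f' \<in> Lp p" using fp p by (auto simp: f'_def intro!: Lp_diff Lp_cscale)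
  have f1: "f \<in> Lp 1" by (rule Lp_subset_1[OF p(1) fp(1)])
  have "fourier_coeff f' n = 0" if "n \<ge> 0" for n
    using that fp f1 by (cases "n = 0") (simp_all add: f'_def fourier_coeff_diff Lp_cscale fourier_coeff_cscale fourier_coeff_1)
  then have z: "fourier_coeff (k * f') 0 = 0" using conj_Hp_annihilate[OF q(1) qp k f'p] by simp
  have "f * k = k * f' + fourier_coeff f 0 *\<^sub>C k" by (simp add: f'_def algebra_simps cscale_mult_right)
  then have "fourier_coeff (f * k) 0 = fourier_coeff (k * f') 0 + fourier_coeff f 0 * fourier_coeff k 0"
    using fourier_coeff_add[OF Holder(1)[OF q(1) qp kq(1) f'p] Lp_cscale(1)[of 1 k "fourier_coeff f 0"], of 0] kq q Lp_1_of_Lp[of q k]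
    by (simp add: fourier_coeff_cscale)
  then show "fourier_coeff (f * k) 0 = fourier_coeff f 0 * fourier_coeff k 0" using z by simp
qed

text \<open>The spectrum is bounded above, so there is a highest nonzero coefficient, and a power of
  t moves it to index 0.\<close>

lemma conj_Hp_leading:
  assumes p: "1 \<le> p" and f: "f \<in> conj_Hp p" and nz: "f \<noteq> 0"
  obtains m where "tpow m * f \<in> conj_Hp p" "fourier_coeff (tpow m * f) 0 \<noteq> 0"
proof -
  have fp: "f \<in> Lp p" "\<And>n. n > 0 \<Longrightarrow> fourier_coeff f n = 0" using f p by (simp_all add: conj_Hp_iff)
  have "\<exists>n. fourier_coeff f n \<noteq> 0"
  proof (rule ccontr)
    assume "\<not> ?thesis"
    then have "f = 0" using fp(1) p Lp_1_of_Lp[of p f] by (intro fourier_coeff_unique) auto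
    then show False using nz by simp
  qed
  then obtain n where n: "fourier_coeff f n \<noteq> 0" by blast
  then have "n \<le> 0" using fp(2) by (meson not_le)
  then have ex: "\<exists>j::nat. fourier_coeff f (- int j) \<noteq> 0" using n by (intro exI[of _ "nat (- n)"]) simp
  define m where "m = (LEAST j::nat. fourier_coeff f (- int j) \<noteq> 0)"
  have m: "fourier_coeff f (- int m) \<noteq> 0" unfolding m_def by (rule LeastI_ex[OF ex])
  have z: "fourier_coeff f (i - int m) = 0" if "i > 0" for i
  proof (cases "i - int m > 0")
    case False
    then have "nat (int m - i) < m" using that by linarith
    then have "fourier_coeff f (- int (nat (int m - i))) = 0" unfolding m_def by (metis (mono_tags, lifting) not_less_Least)
    then show ?thesis using False by simp
  qed (use fp in simp)
  show ?thesis
  proof (rule that[of "int m"])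
    show "tpow (int m) * f \<in> conj_Hp p" using fp p z by (simp add: conj_Hp_iff Lp_tpow_mult fourier_coeff_shift)
    show "fourier_coeff (tpow (int m) * f) 0 \<noteq> 0" using m by (simp add: fourier_coeff_shift)
  qed
qed

text \<open>As for formal power series: after shifting, the leading coefficients multiply.\<close>

lemma conj_Hp_no_zero_divisors:
  assumes p: "1 < p" "1 / p + 1 / q = 1" and f: "f \<in> conj_Hp p" and k: "k \<in> conj_Hp q" and fk: "f * k = 0"
  shows "f = 0 \<or> k = 0"
proof (rule ccontr)
  note q = conjugate_exponent(1)[OF p]
  assume "\<not> ?thesis"
  then obtain m n where m: "tpow m * f \<in> conj_Hp p" "fourier_coeff (tpow m * f) 0 \<noteq> 0"
    and n: "tpow n * k \<in> conj_Hp q" "fourier_coeff (tpow n * k) 0 \<noteq> 0"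
    using conj_Hp_leading[of p f] conj_Hp_leading[of q k] p q f k by (metis less_imp_le)
  have "(tpow m * f) * (tpow n * k) = tpow m * tpow n * (f * k)" by (simp only: mult_ac)
  then have "fourier_coeff ((tpow m * f) * (tpow n * k)) 0 = 0" using fk by simp
  then show False using conj_Hp_mult(3)[OF p m(1) n(1)] m(2) n(2) by simp
qed

text \<open>Oddness kills the constant term and carries the vanishing above 1 to vanishing below -1.
  This is the parity argument common to the factorization, to injectivity and to the analogue of
  Coburn's lemma.\<close>

lemma odd_function_eq:
  assumes u: "u \<in> Lp 1" "reflect u = - u" "\<And>n. n > 1 \<Longrightarrow> fourier_coeff u n = 0"
  shows "u = fourier_coeff u 1 *\<^sub>C (tpow 1 - tpow (- 1))"
proof (rule fourier_coeff_unique)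
  have odd: "fourier_coeff u (- n) = - fourier_coeff u n" for n
    using fourier_coeff_reflect[of u n] u(2) by (simp add: fourier_coeff_uminus)
  fix n :: int
  have R: "fourier_coeff (fourier_coeff u 1 *\<^sub>C (tpow 1 - tpow (- 1))) n
      = fourier_coeff u 1 * ((if n = 1 then 1 else 0) - (if n = -1 then 1 else 0))"
    by (simp add: fourier_coeff_cscale fourier_coeff_diff fourier_coeff_tpow)
  consider "n > 1" | "n = 1" | "n = 0" | "n = -1" | "n < -1" by linarith
  then show "fourier_coeff u n = fourier_coeff (fourier_coeff u 1 *\<^sub>C (tpow 1 - tpow (- 1))) n"
  proof cases
    case 3
    then show ?thesis using odd[of 0] unfolding R by simp
  next
    case 5
    then show ?thesis using odd[of "- n"] u(3)[of "- n"] unfolding R by simp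
  next
    case 1
    then show ?thesis using u(3) unfolding R by simp
  next
    case 2
    then show ?thesis unfolding R by simp
  next
    case 4
    then show ?thesis using odd[of 1] unfolding R by simp
  qed
qed (use u in \<open>auto intro!: Lp_cscale Lp_diff\<close>)

subsection \<open>The spaces \<open>L\<^sup>p\<^sub>J\<close>\<close>

lemma Lp_J_iff:
  assumes "1 \<le> p"
  shows "z \<in> Lp_J p \<longleftrightarrow> z \<in> Lp p \<and> J z = z"
proof
  assume "z \<in> Lp_J p"
  then obtain f where f: "f \<in> Lp p" "z = (1/2) *\<^sub>C (f + J f)" by (auto simp: Lp_J_def)
  then show "z \<in> Lp p \<and> J z = z" using assms Lp_J[of p f] by (auto simp: J_cscale J_add add.commute intro!: Lp_cscale Lp_add)
next
  assume "z \<in> Lp p \<and> J z = z"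
  moreover have "(1/2) *\<^sub>C (z + z) = z"
    by (simp only: L0.scale_right_distrib L0.scale_left_distrib[symmetric]) simp
  ultimately show "z \<in> Lp_J p" unfolding Lp_J_def by (intro image_eqI[of _ _ z]) auto
qed

lemma J_fixed_reflect: "J z = z \<Longrightarrow> reflect z = tpow 1 * z"
  by (metis J_def tpow_mult_cancel(1))

text \<open>On coefficients \<open>J\<close> exchanges n and -1 - n, hence nonnegative and negative
  indices. So x and \<open>J x\<close> have disjoint spectra, and the projection recovers x.\<close>

lemma Hp_plus_J:
  assumes p: "1 < p" and x: "x \<in> Hp p"
  shows "x + J x \<in> Lp p" "J (x + J x) = x + J x" "riesz_proj (x + J x) = x"
    "Lp_norm p (x + J x) \<le> 2 * Lp_norm p x"
proof -
  have xp: "x \<in> Lp p" using x by (simp add: Hp_iff)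
  have Jx: "J x \<in> Lp p" "Lp_norm p (J x) = Lp_norm p x" using xp p by (simp_all add: Lp_J)
  show 1: "x + J x \<in> Lp p" using xp Jx p by (intro Lp_add) auto
  show "J (x + J x) = x + J x" by (simp add: J_add add.commute)
  have "x \<in> Lp 1" "J x \<in> Lp 1" using Lp_subset_1[OF p] xp Jx by blast+
  then show "riesz_proj (x + J x) = x"
    using x by (subst riesz_proj_eq_iff[OF p 1 x]) (auto simp: fourier_coeff_add fourier_coeff_J Hp_iff)
  show "Lp_norm p (x + J x) \<le> 2 * Lp_norm p x" using Lp_add(2)[of p x "J x"] xp Jx p by simp
qed

text \<open>The coefficients of a fixed function of \<open>J\<close> at negative indices are
  determined by the others, so x -> x + \<open>J x\<close> maps H^p onto the fixed
  functions.\<close>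

lemma J_fixed_decomp:
  assumes p: "1 < p" and z: "z \<in> Lp p" "J z = z"
  shows "z = riesz_proj z + J (riesz_proj z)"
proof -
  let ?x = "riesz_proj z"
  have x: "?x \<in> Hp p" by (rule riesz_proj_Hp[OF p z(1)])
  then have xp: "?x \<in> Lp 1" "J ?x \<in> Lp 1" using p Lp_1_of_Lp[of p ?x] Lp_J[of 1 ?x] by (auto simp: Hp_iff)
  show ?thesis
  proof (rule fourier_coeff_unique)
    fix n
    have "fourier_coeff z n = fourier_coeff z (- 1 - n)" using fourier_coeff_J[of z n] z(2) by simp
    then show "fourier_coeff z n = fourier_coeff (?x + J ?x) n"
      using xp by (simp add: fourier_coeff_add fourier_coeff_J fourier_coeff_riesz_proj[OF p z(1)])
  qed (use Lp_subset_1[OF p z(1)] xp in \<open>auto intro: Lp_add\<close>)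
qed

text \<open>Computes the transpose of \<open>J\<close> for the pairing by the coefficient of index
  0: invariance of that coefficient under reflection moves \<open>J\<close> to the other
  factor.\<close>

lemma J_transpose: "fourier_coeff (J x * y) 0 = fourier_coeff (x * (tpow 1 * reflect y)) 0"
proof -
  have "fourier_coeff (J x * y) 0 = fourier_coeff (reflect (J x * y)) 0" by (simp add: fourier_coeff_reflect)
  also have "reflect (J x * y) = x * (tpow 1 * reflect y)" by (simp add: J_def reflect_mult mult_ac)
  finally show ?thesis .
qed

text \<open>Testing with monomials shows that the coefficients of w + t w(1/t) vanish at indices n
  <= 0. These coefficients are symmetric under n -> 1 - n, which covers the remaining
  indices.\<close>

lemma annihilates_LJ:
  assumes p: "1 < p" "1 / p + 1 / q = 1" and w: "w \<in> Lp q"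
    and ann: "\<And>x. x \<in> Hp p \<Longrightarrow> fourier_coeff ((x + J x) * w) 0 = 0"
  shows "tpow 1 * reflect w = - w"
proof -
  note q = conjugate_exponent(1)[OF p]
  let ?v = "tpow 1 * reflect w"
  have v: "?v \<in> Lp q" using w q by (simp add: Lp_tpow_mult Lp_reflect)
  have wv1: "w \<in> Lp 1" "?v \<in> Lp 1" using Lp_subset_1[OF q(1)] w v by blast+
  have vc: "fourier_coeff ?v n = fourier_coeff w (1 - n)" for n
    by (simp add: fourier_coeff_shift fourier_coeff_reflect)
  have le: "fourier_coeff (w + ?v) n = 0" if n: "n \<le> 0" for n
  proof -
    have x: "tpow (- n) \<in> Hp p" using n by simp
    have xp: "tpow (- n) \<in> Lp p" "J (tpow (- n)) \<in> Lp p" by simp_all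
    have "fourier_coeff (tpow (- n) * w + J (tpow (- n)) * w) 0 = 0"
      using ann[OF x] by (simp only: distrib_right)
    then have "fourier_coeff (tpow (- n) * w) 0 + fourier_coeff (J (tpow (- n)) * w) 0 = 0"
      by (subst (asm) fourier_coeff_add[OF Holder(1)[OF p xp(1) w] Holder(1)[OF p xp(2) w]])
    then show ?thesis using wv1
      unfolding J_transpose by (simp add: fourier_coeff_shift fourier_coeff_add)
  qed
  have "w + ?v = 0"
  proof (rule fourier_coeff_unique)
    fix n
    show "fourier_coeff (w + ?v) n = fourier_coeff 0 n"
    proof (cases "n \<le> 0")
      case False
      have "fourier_coeff (w + ?v) n = fourier_coeff (w + ?v) (1 - n)"
        using wv1 by (simp add: fourier_coeff_add vc)
      then show ?thesis using le[of "1 - n"] False by simp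
    qed (use le in simp)
  qed (use wv1 in \<open>auto intro: Lp_add\<close>)
  then show ?thesis by (metis add_eq_0_iff add.commute)
qed

subsection \<open>The operators \<open>M(\<phi>)\<close>\<close>

lemma Linf_mult_Lp: "\<phi> \<in> Linf \<Longrightarrow> 0 < p \<Longrightarrow> f \<in> Lp p \<Longrightarrow> \<phi> * f \<in> Lp p"
  using Linf_dominated dominated_Lp(1) by metis

lemma Linf_mult_bound:
  assumes "\<phi> \<in> Linf" "0 < p"
  obtains C where "0 \<le> C" "\<And>f. f \<in> Lp p \<Longrightarrow> Lp_norm p (\<phi> * f) \<le> C * Lp_norm p f"
  using Linf_dominated[OF assms(1)] dominated_Lp(2) assms(2) by metis

lemma M_op_eq:
  assumes "1 < p" "\<phi> \<in> Linf" "x \<in> Hp p"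
  shows "M_op \<phi> x = riesz_proj (\<phi> * (x + J x))"
  using assms riesz_proj_add[of p "\<phi> * x" "\<phi> * J x"]
  by (simp add: M_op_def T_op_def H_op_def distrib_left Linf_mult_Lp Hp_iff Lp_J)

lemma M_op_bounded:
  assumes p: "1 < p" and \<phi>: "\<phi> \<in> Linf"
  shows "bounded_op (Hp p) (Lp_norm p) (Hp p) (Lp_norm p) (M_op \<phi>)"
proof -
  interpret L0_banach "Hp p" "Lp_norm p" by (rule L0_banach_Hp[OF p])
  obtain C where C: "0 \<le> C" "\<And>f. f \<in> Lp p \<Longrightarrow> Lp_norm p (\<phi> * f) \<le> C * Lp_norm p f"
    using Linf_mult_bound[OF \<phi>, of p] p by auto
  obtain D where D: "0 \<le> D" "\<And>f. f \<in> Lp p \<Longrightarrow> Lp_norm p (riesz_proj f) \<le> D * Lp_norm p f"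
    using riesz_proj_bounded[OF p] by blast
  have L: "\<phi> * (x + J x) \<in> Lp p" if "x \<in> Hp p" for x
    using that p \<phi> by (intro Linf_mult_Lp Hp_plus_J) auto
  show ?thesis
    unfolding bounded_op_def linear_on_space_def
  proof (intro conjI ballI allI exI)
    show "M_op \<phi> ` Hp p \<subseteq> Hp p"
      using L by (auto simp: M_op_eq[OF p \<phi>] intro!: riesz_proj_Hp[OF p])
    fix f g assume fg: "f \<in> Hp p" "g \<in> Hp p"
    have "\<phi> * (f + g + J (f + g)) = \<phi> * (f + J f) + \<phi> * (g + J g)" by (simp add: J_add algebra_simps)
    then show "M_op \<phi> (f + g) = M_op \<phi> f + M_op \<phi> g"
      using fg L by (simp add: M_op_eq[OF p \<phi>] riesz_proj_add[OF p])
  next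
    fix c f assume f: "f \<in> Hp p"
    have "\<phi> * (c *\<^sub>C f + J (c *\<^sub>C f)) = c *\<^sub>C (\<phi> * (f + J f))" by (simp add: J_cscale cscale_mult_right L0.scale_right_distrib distrib_left)
    then show "M_op \<phi> (c *\<^sub>C f) = c *\<^sub>C M_op \<phi> f"
      using f L by (simp add: M_op_eq[OF p \<phi>] riesz_proj_cscale[OF p])
  next
    fix f assume f: "f \<in> Hp p"
    have "Lp_norm p (M_op \<phi> f) \<le> D * Lp_norm p (\<phi> * (f + J f))"
      unfolding M_op_eq[OF p \<phi> f] by (rule D(2)[OF L[OF f]])
    also have "\<dots> \<le> D * (C * Lp_norm p (f + J f))"
      using C(2)[OF Hp_plus_J(1)[OF p f]] D by (intro mult_left_mono) auto
    also have "\<dots> \<le> D * (C * (2 * Lp_norm p f))"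
      using Hp_plus_J(4)[OF p f] C D by (intro mult_left_mono) auto
    finally show "Lp_norm p (M_op \<phi> f) \<le> (D * C * 2) * Lp_norm p f" by (simp add: mult_ac)
  qed
qed

text \<open>Composition with P extends the functional from H^p to L^p, where duality gives a
  representing g. The extension kills negative powers of t, which makes g antianalytic.\<close>

lemma bounded_functional_extend:
  assumes p: "1 < p" "1 / p + 1 / q = 1" and l: "bounded_functional (Hp p) (Lp_norm p) l"
  obtains g where "g \<in> conj_Hp q" "\<And>y. y \<in> Lp p \<Longrightarrow> l (riesz_proj y) = fourier_coeff (y * g) 0"
proof -
  interpret L0_banach "Hp p" "Lp_norm p" by (rule L0_banach_Hp[OF p(1)])
  note q = conjugate_exponent(1)[OF p]
  obtain C where C: "\<And>f. f \<in> Hp p \<Longrightarrow> norm (l f) \<le> C * Lp_norm p f" using l unfolding bounded_functional_def by blast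
  obtain D where D: "0 \<le> D" "\<And>f. f \<in> Lp p \<Longrightarrow> Lp_norm p (riesz_proj f) \<le> D * Lp_norm p f"
    using riesz_proj_bounded[OF p(1)] by blast
  have lin: "\<And>f g. f \<in> Hp p \<Longrightarrow> g \<in> Hp p \<Longrightarrow> l (f + g) = l f + l g" "\<And>c f. f \<in> Hp p \<Longrightarrow> l (c *\<^sub>C f) = c * l f"
    using l by (auto simp: bounded_functional_def linear_on_space_def)
  have "bounded_functional (Lp p) (Lp_norm p) (\<lambda>y. l (riesz_proj y))"
    unfolding bounded_functional_def linear_on_space_def
  proof (intro conjI ballI allI exI)
    fix f assume f: "f \<in> Lp p"
    have "norm (l (riesz_proj f)) \<le> C * Lp_norm p (riesz_proj f)" by (rule C[OF riesz_proj_Hp[OF p(1) f]])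
    also have "\<dots> \<le> \<bar>C\<bar> * Lp_norm p (riesz_proj f)" by (intro mult_right_mono) auto
    also have "\<dots> \<le> \<bar>C\<bar> * (D * Lp_norm p f)" using D(2)[OF f] by (intro mult_left_mono) auto
    finally show "norm (l (riesz_proj f)) \<le> (\<bar>C\<bar> * D) * Lp_norm p f" by (simp add: mult_ac)
  qed (simp_all add: riesz_proj_add[OF p(1)] riesz_proj_cscale[OF p(1)] lin riesz_proj_Hp[OF p(1)])
  then obtain g where g: "g \<in> Lp q" "\<And>y. y \<in> Lp p \<Longrightarrow> l (riesz_proj y) = fourier_coeff (y * g) 0"
    using Lp_dual[OF p] by blast
  have l0: "l 0 = 0" using lin(2)[of 0 0] by simp
  have "fourier_coeff g n = 0" if n: "n > 0" for n
  proof -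
    have "riesz_proj (tpow (- n)) = 0"
      using n by (subst riesz_proj_eq_0_iff[OF p(1)]) (auto simp: fourier_coeff_tpow)
    then have "fourier_coeff (tpow (- n) * g) 0 = 0" using g(2)[of "tpow (- n)"] l0 by simp
    then show ?thesis by (simp add: fourier_coeff_shift)
  qed
  then have "g \<in> conj_Hp q" using g q by (simp add: conj_Hp_iff)
  then show ?thesis using g(2) that by blast
qed

lemma GLinf_D: "\<phi> \<in> GLinf \<Longrightarrow> \<phi> \<in> Linf" "\<phi> \<in> GLinf \<Longrightarrow> unit \<phi>"
  by (auto simp: GLinf_def intro: unitI)

text \<open>An analogue of Coburn's lemma. A kernel vector \<open>x\<close> gives the antianalytic \<open>n = \<phi>(x + Jx)\<close> without
  constant term, and \<open>l\<close> is represented by an antianalytic \<open>g\<close>; since \<open>Jh = h\<close> for \<open>h = x + Jx\<close> and \<open>\<phi>g\<close>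
  annihilates all such \<open>h\<close>, the product \<open>ng\<close> is odd, hence zero.\<close>

lemma coburn:
  assumes p: "1 < p" "1 / p + 1 / q = 1" and \<phi>: "\<phi> \<in> GLinf"
    and x: "x \<in> Hp p" "M_op \<phi> x = 0" "x \<noteq> 0"
    and l: "bounded_functional (Hp p) (Lp_norm p) l" "\<And>y. y \<in> Hp p \<Longrightarrow> l (M_op \<phi> y) = 0"
    and y: "y \<in> Hp p"
  shows "l y = 0"
proof -
  note q = conjugate_exponent(1)[OF p]
  note \<phi>' = GLinf_D[OF \<phi>]
  obtain g where g: "g \<in> conj_Hp q" "\<And>y. y \<in> Lp p \<Longrightarrow> l (riesz_proj y) = fourier_coeff (y * g) 0"
    using bounded_functional_extend[OF p l(1)] by blast
  have gq: "g \<in> Lp q" using g q by (simp add: conj_Hp_iff)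
  define h where "h = x + J x"
  have h: "h \<in> Lp p" "J h = h" "riesz_proj h = x" using Hp_plus_J[OF p(1) x(1)] by (simp_all add: h_def)
  define n where "n = \<phi> * h"
  have np: "n \<in> Lp p" using h \<phi>' p by (simp add: n_def Linf_mult_Lp)
  have "riesz_proj n = 0" using x(2) M_op_eq[OF p(1) \<phi>'(1) x(1)] by (simp add: n_def h_def)
  then have n0: "\<And>m. m \<ge> 0 \<Longrightarrow> fourier_coeff n m = 0" using riesz_proj_eq_0_iff[OF p(1) np] by blast
  then have nc: "n \<in> conj_Hp p" using np p by (simp add: conj_Hp_iff)
  define w where "w = \<phi> * g"
  have wq: "w \<in> Lp q" using gq \<phi>' q by (simp add: w_def Linf_mult_Lp)
  have w: "tpow 1 * reflect w = - w"
  proof (rule annihilates_LJ[OF p wq])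
    fix z assume z: "z \<in> Hp p"
    have "fourier_coeff ((\<phi> * (z + J z)) * g) 0 = l (M_op \<phi> z)"
      using g(2)[of "\<phi> * (z + J z)"] M_op_eq[OF p(1) \<phi>'(1) z] Linf_mult_Lp[OF \<phi>'(1) _ Hp_plus_J(1)[OF p(1) z]] p by simp
    also have "\<dots> = 0" by (rule l(2)[OF z])
    also have "(\<phi> * (z + J z)) * g = (z + J z) * w" by (simp only: w_def mult_ac)
    finally show "fourier_coeff ((z + J z) * w) 0 = 0" .
  qed
  have ng: "n * g = h * w" by (simp only: n_def w_def mult_ac)
  have "reflect (h * w) = (tpow 1 * h) * reflect w" by (simp add: reflect_mult J_fixed_reflect[OF h(2)])
  also have "\<dots> = h * (tpow 1 * reflect w)" by (simp only: mult_ac)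
  also have "\<dots> = - (h * w)" using w by simp
  finally have odd: "reflect (n * g) = - (n * g)" unfolding ng .
  \<comment> \<open>Oddness leaves one mode; its coefficient at index 1 vanishes because the product
    is antianalytic.\<close>
  have "n * g = fourier_coeff (n * g) 1 *\<^sub>C (tpow 1 - tpow (- 1))"
    using conj_Hp_mult[OF p nc g(1)] odd by (intro odd_function_eq) auto
  also have "fourier_coeff (n * g) 1 = 0" by (rule conj_Hp_mult(2)[OF p nc g(1)]) simp
  finally have "n * g = 0" by simp
  then have "n = 0 \<or> g = 0" by (rule conj_Hp_no_zero_divisors[OF p nc g(1)])
  moreover have "n \<noteq> 0"
  proof
    assume "n = 0"
    then have "\<phi> * h = \<phi> * 0" by (simp add: n_def)
    then have "h = 0" by (rule unit_cancel[OF \<phi>'(2)])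
    then have "x = riesz_proj 0" using h(3) by simp
    then show False using x(3) riesz_proj_id[OF p(1), of 0] by (simp add: Hp_iff)
  qed
  ultimately have "g = 0" by blast
  then have "l (riesz_proj y) = 0" using g(2)[of y] y by (simp add: Hp_iff)
  then show ?thesis using riesz_proj_id[OF p(1) y] by simp
qed

subsection \<open>Density of \<open>X\<^sub>1\<close>\<close>

text \<open>Off t = 1 the geometric sums stay bounded by 2 / |1/t - 1|, so the averages tend to 0
  there, and they are dominated by 1. Consequently 1 minus such an average, which is divisible by 1
  - 1/t, approximates 1 in L^p.\<close>

lemma cesaro_tendsto_0:
  assumes p: "1 \<le> p"
  shows "(\<lambda>n. Lp_norm p (of_real (1 / real (Suc n)) *\<^sub>C (\<Sum>i<Suc n. tpow (- int i)))) \<longlonglongrightarrow> 0"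
proof -
  define c where "c n t = of_real (1 / real (Suc n)) * (\<Sum>i<Suc n. t powi (- int i))" for n and t :: complex
  have [measurable]: "(\<lambda>t::complex. \<Sum>i<m. t powi (- int i)) \<in> borel_measurable borel" for m
    by (intro borel_measurable_sum measurable_powi)
  have [measurable]: "c n \<in> borel_measurable borel" for n unfolding c_def by measurable
  have pow: "t powi (- int i) = inverse t ^ i" for t :: complex and i
    by (simp add: power_int_minus power_inverse)
  have "(\<lambda>n. Lp_norm p (abs_L0 (c n) - abs_L0 (\<lambda>_. 0))) \<longlonglongrightarrow> 0"
  proof (rule Lp_dominated_convergence(3)[where w = "\<lambda>_. 1"])
    show "AE t in circle_measure. norm (c n t) \<le> 1" for n
      using AE_circle_norm
    proof eventually_elim
      case (elim t)
      have "norm (\<Sum>i<Suc n. t powi (- int i)) \<le> (\<Sum>i<Suc n. 1)"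
        using elim by (intro sum_norm_le) (simp add: norm_power_int)
      then have "norm (c n t) \<le> (1 / real (Suc n)) * real (Suc n)"
        unfolding c_def norm_mult norm_of_real by (intro mult_mono) auto
      then show ?case by simp
    qed
    show "AE t in circle_measure. (\<lambda>n. c n t) \<longlonglongrightarrow> 0"
      using AE_circle_norm AE_circle_Im
    proof eventually_elim
      case (elim t)
      define z where "z = inverse t"
      have z: "norm z = 1" "z \<noteq> 1" using elim by (auto simp: z_def norm_inverse)
      have "norm (c n t) \<le> (2 / norm (z - 1)) * (1 / real (Suc n))" for n
      proof -
        have "norm (\<Sum>i<Suc n. t powi (- int i)) = norm ((z ^ Suc n - 1) / (z - 1))"
          unfolding pow z_def[symmetric] by (subst geometric_sum[OF z(2)]) simp
        also have "\<dots> \<le> 2 / norm (z - 1)"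
          unfolding norm_divide using norm_triangle_ineq4[of "z ^ Suc n" 1] z
          by (intro divide_right_mono) (auto simp: norm_power norm_mult)
        finally have "\<bar>1 / real (Suc n)\<bar> * norm (\<Sum>i<Suc n. t powi (- int i)) \<le> \<bar>1 / real (Suc n)\<bar> * (2 / norm (z - 1))"
          by (intro mult_left_mono) auto
        then show ?thesis unfolding c_def norm_mult norm_of_real by (simp only: mult.commute) simp
      qed
      moreover have "(\<lambda>n. (2 / norm (z - 1)) * (1 / real (Suc n))) \<longlonglongrightarrow> (2 / norm (z - 1)) * 0"
        using LIMSEQ_inverse_real_of_nat by (intro tendsto_intros) (simp add: inverse_eq_divide)
      ultimately show ?case
        by (intro Lim_null_comparison[of "\<lambda>n. c n t" "\<lambda>n. (2 / norm (z - 1)) * (1 / real (Suc n))"] always_eventually) auto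
    qed
  qed (use p in auto)
  moreover have "abs_L0 (c n) = of_real (1 / real (Suc n)) *\<^sub>C (\<Sum>i<Suc n. tpow (- int i))" for n
  proof -
    have "(\<Sum>i<m. tpow (- int i)) = abs_L0 (\<lambda>t. \<Sum>i<m. t powi (- int i))" for m
      using tpow_sum[of "{..<m}" "\<lambda>_. 1" "\<lambda>i. - int i"] by simp
    then show ?thesis unfolding c_def by (simp only: cscale.abs_eq circle_eq_refl_iff) (simp add: cscale.abs_eq del: sum.lessThan_Suc)
  qed
  moreover have "abs_L0 (\<lambda>_. 0) = 0" by (simp add: zero_L0.abs_eq)
  ultimately show ?thesis by simp
qed

text \<open>Every 1 - t^(-j) is a polynomial multiple of 1 - t^(-1), so 1 minus a Cesaro average
  lies in \<open>X1\<close> and approximates 1. Multiplying it by a polynomial r close to y keeps it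
  in \<open>X1\<close> and approximates y.\<close>

lemma X1_dense:
  assumes p: "1 \<le> p" and y: "y \<in> Lp p" and e: "e > 0"
  obtains r where "r \<in> trig_poly" "Lp_norm p (y - (1 - tpow (- 1)) * r) < e"
proof -
  define b where "b = 1 - tpow (- 1)"
  have bt: "b \<in> trig_poly" unfolding b_def by (intro L0.subspace_diff[OF subspace_trig_poly]) auto
  have tp: "r \<in> Lp p" if "r \<in> trig_poly" for r using trig_poly_Lp[OF p] that by auto
  have sub: "L0.subspace {b * r |r. r \<in> trig_poly}"
    unfolding L0.subspace_def mem_Collect_eq
  proof (intro conjI ballI allI; (elim CollectE exE conjE)?)
    show "\<exists>r. 0 = b * r \<and> r \<in> trig_poly"
      using L0.subspace_0[OF subspace_trig_poly] by (intro exI[of _ 0]) auto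
    show "\<exists>r. x + y = b * r \<and> r \<in> trig_poly" if "x = b * r1" "r1 \<in> trig_poly" "y = b * r2" "r2 \<in> trig_poly" for x y r1 r2
      using that L0.subspace_add[OF subspace_trig_poly] by (intro exI[of _ "r1 + r2"]) (auto simp: distrib_left)
    show "\<exists>r. c *\<^sub>C x = b * r \<and> r \<in> trig_poly" if "x = b * r1" "r1 \<in> trig_poly" for c x r1
      using that L0.subspace_scale[OF subspace_trig_poly] by (intro exI[of _ "c *\<^sub>C r1"]) (auto simp: cscale_mult_right)
  qed
  have one_minus: "1 - tpow (- int j) \<in> {b * r |r. r \<in> trig_poly}" for j
  proof (induction j)
    case (Suc j)
    have "tpow (- int (Suc j)) = tpow (- int j) * tpow (- 1)" by (simp add: tpow_add minus_diff_commute)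
    then have eq: "1 - tpow (- int (Suc j)) = (1 - tpow (- int j)) + b * tpow (- int j)" by (simp add: b_def algebra_simps)
    show ?case unfolding eq by (rule L0.subspace_add[OF sub Suc.IH]) auto
  next
    case 0
    show ?case using L0.subspace_0[OF sub] by simp
  qed
  have c: "\<exists>r\<in>trig_poly. 1 - of_real (1 / real (Suc n)) *\<^sub>C (\<Sum>i<Suc n. tpow (- int i)) = b * r" for n
  proof -
    have "(\<Sum>i<m. 1 - tpow (- int i)) = of_nat m *\<^sub>C 1 - (\<Sum>i<m. tpow (- int i))" for m
      by (induction m) (simp_all add: L0.scale_left_distrib algebra_simps)
    from this[of "Suc n"] have "1 - of_real (1 / real (Suc n)) *\<^sub>C (\<Sum>i<Suc n. tpow (- int i))
        = of_real (1 / real (Suc n)) *\<^sub>C (\<Sum>i<Suc n. 1 - tpow (- int i))"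
      by (simp only: L0.scale_right_diff_distrib) (simp del: of_nat_Suc sum.lessThan_Suc)
    also have "\<dots> \<in> {b * r |r. r \<in> trig_poly}"
      using one_minus by (intro L0.subspace_scale[OF sub] L0.subspace_sum[OF sub])
    finally show ?thesis by auto
  qed
  obtain r where r: "r \<in> trig_poly" "Lp_norm p (y - r) < e / 2" using trig_poly_dense[OF p y, of "e / 2"] e by auto
  obtain C where C: "C \<ge> 0" "\<And>f. dominated C (r * f) f" using dominated_trig_poly[OF r(1)] by blast
  \<comment> \<open>C bounds multiplication by r, and r is chosen before the average; so the average
    can be made small relative to C.\<close>
  have "e / (2 * (C + 1)) > 0" using C e by simp
  then obtain n where n: "Lp_norm p (of_real (1 / real (Suc n)) *\<^sub>C (\<Sum>i<Suc n. tpow (- int i))) < e / (2 * (C + 1))"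
    using order_tendstoD(2)[OF cesaro_tendsto_0[OF p]] by (metis (mono_tags, lifting) eventually_sequentially order_refl)
  define c0 where "c0 = of_real (1 / real (Suc n)) *\<^sub>C (\<Sum>i<Suc n. tpow (- int i))"
  obtain r0 where r0: "r0 \<in> trig_poly" "1 - c0 = b * r0" using c[of n] unfolding c0_def by blast
  have c0p: "c0 \<in> Lp p" unfolding c0_def
    using p by (intro Lp_cscale L0.subspace_sum[OF subspace_Lp]) auto
  have eq: "r - b * (r0 * r) = r * c0"
  proof -
    have "b * (r0 * r) = (1 - c0) * r" unfolding r0(2) by (simp only: mult.assoc)
    then show ?thesis by (simp add: algebra_simps)
  qed
  have rr: "r0 * r \<in> trig_poly" using r r0 by (simp add: trig_poly_mult)
  have "Lp_norm p (y - b * (r0 * r)) \<le> Lp_norm p (y - r) + Lp_norm p (r - b * (r0 * r))"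
    using y r tp trig_poly_mult[OF bt rr] by (intro Lp_diff_trans p) auto
  also have "Lp_norm p (r - b * (r0 * r)) \<le> C * Lp_norm p c0"
    unfolding eq by (rule dominated_Lp(2)[OF C(2)]) (use p C c0p in auto)
  also have "C * Lp_norm p c0 \<le> C * (e / (2 * (C + 1)))"
    using n C unfolding c0_def by (intro mult_left_mono) auto
  also have "\<dots> \<le> e / 2" using C e by (simp add: field_simps)
  finally have "Lp_norm p (y - b * (r0 * r)) < e" using r(2) by simp
  then show ?thesis using that rr unfolding b_def by blast
qed

subsection \<open>The operator \<open>B\<close>\<close>

lemma trig_poly_finite_sum:
  assumes g: "g \<in> Lp 1" and fin: "finite {n. fourier_coeff g n \<noteq> 0}"
  shows "g = (\<Sum>n\<in>{n. fourier_coeff g n \<noteq> 0}. fourier_coeff g n *\<^sub>C tpow n)" "g \<in> trig_poly"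
proof -
  let ?S = "{n. fourier_coeff g n \<noteq> 0}"
  show eq: "g = (\<Sum>n\<in>?S. fourier_coeff g n *\<^sub>C tpow n)"
  proof (rule fourier_coeff_unique[OF g])
    show "(\<Sum>n\<in>?S. fourier_coeff g n *\<^sub>C tpow n) \<in> Lp 1"
      by (intro L0.subspace_sum[OF subspace_Lp] Lp_cscale) auto
    fix m
    have "fourier_coeff (\<Sum>n\<in>?S. fourier_coeff g n *\<^sub>C tpow n) m = (\<Sum>n\<in>?S. fourier_coeff g n * (if n = m then 1 else 0))"
      by (subst fourier_coeff_sum) (auto simp: Lp_cscale fourier_coeff_cscale fourier_coeff_tpow)
    also have "\<dots> = (if m \<in> ?S then fourier_coeff g m else 0)"
      using fin by (simp add: if_distrib[of "(*) _"] sum.delta' cong: if_cong)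
    finally show "fourier_coeff g m = fourier_coeff (\<Sum>n\<in>?S. fourier_coeff g n *\<^sub>C tpow n) m" by auto
  qed
  have "(\<Sum>n\<in>?S. fourier_coeff g n *\<^sub>C tpow n) \<in> trig_poly"
    by (intro L0.subspace_sum[OF subspace_trig_poly] L0.subspace_scale[OF subspace_trig_poly]) auto
  then show "g \<in> trig_poly" using eq by simp
qed

text \<open>A polynomial raises the spectrum of an antianalytic function by finitely many places.
  Hence the projection of the product is itself a polynomial, which is what puts the image of
  \<open>X1\<close> under B into \<open>X2\<close>.\<close>

lemma trig_poly_mult_conj_Hp:
  assumes q: "1 \<le> q" and k: "k \<in> conj_Hp q" and r: "r \<in> trig_poly"
  shows "r * k \<in> Lp q \<and> (\<exists>K. \<forall>n>K. fourier_coeff (r * k) n = 0)"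
  using r
proof (induction r rule: trig_poly_induct)
  case subspace
  have q1: "f \<in> Lp 1" if "f \<in> Lp q" for f using that q Lp_1_of_Lp by blast
  show ?case
    unfolding L0.subspace_def mem_Collect_eq
  proof (intro conjI ballI allI; (elim CollectE exE conjE)?)
    fix f g K L assume f: "f * k \<in> Lp q" "\<forall>n>K. fourier_coeff (f * k) n = 0"
      and g: "g * k \<in> Lp q" "\<forall>n>L. fourier_coeff (g * k) n = 0"
    show "(f + g) * k \<in> Lp q" using f g q by (simp add: distrib_right Lp_add)
    show "\<exists>K. \<forall>n>K. fourier_coeff ((f + g) * k) n = 0"
      using f g q1 by (intro exI[of _ "max K L"]) (simp add: distrib_right fourier_coeff_add)
  qed (use q in \<open>auto simp: cscale_mult_left fourier_coeff_cscale intro: Lp_cscale\<close>)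
next
  case (tpow m)
  have "k \<in> Lp q" "\<And>n. n > 0 \<Longrightarrow> fourier_coeff k n = 0" using k q by (simp_all add: conj_Hp_iff)
  then show ?case using q by (auto simp: Lp_tpow_mult fourier_coeff_shift intro!: exI[of _ m])
qed

text \<open>\<open>t\<^sup>n + t\<^sup>-\<^sup>n\<^sup>-\<^sup>1\<close> is \<open>1 + t\<^sup>-\<^sup>1\<close> times the even function \<open>t\<^sup>n - t\<^sup>n\<^sup>-\<^sup>1 + \<dots> + t\<^sup>-\<^sup>n\<close>.\<close>

lemma plus_J_factor:
  assumes g: "g \<in> trig_poly" "\<And>n. n < 0 \<Longrightarrow> fourier_coeff g n = 0"
  shows "\<exists>e\<in>trig_poly. reflect e = e \<and> g + J g = (1 + tpow (- 1)) * e"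
proof -
  define a where "a = 1 + tpow (- 1)"
  define Q where "Q = {g. \<exists>e\<in>trig_poly. reflect e = e \<and> g + J g = a * e}"
  have sub: "L0.subspace Q"
    unfolding L0.subspace_def Q_def mem_Collect_eq
  proof (intro conjI ballI allI; (elim CollectE bexE conjE)?)
    show "\<exists>e\<in>trig_poly. reflect e = e \<and> 0 + J 0 = a * e"
      using L0.subspace_0[OF subspace_trig_poly] by (intro bexI[of _ 0]) auto
  next
    fix f g e e' assume *: "e \<in> trig_poly" "reflect e = e" "f + J f = a * e" "e' \<in> trig_poly" "reflect e' = e'" "g + J g = a * e'"
    have "f + g + J (f + g) = (f + J f) + (g + J g)" by (simp add: J_add)
    then have "f + g + J (f + g) = a * (e + e')" unfolding *(3,6) by (simp add: distrib_left)
    then show "\<exists>e\<in>trig_poly. reflect e = e \<and> f + g + J (f + g) = a * e"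
      using * L0.subspace_add[OF subspace_trig_poly] by (intro bexI[of _ "e + e'"]) (auto simp: reflect_add)
  next
    fix c f e assume *: "e \<in> trig_poly" "reflect e = e" "f + J f = a * e"
    have "c *\<^sub>C f + J (c *\<^sub>C f) = c *\<^sub>C (f + J f)" by (simp add: J_cscale L0.scale_right_distrib)
    then have "c *\<^sub>C f + J (c *\<^sub>C f) = a * (c *\<^sub>C e)" unfolding *(3) by (simp add: cscale_mult_right)
    then show "\<exists>e\<in>trig_poly. reflect e = e \<and> c *\<^sub>C f + J (c *\<^sub>C f) = a * e"
      using * L0.subspace_scale[OF subspace_trig_poly] by (intro bexI[of _ "c *\<^sub>C e"]) (auto simp: reflect_cscale)
  qed
  have "tpow (int n) \<in> Q" for n
  proof (induction n)
    case 0
    show ?case by (auto simp: Q_def a_def J_def intro!: bexI[of _ 1])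
  next
    case (Suc n)
    then obtain e where e: "e \<in> trig_poly" "reflect e = e" "tpow (int n) + J (tpow (int n)) = a * e" by (auto simp: Q_def)
    let ?e = "tpow (int n + 1) + tpow (- 1 - int n) - e"
    have "a * ?e = tpow (int n + 1) + tpow (- 1 - int n) + tpow (- 1) * tpow (int n + 1) + tpow (- 1) * tpow (- 1 - int n) - a * e"
      by (simp add: a_def algebra_simps)
    also have "\<dots> = tpow (int (Suc n)) + J (tpow (int (Suc n)))"
      unfolding e(3)[symmetric] by (simp add: tpow_add add.commute)
    finally have "tpow (int (Suc n)) + J (tpow (int (Suc n))) = a * ?e" by (rule sym)
    moreover have "?e \<in> trig_poly"
      using e by (intro L0.subspace_diff[OF subspace_trig_poly] L0.subspace_add[OF subspace_trig_poly]) auto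
    moreover have "reflect ?e = ?e" using e by (simp add: reflect_diff reflect_add add.commute)
    ultimately show ?case unfolding Q_def by blast
  qed
  then have tQ: "tpow n \<in> Q" if "n \<ge> 0" for n using that by (metis nat_0_le)
  have g1: "g \<in> Lp 1" using g trig_poly_Lp[of 1] by auto
  have "(\<Sum>n\<in>{n. fourier_coeff g n \<noteq> 0}. fourier_coeff g n *\<^sub>C tpow n) \<in> Q"
    using g(2) by (intro L0.subspace_sum[OF sub] L0.subspace_scale[OF sub] tQ) (metis mem_Collect_eq not_less)
  then have "g \<in> Q" using trig_poly_finite_sum(1)[OF g1 trig_poly_finite_coeffs[OF g(1)]] by simp
  then show ?thesis by (simp add: Q_def a_def)
qed

text \<open>Division by \<open>1 + t\<^sup>-\<^sup>1\<close>: the coefficients of \<open>F\<close> alternate in sign, hence vanish by the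
  Riemann-Lebesgue lemma.\<close>

lemma divide_one_plus:
  assumes F: "F \<in> Lp 1" and z: "\<And>n. n \<ge> 0 \<Longrightarrow> fourier_coeff ((1 + tpow (- 1)) * F) n = 0" and n: "n \<ge> 0"
  shows "fourier_coeff F n = 0"
proof -
  have step: "fourier_coeff F (m + 1) = - fourier_coeff F m" if "m \<ge> 0" for m
  proof -
    have "tpow (- 1) * F \<in> Lp 1" using F by (simp add: Lp_tpow_mult)
    then have "fourier_coeff F m + fourier_coeff F (m + 1) = 0"
      using z[OF that] F by (simp add: distrib_right fourier_coeff_add fourier_coeff_shift)
    then show ?thesis by (simp add: add_eq_0_iff)
  qed
  have c: "norm (fourier_coeff F (int j)) = norm (fourier_coeff F 0)" for j
  proof (induction j)
    case (Suc j)
    then show ?case using step[of "int j"] by (simp add: add.commute)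
  qed simp
  have "(\<lambda>j. norm (fourier_coeff F (int j))) \<longlonglongrightarrow> 0" using tendsto_norm[OF fourier_coeff_tendsto_0[OF F]] by simp
  then have "norm (fourier_coeff F 0) = 0" unfolding c by (simp add: LIMSEQ_const_iff)
  then show ?thesis using c[of "nat n"] n by simp
qed

text \<open>B y is fixed by \<open>J\<close> and solves P(psi z) = P y. The error psi B y - y is
  \<open>\<phi>m\<close> times a function with negative indices only. Since \<open>\<phi>m\<close>
  is antianalytic only after multiplication by 1 + t^(-1), the projection is first shown to vanish
  with this factor, which is then divided out.\<close>

lemma B_op_solves:
  assumes p: "1 < p" "1 / p + 1 / q = 1" and \<psi>: "\<psi> \<in> Linf" "\<psi> = \<phi>m * \<phi>0" and un: "unit \<phi>m" "unit \<phi>0"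
    and f: "(1 + tpow (- 1)) * \<phi>m \<in> conj_Hp p" and k: "(1 - tpow (- 1)) * inverse \<phi>m \<in> conj_Hp q"
    and h: "(1 + tpow (- 1)) * inverse \<phi>0 \<in> Lp p" and even: "reflect \<phi>0 = \<phi>0"
    and y: "y \<in> X1"
  shows "B_op \<phi>m \<phi>0 y \<in> X2 \<phi>0" "B_op \<phi>m \<phi>0 y \<in> Lp p" "J (B_op \<phi>m \<phi>0 y) = B_op \<phi>m \<phi>0 y"
    "y \<in> Lp p" "riesz_proj (\<psi> * B_op \<phi>m \<phi>0 y) = riesz_proj y"
proof -
  note q = conjugate_exponent(1)[OF p]
  define a b where "a = 1 + tpow (- 1)" and "b = 1 - tpow (- 1)"
  define f' k' h' where "f' = a * \<phi>m" and "k' = b * inverse \<phi>m" and "h' = a * inverse \<phi>0"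
  have f': "f' \<in> conj_Hp p" and k': "k' \<in> conj_Hp q" and h': "h' \<in> Lp p"
    using f k h by (simp_all add: f'_def k'_def h'_def a_def b_def)
  obtain r where r: "r \<in> trig_poly" "y = b * r" using y by (auto simp: X1_def b_def)
  have bt: "b \<in> trig_poly" unfolding b_def by (intro L0.subspace_diff[OF subspace_trig_poly]) auto
  show yp: "y \<in> Lp p" using trig_poly_mult[OF bt r(1)] trig_poly_Lp[of p] p r(2) by auto
  have kr: "inverse \<phi>m * y = r * k'" by (simp only: r(2) k'_def mult_ac)
  define g where "g = riesz_proj (r * k')"
  have krq: "r * k' \<in> Lp q" and krK: "\<exists>K. \<forall>n>K. fourier_coeff (r * k') n = 0"
    using trig_poly_mult_conj_Hp[OF _ k' r(1)] q by auto
  have gq: "g \<in> Lp q" unfolding g_def by (rule riesz_proj_pair[OF q krq])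
  have gc: "fourier_coeff g n = (if n \<ge> 0 then fourier_coeff (r * k') n else 0)" for n
    unfolding g_def by (rule fourier_coeff_riesz_proj[OF q krq])
  obtain K where K: "\<And>n. n > K \<Longrightarrow> fourier_coeff (r * k') n = 0" using krK by blast
  have "{n. fourier_coeff g n \<noteq> 0} \<subseteq> {0..K}"
  proof
    fix n assume "n \<in> {n. fourier_coeff g n \<noteq> 0}"
    then have "n \<ge> 0" "fourier_coeff (r * k') n \<noteq> 0" unfolding gc by (auto split: if_splits)
    then show "n \<in> {0..K}" using K[of n] by (auto simp: not_less[symmetric])
  qed
  then have "finite {n. fourier_coeff g n \<noteq> 0}" by (rule finite_subset) simp
  then have gt: "g \<in> trig_poly" using trig_poly_finite_sum(2) Lp_subset_1[OF q gq] by blast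
  have "\<exists>e\<in>trig_poly. reflect e = e \<and> g + J g = a * e" unfolding a_def by (rule plus_J_factor[OF gt]) (simp add: gc)
  then obtain e where e: "e \<in> trig_poly" "reflect e = e" "g + J g = a * e" by blast
  have B: "B_op \<phi>m \<phi>0 y = inverse \<phi>0 * (g + J g)" by (simp add: B_op_def kr g_def Let_def)
  have Bh: "B_op \<phi>m \<phi>0 y = e * h'" unfolding B e(3) by (simp only: h'_def mult_ac)
  have "B_op \<phi>m \<phi>0 y = (1 + tpow (- 1)) * inverse \<phi>0 * e" unfolding B e(3) a_def[symmetric] by (simp only: mult_ac)
  then show "B_op \<phi>m \<phi>0 y \<in> X2 \<phi>0" unfolding X2_def using e by blast
  show Bp: "B_op \<phi>m \<phi>0 y \<in> Lp p" unfolding Bh using e h' p by (intro trig_poly_mult_Lp) auto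
  have Ja: "J (inverse \<phi>0 * (g + J g)) = inverse \<phi>0 * (g + J g)"
    by (simp add: J_mult reflect_inverse even J_add add.commute)
  then show "J (B_op \<phi>m \<phi>0 y) = B_op \<phi>m \<phi>0 y" unfolding B .
  define F where "F = \<psi> * B_op \<phi>m \<phi>0 y - y"
  \<comment> \<open>Both terms have negative indices only: \<open>J\<close> sends the analytic g
    there, and r k' - g is what P removes from r k'.\<close>
  define \<sigma> where "\<sigma> = J g - (r * k' - g)"
  have 1: "\<psi> * B_op \<phi>m \<phi>0 y = \<phi>m * (g + J g)"
  proof -
    have "\<psi> * B_op \<phi>m \<phi>0 y = (\<phi>0 * inverse \<phi>0) * (\<phi>m * (g + J g))" unfolding B \<psi>(2) by (simp only: mult_ac)
    then show ?thesis using unit_inverse[OF un(2)] by simp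
  qed
  have 2: "y = \<phi>m * (r * k')"
  proof -
    have "\<phi>m * (r * k') = (\<phi>m * inverse \<phi>m) * (b * r)" by (simp only: k'_def mult_ac)
    then show ?thesis using unit_inverse[OF un(1)] r(2) by simp
  qed
  have "F = \<phi>m * (g + J g) - \<phi>m * (r * k')" unfolding F_def 1 using 2 by simp
  then have F: "F = \<phi>m * \<sigma>" by (simp add: \<sigma>_def algebra_simps)
  have \<psi>B: "\<psi> * B_op \<phi>m \<phi>0 y \<in> Lp p" using Linf_mult_Lp[OF \<psi>(1) _ Bp] p by simp
  have Fp: "F \<in> Lp p" unfolding F_def using \<psi>B yp p by (intro Lp_diff) auto
  have aF: "a * F = f' * \<sigma>" unfolding F f'_def by (simp only: mult_ac)
  have Jg: "J g \<in> Lp q" using gq q by (simp add: Lp_J)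
  have \<sigma>q: "\<sigma> \<in> Lp q" unfolding \<sigma>_def using Jg gq krq q by (intro Lp_diff) auto
  have \<sigma>0: "fourier_coeff \<sigma> n = 0" if "n \<ge> 0" for n
  proof -
    have "J g \<in> Lp 1" "r * k' - g \<in> Lp 1" "r * k' \<in> Lp 1" "g \<in> Lp 1"
      using Lp_subset_1[OF q] Jg krq gq Lp_diff(1)[of q "r * k'" g] q by auto
    then show ?thesis using that by (simp add: \<sigma>_def fourier_coeff_diff fourier_coeff_J gc)
  qed
  have "fourier_coeff (a * F) n = 0" if "n \<ge> 0" for n
  proof -
    have "fourier_coeff (f' * (tpow (- n) * \<sigma>)) 0 = 0"
      using that \<sigma>q \<sigma>0 q by (intro conj_Hp_annihilate[OF p f']) (auto simp: Lp_tpow_mult fourier_coeff_shift)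
    moreover have "f' * (tpow (- n) * \<sigma>) = tpow (- n) * (f' * \<sigma>)" by (rule mult.left_commute)
    ultimately show ?thesis unfolding aF by (simp add: fourier_coeff_shift)
  qed
  then have "fourier_coeff F n = 0" if "n \<ge> 0" for n
    using divide_one_plus[OF Lp_subset_1[OF p(1) Fp]] that by (simp add: a_def)
  then have "riesz_proj F = 0" using riesz_proj_eq_0_iff[OF p(1) Fp] by blast
  moreover have "riesz_proj F = riesz_proj (\<psi> * B_op \<phi>m \<phi>0 y) - riesz_proj y"
    unfolding F_def by (rule riesz_proj_diff[OF p(1) \<psi>B yp])
  ultimately show "riesz_proj (\<psi> * B_op \<phi>m \<phi>0 y) = riesz_proj y" by simp
qed

subsection \<open>Factorization with index zero and invertibility\<close>

definition has_inverse :: "real \<Rightarrow> L0 \<Rightarrow> (L0 \<Rightarrow> L0) \<Rightarrow> bool" where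
  "has_inverse p \<psi> R \<longleftrightarrow> bounded_op (Hp p) (Lp_norm p) (Hp p) (Lp_norm p) R \<and>
     (\<forall>y\<in>Hp p. M_op \<psi> (R y) = y \<and> R (M_op \<psi> y) = y)"

text \<open>Boundedness of the inverse is the open mapping theorem; its linearity comes from
  injectivity.\<close>

lemma bijective_has_inverse:
  assumes p: "1 < p" and \<psi>: "\<psi> \<in> Linf"
    and surj: "Hp p \<subseteq> M_op \<psi> ` Hp p" and inj: "\<And>x. x \<in> Hp p \<Longrightarrow> M_op \<psi> x = 0 \<Longrightarrow> x = 0"
  obtains R where "has_inverse p \<psi> R"
proof -
  interpret L0_banach "Hp p" "Lp_norm p" by (rule L0_banach_Hp[OF p])
  let ?M = "M_op \<psi>"
  have M: "bounded_op (Hp p) (Lp_norm p) (Hp p) (Lp_norm p) ?M" by (rule M_op_bounded[OF p \<psi>])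
  have Madd: "?M (x + y) = ?M x + ?M y" "?M (c *\<^sub>C x) = c *\<^sub>C ?M x" if "x \<in> Hp p" "y \<in> Hp p" for x y c
    using M that by (auto simp: bounded_op_def linear_on_space_def)
  have MV: "?M x \<in> Hp p" if "x \<in> Hp p" for x using M that by (auto simp: bounded_op_def)
  have inj2: "x = y" if "x \<in> Hp p" "y \<in> Hp p" "?M x = ?M y" for x y
  proof -
    have "?M (x - y) = ?M x - ?M y"
      using Madd(1)[of x "(-1) *\<^sub>C y"] Madd(2)[of y y "-1"] that mem(4)[of y "-1"] by simp
    then show ?thesis using inj[of "x - y"] that by simp
  qed
  obtain C where C: "C \<ge> 0" "\<And>y. y \<in> Hp p \<Longrightarrow> \<exists>x\<in>Hp p. ?M x = y \<and> Lp_norm p x \<le> C * Lp_norm p y"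
    using open_mapping[OF M surj] by blast
  then obtain R where R: "\<And>y. y \<in> Hp p \<Longrightarrow> R y \<in> Hp p" "\<And>y. y \<in> Hp p \<Longrightarrow> ?M (R y) = y"
     "\<And>y. y \<in> Hp p \<Longrightarrow> Lp_norm p (R y) \<le> C * Lp_norm p y" by metis
  have "has_inverse p \<psi> R"
    unfolding has_inverse_def bounded_op_def linear_on_space_def
  proof (intro conjI ballI allI exI)
    show "R ` Hp p \<subseteq> Hp p" using R by auto
    show "R (f + g) = R f + R g" if "f \<in> Hp p" "g \<in> Hp p" for f g
      by (rule inj2) (use that R Madd in auto)
    show "R (c *\<^sub>C f) = c *\<^sub>C R f" if "f \<in> Hp p" for c f
      by (rule inj2) (use that R Madd(2)[OF R(1) R(1), OF that that] in auto)
    show "R (?M y) = y" if "y \<in> Hp p" for y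
      by (rule inj2) (use that R MV in auto)
  qed (use R in auto)
  then show ?thesis by (rule that)
qed

text \<open>In the proof, \<open>f = \<psi>h\<close> is antianalytic because \<open>M(\<psi>) (P h) = 1\<close>, and \<open>k\<close> comes from the
  functional that a similar equation for the adjoint provides. Then \<open>t f k\<close> is odd with
  leading term \<open>t\<close>, so \<open>f k = 1 - t\<^sup>-\<^sup>2\<close>; splitting the right-hand side into \<open>(1 + t\<^sup>-\<^sup>1) (1 - t\<^sup>-\<^sup>1)\<close>
  shows that \<open>f / (1 + t\<^sup>-\<^sup>1)\<close> is the factor \<open>\<phi>\<^sub>-\<close>.\<close>

lemma has_inverse_imp_factorization:
  assumes p: "1 < p" "1 / p + 1 / q = 1" and \<psi>: "\<psi> \<in> GLinf" and R: "has_inverse p \<psi> R"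
  shows "\<exists>\<phi>m \<phi>0. asymmetric_factorization p q \<psi> \<phi>m 0 \<phi>0"
proof -
  interpret L0_banach "Hp p" "Lp_norm p" by (rule L0_banach_Hp[OF p(1)])
  note q = conjugate_exponent(1)[OF p]
  have p1: "1 \<le> p" "0 < p" using p by auto
  note \<psi>' = GLinf_D[OF \<psi>]
  have RV: "\<And>y. y \<in> Hp p \<Longrightarrow> R y \<in> Hp p" and RM: "\<And>y. y \<in> Hp p \<Longrightarrow> M_op \<psi> (R y) = y" "\<And>y. y \<in> Hp p \<Longrightarrow> R (M_op \<psi> y) = y"
    and Radd: "\<And>x y. x \<in> Hp p \<Longrightarrow> y \<in> Hp p \<Longrightarrow> R (x + y) = R x + R y" and Rscale: "\<And>c x. x \<in> Hp p \<Longrightarrow> R (c *\<^sub>C x) = c *\<^sub>C R x"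
    using R by (auto simp: has_inverse_def bounded_op_def linear_on_space_def)
  obtain C0 where "\<And>y. y \<in> Hp p \<Longrightarrow> Lp_norm p (R y) \<le> C0 * Lp_norm p y" using R by (auto simp: has_inverse_def bounded_op_def)
  then have C: "Lp_norm p (R y) \<le> \<bar>C0\<bar> * Lp_norm p y" if "y \<in> Hp p" for y
    using that by (meson abs_ge_self Lp_norm_nonneg mult_right_mono order_trans)
  obtain D where D: "0 \<le> D" "\<And>f. f \<in> Lp p \<Longrightarrow> Lp_norm p (riesz_proj f) \<le> D * Lp_norm p f"
    using riesz_proj_bounded[OF p(1)] by blast
  obtain C\<psi> where C\<psi>: "0 \<le> C\<psi>" "\<And>f. f \<in> Lp p \<Longrightarrow> Lp_norm p (\<psi> * f) \<le> C\<psi> * Lp_norm p f"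
    using Linf_mult_bound[OF \<psi>'(1) p1(2)] by blast
  \<comment> \<open>The operator (I + J) R P, the candidate for the bounded extension of B. Its
    value at y is the only function z fixed by \<open>J\<close> with P(psi z) = P y; this uniqueness
    later identifies it with B on \<open>X1\<close>.\<close>
  define E where "E y = R (riesz_proj y) + J (R (riesz_proj y))" for y
  have RP: "R (riesz_proj y) \<in> Hp p" if "y \<in> Lp p" for y using that RV riesz_proj_Hp[OF p(1)] by blast
  have E: "E y \<in> Lp p" "J (E y) = E y" "riesz_proj (E y) = R (riesz_proj y)" if "y \<in> Lp p" for y
    unfolding E_def by (rule Hp_plus_J[OF p(1) RP[OF that]])+
  have EN: "Lp_norm p (E y) \<le> (2 * (\<bar>C0\<bar> * D)) * Lp_norm p y" if y: "y \<in> Lp p" for y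
  proof -
    have "Lp_norm p (E y) \<le> 2 * Lp_norm p (R (riesz_proj y))" unfolding E_def by (rule Hp_plus_J[OF p(1) RP[OF y]])
    also have "\<dots> \<le> 2 * (\<bar>C0\<bar> * Lp_norm p (riesz_proj y))" using C[OF riesz_proj_Hp[OF p(1) y]] by simp
    also have "\<dots> \<le> 2 * (\<bar>C0\<bar> * (D * Lp_norm p y))" using D(2)[OF y] by (intro mult_left_mono) auto
    finally show ?thesis by (simp add: mult_ac)
  qed
  have Eadd: "E (x + y) = E x + E y" if "x \<in> Lp p" "y \<in> Lp p" for x y
    using that by (simp add: E_def riesz_proj_add[OF p(1)] Radd riesz_proj_Hp[OF p(1)] J_add)
  have Escale: "E (c *\<^sub>C x) = c *\<^sub>C E x" if "x \<in> Lp p" for c x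
    using that by (simp add: E_def riesz_proj_cscale[OF p(1)] Rscale riesz_proj_Hp[OF p(1)] J_cscale L0.scale_right_distrib)
  have E_unique: "E y = z" if y: "y \<in> Lp p" and z: "z \<in> Lp p" "J z = z" "riesz_proj (\<psi> * z) = riesz_proj y" for y z
  proof -
    have x: "riesz_proj z \<in> Hp p" by (rule riesz_proj_Hp[OF p(1) z(1)])
    have "M_op \<psi> (riesz_proj z) = riesz_proj y"
      using M_op_eq[OF p(1) \<psi>'(1) x] J_fixed_decomp[OF p(1) z(1,2)] z(3) by simp
    then have "R (riesz_proj y) = riesz_proj z" using RM(2)[OF x] by simp
    then show ?thesis using J_fixed_decomp[OF p(1) z(1,2)] by (simp add: E_def)
  qed
  define h where "h = E 1"
  have h: "h \<in> Lp p" "J h = h" "riesz_proj h = R 1" using E[of 1] riesz_proj_id[OF p(1), of 1] by (simp_all add: h_def)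
  define f where "f = \<psi> * h"
  have fp: "f \<in> Lp p" unfolding f_def by (rule Linf_mult_Lp[OF \<psi>'(1) p1(2) h(1)])
  have "riesz_proj f = M_op \<psi> (R 1)"
    using M_op_eq[OF p(1) \<psi>'(1) RV[of 1]] riesz_proj_id[OF p(1), of 1] by (simp add: f_def h_def E_def)
  then have Pf: "riesz_proj f = 1" using RM(1)[of 1] by simp
  then have fc: "\<And>n. n \<ge> 0 \<Longrightarrow> fourier_coeff f n = fourier_coeff 1 n" using riesz_proj_eq_iff[OF p(1) fp, of 1] by auto
  have fH: "f \<in> conj_Hp p" and f0: "fourier_coeff f 0 = 1" using fp fc p by (simp_all add: conj_Hp_iff fourier_coeff_1)
  \<comment> \<open>The coefficient of index -1 of y - psi E y. It vanishes on all psi z with z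
    fixed by \<open>J\<close>, so its representing function g satisfies an adjoint equation: psi g
    annihilates these z.\<close>
  define \<Lambda> where "\<Lambda> y = fourier_coeff (tpow 1 * (y - \<psi> * E y)) 0" for y
  have in1: "y - \<psi> * E y \<in> Lp p" if "y \<in> Lp p" for y
    using that E(1)[OF that] p1 \<psi>' by (intro Lp_diff Linf_mult_Lp) auto
  have "bounded_functional (Lp p) (Lp_norm p) \<Lambda>"
    unfolding bounded_functional_def linear_on_space_def
  proof (intro conjI ballI allI exI)
    fix x y assume xy: "x \<in> Lp p" "y \<in> Lp p"
    have eq: "(x + y) - \<psi> * E (x + y) = (x - \<psi> * E x) + (y - \<psi> * E y)" using Eadd[OF xy] by (simp add: algebra_simps)
    show "\<Lambda> (x + y) = \<Lambda> x + \<Lambda> y"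
      unfolding \<Lambda>_def fourier_coeff_shift eq
      by (intro fourier_coeff_add Lp_subset_1[OF p(1)] in1 xy)
  next
    fix c x assume x: "x \<in> Lp p"
    have eq: "c *\<^sub>C x - \<psi> * E (c *\<^sub>C x) = c *\<^sub>C (x - \<psi> * E x)" using Escale[OF x] by (simp add: cscale_mult_right L0.scale_right_diff_distrib)
    show "\<Lambda> (c *\<^sub>C x) = c * \<Lambda> x" unfolding \<Lambda>_def fourier_coeff_shift eq by (rule fourier_coeff_cscale)
  next
    fix y assume y: "y \<in> Lp p"
    have "norm (\<Lambda> y) \<le> Lp_norm p (y - \<psi> * E y)" unfolding \<Lambda>_def fourier_coeff_shift by (rule fourier_coeff_le[OF p1(1) in1[OF y]])
    also have "\<dots> \<le> Lp_norm p y + Lp_norm p (\<psi> * E y)" using y E(1)[OF y] p1 \<psi>' by (intro Lp_diff Linf_mult_Lp) auto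
    also have "Lp_norm p (\<psi> * E y) \<le> C\<psi> * ((2 * (\<bar>C0\<bar> * D)) * Lp_norm p y)"
      using C\<psi>(2)[OF E(1)[OF y]] mult_left_mono[OF EN[OF y] C\<psi>(1)] by linarith
    finally show "norm (\<Lambda> y) \<le> (1 + C\<psi> * (2 * (\<bar>C0\<bar> * D))) * Lp_norm p y" by (simp add: algebra_simps)
  qed
  then obtain g where g: "g \<in> Lp q" "\<And>y. y \<in> Lp p \<Longrightarrow> \<Lambda> y = fourier_coeff (y * g) 0"
    using Lp_dual[OF p] by blast
  \<comment> \<open>E kills negative powers of t, so there the functional reads off the coefficient
    of index -1. Thus g has leading term t, and the shifted k is antianalytic with constant term
    1.\<close>
  have gc: "fourier_coeff g n = (if n = 1 then 1 else 0)" if n: "n > 0" for n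
  proof -
    have "riesz_proj (tpow (- n)) = 0"
      using n by (subst riesz_proj_eq_0_iff[OF p(1)]) (auto simp: fourier_coeff_tpow)
    moreover have "R 0 = 0" using Rscale[of 0 0] by simp
    ultimately have "E (tpow (- n)) = 0" by (simp add: E_def)
    then have "\<Lambda> (tpow (- n)) = (if n = 1 then 1 else 0)" by (simp add: \<Lambda>_def fourier_coeff_shift fourier_coeff_tpow)
    then show ?thesis using g(2)[of "tpow (- n)"] by (simp add: fourier_coeff_shift)
  qed
  define k where "k = tpow (- 1) * g"
  have kH: "k \<in> conj_Hp q" using g gc q by (simp add: k_def conj_Hp_iff Lp_tpow_mult fourier_coeff_shift)
  have k0: "fourier_coeff k 0 = 1" using gc[of 1] by (simp add: k_def fourier_coeff_shift)
  define w0 where "w0 = \<psi> * g"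
  have w0q: "w0 \<in> Lp q" unfolding w0_def using g \<psi>' q by (intro Linf_mult_Lp) auto
  have w0: "tpow 1 * reflect w0 = - w0"
  proof (rule annihilates_LJ[OF p w0q])
    fix x assume x: "x \<in> Hp p"
    have z: "x + J x \<in> Lp p" "J (x + J x) = x + J x" using Hp_plus_J[OF p(1) x] by simp_all
    have \<psi>z: "\<psi> * (x + J x) \<in> Lp p" using z \<psi>' p1 by (intro Linf_mult_Lp) auto
    have "E (\<psi> * (x + J x)) = x + J x" by (rule E_unique[OF \<psi>z z]) simp
    then have "\<Lambda> (\<psi> * (x + J x)) = 0" by (simp add: \<Lambda>_def)
    moreover have "\<psi> * (x + J x) * g = (x + J x) * w0" by (simp only: w0_def mult_ac)
    ultimately show "fourier_coeff ((x + J x) * w0) 0 = 0" using g(2)[OF \<psi>z] by simp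
  qed
  define w where "w = \<psi> * k"
  have ww0: "w = tpow (- 1) * w0" by (simp only: w_def w0_def k_def mult_ac)
  have w0w: "w0 = tpow 1 * w" by (simp add: ww0 tpow_mult_assoc)
  have wq: "w \<in> Lp q" unfolding ww0 using w0q q by (simp add: Lp_tpow_mult)
  have rw: "reflect w = - (tpow 1 * w)"
  proof -
    have "reflect w = tpow 1 * reflect w0" unfolding ww0 by (simp add: reflect_mult)
    also have "\<dots> = - w0" by (rule w0)
    finally show ?thesis by (simp only: w0w)
  qed
  have rh: "reflect h = tpow 1 * h" by (rule J_fixed_reflect[OF h(2)])
  have fk: "f * k = h * w" by (simp only: f_def w_def mult_ac)
  have fk_eq: "f * k = 1 - tpow (- 2)"
  proof -
    let ?u = "tpow 1 * (f * k)"
    have "reflect ?u = tpow (- 1) * ((tpow 1 * h) * (- (tpow 1 * w)))" by (simp add: fk reflect_mult rh rw)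
    also have "\<dots> = - ((tpow (- 1) * tpow 1) * (tpow 1 * (h * w)))" by (simp only: mult_ac mult_minus_right mult_minus_left)
    also have "\<dots> = - ?u" by (simp add: tpow_add fk)
    finally have "?u = fourier_coeff ?u 1 *\<^sub>C (tpow 1 - tpow (- 1))"
      using conj_Hp_mult[OF p fH kH] by (intro odd_function_eq) (auto simp: Lp_tpow_mult fourier_coeff_shift)
    also have "fourier_coeff ?u 1 = 1" using conj_Hp_mult(3)[OF p fH kH] by (simp add: fourier_coeff_shift f0 k0)
    finally have "?u = tpow 1 - tpow (- 1)" by simp
    then have "tpow (- 1) * ?u = tpow (- 1) * (tpow 1 - tpow (- 1))" by simp
    then show ?thesis by (simp add: tpow_mult_assoc right_diff_distrib tpow_add)
  qed
  define a b where "a = 1 + tpow (- 1)" and "b = 1 - tpow (- 1)"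
  have ua: "a * inverse a = 1" and ub: "b * inverse b = 1"
    using unit_inverse[OF unit_tpow_plus(1)] unit_inverse[OF unit_tpow_plus(2)] by (simp_all add: a_def b_def)
  have ab: "a * b = f * k" unfolding fk_eq a_def b_def by (simp add: algebra_simps tpow_add)
  define \<phi>m \<phi>0 where "\<phi>m = f * inverse a" and "\<phi>0 = w * inverse b"
  have fkab: "f * inverse a * (k * inverse b) = 1"
  proof -
    have "f * inverse a * (k * inverse b) = (f * k) * (inverse a * inverse b)" by (simp only: mult_ac)
    also have "\<dots> = (a * inverse a) * (b * inverse b)" unfolding ab[symmetric] by (simp only: mult_ac)
    finally show ?thesis by (simp add: ua ub)
  qed
  have im: "inverse \<phi>m = k * inverse b" unfolding \<phi>m_def by (rule inverse_eqI[OF fkab])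
  have i0: "inverse \<phi>0 = h * inverse a" unfolding \<phi>0_def
  proof (rule inverse_eqI)
    have "w * inverse b * (h * inverse a) = (h * w) * (inverse a * inverse b)" by (simp only: mult_ac)
    also have "\<dots> = f * inverse a * (k * inverse b)" unfolding fk[symmetric] by (simp only: mult_ac)
    finally show "w * inverse b * (h * inverse a) = 1" using fkab by simp
  qed
  have fact: "\<psi> = \<phi>m * \<phi>0"
  proof -
    have "\<phi>m * \<phi>0 = \<psi> * (f * inverse a * (k * inverse b))" unfolding \<phi>m_def \<phi>0_def w_def by (simp only: mult_ac)
    then show ?thesis by (simp add: fkab)
  qed
  have um: "unit \<phi>m" by (rule unitI[of _ "k * inverse b"]) (simp add: \<phi>m_def fkab)
  have u0: "unit \<phi>0" using \<psi>'(2) unit_multD(2)[of \<phi>m \<phi>0] fact by simp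
  have af: "a * \<phi>m = f"
  proof -
    have "a * \<phi>m = (a * inverse a) * f" unfolding \<phi>m_def by (simp only: mult_ac)
    then show ?thesis by (simp add: ua)
  qed
  have bk: "b * inverse \<phi>m = k"
  proof -
    have "b * inverse \<phi>m = (b * inverse b) * k" unfolding im by (simp only: mult_ac)
    then show ?thesis by (simp add: ub)
  qed
  have bw: "b * \<phi>0 = w"
  proof -
    have "b * \<phi>0 = (b * inverse b) * w" unfolding \<phi>0_def by (simp only: mult_ac)
    then show ?thesis by (simp add: ub)
  qed
  have ah: "a * inverse \<phi>0 = h"
  proof -
    have "a * inverse \<phi>0 = (a * inverse a) * h" unfolding i0 by (simp only: mult_ac)
    then show ?thesis by (simp add: ua)
  qed
  have ta: "tpow 1 * a = 1 + tpow 1" and tb: "tpow 1 * b = - (1 - tpow 1)" and rb: "reflect b = 1 - tpow 1"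
    by (simp_all add: a_def b_def algebra_simps tpow_add reflect_diff)
  \<comment> \<open>Reflection multiplies both w and its divisor 1 - t^(-1) by -t, so the quotient
    is even.\<close>
  have even: "reflect \<phi>0 = \<phi>0"
  proof -
    have "reflect b * reflect \<phi>0 = - (tpow 1 * (b * \<phi>0))" using rw bw by (metis reflect_mult)
    also have "\<dots> = - ((tpow 1 * b) * \<phi>0)" by (simp only: mult.assoc)
    also have "\<dots> = reflect b * \<phi>0" unfolding tb rb by (simp only: mult_minus_left minus_minus)
    finally show ?thesis by (rule unit_cancel[rotated]) (simp add: rb unit_tpow_plus)
  qed
  have evena: "reflect (abs_fun (1 + tpow 1)) = abs_fun (1 + tpow 1)" "reflect (abs_fun (1 - tpow 1)) = abs_fun (1 - tpow 1)"
    using reflect_abs_tpow[of 1] reflect_abs_tpow[of "-1"] by simp_all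
  have c1: "abs_fun (1 - tpow 1) * \<phi>0 \<in> Lp_even q"
  proof -
    have eq: "(1 - tpow 1) * \<phi>0 = - (tpow 1 * w)" unfolding bw[symmetric] mult.assoc[symmetric] tb by (simp only: mult_minus_left minus_minus)
    have "(1 - tpow 1) * \<phi>0 \<in> Lp q" unfolding eq using wq q by (intro Lp_uminus) (auto simp: Lp_tpow_mult)
    then have "abs_fun (1 - tpow 1) * \<phi>0 \<in> Lp q" using q by (intro dominated_Lp(1)[OF dominated_abs(3)]) auto
    then show ?thesis by (simp add: Lp_even_def reflect_mult evena even)
  qed
  have c2: "abs_fun (1 + tpow 1) * inverse \<phi>0 \<in> Lp_even p"
  proof -
    have eq: "(1 + tpow 1) * inverse \<phi>0 = tpow 1 * h" unfolding ah[symmetric] ta[symmetric] by (simp only: mult.assoc)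
    have "(1 + tpow 1) * inverse \<phi>0 \<in> Lp p" unfolding eq using h p1 by (simp add: Lp_tpow_mult)
    then have "abs_fun (1 + tpow 1) * inverse \<phi>0 \<in> Lp p" using p1 by (intro dominated_Lp(1)[OF dominated_abs(3)]) auto
    then show ?thesis by (simp add: Lp_even_def reflect_mult evena even reflect_inverse)
  qed
  have cf: "(1 + tpow (- 1)) * \<phi>m \<in> conj_Hp p" and ck: "(1 - tpow (- 1)) * inverse \<phi>m \<in> conj_Hp q" and ch: "(1 + tpow (- 1)) * inverse \<phi>0 \<in> Lp p"
    using af bk ah fH kH h by (simp_all add: a_def b_def)
  note Bs = B_op_solves[OF p \<psi>'(1) fact um u0 cf ck ch even]
  have "bounded_op (Lp p) (Lp_norm p) (Lp_J p) (Lp_norm p) E"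
    unfolding bounded_op_def linear_on_space_def
  proof (intro conjI ballI allI exI)
    show "E ` Lp p \<subseteq> Lp_J p" using E by (auto simp: Lp_J_iff[OF p1(1)])
    show "Lp_norm p (E f) \<le> (2 * (\<bar>C0\<bar> * D)) * Lp_norm p f" if "f \<in> Lp p" for f
      by (rule EN[OF that])
  qed (simp_all add: Eadd Escale)
  moreover have "\<forall>y\<in>X1. E y = B_op \<phi>m \<phi>0 y"
    using E_unique Bs by blast
  moreover have "\<psi> = \<phi>m * tpow 0 * \<phi>0" using fact by simp
  ultimately have "asymmetric_factorization p q \<psi> \<phi>m 0 \<phi>0"
    unfolding asymmetric_factorization_def using cf ck c1 c2 Bs(1) by blast
  then show ?thesis by blast
qed

text \<open>Let E be the bounded extension of B. Then P E is a right inverse of M(psi), by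
  continuity from \<open>X1\<close>. For injectivity, psi z for a kernel vector is paired with (1 -
  t^(-1)) / phi_-: the product is odd after a shift by t, its leading coefficient is 0, and so it
  vanishes.\<close>

lemma factorization_imp_has_inverse:
  assumes p: "1 < p" "1 / p + 1 / q = 1" and \<psi>: "\<psi> \<in> GLinf" and fac: "asymmetric_factorization p q \<psi> \<phi>m 0 \<phi>0"
  obtains R where "has_inverse p \<psi> R"
proof -
  note q = conjugate_exponent(1)[OF p]
  have p1: "1 \<le> p" "0 < p" using p by auto
  note \<psi>' = GLinf_D[OF \<psi>]
  have fact: "\<psi> = \<phi>m * \<phi>0" and cf: "(1 + tpow (- 1)) * \<phi>m \<in> conj_Hp p" and ck: "(1 - tpow (- 1)) * inverse \<phi>m \<in> conj_Hp q"
    and c1: "abs_fun (1 - tpow 1) * \<phi>0 \<in> Lp_even q" and c2: "abs_fun (1 + tpow 1) * inverse \<phi>0 \<in> Lp_even p"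
    using fac by (simp_all add: asymmetric_factorization_def)
  obtain E where Eb: "bounded_op (Lp p) (Lp_norm p) (Lp_J p) (Lp_norm p) E" and EB: "\<And>y. y \<in> X1 \<Longrightarrow> E y = B_op \<phi>m \<phi>0 y"
    using fac by (auto simp: asymmetric_factorization_def)
  have um: "unit \<phi>m" and u0: "unit \<phi>0" using \<psi>'(2) fact unit_multD[of \<phi>m \<phi>0] by simp_all
  have evena: "reflect (abs_fun (1 - tpow 1)) = abs_fun (1 - tpow 1)"
    using reflect_abs_tpow[of "-1"] by simp
  have "abs_fun (1 - tpow 1) * reflect \<phi>0 = abs_fun (1 - tpow 1) * \<phi>0"
    using c1 evena by (simp add: Lp_even_def reflect_mult)
  \<comment> \<open>Condition (ii) makes the product with the weight even; the weight is itself even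
    and nonzero almost everywhere, so it cancels.\<close>
  then have even: "reflect \<phi>0 = \<phi>0" by (rule unit_cancel[OF unit_tpow_plus(6)])
  have ch: "(1 + tpow (- 1)) * inverse \<phi>0 \<in> Lp p"
  proof -
    have "(1 + tpow 1) * inverse \<phi>0 \<in> Lp p"
      by (rule dominated_Lp(1)[OF dominated_abs(4)]) (use c2 p1 in \<open>auto simp: Lp_even_def\<close>)
    then have "tpow (- 1) * ((1 + tpow 1) * inverse \<phi>0) \<in> Lp p"
      by (subst Lp_tpow_mult(1)[OF p1(2)])
    moreover have eq: "tpow (- 1) * (1 + tpow 1) = 1 + tpow (- 1)" by (simp add: distrib_left tpow_add)
    ultimately show ?thesis by (simp only: mult.assoc[symmetric] eq)
  qed
  define w where "w = (1 - tpow (- 1)) * \<phi>0"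
  have wq: "w \<in> Lp q"
  proof -
    have "(1 - tpow 1) * \<phi>0 \<in> Lp q"
      by (rule dominated_Lp(1)[OF dominated_abs(4)]) (use c1 q in \<open>auto simp: Lp_even_def\<close>)
    then have "- (tpow (- 1) * ((1 - tpow 1) * \<phi>0)) \<in> Lp q" using q by (intro Lp_uminus) (auto simp: Lp_tpow_mult)
    moreover have "- (tpow (- 1) * ((1 - tpow 1) * \<phi>0)) = w"
      by (simp add: w_def algebra_simps tpow_mult_assoc tpow_add)
    ultimately show ?thesis by simp
  qed
  have rw: "reflect w = - (tpow 1 * w)"
    by (simp add: w_def reflect_mult reflect_diff even algebra_simps tpow_mult_assoc tpow_add)
  note Bs = B_op_solves[OF p \<psi>'(1) fact um u0 cf ck ch even]
  have EV: "E y \<in> Lp p" "J (E y) = E y" if "y \<in> Lp p" for y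
    using Eb that Lp_J_iff[OF p1(1), of "E y"] by (auto simp: bounded_op_def)
  have Eadd: "E (x + y) = E x + E y" and Escale: "E (c *\<^sub>C x) = c *\<^sub>C E x" if "x \<in> Lp p" "y \<in> Lp p" for x y c
    using Eb that by (auto simp: bounded_op_def linear_on_space_def)
  obtain CE0 where "\<And>y. y \<in> Lp p \<Longrightarrow> Lp_norm p (E y) \<le> CE0 * Lp_norm p y" using Eb by (auto simp: bounded_op_def)
  then have CE: "Lp_norm p (E y) \<le> \<bar>CE0\<bar> * Lp_norm p y" if "y \<in> Lp p" for y
    using that by (meson abs_ge_self Lp_norm_nonneg mult_right_mono order_trans)
  obtain D where D: "0 \<le> D" "\<And>f. f \<in> Lp p \<Longrightarrow> Lp_norm p (riesz_proj f) \<le> D * Lp_norm p f"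
    using riesz_proj_bounded[OF p(1)] by blast
  obtain C\<psi> where C\<psi>: "0 \<le> C\<psi>" "\<And>f. f \<in> Lp p \<Longrightarrow> Lp_norm p (\<psi> * f) \<le> C\<psi> * Lp_norm p f"
    using Linf_mult_bound[OF \<psi>'(1) p1(2)] by blast
  have \<psi>E: "\<psi> * E y \<in> Lp p" if "y \<in> Lp p" for y using EV(1)[OF that] \<psi>' p1 by (intro Linf_mult_Lp) auto
  \<comment> \<open>The defect in the equation P(psi E y) = P y. It is bounded in y and vanishes on
    \<open>X1\<close>, hence everywhere by density.\<close>
  define Z where "Z y = riesz_proj (\<psi> * E y - y)" for y
  have Zin: "\<psi> * E y - y \<in> Lp p" if "y \<in> Lp p" for y using \<psi>E[OF that] that p1 by (intro Lp_diff) auto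
  define CZ where "CZ = D * (C\<psi> * \<bar>CE0\<bar> + 1)"
  have ZN: "Lp_norm p (Z y) \<le> CZ * Lp_norm p y" if y: "y \<in> Lp p" for y
  proof -
    have "Lp_norm p (Z y) \<le> D * Lp_norm p (\<psi> * E y - y)" unfolding Z_def by (rule D(2)[OF Zin[OF y]])
    also have "\<dots> \<le> D * (Lp_norm p (\<psi> * E y) + Lp_norm p y)"
      using \<psi>E[OF y] y p1 D by (intro mult_left_mono Lp_diff) auto
    also have "\<dots> \<le> D * (C\<psi> * (\<bar>CE0\<bar> * Lp_norm p y) + Lp_norm p y)"
      using C\<psi>(2)[OF EV(1)[OF y]] mult_left_mono[OF CE[OF y] C\<psi>(1)] D by (intro mult_left_mono add_right_mono) auto
    finally show ?thesis by (simp add: CZ_def algebra_simps)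
  qed
  have Z0: "Z y = 0" if y: "y \<in> Lp p" for y
  proof -
    have "Lp_norm p (Z y) \<le> e * CZ" if e: "e > 0" for e
    proof -
      obtain r where r: "r \<in> trig_poly" "Lp_norm p (y - (1 - tpow (- 1)) * r) < e" using X1_dense[OF p1(1) y e] by blast
      define v where "v = (1 - tpow (- 1)) * r"
      have v: "v \<in> X1" unfolding v_def X1_def using r(1) by blast
      have vp: "v \<in> Lp p" by (rule Bs(4)[OF v])
      have "Z v = riesz_proj (\<psi> * E v) - riesz_proj v" unfolding Z_def by (rule riesz_proj_diff[OF p(1) \<psi>E[OF vp] vp])
      then have Zv: "Z v = 0" using Bs(5)[OF v] EB[OF v] by simp
      have d: "y - v \<in> Lp p" using y vp p1 by (intro Lp_diff) auto
      have Ey: "E y = E (y - v) + E v" using Eadd[OF d vp] by simp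
      have eq: "\<psi> * E y - y = (\<psi> * E (y - v) - (y - v)) + (\<psi> * E v - v)"
        unfolding Ey by (simp add: algebra_simps)
      have "Z y = Z (y - v) + Z v"
        unfolding Z_def eq by (rule riesz_proj_add[OF p(1) Zin[OF d] Zin[OF vp]])
      then have "Lp_norm p (Z y) \<le> CZ * Lp_norm p (y - v)" using ZN[OF d] Zv by simp
      also have "\<dots> \<le> CZ * e" using r(2) C\<psi> D unfolding v_def CZ_def by (intro mult_left_mono) auto
      finally show ?thesis by (simp add: mult.commute)
    qed
    moreover have "0 \<le> CZ" using C\<psi> D by (simp add: CZ_def)
    ultimately have "Lp_norm p (Z y) \<le> 0" by (rule le_0_if_le_eps)
    then have "Lp_norm p (Z y) = 0" using Lp_norm_nonneg[of p "Z y"] by linarith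
    moreover have "Z y \<in> Lp p" unfolding Z_def by (rule riesz_proj_pair[OF p(1) Zin[OF y]])
    ultimately show ?thesis using Lp_norm_eq_0 p1 by blast
  qed
  define R where "R y = riesz_proj (E y)" for y
  have RV: "R y \<in> Hp p" if "y \<in> Lp p" for y unfolding R_def by (rule riesz_proj_Hp[OF p(1) EV(1)[OF that]])
  have MR: "M_op \<psi> (R y) = y" if y: "y \<in> Hp p" for y
  proof -
    have yp: "y \<in> Lp p" using y by (simp add: Hp_iff)
    have "M_op \<psi> (R y) = riesz_proj (\<psi> * E y)"
      using M_op_eq[OF p(1) \<psi>'(1) RV[OF yp]] J_fixed_decomp[OF p(1) EV[OF yp]] by (simp add: R_def)
    also have "\<dots> = riesz_proj y" using Z0[OF yp] riesz_proj_diff[OF p(1) \<psi>E[OF yp] yp] by (simp add: Z_def)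
    finally show ?thesis using riesz_proj_id[OF p(1) y] by simp
  qed
  have inj: "x = 0" if x: "x \<in> Hp p" and 0: "M_op \<psi> x = 0" for x
  proof -
    define z where "z = x + J x"
    have z: "z \<in> Lp p" "J z = z" "riesz_proj z = x" using Hp_plus_J[OF p(1) x] by (simp_all add: z_def)
    define n where "n = \<psi> * z"
    have np: "n \<in> Lp p" unfolding n_def using z \<psi>' p1 by (intro Linf_mult_Lp) auto
    have "riesz_proj n = 0" using 0 M_op_eq[OF p(1) \<psi>'(1) x] by (simp add: n_def z_def)
    then have n0: "\<And>m. m \<ge> 0 \<Longrightarrow> fourier_coeff n m = 0" using riesz_proj_eq_0_iff[OF p(1) np] by blast
    then have nH: "n \<in> conj_Hp p" using np p1 by (simp add: conj_Hp_iff)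
    define k where "k = (1 - tpow (- 1)) * inverse \<phi>m"
    have kH: "k \<in> conj_Hp q" using ck by (simp add: k_def)
    have nk: "n * k = z * w"
    proof -
      have "n * k = (\<phi>m * inverse \<phi>m) * (z * ((1 - tpow (- 1)) * \<phi>0))" unfolding n_def k_def fact by (simp only: mult_ac)
      then show ?thesis using unit_inverse[OF um] by (simp add: w_def)
    qed
    let ?u = "tpow 1 * (n * k)"
    have "reflect ?u = tpow (- 1) * ((tpow 1 * z) * (- (tpow 1 * w)))"
      by (simp add: nk reflect_mult J_fixed_reflect[OF z(2)] rw)
    also have "\<dots> = - ((tpow (- 1) * tpow 1) * (tpow 1 * (z * w)))" by (simp only: mult_ac mult_minus_right mult_minus_left)
    also have "\<dots> = - ?u" by (simp add: tpow_add nk)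
    finally have "?u = fourier_coeff ?u 1 *\<^sub>C (tpow 1 - tpow (- 1))"
      using conj_Hp_mult[OF p nH kH] by (intro odd_function_eq) (auto simp: Lp_tpow_mult fourier_coeff_shift)
    \<comment> \<open>The leading coefficient is the product of the constant terms, and n has
      constant term 0 because x is in the kernel.\<close>
    also have "fourier_coeff ?u 1 = 0" using conj_Hp_mult(3)[OF p nH kH] n0[of 0] by (simp add: fourier_coeff_shift)
    finally have "tpow 1 * (n * k) = 0" by simp
    then have "tpow 1 * (n * k) = tpow 1 * 0" by simp
    then have "n * k = 0" by (rule unit_cancel[OF unit_tpow])
    then have "k * n = k * 0" by (simp add: mult.commute)
    moreover have "unit k" unfolding k_def
      using um by (intro unit_mult unit_tpow_plus) (rule unitI[of _ \<phi>m], simp add: unit_def mult.commute)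
    ultimately have "n = 0" using unit_cancel by blast
    then have "\<psi> * z = \<psi> * 0" by (simp add: n_def)
    then have "z = 0" by (rule unit_cancel[OF \<psi>'(2)])
    then have "x = riesz_proj 0" using z(3) by simp
    then show ?thesis using riesz_proj_id[OF p(1), of 0] by (simp add: Hp_iff)
  qed
  have "Hp p \<subseteq> M_op \<psi> ` Hp p"
  proof
    fix y assume "y \<in> Hp p"
    then show "y \<in> M_op \<psi> ` Hp p" using MR RV by (metis Hp_iff image_eqI)
  qed
  then show ?thesis using bijective_has_inverse[OF p(1) \<psi>'(1)] inj that by blast
qed

subsection \<open>Shifts\<close>

definition bshift :: "nat \<Rightarrow> L0 \<Rightarrow> L0" where
  "bshift n y = riesz_proj (tpow (- int n) * y)"

abbreviation mono_t :: "nat \<Rightarrow> L0" where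
  "mono_t j \<equiv> tpow (int j)"

context
  fixes p :: real
  assumes p: "1 < p"
begin

lemma Hp_Lp: "y \<in> Hp p \<Longrightarrow> y \<in> Lp p" "y \<in> Hp p \<Longrightarrow> y \<in> Lp 1" "y \<in> Hp p \<Longrightarrow> tpow m * y \<in> Lp p"
  using p Lp_subset_1[OF p] by (auto simp: Hp_iff Lp_tpow_mult)

lemma bshift_Hp: "y \<in> Hp p \<Longrightarrow> bshift n y \<in> Hp p"
  unfolding bshift_def by (intro riesz_proj_Hp[OF p] Hp_Lp)

lemma fourier_coeff_bshift:
  assumes "y \<in> Hp p"
  shows "fourier_coeff (bshift n y) m = (if m \<ge> 0 then fourier_coeff y (m + int n) else 0)"
  unfolding bshift_def by (simp add: fourier_coeff_riesz_proj[OF p Hp_Lp(3)[OF assms]] fourier_coeff_shift)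

lemma bshift_bounded: "bounded_op (Hp p) (Lp_norm p) (Hp p) (Lp_norm p) (bshift n)"
proof -
  obtain D where D: "0 \<le> D" "\<And>f. f \<in> Lp p \<Longrightarrow> Lp_norm p (riesz_proj f) \<le> D * Lp_norm p f"
    using riesz_proj_bounded[OF p] by blast
  show ?thesis
    unfolding bounded_op_def linear_on_space_def
  proof (intro conjI ballI allI exI)
    show "bshift n ` Hp p \<subseteq> Hp p" using bshift_Hp by auto
    show "bshift n (f + g) = bshift n f + bshift n g" if "f \<in> Hp p" "g \<in> Hp p" for f g
      unfolding bshift_def distrib_left using that by (intro riesz_proj_add[OF p] Hp_Lp)
    show "bshift n (c *\<^sub>C f) = c *\<^sub>C bshift n f" if "f \<in> Hp p" for c f
      unfolding bshift_def cscale_mult_right using that by (intro riesz_proj_cscale[OF p] Hp_Lp)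
    show "Lp_norm p (bshift n f) \<le> D * Lp_norm p f" if "f \<in> Hp p" for f
      using D(2)[OF Hp_Lp(3)[OF that], of "- int n"] p by (simp add: bshift_def Lp_tpow_mult)
  qed
qed

lemma bshift_mono: "y \<in> Hp p \<Longrightarrow> mono_t n * y \<in> Hp p" "y \<in> Hp p \<Longrightarrow> bshift n (mono_t n * y) = y"
proof -
  assume y: "y \<in> Hp p"
  then show "mono_t n * y \<in> Hp p" using p by (auto simp: Hp_iff Lp_tpow_mult fourier_coeff_shift)
  show "bshift n (mono_t n * y) = y" unfolding bshift_def tpow_mult_assoc using riesz_proj_id[OF p y] by simp
qed

lemma bshift_kernel:
  assumes y: "y \<in> Hp p"
  shows "bshift n y = 0 \<longleftrightarrow> y = (\<Sum>j<n. fourier_coeff y (int j) *\<^sub>C mono_t j)"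
proof -
  let ?s = "\<Sum>j<n. fourier_coeff y (int j) *\<^sub>C mono_t j"
  have s1: "?s \<in> Lp 1" by (intro L0.subspace_sum[OF subspace_Lp] Lp_cscale) auto
  have sc: "fourier_coeff ?s m = (if 0 \<le> m \<and> m < int n then fourier_coeff y m else 0)" for m
  proof -
    have "fourier_coeff ?s m = (\<Sum>j<n. fourier_coeff y (int j) * (if int j = m then 1 else 0))"
      by (subst fourier_coeff_sum) (auto simp: Lp_cscale fourier_coeff_cscale fourier_coeff_tpow)
    also have "\<dots> = (\<Sum>j<n. if j = nat m \<and> 0 \<le> m then fourier_coeff y m else 0)"
      by (intro sum.cong) auto
    also have "\<dots> = (if 0 \<le> m \<and> m < int n then fourier_coeff y m else 0)"
      by (cases "0 \<le> m") (auto simp: sum.delta)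
    finally show ?thesis .
  qed
  show ?thesis
  proof
    assume z: "bshift n y = 0"
    show "y = ?s"
    proof (rule fourier_coeff_unique[OF Hp_Lp(2)[OF y] s1])
      fix m
      have "fourier_coeff y m = 0" if "m \<ge> int n"
        using fourier_coeff_bshift[OF y, of n "m - int n"] z that by simp
      then show "fourier_coeff y m = fourier_coeff ?s m" using y unfolding sc by (auto simp: Hp_iff)
    qed
  next
    assume eq: "y = ?s"
    have "fourier_coeff y (m + int n) = 0" if "m \<ge> 0" for m
      using sc[of "m + int n"] that unfolding eq[symmetric] by simp
    then have "fourier_coeff (bshift n y) m = 0" for m using fourier_coeff_bshift[OF y, of n m] by simp
    then show "bshift n y = 0" using Hp_Lp(2)[OF bshift_Hp[OF y]] by (intro fourier_coeff_unique) auto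
  qed
qed

lemma bshift_mono_0: "j < n \<Longrightarrow> bshift n (mono_t j) = 0"
proof -
  assume j: "j < n"
  have m: "mono_t j \<in> Hp p" by simp
  have "fourier_coeff (bshift n (mono_t j)) k = 0" for k
    using j fourier_coeff_bshift[OF m, of n k] by (simp add: fourier_coeff_tpow)
  then show ?thesis using Hp_Lp(2)[OF bshift_Hp[OF m]] by (intro fourier_coeff_unique) auto
qed

text \<open>What P discards has negative indices, and multiplication by t^(-n) with n >= 0 moves it
  further to the left. So projecting before the shift changes nothing after the final
  projection.\<close>

lemma M_op_bshift:
  assumes \<phi>: "\<phi> \<in> Linf" "tpow (- int n) * \<phi> \<in> Linf" and x: "x \<in> Hp p"
  shows "M_op (tpow (- int n) * \<phi>) x = bshift n (M_op \<phi> x)"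
proof -
  let ?z = "\<phi> * (x + J x)"
  have z: "?z \<in> Lp p" using \<phi> Hp_plus_J(1)[OF p x] p by (intro Linf_mult_Lp) auto
  have tz: "tpow (- int n) * ?z \<in> Lp p" using z p by (simp add: Lp_tpow_mult)
  have Pz: "riesz_proj ?z \<in> Hp p" by (rule riesz_proj_Hp[OF p z])
  have "M_op (tpow (- int n) * \<phi>) x = riesz_proj (tpow (- int n) * ?z)"
    using M_op_eq[OF p \<phi>(2) x] by (simp only: mult.assoc)
  also have "\<dots> = bshift n (riesz_proj ?z)"
    by (subst riesz_proj_eq_iff[OF p tz bshift_Hp[OF Pz]])
       (simp add: fourier_coeff_bshift[OF Pz] fourier_coeff_riesz_proj[OF p z] fourier_coeff_shift)
  finally show ?thesis using M_op_eq[OF p \<phi>(1) x] by simp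
qed

end

lemma Linf_tpow_mult: "\<phi> \<in> Linf \<Longrightarrow> tpow n * \<phi> \<in> Linf"
proof -
  assume \<phi>: "\<phi> \<in> Linf"
  obtain u where u [measurable]: "u \<in> borel_measurable borel" and e: "\<phi> = abs_L0 u" by (rule L0_exhaust)
  obtain C where C: "AE t in circle_measure. norm (u t) \<le> C"
    using \<phi> u by (auto simp: Linf_def e ess_bounded.abs_eq)
  have "AE t in circle_measure. norm (t powi n * u t) \<le> C"
    using C AE_circle_norm by eventually_elim (simp add: norm_mult norm_power_int)
  then show "tpow n * \<phi> \<in> Linf"
    by (auto simp: Linf_def e tpow.abs_eq times_L0.abs_eq ess_bounded.abs_eq)
qed

lemma GLinf_tpow_mult: "\<phi> \<in> GLinf \<Longrightarrow> tpow n * \<phi> \<in> GLinf"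
proof -
  assume "\<phi> \<in> GLinf"
  then obtain g where g: "\<phi> \<in> Linf" "g \<in> Linf" "\<phi> * g = 1" by (auto simp: GLinf_def)
  have "(tpow n * \<phi>) * (tpow (- n) * g) = (tpow n * tpow (- n)) * (\<phi> * g)" by (simp only: mult_ac)
  then have "(tpow n * \<phi>) * (tpow (- n) * g) = 1" using g by (simp add: tpow_add)
  then show "tpow n * \<phi> \<in> GLinf" using g Linf_tpow_mult unfolding GLinf_def by blast
qed

subsection \<open>Invertibility of a shifted operator\<close>

text \<open>The closed range of finite codimension is complemented by finitely many monomials t^j, j
  < n. The n-fold backward shift kills exactly these while it is onto, so its composition with
  M(phi) is surjective.\<close>

lemma fredholm_imp_surjective:
  assumes p: "1 < p" and \<phi>: "\<phi> \<in> GLinf" and fred: "fredholm (Hp p) (Lp_norm p) (M_op \<phi>)"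
  shows "\<exists>n F. finite F \<and> Hp p \<subseteq> M_op (tpow (- int n) * \<phi>) ` Hp p \<and> ker_on (Hp p) (M_op (tpow (- int n) * \<phi>)) \<subseteq> L0.span F"
proof -
  interpret L0_banach "Hp p" "Lp_norm p" by (rule L0_banach_Hp[OF p])
  have \<phi>L: "tpow (- int n) * \<phi> \<in> Linf" for n using GLinf_D(1)[OF GLinf_tpow_mult[OF \<phi>]] .
  note \<phi>' = GLinf_D(1)[OF \<phi>]
  let ?M = "M_op \<phi>" and ?Mn = "\<lambda>n. M_op (tpow (- int n) * \<phi>)"
  have Mn: "?Mn n x = bshift n (?M x)" if "x \<in> Hp p" for n x by (rule M_op_bshift[OF p \<phi>' \<phi>L that])
  have bM: "bounded_op (Hp p) (Lp_norm p) (Hp p) (Lp_norm p) ?M" by (rule M_op_bounded[OF p \<phi>'])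
  then have MV: "?M x \<in> Hp p" and Madd: "?M (x + y) = ?M x + ?M y" and Mscale: "?M (c *\<^sub>C x) = c *\<^sub>C ?M x" if "x \<in> Hp p" "y \<in> Hp p" for x y c
    using that by (auto simp: bounded_op_def linear_on_space_def)
  have bS: "bshift n (x + y) = bshift n x + bshift n y" "bshift n (c *\<^sub>C x) = c *\<^sub>C bshift n x" if "x \<in> Hp p" "y \<in> Hp p" for x y c n
    using bshift_bounded[OF p, of n] that by (auto simp: bounded_op_def linear_on_space_def)
  have sub: "L0.subspace (?M ` Hp p)"
  proof (rule L0.subspaceI)
    show "0 \<in> ?M ` Hp p" using Mscale[of 0 0 0] by (auto intro!: image_eqI[of _ _ 0])
    show "x + y \<in> ?M ` Hp p" if xy: "x \<in> ?M ` Hp p" "y \<in> ?M ` Hp p" for x y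
    proof -
      obtain u v where uv: "u \<in> Hp p" "x = ?M u" "v \<in> Hp p" "y = ?M v" using xy by blast
      then have "x + y = ?M (u + v)" using Madd by simp
      then show ?thesis using uv by blast
    qed
    show "c *\<^sub>C x \<in> ?M ` Hp p" if x: "x \<in> ?M ` Hp p" for c x
    proof -
      obtain u where u: "u \<in> Hp p" "x = ?M u" using x by blast
      then have "c *\<^sub>C x = ?M (c *\<^sub>C u)" using Mscale by simp
      then show ?thesis using u by blast
    qed
  qed
  obtain F where F: "finite F" "F \<subseteq> Hp p" "Hp p \<subseteq> L0.span (F \<union> ?M ` Hp p)"
    using fred by (auto simp: fredholm_def)
  have closed: "norm_closed_in (Hp p) (Lp_norm p) (?M ` Hp p)" using fred by (simp add: fredholm_def)
  have dense: "\<exists>s\<in>L0.span (range mono_t). Lp_norm p (y - s) < \<epsilon>" if y: "y \<in> Hp p" and e: "\<epsilon> > 0" for y \<epsilon>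
  proof -
    obtain D where D: "0 \<le> D" "\<And>f. f \<in> Lp p \<Longrightarrow> Lp_norm p (riesz_proj f) \<le> D * Lp_norm p f"
      using riesz_proj_bounded[OF p] by blast
    have "\<epsilon> / (D + 1) > 0" using e D by simp
    then obtain r where r: "r \<in> trig_poly" "Lp_norm p (y - r) < \<epsilon> / (D + 1)"
      using trig_poly_dense[of p y] p y by (metis Hp_iff less_imp_le)
    have rp: "r \<in> Lp p" using r trig_poly_Lp[of p] p by auto
    obtain h where h: "h \<in> trig_poly" "riesz_pair r h" using trig_poly_riesz_pair[OF r(1)] by blast
    have hr: "h = riesz_proj r" using h by (simp add: riesz_proj_eqI)
    have "Lp_norm p (y - h) = Lp_norm p (riesz_proj (y - r))"
      using riesz_proj_diff[OF p _ rp, of y] riesz_proj_id[OF p y] y by (simp add: hr Hp_iff)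
    also have "\<dots> \<le> D * Lp_norm p (y - r)" using y rp p by (intro D(2) Lp_diff) (auto simp: Hp_iff)
    also have "\<dots> \<le> D * (\<epsilon> / (D + 1))" using r D by (intro mult_left_mono) auto
    also have "\<dots> < \<epsilon>" using D e by (simp add: field_simps)
    finally have "Lp_norm p (y - h) < \<epsilon>" .
    moreover have "h \<in> L0.span (range mono_t)"
    proof -
      have h1: "h \<in> Lp 1" using h trig_poly_Lp[of 1] by auto
      have "tpow n \<in> L0.span (range mono_t)" if "fourier_coeff h n \<noteq> 0" for n
      proof -
        have "n \<ge> 0" using that h(2) by (auto simp: riesz_pair_def split: if_splits)
        then have "tpow n = mono_t (nat n)" by simp
        then show ?thesis by (metis L0.span_base rangeI)
      qed
      then have "(\<Sum>n\<in>{n. fourier_coeff h n \<noteq> 0}. fourier_coeff h n *\<^sub>C tpow n) \<in> L0.span (range mono_t)"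
        by (intro L0.span_sum L0.span_scale) auto
      then show ?thesis using trig_poly_finite_sum(1)[OF h1 trig_poly_finite_coeffs[OF h(1)]] by simp
    qed
    ultimately show ?thesis by blast
  qed
  obtain n where n: "Hp p \<subseteq> L0.span (mono_t ` {..<n} \<union> ?M ` Hp p)"
    using dense_complement[OF F(1) sub _ closed F(3), of mono_t] MV dense by auto
  have surj: "Hp p \<subseteq> ?Mn n ` Hp p"
  proof
    fix y assume y: "y \<in> Hp p"
    \<comment> \<open>y is the n-fold backward shift of t^n y; splitting the latter into a
      polynomial of degree below n and an element of the range leaves only the range part after
      shifting.\<close>
    have "mono_t n * y \<in> L0.span (mono_t ` {..<n} \<union> ?M ` Hp p)" using n bshift_mono(1)[OF p y] by blast
    then obtain a b where ab: "mono_t n * y = a + b" "a \<in> L0.span (mono_t ` {..<n})" "b \<in> L0.span (?M ` Hp p)"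
      unfolding L0.span_Un by blast
    have "b \<in> ?M ` Hp p" using ab(3) sub by (simp add: L0.span_eq_iff[THEN iffD2])
    then obtain x where x: "x \<in> Hp p" "b = ?M x" by blast
    have "a \<in> Hp p \<and> bshift n a = 0"
    proof -
      have "L0.subspace {a \<in> Hp p. bshift n a = 0}"
      proof (rule L0.subspaceI)
        show "0 \<in> {a \<in> Hp p. bshift n a = 0}" using bS(2)[of 0 0 n 0] by simp
        show "u + v \<in> {a \<in> Hp p. bshift n a = 0}" if "u \<in> {a \<in> Hp p. bshift n a = 0}" "v \<in> {a \<in> Hp p. bshift n a = 0}" for u v
          using that bS(1)[of u v n] by simp
        show "c *\<^sub>C u \<in> {a \<in> Hp p. bshift n a = 0}" if "u \<in> {a \<in> Hp p. bshift n a = 0}" for c u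
          using that bS(2)[of u u n c] by simp
      qed
      moreover have "mono_t ` {..<n} \<subseteq> {a \<in> Hp p. bshift n a = 0}" using bshift_mono_0[OF p] by auto
      ultimately show ?thesis using L0.span_minimal ab(2) by blast
    qed
    then have "bshift n (mono_t n * y) = bshift n b" unfolding ab(1) using bS(1)[of a b n] MV[OF x(1) x(1)] x(2) by simp
    then have "y = ?Mn n x" using bshift_mono(2)[OF p y] Mn[OF x(1)] x(2) by simp
    then show "y \<in> ?Mn n ` Hp p" using x(1) by blast
  qed
  \<comment> \<open>One shift enlarges the kernel by at most one dimension: vectors of the new
    kernel are mapped to constants by the old operator, and a single preimage of 1, if there is one,
    accounts for them.\<close>
  have "\<exists>F. finite F \<and> ker_on (Hp p) (?Mn n) \<subseteq> L0.span F" for n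
  proof (induction n)
    case 0
    then show ?case using fred by (auto simp: fredholm_def)
  next
    case (Suc n)
    then obtain F where F: "finite F" "ker_on (Hp p) (?Mn n) \<subseteq> L0.span F" by blast
    let ?A = "?Mn n"
    have bA: "bounded_op (Hp p) (Lp_norm p) (Hp p) (Lp_norm p) ?A" by (rule M_op_bounded[OF p \<phi>L])
    then have AV: "?A x \<in> Hp p" and Aadd: "?A (x + y) = ?A x + ?A y" and Ascale: "?A (c *\<^sub>C x) = c *\<^sub>C ?A x" if "x \<in> Hp p" "y \<in> Hp p" for x y c
      using that by (auto simp: bounded_op_def linear_on_space_def)
    have "tpow (- int (Suc n)) * \<phi> = tpow (- int 1) * (tpow (- int n) * \<phi>)" by (simp add: tpow_mult_assoc)
    then have step: "?Mn (Suc n) x = bshift 1 (?A x)" if "x \<in> Hp p" for x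
      using M_op_bshift[OF p \<phi>L[of n], of 1 x] \<phi>L[of "Suc n"] that by simp
    have k: "?A x = fourier_coeff (?A x) 0 *\<^sub>C 1" if "x \<in> Hp p" "?Mn (Suc n) x = 0" for x
      using bshift_kernel[OF p AV[OF that(1) that(1)], of 1] step[OF that(1)] that(2) by simp
    show ?case
    proof (cases "\<exists>x0\<in>Hp p. ?A x0 = 1")
      case True
      then obtain x0 where x0: "x0 \<in> Hp p" "?A x0 = 1" by blast
      have "ker_on (Hp p) (?Mn (Suc n)) \<subseteq> L0.span (insert x0 F)"
      proof
        fix x assume "x \<in> ker_on (Hp p) (?Mn (Suc n))"
        then have x: "x \<in> Hp p" "?Mn (Suc n) x = 0" by (simp_all add: ker_on_def)
        define c where "c = fourier_coeff (?A x) 0"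
        have "?A (x + (- c) *\<^sub>C x0) = ?A x + (- c) *\<^sub>C ?A x0"
          using Aadd[OF x(1), of "(- c) *\<^sub>C x0"] Ascale[OF x0(1) x0(1), of "- c"] mem(4)[OF x0(1), of "- c"] by simp
        also have "\<dots> = 0" using k[OF x] x0(2) by (simp add: c_def)
        finally have "x - c *\<^sub>C x0 \<in> ker_on (Hp p) ?A" using x x0 by (simp add: ker_on_def)
        then have "x - c *\<^sub>C x0 \<in> L0.span F" using F by blast
        then show "x \<in> L0.span (insert x0 F)" unfolding L0.span_breakdown_eq by blast
      qed
      then show ?thesis using F(1) by (intro exI[of _ "insert x0 F"]) auto
    next
      case False
      have "ker_on (Hp p) (?Mn (Suc n)) \<subseteq> ker_on (Hp p) ?A"
      proof
        fix x assume "x \<in> ker_on (Hp p) (?Mn (Suc n))"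
        then have x: "x \<in> Hp p" "?Mn (Suc n) x = 0" by (simp_all add: ker_on_def)
        define c where "c = fourier_coeff (?A x) 0"
        have "c = 0"
        proof (rule ccontr)
          assume "c \<noteq> 0"
          then have "?A ((1 / c) *\<^sub>C x) = 1" using Ascale[OF x(1) x(1), of "1 / c"] k[OF x] by (metis L0.scale_one L0.scale_scale c_def nonzero_divide_eq_eq)
          then show False using False x(1) by auto
        qed
        then show "x \<in> ker_on (Hp p) ?A" using k[OF x] x by (simp add: ker_on_def c_def)
      qed
      then show ?thesis using F by blast
    qed
  qed
  then show ?thesis using surj by blast
qed

text \<open>Multiplying the symbol by t undoes one backward shift. While the kernel is nonzero,
  surjectivity survives this step as soon as 1 is in the new range, and then the kernel loses a
  dimension because a preimage of 1 lies in the old kernel but not in the new one.\<close>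

lemma surjective_descent:
  assumes p: "1 < p" "1 / p + 1 / q = 1" 
    and "\<xi> \<in> GLinf" "Hp p \<subseteq> M_op \<xi> ` Hp p" "finite F" "ker_on (Hp p) (M_op \<xi>) \<subseteq> L0.span F"
  shows "\<exists>m. Hp p \<subseteq> M_op (tpow m * \<xi>) ` Hp p \<and> ker_on (Hp p) (M_op (tpow m * \<xi>)) \<subseteq> {0}"
  using assms(3-6)
proof (induction "card F" arbitrary: \<xi> F rule: less_induct)
  case less
  interpret L0_banach "Hp p" "Lp_norm p" by (rule L0_banach_Hp[OF p(1)])
  show ?case
  proof (cases "ker_on (Hp p) (M_op \<xi>) \<subseteq> {0}")
    case True
    then show ?thesis using less.prems by (intro exI[of _ 0]) simp
  next
    case False
    then obtain x where x: "x \<in> Hp p" "M_op \<xi> x = 0" "x \<noteq> 0" by (auto simp: ker_on_def)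
    define \<eta> where "\<eta> = tpow 1 * \<xi>"
    have \<eta>: "\<eta> \<in> GLinf" unfolding \<eta>_def by (rule GLinf_tpow_mult[OF less.prems(1)])
    note \<eta>' = GLinf_D(1)[OF \<eta>] and \<xi>' = GLinf_D(1)[OF less.prems(1)]
    have \<xi>: "\<xi> = tpow (- int 1) * \<eta>" by (simp add: \<eta>_def tpow_mult_assoc)
    let ?A = "M_op \<eta>" and ?M = "M_op \<xi>"
    have step: "?M x = bshift 1 (?A x)" if "x \<in> Hp p" for x
      using M_op_bshift[OF p(1) \<eta>', of 1 x] \<xi>' that unfolding \<xi>[symmetric] by simp
    have bA: "bounded_op (Hp p) (Lp_norm p) (Hp p) (Lp_norm p) ?A" by (rule M_op_bounded[OF p(1) \<eta>'])
    then have AV: "?A x \<in> Hp p" and Aadd: "?A (x + y) = ?A x + ?A y" and Ascale: "?A (c *\<^sub>C x) = c *\<^sub>C ?A x" if "x \<in> Hp p" "y \<in> Hp p" for x y c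
      using that by (auto simp: bounded_op_def linear_on_space_def)
    have Adiff: "?A (x - y) = ?A x - ?A y" if "x \<in> Hp p" "y \<in> Hp p" for x y
      using Aadd[OF that(1), of "(-1) *\<^sub>C y"] Ascale[OF that(2) that(2), of "-1"] mem(4)[OF that(2), of "-1"] by simp
    have bS: "bshift 1 (x + y) = bshift 1 x + bshift 1 y" "bshift 1 (c *\<^sub>C x) = c *\<^sub>C bshift 1 x" if "x \<in> Hp p" "y \<in> Hp p" for x y c
      using bshift_bounded[OF p(1), of 1] that by (auto simp: bounded_op_def linear_on_space_def)
    have bSdiff: "bshift 1 (x - y) = bshift 1 x - bshift 1 y" if "x \<in> Hp p" "y \<in> Hp p" for x y
      using bS(1)[OF that(1), of "(-1) *\<^sub>C y"] bS(2)[OF that(2) that(2), of "-1"] mem(4)[OF that(2), of "-1"] by simp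
    have k: "y = fourier_coeff y 0 *\<^sub>C 1" if "y \<in> Hp p" "bshift 1 y = 0" for y
      using bshift_kernel[OF p(1) that(1), of 1] that(2) by simp
    \<comment> \<open>If 1 were not in the range, x would stay in the kernel of the new operator,
      while a nonzero bounded functional annihilated its range. The analogue of Coburn's lemma
      excludes that both happen.\<close>
    have "\<exists>x0\<in>Hp p. ?A x0 = 1"
    proof (rule ccontr)
      assume no: "\<not> ?thesis"
      have Ax: "?A x = 0"
      proof -
        define c where "c = fourier_coeff (?A x) 0"
        have Axc: "?A x = c *\<^sub>C 1" using k[OF AV[OF x(1) x(1)]] step[OF x(1)] x(2) by (simp add: c_def)
        have "c = 0"
        proof (rule ccontr)
          assume "c \<noteq> 0"
          then have "?A ((1 / c) *\<^sub>C x) = 1" using Ascale[OF x(1) x(1), of "1 / c"] Axc by simp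
          then show False using no x(1) by auto
        qed
        then show ?thesis using Axc by simp
      qed
      have bM: "bounded_op (Hp p) (Lp_norm p) (Hp p) (Lp_norm p) ?M" by (rule M_op_bounded[OF p(1) \<xi>'])
      obtain C where C: "C \<ge> 0" "\<And>y. y \<in> Hp p \<Longrightarrow> \<exists>x\<in>Hp p. ?M x = y \<and> Lp_norm p x \<le> C * Lp_norm p y"
        using open_mapping[OF bM less.prems(2)] by blast
      obtain CA where CA: "\<And>f. f \<in> Hp p \<Longrightarrow> Lp_norm p (?A f) \<le> CA * Lp_norm p f" using bA unfolding bounded_op_def by blast
      obtain CS where CS: "\<And>f. f \<in> Hp p \<Longrightarrow> Lp_norm p (bshift 1 f) \<le> CS * Lp_norm p f"
        using bshift_bounded[OF p(1), of 1] unfolding bounded_op_def by blast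
      have ex: "\<exists>z\<in>Hp p. Lp_norm p z \<le> C * Lp_norm p (bshift 1 y) \<and> y - ?A z = fourier_coeff (y - ?A z) 0 *\<^sub>C 1" if y: "y \<in> Hp p" for y
      proof -
        obtain z where z: "z \<in> Hp p" "?M z = bshift 1 y" "Lp_norm p z \<le> C * Lp_norm p (bshift 1 y)"
          using C(2)[OF bshift_Hp[OF p(1) y]] by blast
        have "bshift 1 (y - ?A z) = 0" using bSdiff[OF y AV[OF z(1) z(1)]] step[OF z(1)] z(2) by simp
        then show ?thesis using k[of "y - ?A z"] y AV[OF z(1) z(1)] z by blast
      qed
      \<comment> \<open>Surjectivity of the old operator solves y = A z up to a constant. The
        constant is unique since 1 is outside the range; it is bounded by y because z can be chosen
        with an open mapping bound.\<close>
      define l where "l y = (THE c. \<exists>z\<in>Hp p. y - ?A z = c *\<^sub>C 1)" for y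
      have uniq: "c = d" if z: "z \<in> Hp p" "y - ?A z = c *\<^sub>C 1" and z': "z' \<in> Hp p" "y - ?A z' = d *\<^sub>C 1" for y z z' c d
      proof (rule ccontr)
        assume "c \<noteq> d"
        have "?A (z' - z) = (y - ?A z) - (y - ?A z')" using Adiff[OF z'(1) z(1)] by simp
        also have "\<dots> = (c - d) *\<^sub>C 1" unfolding z(2) z'(2) by (simp add: L0.scale_left_diff_distrib)
        finally have "?A ((1 / (c - d)) *\<^sub>C (z' - z)) = 1"
          using Ascale[of "z' - z" "z' - z" "1 / (c - d)"] z z' \<open>c \<noteq> d\<close> by simp
        then show False using no z z' by auto
      qed
      have l_eq: "l y = c" if "z \<in> Hp p" "y - ?A z = c *\<^sub>C 1" for y z c
        unfolding l_def by (rule the_equality) (use that uniq in blast)+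
      have l_ex: "\<exists>z\<in>Hp p. Lp_norm p z \<le> C * Lp_norm p (bshift 1 y) \<and> y - ?A z = l y *\<^sub>C 1" if y: "y \<in> Hp p" for y
        using ex[OF y] l_eq by metis
      have "bounded_functional (Hp p) (Lp_norm p) l"
        unfolding bounded_functional_def linear_on_space_def
      proof (intro conjI ballI allI exI)
        fix y y' assume y: "y \<in> Hp p" "y' \<in> Hp p"
        obtain z z' where z: "z \<in> Hp p" "y - ?A z = l y *\<^sub>C 1" "z' \<in> Hp p" "y' - ?A z' = l y' *\<^sub>C 1"
          using l_ex y by metis
        have "y + y' - ?A (z + z') = (y - ?A z) + (y' - ?A z')" using Aadd[OF z(1,3)] by simp
        also have "\<dots> = (l y + l y') *\<^sub>C 1" unfolding z(2,4) by (simp add: L0.scale_left_distrib)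
        finally show "l (y + y') = l y + l y'" using z by (intro l_eq[of "z + z'"]) auto
      next
        fix c y assume y: "y \<in> Hp p"
        obtain z where z: "z \<in> Hp p" "y - ?A z = l y *\<^sub>C 1" using l_ex y by metis
        have "c *\<^sub>C y - ?A (c *\<^sub>C z) = c *\<^sub>C (y - ?A z)" using Ascale[OF z(1) z(1), of c] by (simp add: L0.scale_right_diff_distrib)
        also have "\<dots> = (c * l y) *\<^sub>C 1" unfolding z(2) by simp
        finally show "l (c *\<^sub>C y) = c * l y" using z by (intro l_eq[of "c *\<^sub>C z"]) auto
      next
        fix y assume y: "y \<in> Hp p"
        obtain z where z: "z \<in> Hp p" "Lp_norm p z \<le> C * Lp_norm p (bshift 1 y)" "y - ?A z = l y *\<^sub>C 1" using l_ex[OF y] by blast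
        have "norm (l y) = Lp_norm p (y - ?A z)" unfolding z(3) using p by (simp add: Lp_cscale)
        also have "\<dots> \<le> Lp_norm p y + Lp_norm p (?A z)" by (rule N_diff[OF y AV[OF z(1) z(1)]])
        also have "Lp_norm p (?A z) \<le> \<bar>CA\<bar> * Lp_norm p z" using CA[OF z(1)] by (rule order_trans) (simp add: mult_right_mono)
        also have "\<bar>CA\<bar> * Lp_norm p z \<le> \<bar>CA\<bar> * (C * Lp_norm p (bshift 1 y))" using z(2) by (intro mult_left_mono) auto
        also have "\<dots> \<le> \<bar>CA\<bar> * (C * (\<bar>CS\<bar> * Lp_norm p y))"
        proof -
          have "Lp_norm p (bshift 1 y) \<le> \<bar>CS\<bar> * Lp_norm p y" using CS[OF y] by (rule order_trans) (simp add: mult_right_mono)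
          then show ?thesis using C(1) by (intro mult_left_mono) auto
        qed
        finally show "norm (l y) \<le> (1 + \<bar>CA\<bar> * (C * \<bar>CS\<bar>)) * Lp_norm p y" by (simp add: algebra_simps)
      qed
      moreover have "l (?A y) = 0" if "y \<in> Hp p" for y using that by (intro l_eq[of y]) auto
      ultimately have "l 1 = 0" by (rule coburn[OF p \<eta> x(1) Ax x(3)]) simp_all
      moreover have "l 1 = 1"
      proof (rule l_eq[of 0])
        have "?A 0 = 0" using Ascale[of 0 0 0] by simp
        then show "1 - ?A 0 = 1 *\<^sub>C 1" by simp
      qed simp
      ultimately show False by simp
    qed
    then obtain x0 where x0: "x0 \<in> Hp p" "?A x0 = 1" by blast
    have surj: "Hp p \<subseteq> ?A ` Hp p"
    proof
      fix y assume y: "y \<in> Hp p"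
      have "bshift 1 y \<in> ?M ` Hp p" by (rule subsetD[OF less.prems(2) bshift_Hp[OF p(1) y]])
      then obtain z where z: "z \<in> Hp p" "?M z = bshift 1 y" by (metis imageE)
      have "bshift 1 (y - ?A z) = 0" using bSdiff[OF y AV[OF z(1) z(1)]] step[OF z(1)] z(2) by simp
      then have "y - ?A z = fourier_coeff (y - ?A z) 0 *\<^sub>C ?A x0" using k[of "y - ?A z"] y AV[OF z(1) z(1)] x0(2) by simp
      then obtain c where c: "y - ?A z = c *\<^sub>C ?A x0" by blast
      have "?A (z + c *\<^sub>C x0) = ?A z + c *\<^sub>C ?A x0"
        using Aadd[OF z(1), of "c *\<^sub>C x0"] Ascale[OF x0(1) x0(1)] x0(1) by simp
      then have "y = ?A (z + c *\<^sub>C x0)" unfolding c[symmetric] by simp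
      then show "y \<in> ?A ` Hp p" using z(1) x0(1) by blast
    qed
    let ?K = "ker_on (Hp p) ?A"
    have Ksub: "L0.subspace ?K"
    proof (rule L0.subspaceI)
      show "0 \<in> ?K" using Ascale[of 0 0 0] by (simp add: ker_on_def)
      show "u + v \<in> ?K" if "u \<in> ?K" "v \<in> ?K" for u v using that Aadd by (simp add: ker_on_def)
      show "c *\<^sub>C u \<in> ?K" if "u \<in> ?K" for c u using that Ascale[of u u c] by (simp add: ker_on_def)
    qed
    have bS1: "bshift 1 1 = 0" using bshift_mono_0[OF p(1), of 0 1] by simp
    have bS0: "bshift 1 0 = 0" using bS(2)[of 0 0 0] by simp
    have "?K \<subseteq> ker_on (Hp p) ?M"
      using step bS0 by (simp add: ker_on_def subset_eq)
    moreover have "x0 \<in> ker_on (Hp p) ?M" using step[OF x0(1)] x0 bS1 by (simp add: ker_on_def)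
    ultimately have KM: "?K \<subseteq> L0.span F" "x0 \<in> L0.span F" using less.prems(4) by blast+
    \<comment> \<open>A basis of the new kernel. Adjoining x0 keeps it independent inside the span
      of F, so it has fewer elements than F and can replace F in the induction.\<close>
    obtain B where B: "B \<subseteq> ?K" "L0.independent B" "?K \<subseteq> L0.span B" using L0.maximal_independent_subset by blast
    have "x0 \<notin> L0.span B"
    proof
      assume "x0 \<in> L0.span B"
      then have "x0 \<in> ?K" using L0.span_minimal[OF B(1) Ksub] by blast
      then show False using x0(2) by (simp add: ker_on_def)
    qed
    then have ind: "L0.independent (insert x0 B)" and x0B: "x0 \<notin> B"
      using B(2) L0.independent_insertI L0.span_base by blast+
    have sub: "insert x0 B \<subseteq> L0.span F" using KM B(1) by blast
    note fin = L0.independent_span_bound[OF less.prems(3) ind sub]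
    then have "card B < card F" using x0B by auto
    have "\<exists>m. Hp p \<subseteq> M_op (tpow m * \<eta>) ` Hp p \<and> ker_on (Hp p) (M_op (tpow m * \<eta>)) \<subseteq> {0}"
      by (rule less.hyps[OF \<open>card B < card F\<close> \<eta> surj _ B(3)]) (use fin in simp)
    then obtain m where "Hp p \<subseteq> M_op (tpow m * \<eta>) ` Hp p" "ker_on (Hp p) (M_op (tpow m * \<eta>)) \<subseteq> {0}" by blast
    moreover have "tpow m * \<eta> = tpow (m + 1) * \<xi>" by (simp add: \<eta>_def tpow_mult_assoc)
    ultimately show ?thesis by auto
  qed
qed

subsection \<open>Defect numbers\<close>

text \<open>Biorthogonal functionals recover the coefficients of a linear combination; they need to
  be linear only on V.\<close>

lemma independent_by_functionals:
  fixes b :: "nat \<Rightarrow> L0"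
  assumes V: "L0.subspace V" "\<And>j. j < n \<Longrightarrow> b j \<in> V"
    and L: "\<And>i. linear_on_space (*) V (L i)" "\<And>i j. i < n \<Longrightarrow> j < n \<Longrightarrow> L i (b j) = (if i = j then 1 else 0)"
  shows "inj_on b {..<n}" "L0.independent (b ` {..<n})"
proof -
  show inj: "inj_on b {..<n}"
  proof (rule inj_onI)
    fix i j assume "i \<in> {..<n}" "j \<in> {..<n}" "b i = b j"
    then show "i = j" using L(2)[of i i] L(2)[of i j] by (auto split: if_splits)
  qed
  have sum: "L i (\<Sum>j\<in>A. c j *\<^sub>C b j) = (\<Sum>j\<in>A. c j * L i (b j))" if "finite A" "A \<subseteq> {..<n}" for i c A
    using that
  proof (induction A)
    case empty
    show ?case using linear_on_space_0[OF L(1) L0.subspace_0[OF V(1)]] by simp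
  next
    case (insert x A)
    have x: "c x *\<^sub>C b x \<in> V" "b x \<in> V" using insert V by (auto intro: L0.subspace_scale)
    have "(\<Sum>j\<in>A. c j *\<^sub>C b j) \<in> V" using insert V by (intro L0.subspace_sum L0.subspace_scale) auto
    then show ?case using insert x L(1)[of i] by (simp add: linear_on_space_def)
  qed
  show "L0.independent (b ` {..<n})"
  proof (rule L0.independent_if_scalars_zero)
    fix f x assume s: "(\<Sum>x\<in>b ` {..<n}. f x *\<^sub>C x) = 0" and "x \<in> b ` {..<n}"
    then obtain i where i: "i < n" "x = b i" by blast
    have "(\<Sum>j<n. f (b j) *\<^sub>C b j) = 0" using s by (subst (asm) sum.reindex[OF inj]) simp
    then have "(\<Sum>j<n. f (b j) * L i (b j)) = 0"
      using sum[of "{..<n}" i "\<lambda>j. f (b j)"] linear_on_space_0[OF L(1) L0.subspace_0[OF V(1)]] by simp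
    moreover have "(\<Sum>j<n. f (b j) * L i (b j)) = (\<Sum>j<n. if j = i then f (b i) else 0)"
      using L(2) i by (intro sum.cong) auto
    ultimately show "f x = 0" using i by (simp add: sum.delta)
  qed simp
qed

lemma fourier_coeff_linear_on_Hp: "1 < p \<Longrightarrow> linear_on_space (*) (Hp p) (\<lambda>y. fourier_coeff y m)"
  by (auto simp: linear_on_space_def fourier_coeff_cscale Hp_iff intro!: fourier_coeff_add Lp_subset_1)

lemma linear_on_space_compose:
  assumes "linear_on_space (*) V l" "bounded_op V N V N A"
  shows "linear_on_space (*) V (\<lambda>y. l (A y))"
  using assms by (auto simp: linear_on_space_def bounded_op_def image_subset_iff)

text \<open>Here M(phi) is the n-fold backward shift after the invertible M(psi). It is therefore
  onto, and its kernel is the image under R of the polynomials of degree below n.\<close>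

lemma negative_index:
  assumes p: "1 < p" and \<phi>: "\<phi> \<in> GLinf" and \<psi>: "\<psi> \<in> GLinf" and R: "has_inverse p \<psi> R" and eq: "\<phi> = tpow (- int n) * \<psi>"
  shows "fredholm (Hp p) (Lp_norm p) (M_op \<phi>)"
    "\<exists>F. finite F \<and> ker_on (Hp p) (M_op \<phi>) \<subseteq> L0.span F" "L0.dim (ker_on (Hp p) (M_op \<phi>)) = n"
    "ker_adjoint (Hp p) (Lp_norm p) (M_op \<phi>) = {0}"
proof -
  interpret L0_banach "Hp p" "Lp_norm p" by (rule L0_banach_Hp[OF p])
  let ?M = "M_op \<phi>" and ?N = "M_op \<psi>" and ?K = "ker_on (Hp p) (M_op \<phi>)"
  have bR: "bounded_op (Hp p) (Lp_norm p) (Hp p) (Lp_norm p) R" and NR: "\<And>y. y \<in> Hp p \<Longrightarrow> ?N (R y) = y" and RN: "\<And>y. y \<in> Hp p \<Longrightarrow> R (?N y) = y"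
    using R by (auto simp: has_inverse_def)
  have bN: "bounded_op (Hp p) (Lp_norm p) (Hp p) (Lp_norm p) ?N" by (rule M_op_bounded[OF p GLinf_D(1)[OF \<psi>]])
  have bM: "bounded_op (Hp p) (Lp_norm p) (Hp p) (Lp_norm p) ?M" by (rule M_op_bounded[OF p GLinf_D(1)[OF \<phi>]])
  have RV: "R y \<in> Hp p" and NV: "?N y \<in> Hp p" if "y \<in> Hp p" for y using bR bN that by (auto simp: bounded_op_def)
  have Radd: "\<And>x y. x \<in> Hp p \<Longrightarrow> y \<in> Hp p \<Longrightarrow> R (x + y) = R x + R y" and Rscale: "\<And>c x. x \<in> Hp p \<Longrightarrow> R (c *\<^sub>C x) = c *\<^sub>C R x"
    using bR by (auto simp: bounded_op_def linear_on_space_def)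
  have step: "?M x = bshift n (?N x)" if "x \<in> Hp p" for x
    using M_op_bshift[OF p GLinf_D(1)[OF \<psi>] _ that, of n] GLinf_D(1)[OF \<phi>] unfolding eq by simp
  define b where "b j = R (mono_t j)" for j
  have bV: "b j \<in> Hp p" for j unfolding b_def by (rule RV) simp
  have Mb: "?M (b j) = 0" if "j < n" for j
    using that step[OF bV] NR[of "mono_t j"] bshift_mono_0[OF p] by (simp add: b_def)
  have span: "?K \<subseteq> L0.span (b ` {..<n})"
  proof
    fix x assume "x \<in> ?K"
    then have x: "x \<in> Hp p" "?M x = 0" by (simp_all add: ker_on_def)
    have Rsum: "R (\<Sum>j\<in>A. c j *\<^sub>C mono_t j) = (\<Sum>j\<in>A. c j *\<^sub>C b j)" if "finite A" for A c
      using that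
    proof (induction A)
      case empty
      show ?case using Rscale[of 0 0] by simp
    next
      case (insert i A)
      have "(\<Sum>j\<in>A. c j *\<^sub>C mono_t j) \<in> Hp p" by (intro L0.subspace_sum[OF subspace]) auto
      then show ?case using insert by (simp add: Radd Rscale b_def)
    qed
    have "?N x = (\<Sum>j<n. fourier_coeff (?N x) (int j) *\<^sub>C mono_t j)"
      using bshift_kernel[OF p NV[OF x(1)], of n] step[OF x(1)] x(2) by simp
    then have "R (?N x) = (\<Sum>j<n. fourier_coeff (?N x) (int j) *\<^sub>C b j)"
      using Rsum[of "{..<n}" "\<lambda>j. fourier_coeff (?N x) (int j)"] by simp
    then have "x = (\<Sum>j<n. fourier_coeff (?N x) (int j) *\<^sub>C b j)" using RN[OF x(1)] by simp
    moreover have "(\<Sum>j<n. fourier_coeff (?N x) (int j) *\<^sub>C b j) \<in> L0.span (b ` {..<n})"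
      by (intro L0.span_sum L0.span_scale L0.span_base) auto
    ultimately show "x \<in> L0.span (b ` {..<n})" by simp
  qed
  then show fin: "\<exists>F. finite F \<and> ?K \<subseteq> L0.span F" by (intro exI[of _ "b ` {..<n}"]) auto
  have ind: "inj_on b {..<n}" "L0.independent (b ` {..<n})"
  proof -
    note lin = linear_on_space_compose[OF fourier_coeff_linear_on_Hp[OF p] bN]
    have dual: "fourier_coeff (?N (b j)) (int i) = (if i = j then 1 else 0)" for i j
      by (simp add: b_def NR fourier_coeff_tpow)
    show "inj_on b {..<n}" "L0.independent (b ` {..<n})"
      using independent_by_functionals[of "Hp p" n b "\<lambda>i y. fourier_coeff (?N y) (int i)", OF subspace bV lin dual] by blast+
  qed
  show "L0.dim ?K = n"
  proof (rule L0.dim_unique[OF _ span ind(2)])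
    show "b ` {..<n} \<subseteq> ?K" using bV Mb by (auto simp: ker_on_def)
    show "card (b ` {..<n}) = n" using card_image[OF ind(1)] by simp
  qed
  have surj: "?M ` Hp p = Hp p"
  proof
    show "?M ` Hp p \<subseteq> Hp p" using bM by (simp add: bounded_op_def)
    show "Hp p \<subseteq> ?M ` Hp p"
    proof
      fix y assume y: "y \<in> Hp p"
      have t: "mono_t n * y \<in> Hp p" by (rule bshift_mono(1)[OF p y])
      have "?M (R (mono_t n * y)) = y" using step[OF RV[OF t]] NR[OF t] bshift_mono(2)[OF p y] by simp
      then show "y \<in> ?M ` Hp p" using RV[OF t] by (metis image_eqI)
    qed
  qed
  show "fredholm (Hp p) (Lp_norm p) ?M"
    unfolding fredholm_def
  proof (intro conjI bM fin)
    show "norm_closed_in (Hp p) (Lp_norm p) (?M ` Hp p)" unfolding surj by (simp add: norm_closed_in_def)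
    show "\<exists>F. finite F \<and> F \<subseteq> Hp p \<and> Hp p \<subseteq> L0.span (F \<union> ?M ` Hp p)"
      unfolding surj using L0.span_superset[of "Hp p"] by (intro exI[of _ "{}"]) auto
  qed
  show "ker_adjoint (Hp p) (Lp_norm p) ?M = {0}"
  proof
    show "{0} \<subseteq> ker_adjoint (Hp p) (Lp_norm p) ?M"
      by (auto simp: ker_adjoint_def dual_space_def linear_on_space_def adjoint_op_def fun_eq_iff intro!: exI[of _ 0])
    show "ker_adjoint (Hp p) (Lp_norm p) ?M \<subseteq> {0}"
    proof
      fix l assume l: "l \<in> ker_adjoint (Hp p) (Lp_norm p) ?M"
      have "l y = 0" for y
      proof (cases "y \<in> Hp p")
        case True
        then obtain x where x: "x \<in> Hp p" "y = ?M x" using surj by blast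
        have "adjoint_op (Hp p) ?M l x = 0" using l by (simp add: ker_adjoint_def)
        then show ?thesis using x by (simp add: adjoint_op_def)
      qed (use l in \<open>simp add: ker_adjoint_def dual_space_def\<close>)
      then show "l \<in> {0}" by (simp add: fun_eq_iff)
    qed
  qed
qed

lemma fnl_sum_apply: "(\<Sum>j\<in>A. (\<lambda>f. c j * l j f)) y = (\<Sum>j\<in>A. c j * l j y)" for c :: "nat \<Rightarrow> complex" and l :: "nat \<Rightarrow> L0 \<Rightarrow> complex"
  by (induction A rule: infinite_finite_induct) auto

text \<open>Here the backward shift after M(phi) is invertible, so M(phi) has a bounded left
  inverse. This gives a bounded projection onto the range whose complementary part consists of
  polynomials of degree below n.\<close>

lemma positive_index:
  assumes p: "1 < p" and \<phi>: "\<phi> \<in> GLinf" and \<psi>: "\<psi> \<in> GLinf" and R: "has_inverse p \<psi> R" and eq: "\<psi> = tpow (- int n) * \<phi>"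
  shows "fredholm (Hp p) (Lp_norm p) (M_op \<phi>)"
    "ker_on (Hp p) (M_op \<phi>) = {0}"
    "\<exists>F. finite F \<and> ker_adjoint (Hp p) (Lp_norm p) (M_op \<phi>) \<subseteq> fnl.span F"
    "fnl.dim (ker_adjoint (Hp p) (Lp_norm p) (M_op \<phi>)) = n"
proof -
  interpret L0_banach "Hp p" "Lp_norm p" by (rule L0_banach_Hp[OF p])
  let ?M = "M_op \<phi>" and ?N = "M_op \<psi>" and ?A = "ker_adjoint (Hp p) (Lp_norm p) (M_op \<phi>)"
  have bR: "bounded_op (Hp p) (Lp_norm p) (Hp p) (Lp_norm p) R" and NR: "\<And>y. y \<in> Hp p \<Longrightarrow> ?N (R y) = y" and RN: "\<And>y. y \<in> Hp p \<Longrightarrow> R (?N y) = y"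
    using R by (auto simp: has_inverse_def)
  have bM: "bounded_op (Hp p) (Lp_norm p) (Hp p) (Lp_norm p) ?M" by (rule M_op_bounded[OF p GLinf_D(1)[OF \<phi>]])
  have bS: "bounded_op (Hp p) (Lp_norm p) (Hp p) (Lp_norm p) (bshift n)" by (rule bshift_bounded[OF p])
  have RV: "R y \<in> Hp p" and MV: "?M y \<in> Hp p" and SV: "bshift n y \<in> Hp p" if "y \<in> Hp p" for y
    using bR bM bS that by (auto simp: bounded_op_def)
  have add: "R (x + y) = R x + R y" "?M (x + y) = ?M x + ?M y" "bshift n (x + y) = bshift n x + bshift n y" if "x \<in> Hp p" "y \<in> Hp p" for x y
    using bR bM bS that by (auto simp: bounded_op_def linear_on_space_def)
  have scale': "R (c *\<^sub>C x) = c *\<^sub>C R x" "?M (c *\<^sub>C x) = c *\<^sub>C ?M x" "bshift n (c *\<^sub>C x) = c *\<^sub>C bshift n x" if "x \<in> Hp p" for x c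
    using bR bM bS that by (auto simp: bounded_op_def linear_on_space_def)
  obtain CR where CR: "\<And>y. y \<in> Hp p \<Longrightarrow> Lp_norm p (R y) \<le> CR * Lp_norm p y" using bR unfolding bounded_op_def by blast
  obtain CM where CM: "\<And>y. y \<in> Hp p \<Longrightarrow> Lp_norm p (?M y) \<le> CM * Lp_norm p y" using bM unfolding bounded_op_def by blast
  obtain CS where CS: "\<And>y. y \<in> Hp p \<Longrightarrow> Lp_norm p (bshift n y) \<le> CS * Lp_norm p y" using bS unfolding bounded_op_def by blast
  have step: "?N x = bshift n (?M x)" if "x \<in> Hp p" for x
    using M_op_bshift[OF p GLinf_D(1)[OF \<phi>] _ that, of n] GLinf_D(1)[OF \<psi>] unfolding eq by simp
  have 0: "R 0 = 0" "?M 0 = 0" "bshift n 0 = 0" using scale'[of 0 0] by simp_all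
  \<comment> \<open>A projection onto the range of M(phi): it fixes that range, and y and Q y have
    the same n-fold backward shift, so y - Q y is a polynomial of degree below n. Closedness of the
    range follows from its boundedness.\<close>
  define Q where "Q y = ?M (R (bshift n y))" for y
  have QV: "Q y \<in> Hp p" if "y \<in> Hp p" for y unfolding Q_def using that RV MV SV by blast
  have Qadd: "Q (x + y) = Q x + Q y" if "x \<in> Hp p" "y \<in> Hp p" for x y
    unfolding Q_def using that by (simp add: add SV RV)
  have Qscale: "Q (c *\<^sub>C x) = c *\<^sub>C Q x" if "x \<in> Hp p" for x c
    unfolding Q_def using that by (simp add: scale' SV RV)
  have QM: "Q (?M x) = ?M x" if "x \<in> Hp p" for x unfolding Q_def using that RN[OF that] step[OF that] by simp
  define CQ where "CQ = \<bar>CM\<bar> * (\<bar>CR\<bar> * \<bar>CS\<bar>)"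
  have QN: "Lp_norm p (Q y) \<le> CQ * Lp_norm p y" if y: "y \<in> Hp p" for y
  proof -
    have "Lp_norm p (Q y) \<le> \<bar>CM\<bar> * Lp_norm p (R (bshift n y))"
      unfolding Q_def using CM[OF RV[OF SV[OF y]]] by (rule order_trans) (simp add: mult_right_mono)
    also have "\<dots> \<le> \<bar>CM\<bar> * (\<bar>CR\<bar> * Lp_norm p (bshift n y))"
      using CR[OF SV[OF y]] by (intro mult_left_mono, rule order_trans) (simp_all add: mult_right_mono)
    also have "\<dots> \<le> \<bar>CM\<bar> * (\<bar>CR\<bar> * (\<bar>CS\<bar> * Lp_norm p y))"
      using CS[OF y] by (intro mult_left_mono, rule order_trans) (simp_all add: mult_right_mono)
    finally show ?thesis by (simp add: CQ_def mult.assoc)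
  qed
  have Qsum: "y - Q y = (\<Sum>j<n. fourier_coeff (y - Q y) (int j) *\<^sub>C mono_t j)" if y: "y \<in> Hp p" for y
  proof -
    have m: "(-1) *\<^sub>C Q y \<in> Hp p" by (rule mem(4)[OF QV[OF y]])
    have "bshift n (y - Q y) = bshift n y - bshift n (Q y)"
      using add(3)[OF y m] scale'(3)[OF QV[OF y], of "-1"] by simp
    also have "bshift n (Q y) = bshift n y"
      unfolding Q_def using step[OF RV[OF SV[OF y]]] NR[OF SV[OF y]] by simp
    finally have "bshift n (y - Q y) = 0" by simp
    then show ?thesis using bshift_kernel[OF p, of "y - Q y" n] y QV[OF y] by simp
  qed
  have inj: "x = 0" if "x \<in> Hp p" "?M x = 0" for x
    using RN[OF that(1)] step[OF that(1)] that(2) 0 by simp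
  show ker: "ker_on (Hp p) ?M = {0}" using inj 0 by (auto simp: ker_on_def)
  show "fredholm (Hp p) (Lp_norm p) ?M"
    unfolding fredholm_def
  proof (intro conjI bM)
    show "norm_closed_in (Hp p) (Lp_norm p) (?M ` Hp p)"
      unfolding norm_closed_in_def
    proof (intro ballI allI impI, elim conjE)
      fix g and u :: "nat \<Rightarrow> L0"
      assume g: "g \<in> Hp p" and u: "range u \<subseteq> ?M ` Hp p" and lim: "(\<lambda>k. Lp_norm p (u k - g)) \<longlonglongrightarrow> 0"
      have uV: "u k \<in> Hp p" "Q (u k) = u k" for k
      proof -
        obtain x where "x \<in> Hp p" "u k = ?M x" using u by blast
        then show "u k \<in> Hp p" "Q (u k) = u k" using MV QM by simp_all
      qed
      have "Q g = g"
      proof (rule limit_unique[OF QV[OF g] g uV(1) _ lim])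
        have "Lp_norm p (u k - Q g) \<le> CQ * Lp_norm p (u k - g)" for k
        proof -
          have m: "(-1) *\<^sub>C g \<in> Hp p" by (rule mem(4)[OF g])
          have "Q (u k - g) = u k - Q g" using Qadd[OF uV(1) m, of k] Qscale[OF g, of "-1"] uV(2)[of k] by simp
          then show ?thesis using QN[of "u k - g"] uV(1)[of k] g by simp
        qed
        then have "norm (Lp_norm p (u k - Q g)) \<le> CQ * Lp_norm p (u k - g)" for k by simp
        moreover have "(\<lambda>k. CQ * Lp_norm p (u k - g)) \<longlonglongrightarrow> 0" using tendsto_mult_right_zero[OF lim] .
        ultimately show "(\<lambda>k. Lp_norm p (u k - Q g)) \<longlonglongrightarrow> 0"
          by (rule Lim_null_comparison[OF always_eventually, OF allI])
      qed
      then show "g \<in> ?M ` Hp p" unfolding Q_def using RV[OF SV[OF g]] by (metis image_eqI)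
    qed
    show "\<exists>F. finite F \<and> ker_on (Hp p) ?M \<subseteq> L0.span F" unfolding ker by (intro exI[of _ "{0}"]) (auto intro: L0.span_base)
    show "\<exists>F. finite F \<and> F \<subseteq> Hp p \<and> Hp p \<subseteq> L0.span (F \<union> ?M ` Hp p)"
    proof (intro exI[of _ "mono_t ` {..<n}"] conjI subsetI)
      fix y assume y: "y \<in> Hp p"
      let ?S = "mono_t ` {..<n} \<union> ?M ` Hp p"
      have "(\<Sum>j<n. fourier_coeff (y - Q y) (int j) *\<^sub>C mono_t j) \<in> L0.span ?S"
        by (intro L0.span_sum L0.span_scale L0.span_base) auto
      then have "y - Q y \<in> L0.span ?S" using Qsum[OF y] by simp
      moreover have "Q y \<in> L0.span ?S" unfolding Q_def using RV[OF SV[OF y]] by (intro L0.span_base) auto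
      ultimately have "(y - Q y) + Q y \<in> L0.span ?S" by (rule L0.span_add)
      then show "y \<in> L0.span ?S" by simp
    qed auto
  qed
  \<comment> \<open>The coefficients of the polynomial y - Q y. They annihilate the range, where Q
    is the identity, and on t^i with i < n they are the dual basis since Q vanishes there. The value
    0 off H^p is required by \<open>dual_space\<close>.\<close>
  define l where "l j y = (if y \<in> Hp p then fourier_coeff (y - Q y) (int j) else 0)" for j :: nat and y
  have dV: "y - Q y \<in> Hp p" if "y \<in> Hp p" for y using that QV[OF that] by auto
  have lA: "l j \<in> ?A" for j
    unfolding ker_adjoint_def dual_space_def linear_on_space_def mem_Collect_eq
  proof (intro conjI ballI allI exI impI)
    fix x y assume xy: "x \<in> Hp p" "y \<in> Hp p"
    have eq: "x + y - Q (x + y) = (x - Q x) + (y - Q y)" using Qadd[OF xy] by simp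
    show "l j (x + y) = l j x + l j y"
      using xy fourier_coeff_linear_on_Hp[OF p, of "int j"] dV[OF xy(1)] dV[OF xy(2)] unfolding l_def eq by (simp add: linear_on_space_def)
  next
    fix c x assume x: "x \<in> Hp p"
    have eq: "c *\<^sub>C x - Q (c *\<^sub>C x) = c *\<^sub>C (x - Q x)" using Qscale[OF x] by (simp add: L0.scale_right_diff_distrib)
    show "l j (c *\<^sub>C x) = c * l j x" using x unfolding l_def eq by (simp add: fourier_coeff_cscale)
  next
    fix y assume y: "y \<in> Hp p"
    have "norm (l j y) \<le> Lp_norm p (y - Q y)"
      using y dV[OF y] p fourier_coeff_le[of p "y - Q y" "int j"] by (simp add: l_def Hp_iff)
    also have "\<dots> \<le> Lp_norm p y + Lp_norm p (Q y)" by (rule N_diff[OF y QV[OF y]])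
    also have "Lp_norm p (Q y) \<le> CQ * Lp_norm p y" by (rule QN[OF y])
    finally show "norm (l j y) \<le> (1 + CQ) * Lp_norm p y" by (simp add: algebra_simps)
  next
    show "l j y = 0" if "y \<notin> Hp p" for y using that by (simp add: l_def)
    show "adjoint_op (Hp p) ?M (l j) = 0"
      using QM MV by (auto simp: adjoint_op_def l_def fun_eq_iff)
  qed
  have l_mono: "l i (mono_t j) = (if i = j then 1 else 0)" if "j < n" for i j
    using bshift_mono_0[OF p that] 0 by (simp add: l_def Q_def fourier_coeff_tpow)
  have span: "?A \<subseteq> fnl.span (l ` {..<n})"
  proof
    fix m assume "m \<in> ?A"
    then have m: "linear_on_space (*) (Hp p) m" "\<And>y. y \<notin> Hp p \<Longrightarrow> m y = 0" "adjoint_op (Hp p) ?M m = 0"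
      by (auto simp: ker_adjoint_def dual_space_def)
    have mM: "m (?M x) = 0" if "x \<in> Hp p" for x
    proof -
      have "adjoint_op (Hp p) ?M m x = 0" using m(3) by simp
      then show ?thesis using that by (simp add: adjoint_op_def)
    qed
    have madd: "m (x + y) = m x + m y" "m (c *\<^sub>C x) = c * m x" if "x \<in> Hp p" "y \<in> Hp p" for x y c
      using m(1) that by (auto simp: linear_on_space_def)
    have msum: "m (\<Sum>j\<in>A. c j *\<^sub>C mono_t j) = (\<Sum>j\<in>A. c j * m (mono_t j))" if "finite A" for A c
      using that
    proof (induction A)
      case empty
      show ?case using madd(2)[of 0 0 0] by simp
    next
      case (insert i A)
      have "(\<Sum>j\<in>A. c j *\<^sub>C mono_t j) \<in> Hp p" by (intro L0.subspace_sum[OF subspace]) auto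
      then show ?case using insert madd(1)[of "c i *\<^sub>C mono_t i" "\<Sum>j\<in>A. c j *\<^sub>C mono_t j"] madd(2)[of "mono_t i" "mono_t i" "c i"] by simp
    qed
    have "m = (\<Sum>j<n. (\<lambda>f. m (mono_t j) * l j f))"
    proof
      fix y
      show "m y = (\<Sum>j<n. (\<lambda>f. m (mono_t j) * l j f)) y"
      proof (cases "y \<in> Hp p")
        case True
        have "m y = m ((y - Q y) + Q y)" by simp
        also have "\<dots> = m (y - Q y) + m (Q y)" by (rule madd(1)[OF dV[OF True] QV[OF True]])
        also have "m (Q y) = 0" unfolding Q_def by (rule mM[OF RV[OF SV[OF True]]])
        also have "m (y - Q y) = (\<Sum>j<n. fourier_coeff (y - Q y) (int j) * m (mono_t j))"
          by (subst Qsum[OF True]) (rule msum, simp)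
        finally show ?thesis using True unfolding fnl_sum_apply by (simp add: l_def mult.commute)
      qed (simp add: fnl_sum_apply m(2) l_def)
    qed
    moreover have "(\<Sum>j<n. (\<lambda>f. m (mono_t j) * l j f)) \<in> fnl.span (l ` {..<n})"
      by (intro fnl.span_sum fnl.span_scale fnl.span_base) auto
    ultimately show "m \<in> fnl.span (l ` {..<n})" by simp
  qed
  then show "\<exists>F. finite F \<and> ?A \<subseteq> fnl.span F" by (intro exI[of _ "l ` {..<n}"]) auto
  have linj: "inj_on l {..<n}"
  proof (rule inj_onI)
    fix i j assume "i \<in> {..<n}" "j \<in> {..<n}" "l i = l j"
    then show "i = j" using l_mono[of j i] l_mono[of j j] by (auto split: if_splits)
  qed
  have ind: "fnl.independent (l ` {..<n})"
  proof (rule fnl.independent_if_scalars_zero)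
    fix f x assume s: "(\<Sum>x\<in>l ` {..<n}. (\<lambda>g. f x * x g)) = 0" and "x \<in> l ` {..<n}"
    then obtain i where i: "i < n" "x = l i" by blast
    have "(\<Sum>j<n. (\<lambda>g. f (l j) * l j g)) = 0" using s by (subst (asm) sum.reindex[OF linj]) simp
    then have "(\<Sum>j<n. f (l j) * l j (mono_t i)) = 0" by (metis fnl_sum_apply zero_fun_apply)
    moreover have "(\<Sum>j<n. f (l j) * l j (mono_t i)) = (\<Sum>j<n. if j = i then f (l i) else 0)"
      using l_mono[OF i(1)] by (intro sum.cong) auto
    ultimately show "f x = 0" using i by (simp add: sum.delta)
  qed simp
  show "fnl.dim ?A = n"
  proof (rule fnl.dim_unique[OF _ span ind])
    show "l ` {..<n} \<subseteq> ?A" using lA by auto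
    show "card (l ` {..<n}) = n" using card_image[OF linj] by simp
  qed
qed

text \<open>Conditions (i) to (iii) concern the two outer factors alone, so a power of t passes
  freely between phi and the index. This reduces everything to index 0.\<close>

lemma factorization_shift:
  assumes "asymmetric_factorization p q \<phi> \<phi>m \<kappa> \<phi>0"
  shows "asymmetric_factorization p q (tpow m * \<phi>) \<phi>m (m + \<kappa>) \<phi>0"
proof -
  have "tpow m * \<phi> = \<phi>m * (tpow m * tpow \<kappa>) * \<phi>0"
    using assms by (simp add: asymmetric_factorization_def mult_ac)
  then show ?thesis using assms by (simp add: asymmetric_factorization_def tpow_add)
qed

theorem theorem6p4:
  fixes p q :: real and \<phi> :: L0
  assumes "1 < p" and "1 / p + 1 / q = 1"
    and "\<phi> \<in> GLinf"
  shows "(fredholm (Hp p) (Lp_norm p) (M_op \<phi>) \<longleftrightarrow>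
            (\<exists>\<phi>m \<kappa> \<phi>0. asymmetric_factorization p q \<phi> \<phi>m \<kappa> \<phi>0)) \<and>
         (\<forall>\<phi>m \<kappa> \<phi>0. asymmetric_factorization p q \<phi> \<phi>m \<kappa> \<phi>0 \<longrightarrow>
            (\<exists>F. finite F \<and> ker_on (Hp p) (M_op \<phi>) \<subseteq> L0.span F) \<and>
            int (L0.dim (ker_on (Hp p) (M_op \<phi>))) = max 0 (- \<kappa>) \<and>
            (\<exists>F. finite F \<and> ker_adjoint (Hp p) (Lp_norm p) (M_op \<phi>) \<subseteq> fnl.span F) \<and>
            int (fnl.dim (ker_adjoint (Hp p) (Lp_norm p) (M_op \<phi>))) = max 0 \<kappa>)"
proof -
  note p = assms(1,2) and \<phi> = assms(3)
  let ?M = "M_op \<phi>"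
  let ?K = "ker_on (Hp p) ?M" and ?A = "ker_adjoint (Hp p) (Lp_norm p) ?M"
  have main: "fredholm (Hp p) (Lp_norm p) ?M \<and>
            (\<exists>F. finite F \<and> ?K \<subseteq> L0.span F) \<and> int (L0.dim ?K) = max 0 (- \<kappa>) \<and>
            (\<exists>F. finite F \<and> ?A \<subseteq> fnl.span F) \<and> int (fnl.dim ?A) = max 0 \<kappa>"
    if fac: "asymmetric_factorization p q \<phi> \<phi>m \<kappa> \<phi>0" for \<phi>m \<kappa> \<phi>0
  proof -
    \<comment> \<open>The same outer factors represent psi with index 0, so M(psi) is invertible;
      phi is recovered from it by a shift in the direction given by the sign of the index.\<close>
    define \<psi> where "\<psi> = tpow (- \<kappa>) * \<phi>"
    have \<psi>: "\<psi> \<in> GLinf" unfolding \<psi>_def by (rule GLinf_tpow_mult[OF \<phi>])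
    have "asymmetric_factorization p q \<psi> \<phi>m 0 \<phi>0" using factorization_shift[OF fac, of "- \<kappa>"] by (simp add: \<psi>_def)
    then obtain R where R: "has_inverse p \<psi> R" using factorization_imp_has_inverse[OF p \<psi>] by blast
    show ?thesis
    proof (cases "\<kappa> \<le> 0")
      case True
      have "\<phi> = tpow (- int (nat (- \<kappa>))) * \<psi>" using True by (simp add: \<psi>_def tpow_mult_assoc)
      note * = negative_index[OF p(1) \<phi> \<psi> R this]
      have "fnl.dim ({0} :: (L0 \<Rightarrow> complex) set) = 0"
        by (rule fnl.dim_unique[of "{}"]) (auto simp: fnl.independent_empty intro: fnl.span_zero)
      moreover have "\<exists>F. finite F \<and> {0 :: L0 \<Rightarrow> complex} \<subseteq> fnl.span F"
        by (intro exI[of _ "{0}"]) (auto intro: fnl.span_base)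
      ultimately show ?thesis using * True by simp
    next
      case False
      have "\<psi> = tpow (- int (nat \<kappa>)) * \<phi>" using False by (simp add: \<psi>_def)
      note * = positive_index[OF p(1) \<phi> \<psi> R this]
      have "L0.dim {0} = 0"
        by (rule L0.dim_unique[of "{}"]) (auto simp: L0.independent_empty intro: L0.span_zero)
      moreover have "\<exists>F. finite F \<and> {0} \<subseteq> L0.span F"
        by (intro exI[of _ "{0}"]) (auto intro: L0.span_base)
      ultimately show ?thesis using * False by simp
    qed
  qed
  have "\<exists>\<phi>m \<kappa> \<phi>0. asymmetric_factorization p q \<phi> \<phi>m \<kappa> \<phi>0" if fred: "fredholm (Hp p) (Lp_norm p) ?M"
  proof -
    obtain n F where n: "finite F" "Hp p \<subseteq> M_op (tpow (- int n) * \<phi>) ` Hp p"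
      "ker_on (Hp p) (M_op (tpow (- int n) * \<phi>)) \<subseteq> L0.span F"
      using fredholm_imp_surjective[OF p(1) \<phi> fred] by blast
    note surjective_descent[OF p GLinf_tpow_mult[OF \<phi>, of "- int n"] n(2,1,3)]
    then obtain m where m: "Hp p \<subseteq> M_op (tpow m * (tpow (- int n) * \<phi>)) ` Hp p"
      "ker_on (Hp p) (M_op (tpow m * (tpow (- int n) * \<phi>))) \<subseteq> {0}"
      by (elim exE conjE)
    define \<psi> where "\<psi> = tpow (m - int n) * \<phi>"
    have \<psi>: "\<psi> \<in> GLinf" unfolding \<psi>_def by (rule GLinf_tpow_mult[OF \<phi>])
    have eq: "tpow m * (tpow (- int n) * \<phi>) = \<psi>" by (simp add: \<psi>_def tpow_mult_assoc)
    have "x = 0" if "x \<in> Hp p" "M_op \<psi> x = 0" for x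
      using m(2) that unfolding eq by (auto simp: ker_on_def)
    then obtain R where "has_inverse p \<psi> R"
      by (rule bijective_has_inverse[OF p(1) GLinf_D(1)[OF \<psi>] m(1)[unfolded eq]])
    then obtain \<phi>m \<phi>0 where "asymmetric_factorization p q \<psi> \<phi>m 0 \<phi>0"
      using has_inverse_imp_factorization[OF p \<psi>] by blast
    \<comment> \<open>The index records the net shift: n backward shifts to become surjective, then
      m multiplications by t to remove the kernel.\<close>
    from factorization_shift[OF this, of "int n - m"]
    have "asymmetric_factorization p q \<phi> \<phi>m (int n - m) \<phi>0" by (simp add: \<psi>_def tpow_mult_assoc)
    then show ?thesis by blast
  qed
  then show ?thesis using main by blast
qed

end
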